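(* For $\mathcal T\in\mathbb T$ let $\mathcal T_*\succ\mathcal T$ be a uniform red-refinement of $\mathcal T$ and $\mathcal T_{**}\succ\mathcal T_*$ a uniform red-refinement of $\mathcal T_*$. Let $\mathscr U_{\mathcal T}:=\{u\in H^1_{0,\gamma}(\Omega):u|_T\in\mathcal P_1\ (T\in\mathcal T)\}$ with nodal basis $\Phi_{\mathcal T}=\{\phi_\nu:\nu\in N^0_{\mathcal T}\}$. For $\nu\in N_{\mathcal T}$ define $$\widetilde\phi_\nu:=\tfrac1{d+1}\sum_{T\in\mathcal T,\ T\subset\omega_{\mathcal T,\nu}}\Big(\mathbb 1_T+\tfrac{d\,2^{1+d}}{d+1}\mathbb 1_{T_{*,\nu}}-\tfrac{2^{1+d}}{d+1}\sum_{\nu'\in N_T,\ \nu'\ne\nu}\mathbb 1_{T_{*,\nu'}}\Big),$$ which satisfy $\langle\widetilde\phi_\nu,\phi_{\nu'}\rangle_{L_2(\Omega)}=\delta_{\nu\nu'}(d+1)^{-1}|\omega_{\mathcal T,\nu}|$ for $\nu,\nu'\in N^0_{\mathcal T}$, and let $Q_{\mathcal T}$ be the biorthogonal projector $$Q_{\mathcal T}u:=\sum_{\nu\in N^0_{\mathcal T}}\frac{\langle u,\widetilde\phi_\nu\rangle_{L_2(\Omega)}}{\langle\phi_\nu,\widetilde\phi_\nu\rangle_{L_2(\Omega)}}\phi_\nu .$$ For $\nu\in N^0_{\mathcal T}$ let $$\theta_\nu:=\tfrac{2^{d+2}}{d+2}\big(2^d\,\mathbb 1_{\omega_{\mathcal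 T_{**},\nu}}-\mathbb 1_{\omega_{\mathcal T_*,\nu}}\big),\qquad\psi_\nu:=\phi_\nu+\theta_\nu,$$ $\Theta_{\mathcal T}:=\{\theta_\nu:\nu\in N^0_{\mathcal T}\}$, $\mathscr B_{\mathcal T}:=\operatorname{span}\Theta_{\mathcal T}$, $\Psi_{\mathcal T}:=\{\psi_\nu:\nu\in N^0_{\mathcal T}\}$ and $\mathscr W_{\mathcal T}:=\operatorname{span}\Psi_{\mathcal T}$. Then $\mathscr W_{\mathcal T}\subset\mathscr Z_{\mathcal T}:=\mathscr U_{\mathcal T}+\mathscr B_{\mathcal T}$ and, with all constants independent of $\mathcal T\in\mathbb T$: (a) $Q_{\mathcal T}\in\mathcal L(L_2(\Omega),H^1_{0,\gamma}(\Omega)')$ is a projector with $\mathscr U_{\mathcal T}\subseteq\operatorname{ran}Q_{\mathcal T}$ and $\mathscr B_{\mathcal T}\subseteq\operatorname{ran}(\mathrm{Id}-Q_{\mathcal T})$, both subspaces of $L_2(\Omega)$, and (1) $\|h_{\mathcal T}^{-1}(\mathrm{Id}-Q_{\mathcal T}')\|_{\mathcal L(H^1_{0,\gamma}(\Omega),L_2(\Omega))}\lesssim1$; (2) $\sup_{\mathcal T\in\mathbb T}\|Q_{\mathcal T}|_{\mathscr Z_{\mathcal T}}\|_{\mathcal L((\mathscr Z_{\mathcal T},\|\cdot\|_{L_2(\Omega)}),L_2(\Omega))}\lesssim1$; (3) $\|h_{\mathcal T}z\|_{L_2(\Omega)}\lesssim\|z\|_{H^1_{0,\gamma}(\Omega)'}$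 for all $z\in\mathscr Z_{\mathcal T}$; (b) $Q_{\mathcal T}\psi_\nu=\phi_\nu$, and so $(\mathrm{Id}-Q_{\mathcal T})\psi_\nu=\theta_\nu$, for all $\nu\in N^0_{\mathcal T}$; (c) $\Theta_{\mathcal T}$ is an $\|h_{\mathcal T}^s\cdot\|_{L_2(\Omega)}$-orthogonal basis for $\mathscr B_{\mathcal T}$, i.e. it is a basis and $\langle h_{\mathcal T}^s\theta_\nu,h_{\mathcal T}^s\theta_{\nu'}\rangle_{L_2(\Omega)}=0$ for $\nu\neq\nu'$.
   Context: $\Omega\subset\mathbb R^d$ is a bounded polytopal domain, $\gamma\subset\partial\Omega$ is measurable, closed and possibly empty, and $s\in[0,1]$. $H^1_{0,\gamma}(\Omega)$ is the space of $H^1(\Omega)$-functions vanishing on $\gamma$; $L_2(\Omega)\simeq L_2(\Omega)'$ is embedded in its dual $H^1_{0,\gamma}(\Omega)'$. $\mathbb T$ is a family of conforming partitions $\mathcal T$ of $\Omega$ into closed uniformly shape regular $d$-simplices; neighbouring simplices (those with $T\cap T'\neq\emptyset$) have uniformly comparable sizes (a consequence of conformity and shape regularity for $d>1$, imposed for $d=1$). For every $\mathcal T$, $\gamma$ is the (possibly empty) union of $(d-1)$-faces of simplices $T\in\mathcal T$. $N_T$ is the set of vertices of $T$, $N_{\mathcal T}$ the set of all vertices of $\mathcal T$, and $N^0_{\mathcal T}$ the set of those not on $\gamma$; $h_T:=|T|^{1/d}$ and $h_{\mathcal T}$ is the piecewise constant function with $h_{\mathcal T}|_T=h_T$. For a partition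 $\mathcal S$ and a vertex $\nu$, $\omega_{\mathcal S,\nu}:=\bigcup\{T\in\mathcal S:\nu\in T\}$. $\mathbb 1_K$ is the indicator function of $K$. The nodal basis satisfies $\phi_\nu(\nu')=\delta_{\nu\nu'}$ for $\nu,\nu'\in N^0_{\mathcal T}$; $\mathcal P_1$ denotes polynomials of degree at most $1$. $Q_{\mathcal T}':H^1_{0,\gamma}(\Omega)\to L_2(\Omega)$ is the adjoint of $Q_{\mathcal T}$. Uniform red-refinement: every simplex $T$ is subdivided into $2^d$ subsimplices of equal volume (uniformly shape regular); for each vertex $\nu$ of $T\in\mathcal T$ exactly one of them, denoted $T_{*,\nu}\in\mathcal T_*$, contains $\nu$, and it is the image of $T$ under the homothety with centre $\nu$ and ratio $1/2$ (likewise from $\mathcal T_*$ to $\mathcal T_{**}$). $\lambda\lesssim\mu$ means that $\lambda\le C\mu$ with $C$ independent of $\mathcal T\in\mathbb T$ (and of the functions involved). *)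

theory Defs
  imports "HOL-Analysis.Analysis"
begin

section \<open>Lebesgue and Sobolev spaces\<close>

text \<open>
  Elements of \<open>L\<^sub>2(\<Omega>)\<close> are represented by total functions of which only the values on \<open>\<Omega>\<close> up to
  null sets matter; equality in \<open>L\<^sub>2(\<Omega>)\<close> is \<open>ae_eq \<Omega>\<close>.
\<close>

definition ae_eq :: "'a::euclidean_space set \<Rightarrow> ('a \<Rightarrow> 'b) \<Rightarrow> ('a \<Rightarrow> 'b) \<Rightarrow> bool" where
  "ae_eq \<Omega> f g \<longleftrightarrow> (AE x in lebesgue_on \<Omega>. f x = g x)"

definition L2 :: "'a::euclidean_space set \<Rightarrow> ('a \<Rightarrow> 'b::euclidean_space) set" where
  "L2 \<Omega> = {f. f \<in> borel_measurable (lebesgue_on \<Omega>) \<and>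
               integrable (lebesgue_on \<Omega>) (\<lambda>x. (norm (f x))\<^sup>2)}"

definition l2_norm :: "'a::euclidean_space set \<Rightarrow> ('a \<Rightarrow> 'b::euclidean_space) \<Rightarrow> real" where
  "l2_norm \<Omega> f = sqrt (integral\<^sup>L (lebesgue_on \<Omega>) (\<lambda>x. (norm (f x))\<^sup>2))"

definition l2_inner :: "'a::euclidean_space set \<Rightarrow> ('a \<Rightarrow> real) \<Rightarrow> ('a \<Rightarrow> real) \<Rightarrow> real" where
  "l2_inner \<Omega> f g = integral\<^sup>L (lebesgue_on \<Omega>) (\<lambda>x. f x * g x)"

text \<open>
  \<open>G\<close> is the weak gradient of \<open>u\<close> on \<open>\<Omega>\<close>, tested with \<open>C\<^sup>1\<close> functions \<open>\<eta>\<close> (with gradient \<open>g\<close>) of compact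
  support in \<open>\<Omega>\<close>.
\<close>

definition weak_gradient ::
  "'a::euclidean_space set \<Rightarrow> ('a \<Rightarrow> real) \<Rightarrow> ('a \<Rightarrow> 'a) \<Rightarrow> bool" where
  "weak_gradient \<Omega> u G \<longleftrightarrow>
     (\<forall>(\<eta> :: 'a \<Rightarrow> real) (g :: 'a \<Rightarrow> 'a) K.
        (\<forall>x. (\<eta> has_derivative (\<lambda>y. g x \<bullet> y)) (at x)) \<and> continuous_on UNIV g \<and>
        compact K \<and> K \<subseteq> \<Omega> \<and> (\<forall>x. x \<notin> K \<longrightarrow> \<eta> x = 0) \<longrightarrow>
        integral\<^sup>L (lebesgue_on \<Omega>) (\<lambda>x. u x *\<^sub>R g x) =
        - integral\<^sup>L (lebesgue_on \<Omega>) (\<lambda>x. \<eta> x *\<^sub>R G x))"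

definition H1 :: "'a::euclidean_space set \<Rightarrow> ('a \<Rightarrow> real) set" where
  "H1 \<Omega> = {u \<in> L2 \<Omega>. \<exists>G \<in> L2 \<Omega>. weak_gradient \<Omega> u G}"

definition wgrad :: "'a::euclidean_space set \<Rightarrow> ('a \<Rightarrow> real) \<Rightarrow> 'a \<Rightarrow> 'a" where
  "wgrad \<Omega> u = (SOME G. G \<in> L2 \<Omega> \<and> weak_gradient \<Omega> u G)"

definition h1_norm :: "'a::euclidean_space set \<Rightarrow> ('a \<Rightarrow> real) \<Rightarrow> real" where
  "h1_norm \<Omega> u = sqrt ((l2_norm \<Omega> u)\<^sup>2 + (l2_norm \<Omega> (wgrad \<Omega> u))\<^sup>2)"

text \<open>
  \<open>H\<^sup>1\<close>-functions vanishing on \<open>\<gamma>\<close>: the \<open>H\<^sup>1(\<Omega>)\<close>-closure of the \<open>H\<^sup>1(\<Omega>)\<close>-functions that are continuous on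
  the closure of \<open>\<Omega>\<close> and vanish pointwise on \<open>\<gamma>\<close>. For a polytopal domain and \<open>\<gamma>\<close> a union of boundary
  facets this is the space of functions with zero trace on \<open>\<gamma>\<close>, and \<open>H\<^sup>1(\<Omega>)\<close> itself if \<open>\<gamma>\<close> is empty.
\<close>

definition H1_0 :: "'a::euclidean_space set \<Rightarrow> 'a set \<Rightarrow> ('a \<Rightarrow> real) set" where
  "H1_0 \<Omega> \<gamma> = {u \<in> H1 \<Omega>. \<forall>e>0. \<exists>v \<in> H1 \<Omega>. continuous_on (closure \<Omega>) v \<and>
                 (\<forall>x\<in>\<gamma>. v x = 0) \<and> h1_norm \<Omega> (\<lambda>x. u x - v x) < e}"

definition H1_0_dual :: "'a::euclidean_space set \<Rightarrow> 'a set \<Rightarrow> (('a \<Rightarrow> real) \<Rightarrow> real) set" where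
  "H1_0_dual \<Omega> \<gamma> =
     {F. (\<forall>u\<in>H1_0 \<Omega> \<gamma>. \<forall>v\<in>H1_0 \<Omega> \<gamma>. \<forall>a b. F (\<lambda>x. a * u x + b * v x) = a * F u + b * F v) \<and>
         (\<exists>C. \<forall>v\<in>H1_0 \<Omega> \<gamma>. \<bar>F v\<bar> \<le> C * h1_norm \<Omega> v)}"

definition dual_norm ::
  "'a::euclidean_space set \<Rightarrow> 'a set \<Rightarrow> (('a \<Rightarrow> real) \<Rightarrow> real) \<Rightarrow> real" where
  "dual_norm \<Omega> \<gamma> F = Sup {\<bar>F v\<bar> | v. v \<in> H1_0 \<Omega> \<gamma> \<and> h1_norm \<Omega> v \<le> 1}"

text \<open>The embedding of \<open>L\<^sub>2(\<Omega>) \<simeq> L\<^sub>2(\<Omega>)'\<close> into the dual of \<open>H1_0 \<Omega> \<gamma>\<close>.\<close>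

definition dual_embed :: "'a::euclidean_space set \<Rightarrow> ('a \<Rightarrow> real) \<Rightarrow> ('a \<Rightarrow> real) \<Rightarrow> real" where
  "dual_embed \<Omega> f = (\<lambda>v. l2_inner \<Omega> f v)"

text \<open>
  The adjoint \<open>A' : H1_0 \<Omega> \<gamma> \<rightarrow> L\<^sub>2(\<Omega>)\<close> of an operator \<open>A\<close> that maps \<open>L\<^sub>2(\<Omega>)\<close> into itself and is viewed as
  an operator from \<open>L\<^sub>2(\<Omega>)\<close> into the dual of \<open>H1_0 \<Omega> \<gamma>\<close>; \<open>A' v\<close> is determined up to null sets.
\<close>

definition adjoint_op ::
  "'a::euclidean_space set \<Rightarrow> (('a \<Rightarrow> real) \<Rightarrow> ('a \<Rightarrow> real)) \<Rightarrow> ('a \<Rightarrow> real) \<Rightarrow> 'a \<Rightarrow> real" where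
  "adjoint_op \<Omega> A v =
     (SOME w. w \<in> L2 \<Omega> \<and> (\<forall>u \<in> L2 \<Omega>. dual_embed \<Omega> (A u) v = l2_inner \<Omega> u w))"

text \<open>\<open>A\<close> maps \<open>(X, nX)\<close> into \<open>(Y, nY)\<close> with operator norm at most \<open>C\<close>.\<close>

definition op_norm_le ::
  "'x set \<Rightarrow> ('x \<Rightarrow> real) \<Rightarrow> 'y set \<Rightarrow> ('y \<Rightarrow> real) \<Rightarrow> ('x \<Rightarrow> 'y) \<Rightarrow> real \<Rightarrow> bool" where
  "op_norm_le X nX Y nY A C \<longleftrightarrow> (\<forall>x\<in>X. A x \<in> Y \<and> nY (A x) \<le> C * nX x)"

definition L2_linear ::
  "'a::euclidean_space set \<Rightarrow> (('a \<Rightarrow> real) \<Rightarrow> ('a \<Rightarrow> real)) \<Rightarrow> bool" where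
  "L2_linear \<Omega> A \<longleftrightarrow>
     (\<forall>u\<in>L2 \<Omega>. \<forall>v\<in>L2 \<Omega>. \<forall>a b.
        ae_eq \<Omega> (A (\<lambda>x. a * u x + b * v x)) (\<lambda>x. a * A u x + b * A v x))"

definition L2_projector ::
  "'a::euclidean_space set \<Rightarrow> (('a \<Rightarrow> real) \<Rightarrow> ('a \<Rightarrow> real)) \<Rightarrow> bool" where
  "L2_projector \<Omega> A \<longleftrightarrow> (\<forall>u\<in>L2 \<Omega>. A u \<in> L2 \<Omega> \<and> ae_eq \<Omega> (A (A u)) (A u))"

definition L2_range ::
  "'a::euclidean_space set \<Rightarrow> (('a \<Rightarrow> real) \<Rightarrow> ('a \<Rightarrow> real)) \<Rightarrow> ('a \<Rightarrow> real) set" where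
  "L2_range \<Omega> A = {v \<in> L2 \<Omega>. \<exists>u \<in> L2 \<Omega>. ae_eq \<Omega> v (A u)}"

definition L2_subspace :: "'a::euclidean_space set \<Rightarrow> ('a \<Rightarrow> real) set \<Rightarrow> bool" where
  "L2_subspace \<Omega> X \<longleftrightarrow> X \<subseteq> L2 \<Omega> \<and> X \<noteq> {} \<and>
     (\<forall>u\<in>X. \<forall>v\<in>X. \<forall>a b. (\<lambda>x. a * u x + b * v x) \<in> X)"

definition fun_span :: "'i set \<Rightarrow> ('i \<Rightarrow> 'a \<Rightarrow> real) \<Rightarrow> ('a \<Rightarrow> real) set" where
  "fun_span I f = {(\<lambda>x. \<Sum>i\<in>I. c i * f i x) | c. True}"

definition L2_basis ::
  "'a::euclidean_space set \<Rightarrow> ('a \<Rightarrow> real) set \<Rightarrow> 'i set \<Rightarrow> ('i \<Rightarrow> 'a \<Rightarrow> real) \<Rightarrow> bool" where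
  "L2_basis \<Omega> X I f \<longleftrightarrow> finite I \<and> (\<forall>i\<in>I. f i \<in> X) \<and>
     (\<forall>u\<in>X. \<exists>c. ae_eq \<Omega> u (\<lambda>x. \<Sum>i\<in>I. c i * f i x)) \<and>
     (\<forall>c. ae_eq \<Omega> (\<lambda>x. \<Sum>i\<in>I. c i * f i x) (\<lambda>x. 0) \<longrightarrow> (\<forall>i\<in>I. c i = 0))"


section \<open>Domains and partitions\<close>

text \<open>
  The last two clauses express that \<open>\<Omega>\<close> has neither slits nor points where it touches itself; they
  hold for every Lipschitz polytope. Without them, the continuous piecewise linear functions would
  not exhaust the piecewise linear functions in \<open>H\<^sup>1(\<Omega>)\<close>, so the latter would have no nodal basis.
\<close>

definition polytopal_domain :: "'a::euclidean_space set \<Rightarrow> bool" where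
  "polytopal_domain \<Omega> \<longleftrightarrow>
     open \<Omega> \<and> connected \<Omega> \<and> bounded \<Omega> \<and> \<Omega> \<noteq> {} \<and>
     (\<exists>\<P>. finite \<P> \<and> (\<forall>P\<in>\<P>. polytope P) \<and> closure \<Omega> = \<Union>\<P>) \<and>
     interior (closure \<Omega>) = \<Omega> \<and>
     (\<forall>x \<in> frontier \<Omega>. \<forall>e>0. \<exists>V. open V \<and> x \<in> V \<and> V \<subseteq> ball x e \<and> connected (V \<inter> \<Omega>))"

definition conforming_partition :: "'a::euclidean_space set \<Rightarrow> 'a set set \<Rightarrow> bool" where
  "conforming_partition \<Omega> \<T> \<longleftrightarrow>
     triangulation \<T> \<and> (\<forall>T\<in>\<T>. int DIM('a) simplex T) \<and> \<Union>\<T> = closure \<Omega>"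

definition verts :: "'a::euclidean_space set \<Rightarrow> 'a set" where
  "verts T = {\<nu>. \<nu> extreme_point_of T}"

definition nodes :: "'a::euclidean_space set set \<Rightarrow> 'a set" where
  "nodes \<T> = (\<Union>T\<in>\<T>. verts T)"

definition free_nodes :: "'a::euclidean_space set \<Rightarrow> 'a set set \<Rightarrow> 'a set" where
  "free_nodes \<gamma> \<T> = nodes \<T> - \<gamma>"

definition patch :: "'a::euclidean_space set set \<Rightarrow> 'a \<Rightarrow> 'a set" where
  "patch \<S> \<nu> = \<Union>{T \<in> \<S>. \<nu> \<in> T}"

definition simplex_size :: "'a::euclidean_space set \<Rightarrow> real" where
  "simplex_size T = root DIM('a) (measure lebesgue T)"

text \<open>Piecewise constant mesh size; the value on the null set of simplex boundaries is irrelevant.\<close>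

definition mesh_size :: "'a::euclidean_space set set \<Rightarrow> 'a \<Rightarrow> real" where
  "mesh_size \<T> x = (\<Sum>T\<in>\<T>. simplex_size T * indicator (interior T) x)"

text \<open>Bounded ratio of the diameter to the radius of an inscribed ball.\<close>

definition uniformly_shape_regular :: "'a::euclidean_space set set set \<Rightarrow> bool" where
  "uniformly_shape_regular \<TT> \<longleftrightarrow>
     (\<exists>\<sigma>. \<forall>\<T>\<in>\<TT>. \<forall>T\<in>\<T>. \<exists>c r. 0 < r \<and> cball c r \<subseteq> T \<and> diameter T \<le> \<sigma> * r)"

definition neighbours_comparable :: "'a::euclidean_space set set set \<Rightarrow> bool" where
  "neighbours_comparable \<TT> \<longleftrightarrow>
     (\<exists>\<kappa>. \<forall>\<T>\<in>\<TT>. \<forall>T\<in>\<T>. \<forall>T'\<in>\<T>. T \<inter> T' \<noteq> {} \<longrightarrow> simplex_size T \<le> \<kappa> * simplex_size T')"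

definition admissible_family ::
  "'a::euclidean_space set \<Rightarrow> 'a set \<Rightarrow> 'a set set set \<Rightarrow> bool" where
  "admissible_family \<Omega> \<gamma> \<TT> \<longleftrightarrow>
     (\<forall>\<T>\<in>\<TT>. conforming_partition \<Omega> \<T> \<and>
        (\<exists>\<F>. (\<forall>F\<in>\<F>. \<exists>T\<in>\<T>. F facet_of T) \<and> \<gamma> = \<Union>\<F>)) \<and>
     uniformly_shape_regular \<TT> \<and>
     (DIM('a) = 1 \<longrightarrow> neighbours_comparable \<TT>)"

definition red_refinement :: "'a::euclidean_space set set \<Rightarrow> 'a set set \<Rightarrow> bool" where
  "red_refinement \<T> \<S> \<longleftrightarrow>
     (\<forall>S\<in>\<S>. int DIM('a) simplex S \<and> (\<exists>T\<in>\<T>. S \<subseteq> T)) \<and>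
     (\<forall>S\<in>\<S>. \<forall>S'\<in>\<S>. S \<noteq> S' \<longrightarrow> interior S \<inter> interior S' = {}) \<and>
     (\<forall>T\<in>\<T>. card {S \<in> \<S>. S \<subseteq> T} = 2 ^ DIM('a) \<and> \<Union>{S \<in> \<S>. S \<subseteq> T} = T \<and>
        (\<forall>S\<in>\<S>. S \<subseteq> T \<longrightarrow> measure lebesgue S = measure lebesgue T / 2 ^ DIM('a)) \<and>
        (\<forall>\<nu>\<in>verts T. {S \<in> \<S>. S \<subseteq> T \<and> \<nu> \<in> S} = {(\<lambda>x. \<nu> + (1/2) *\<^sub>R (x - \<nu>)) ` T}))"

text \<open>The subsimplex \<open>T\<^bsub>*,\<nu>\<^esub>\<close> of \<open>T\<close> in the refinement \<open>\<S>\<close>, for a vertex \<open>\<nu>\<close> of \<open>T\<close>.\<close>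

definition corner :: "'a::euclidean_space set set \<Rightarrow> 'a set \<Rightarrow> 'a \<Rightarrow> 'a set" where
  "corner \<S> T \<nu> = (THE S. S \<in> \<S> \<and> S \<subseteq> T \<and> \<nu> \<in> S)"


section \<open>Finite element spaces and the biorthogonal projector\<close>

definition U_space ::
  "'a::euclidean_space set \<Rightarrow> 'a set \<Rightarrow> 'a set set \<Rightarrow> ('a \<Rightarrow> real) set" where
  "U_space \<Omega> \<gamma> \<T> = {u \<in> H1_0 \<Omega> \<gamma>.
     \<forall>T\<in>\<T>. \<exists>a b. AE x in lebesgue_on \<Omega>. x \<in> T \<longrightarrow> u x = a \<bullet> x + b}"

definition hat :: "'a::euclidean_space set set \<Rightarrow> 'a \<Rightarrow> 'a \<Rightarrow> real" where
  "hat \<T> \<nu> = (THE f. (\<forall>T\<in>\<T>. \<exists>a b. \<forall>x\<in>T. f x = a \<bullet> x + b) \<and>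
                     (\<forall>\<nu>'\<in>nodes \<T>. f \<nu>' = (if \<nu>' = \<nu> then 1 else 0)) \<and>
                     (\<forall>x. x \<notin> \<Union>\<T> \<longrightarrow> f x = 0))"

definition dual_hat ::
  "'a::euclidean_space set set \<Rightarrow> 'a set set \<Rightarrow> 'a \<Rightarrow> 'a \<Rightarrow> real" where
  "dual_hat \<T> \<S> \<nu> x =
     1 / (real DIM('a) + 1) *
     (\<Sum>T \<in> {T \<in> \<T>. T \<subseteq> patch \<T> \<nu>}.
        indicator T x
        + real DIM('a) * 2 ^ (1 + DIM('a)) / (real DIM('a) + 1) * indicator (corner \<S> T \<nu>) x
        - 2 ^ (1 + DIM('a)) / (real DIM('a) + 1) *
            (\<Sum>\<nu>' \<in> verts T - {\<nu>}. indicator (corner \<S> T \<nu>') x))"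

definition biorth_proj ::
  "'a::euclidean_space set \<Rightarrow> 'a set \<Rightarrow> 'a set set \<Rightarrow> 'a set set \<Rightarrow> ('a \<Rightarrow> real) \<Rightarrow> 'a \<Rightarrow> real" where
  "biorth_proj \<Omega> \<gamma> \<T> \<S> u x =
     (\<Sum>\<nu>\<in>free_nodes \<gamma> \<T>.
        l2_inner \<Omega> u (dual_hat \<T> \<S> \<nu>) / l2_inner \<Omega> (hat \<T> \<nu>) (dual_hat \<T> \<S> \<nu>) * hat \<T> \<nu> x)"

text \<open>Here \<open>\<S>\<close> and \<open>\<S>'\<close> are the first and the second red-refinement.\<close>

definition theta :: "'a::euclidean_space set set \<Rightarrow> 'a set set \<Rightarrow> 'a \<Rightarrow> 'a \<Rightarrow> real" where
  "theta \<S> \<S>' \<nu> x =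
     2 ^ (DIM('a) + 2) / (real DIM('a) + 2) *
     (2 ^ DIM('a) * indicator (patch \<S>' \<nu>) x - indicator (patch \<S> \<nu>) x)"

definition psi ::
  "'a::euclidean_space set set \<Rightarrow> 'a set set \<Rightarrow> 'a set set \<Rightarrow> 'a \<Rightarrow> 'a \<Rightarrow> real" where
  "psi \<T> \<S> \<S>' \<nu> x = hat \<T> \<nu> x + theta \<S> \<S>' \<nu> x"

definition B_space ::
  "'a::euclidean_space set \<Rightarrow> 'a set set \<Rightarrow> 'a set set \<Rightarrow> 'a set set \<Rightarrow> ('a \<Rightarrow> real) set" where
  "B_space \<gamma> \<T> \<S> \<S>' = fun_span (free_nodes \<gamma> \<T>) (theta \<S> \<S>')"

definition W_space ::
  "'a::euclidean_space set \<Rightarrow> 'a set set \<Rightarrow> 'a set set \<Rightarrow> 'a set set \<Rightarrow> ('a \<Rightarrow> real) set" where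
  "W_space \<gamma> \<T> \<S> \<S>' = fun_span (free_nodes \<gamma> \<T>) (psi \<T> \<S> \<S>')"

definition Z_space ::
  "'a::euclidean_space set \<Rightarrow> 'a set \<Rightarrow> 'a set set \<Rightarrow> 'a set set \<Rightarrow> 'a set set \<Rightarrow>
   ('a \<Rightarrow> real) set" where
  "Z_space \<Omega> \<gamma> \<T> \<S> \<S>' =
     {(\<lambda>x. u x + b x) | u b. u \<in> U_space \<Omega> \<gamma> \<T> \<and> b \<in> B_space \<gamma> \<T> \<S> \<S>'}"

end

theory Submission
  imports Defs
begin

text \<open>
 \<open>Q\<close> maps \<open>\<psi>\<^sub>\<nu>\<close> to \<open>\<phi>\<^sub>\<nu>\<close> since \<open>\<theta>\<^sub>\<nu>\<close> lives on the corners at \<open>\<nu>\<close>, where it has mean value zero and all dual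
 functions are constant. For (1), the dual functions of the vertices of a simplex \<open>T\<close> add up to one on
 \<open>T\<close>, so that \<open>Q'\<close> reproduces constants on simplices without vertices on \<open>\<gamma>\<close>. Hence \<open>v - Q' v\<close> on \<open>T\<close> is
 bounded by \<open>v - c\<close> on the simplices that meet \<open>T\<close>, where \<open>c\<close> is the mean value of \<open>v\<close> on \<open>T\<close>, or zero if \<open>T\<close>
 has a vertex on \<open>\<gamma>\<close>. Vertex patches are connected through facets, because \<open>\<Omega>\<close> does not touch itself, and
 a Poincare inequality on a ball around the centroid of a facet carries a bound from one simplex to
 its neighbour; for a facet in \<open>\<gamma>\<close>, \<open>v\<close> is extended by zero across the facet. The Poincare inequality
 on a convex set results from integrating a bound for \<open>v(x + z) - v(x)\<close> in \<open>L\<^sub>2\<close> over all translations \<open>z\<close>.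
 For (3), an element of \<open>U + B\<close> is affine on every cell of the second refinement; it is tested with
 the sum of its pieces multiplied by bump functions and squared cell sizes.
\<close>

section \<open>Square integrable functions\<close>

text \<open>All constants must be uniform over the family, so every bound is explicit in the
  dimension, the shape ratio \<open>sig\<close> and the neighbour ratio. The length of a chain of
  simplices around a vertex is bounded by counting: shrunk copies of the simplices at a vertex pack
  disjoint balls into one ball, so a star has at most \<open>sig ^ d\<close> members, whatever their
  sizes. The Poincare inequality is used mostly in a form without mean values: a function is
  controlled on a convex set by its values on a part of it and by its gradient. That form serves
  interior facets and facets in \<open>gam\<close> alike. Traces never appear: \<open>H1_0\<close>
  is a closure, and it enters only through the extension by zero, whose weak gradient is found for
  continuous approximants and passes to the limit. The same tools give the nodal basis, since a jump
  across a facet would contradict the Poincare inequality on shrinking balls. Biorthogonality, the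
  constant sum of the dual functions on a simplex and their orthogonality to \<open>theta\<close>
  all rest on one description of the corners: they are superlevel sets of barycentric coordinates,
  at height 1/2 for the first and 3/4 for the second refinement.\<close>

abbreviation vol :: "'a::euclidean_space set => real" where "vol \<equiv> measure lebesgue"

abbreviation leb :: "'a::euclidean_space set => 'a measure" where "leb \<equiv> lebesgue_on"

abbreviation lint :: "'a::euclidean_space set => ('a => 'b::{banach,second_countable_topology}) => 'b" where
  "lint D \<equiv> integral\<^sup>L (leb D)"

abbreviation hsize :: "'a::euclidean_space set => real" where "hsize \<equiv> simplex_size"

abbreviation cnorm :: "'a::euclidean_space set => ('a => 'b::euclidean_space) => real" where
  "cnorm T \<equiv> l2_norm (interior T)"

lemmas lint_cong = Bochner_Integration.integral_cong

lemma L2_meas: "f : L2 D ==> f : borel_measurable (leb D)"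
 by (simp add: L2_def)

lemma L2_sq_int: "f : L2 D ==> integrable (leb D) (%x. (norm (f x))^2)"
 by (simp add: L2_def)

lemma L2_sqr_int:
 fixes f :: "'a::euclidean_space => real"
 shows "f : L2 D ==> integrable (leb D) (%x. (f x)^2)"
 using L2_sq_int[of f D] by simp

lemma l2_norm_sq: "(l2_norm D f)^2 = lint D (%x. (norm (f x))^2)"
 by (simp add: l2_norm_def integral_nonneg_AE)

lemma l2_norm_nonneg [simp]: "0 <= l2_norm D f"
 by (simp add: l2_norm_def integral_nonneg_AE)

lemma L2_inner_integrable:
 assumes "f : L2 D" "g : L2 D"
 shows "integrable (leb D) (%x. f x \<bullet> g x)"
proof (rule Bochner_Integration.integrable_bound)
 show "integrable (leb D) (%x. (norm (f x))^2 + (norm (g x))^2)"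
  using assms by (intro Bochner_Integration.integrable_add L2_sq_int)
 show "(%x. f x \<bullet> g x) : borel_measurable (leb D)"
  using assms[THEN L2_meas] by measurable
 show "AE x in leb D. norm (f x \<bullet> g x) <= norm ((norm (f x))^2 + (norm (g x))^2)"
 proof (rule AE_I2)
  fix x
  have "\<bar>f x \<bullet> g x\<bar> <= norm (f x) * norm (g x)"
   by (rule Cauchy_Schwarz_ineq2)
  also have "... <= (norm (f x))^2 + (norm (g x))^2"
   using sum_squares_bound[of "norm (f x)" "norm (g x)"]
    mult_nonneg_nonneg[OF norm_ge_zero[of "f x"] norm_ge_zero[of "g x"]] by linarith
  finally show "norm (f x \<bullet> g x) <= norm ((norm (f x))^2 + (norm (g x))^2)"
   by simp
 qed
qed

lemma L2_mult_int:
 fixes f g :: "'a::euclidean_space => real"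
 assumes "f : L2 D" "g : L2 D"
 shows "integrable (leb D) (%x. f x * g x)"
 using L2_inner_integrable[OF assms] by simp

lemma L2_scaleR: "f : L2 D ==> (%x. a *\<^sub>R f x) : L2 D"
 by (auto simp: L2_def power_mult_distrib)

lemma L2_cmult: "f : L2 D ==> (%x. a * f x :: real) : L2 D"
 using L2_scaleR[of f D a] by simp

lemma L2_add:
 assumes "f : L2 D" "g : L2 D"
 shows "(%x. f x + g x) : L2 D"
proof -
 have "integrable (leb D) (%x. (norm (f x))^2 + (norm (g x))^2 + 2 * (f x \<bullet> g x))"
  using assms by (intro Bochner_Integration.integrable_add integrable_mult_right
    L2_sq_int L2_inner_integrable)
 hence "integrable (leb D) (%x. (norm (f x + g x))^2)"
  by (simp add: power2_norm_eq_inner inner_add inner_commute algebra_simps)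
 thus ?thesis
  using assms by (auto simp: L2_def)
qed

lemma L2_diff: "f : L2 D ==> g : L2 D ==> (%x. f x - g x) : L2 D"
 using L2_add[of f D "%x. (-1) *\<^sub>R g x"] L2_scaleR[of g D "-1"] by simp

lemma L2_zero [simp]: "(%x. 0) : L2 D"
 by (simp add: L2_def)

lemma L2_sum: "(!!i. i : I ==> f i : L2 D) ==> (%x. SUM i:I. f i x) : L2 D"
 by (induction I rule: infinite_finite_induct) (auto intro: L2_add)

lemma L2_lincomb:
 fixes f :: "'i => 'a::euclidean_space => real"
 shows "(!!i. i : I ==> f i : L2 D) ==> (%x. SUM i:I. c i * f i x) : L2 D"
 by (intro L2_sum L2_cmult)

lemma L2_dot:
 assumes "f : L2 D"
 shows "(%x. f x \<bullet> e) : L2 D"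
proof -
 have "integrable (leb D) (%x. (norm (f x \<bullet> e))^2)"
 proof (rule Bochner_Integration.integrable_bound)
  show "integrable (leb D) (%x. (norm (f x))^2 * (norm e)^2)"
   using L2_sq_int[OF assms] by simp
  show "(%x. (norm (f x \<bullet> e))^2) : borel_measurable (leb D)"
   using L2_meas[OF assms] by measurable
  show "AE x in leb D. norm ((norm (f x \<bullet> e))^2) <= norm ((norm (f x))^2 * (norm e)^2)"
  proof (rule AE_I2)
   fix x
   show "norm ((norm (f x \<bullet> e))^2) <= norm ((norm (f x))^2 * (norm e)^2)"
    using power_mono[OF Cauchy_Schwarz_ineq2[of "f x" e] abs_ge_zero, of 2]
    by (simp add: power_mult_distrib)
  qed
 qed
 thus ?thesis
  using L2_meas[OF assms] by (auto simp: L2_def)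
qed

lemma L2_cong_AE:
 assumes "f : L2 D" "g : borel_measurable (leb D)" "AE x in leb D. f x = g x"
 shows "g : L2 D"
proof -
 have "integrable (leb D) (%x. (norm (g x))^2)"
  using L2_sq_int[OF assms(1)] assms
  by (subst integrable_cong_AE[where g = "%x. (norm (f x))^2"]) (auto simp: L2_def)
 thus ?thesis
  using assms by (simp add: L2_def)
qed

lemma int_const:
 fixes c :: "'b::euclidean_space"
 shows "D : lmeasurable ==> integrable (leb D) (%x. c)"
 by (rule finite_measure.integrable_const) (rule finite_measure_lebesgue_on)

lemma L2_bounded:
 assumes "D : lmeasurable" "f : borel_measurable (leb D)" "!!x. x : D ==> norm (f x) <= B"
 shows "f : L2 D"
proof -
 have "integrable (leb D) (%x. (norm (f x))^2)"
 proof (rule Bochner_Integration.integrable_bound)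
  show "integrable (leb D) (%x. B^2)"
   using assms(1) by (rule int_const)
  show "(%x. (norm (f x))^2) : borel_measurable (leb D)"
   using assms(2) by measurable
  show "AE x in leb D. norm ((norm (f x))^2) <= norm (B^2)"
   by (rule AE_I2) (use assms(3) in \<open>auto intro!: power_mono\<close>)
 qed
 thus ?thesis using assms by (simp add: L2_def)
qed

lemma L2_mult_bounded:
 fixes f :: "'a::euclidean_space => real"
 assumes "f : L2 D" "g : borel_measurable (leb D)" "!!x. x : D ==> \<bar>g x\<bar> <= B"
 shows "(%x. g x * f x) : L2 D"
proof -
 have "integrable (leb D) (%x. (norm (g x * f x))^2)"
 proof (rule Bochner_Integration.integrable_bound)
  show "integrable (leb D) (%x. B^2 * (norm (f x))^2)"
   using L2_sq_int[OF assms(1)] by simp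
  show "(%x. (norm (g x * f x))^2) : borel_measurable (leb D)"
   using assms(2) L2_meas[OF assms(1)] by measurable
  show "AE x in leb D. norm ((norm (g x * f x))^2) <= norm (B^2 * (norm (f x))^2)"
  proof (rule AE_I2)
   fix x assume "x : space (leb D)"
   hence "\<bar>g x\<bar> <= B" using assms(3) by simp
   hence "(g x)^2 <= B^2" by (metis abs_ge_zero power2_abs power_mono)
   thus "norm ((norm (g x * f x))^2) <= norm (B^2 * (norm (f x))^2)"
    by (auto simp: power_mult_distrib mult_right_mono)
  qed
 qed
 moreover have "(%x. g x * f x) : borel_measurable (leb D)"
  using assms(2) L2_meas[OF assms(1)] by measurable
 ultimately show ?thesis by (simp add: L2_def)
qed

lemma L2_subset:
 assumes "f : L2 D" "E <= D" "E : sets lebesgue" "D : sets lebesgue"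
 shows "f : L2 E"
proof -
 have E: "E Int D = E" "D Int E = E" using assms by auto
 have eq: "leb E = restrict_space (leb D) E"
  using assms by (simp add: restrict_restrict_space E)
 have "f : borel_measurable (leb E)"
  unfolding eq using L2_meas[OF assms(1)] by (rule measurable_restrict_space1)
 moreover have "integrable (leb E) (%x. (norm (f x))^2)"
  unfolding eq
 proof (subst integrable_restrict_space)
  show "E Int space (leb D) : sets (leb D)"
   using assms by (simp add: E sets_restrict_space_iff)
  hence "E : sets (leb D)" by (simp add: E)
  thus "integrable (leb D) (%x. indicat_real E x *\<^sub>R (norm (f x))^2)"
   using L2_sq_int[OF assms(1)]
   using integrable_mult_indicator by blast
 qed
 ultimately show ?thesis by (simp add: L2_def)
qed

lemma lint_mono_set:
 fixes f :: "'a::euclidean_space => real"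
 assumes "integrable (leb D) f" "E <= D" "E : sets lebesgue" "D : sets lebesgue"
  "!!x. x : D ==> 0 <= f x"
 shows "lint E f <= lint D f"
 by (rule integral_mono_lebesgue_on_AE) (use assms in auto)

lemma integrable_on_subset:
 fixes f :: "'a::euclidean_space => 'b::euclidean_space"
 assumes "integrable (leb D) f" "E <= D" "E : sets lebesgue" "D : sets lebesgue"
 shows "integrable (leb E) f"
proof -
 have "integrable lebesgue (%x. indicator E x *\<^sub>R (indicator D x *\<^sub>R f x))"
  by (rule integrable_mult_indicator[OF assms(3)])
    (use assms in \<open>simp add: integrable_restrict_space\<close>)
 moreover have "(%x. indicator E x *\<^sub>R (indicator D x *\<^sub>R f x)) = (%x. indicator E x *\<^sub>R f x)"
  using assms(2) by (intro ext) (auto split: split_indicator)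
 ultimately show ?thesis using assms by (simp add: integrable_restrict_space)
qed

lemma l2_norm_cong_AE:
 assumes "f : L2 D" "g : L2 D" "AE x in leb D. f x = g x"
 shows "l2_norm D f = l2_norm D g"
 unfolding l2_norm_def
 by (rule arg_cong[where f = sqrt], rule integral_cong_AE)
   (use assms in \<open>auto simp: L2_def\<close>)

text \<open>Stands in for the triangle inequality in \<open>L2\<close>; a factor 2 replaces the
  square roots.\<close>

lemma integral_norm_sq_add_le:
 assumes "f : L2 D" "g : L2 D"
 shows "lint D (%x. (norm (f x + g x))^2)
  <= 2 * lint D (%x. (norm (f x))^2) + 2 * lint D (%x. (norm (g x))^2)"
proof -
 have "lint D (%x. (norm (f x + g x))^2)
  <= lint D (%x. 2 * (norm (f x))^2 + 2 * (norm (g x))^2)"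
 proof (rule integral_mono)
  fix x
  have "(norm (f x + g x))^2 <= (norm (f x) + norm (g x))^2"
   by (intro power_mono norm_triangle_ineq) simp
  also have "... <= 2 * (norm (f x))^2 + 2 * (norm (g x))^2"
   using sum_squares_bound[of "norm (f x)" "norm (g x)"] by (simp add: power2_sum)
  finally show "(norm (f x + g x))^2 <= 2 * (norm (f x))^2 + 2 * (norm (g x))^2" .
 qed (use assms L2_add[OF assms] in \<open>auto intro!: L2_sq_int Bochner_Integration.integrable_add\<close>)
 also have "... = 2 * lint D (%x. (norm (f x))^2) + 2 * lint D (%x. (norm (g x))^2)"
  using assms by (subst Bochner_Integration.integral_add) (auto intro: L2_sq_int)
 finally show ?thesis .
qed

text \<open>The integral of \<open>(t f + r g)^2\<close> is a nonnegative quadratic form in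
  \<open>t\<close> and \<open>r\<close>; at \<open>t = ?G\<close>, \<open>r = -?I\<close> it factors
  as \<open>?G\<close> times the discriminant.\<close>

lemma L2_CS:
 fixes f g :: "'a::euclidean_space => real"
 assumes "f : L2 D" "g : L2 D"
 shows "\<bar>l2_inner D f g\<bar> <= l2_norm D f * l2_norm D g"
proof -
 let ?F = "(l2_norm D f)^2" and ?G = "(l2_norm D g)^2" and ?I = "l2_inner D f g"
 have sq: "0 <= ?F * t^2 + 2 * ?I * t * r + ?G * r^2" for t r :: real
 proof -
  have "0 <= lint D (%x. (t * f x + r * g x)^2)"
   by (simp add: integral_nonneg_AE)
  also have "(%x. (t * f x + r * g x)^2) = (%x. (f x)^2 * t^2 + (f x * g x) * (2 * t * r) + (g x)^2 * r^2)"
   by (auto simp: power2_eq_square algebra_simps)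
  also have "lint D ... = ?F * t^2 + ?I * (2 * t * r) + ?G * r^2"
   using assms L2_mult_int[OF assms] L2_sqr_int[OF assms(1)] L2_sqr_int[OF assms(2)]
   by (simp add: l2_norm_sq l2_inner_def)
  finally show ?thesis by (simp add: algebra_simps)
 qed
 have "?I^2 <= ?F * ?G"
 proof (cases "?G = 0")
  case True
  have "?I = 0"
  proof (rule ccontr)
   assume "?I ~= 0"
   \<comment> \<open>With \<open>t = 1\<close> and \<open>?G = 0\<close> the form is affine in
     \<open>r\<close>; this \<open>r\<close> gives it the value -1.\<close>
   with sq[of "1" "- (?F + 1) / (2 * ?I)"] True show False
    by (simp add: field_simps)
  qed
  thus ?thesis by simp
 next
  case False
  have "0 <= ?G * (?F * ?G - ?I^2)"
   using sq[of ?G "- ?I"] by (simp add: power2_eq_square algebra_simps)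
  thus ?thesis
   using False by (simp add: zero_le_mult_iff)
 qed
 hence "\<bar>?I\<bar> <= sqrt (?F * ?G)"
  by (metis real_sqrt_abs real_sqrt_le_mono)
 thus ?thesis by (simp add: real_sqrt_mult)
qed


section \<open>Test functions\<close>

text \<open>The premise under which \<open>weak_gradient\<close> is tested. The gradient is a second
  argument because sums, products and translates of test functions have to carry it along.\<close>

definition test_fn :: "'a::euclidean_space set => ('a => real) => ('a => 'a) => bool" where
 "test_fn D eta g \<longleftrightarrow> (ALL x. (eta has_derivative (%y. g x \<bullet> y)) (at x)) & continuous_on UNIV g &
   (EX K. compact K & K <= D & (ALL x. x ~: K --> eta x = 0))"

lemma test_fn_deriv: "test_fn D eta g ==> (eta has_derivative (%y. g x \<bullet> y)) (at x)"
 by (simp add: test_fn_def)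

lemma test_fn_cont: "test_fn D eta g ==> continuous_on UNIV eta"
 by (meson continuous_at_imp_continuous_on has_derivative_continuous test_fn_deriv)

lemma test_fn_cont_grad: "test_fn D eta g ==> continuous_on UNIV g"
 by (simp add: test_fn_def)

text \<open>The complement of the support is open and \<open>eta\<close> is zero on it, so
  uniqueness of the derivative makes \<open>g\<close> vanish there too.\<close>

lemma test_fn_support:
 assumes "test_fn D eta g"
 obtains K where "compact K" "K <= D" "!!x. x ~: K ==> eta x = 0" "!!x. x ~: K ==> g x = 0"
proof -
 obtain K where K: "compact K" "K <= D" "!!x. x ~: K ==> eta x = 0"
  using assms by (auto simp: test_fn_def)
 have "g x = 0" if "x ~: K" for x
 proof -
  have op: "open (- K)" using K(1) by (simp add: compact_imp_closed open_Compl)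
  have "((%x. 0) has_derivative (%y. g x \<bullet> y)) (at x)"
   by (rule has_derivative_transform_within_open[OF test_fn_deriv[OF assms] op])
     (use that K(3) in auto)
  hence "(%y. g x \<bullet> y) = (%y. 0)"
   using has_derivative_const has_derivative_unique by blast
  hence "g x \<bullet> g x = 0" by meson
  thus ?thesis by simp
 qed
 with K that show thesis by blast
qed

lemma compact_support_bounded:
 fixes f :: "'a::euclidean_space => 'b::real_normed_vector"
 assumes "continuous_on UNIV f" "compact K" "!!x. x ~: K ==> f x = 0"
 obtains B where "0 < B" "!!x. norm (f x) <= B"
proof -
 have "bounded (f ` K)"
  by (meson assms compact_continuous_image compact_imp_bounded continuous_on_subset subset_UNIV)
 then obtain B where "0 < B" "!!x. x : K ==> norm (f x) <= B"
  unfolding bounded_pos by blast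
 thus thesis
  using assms(3) by (intro that[of B]) (auto simp: less_imp_le, metis norm_zero less_imp_le)
qed

lemma test_fn_bounded:
 assumes "test_fn D eta g"
 obtains B where "0 < B" "!!x. \<bar>eta x\<bar> <= B" "!!x. norm (g x) <= B"
proof -
 obtain K where K: "compact K" "!!x. x ~: K ==> eta x = 0" "!!x. x ~: K ==> g x = 0"
  using test_fn_support[OF assms] by metis
 obtain B1 where "0 < B1" "!!x. norm (eta x) <= B1"
  using compact_support_bounded[OF test_fn_cont[OF assms] K(1,2)] by metis
 moreover obtain B2 where "0 < B2" "!!x. norm (g x) <= B2"
  using compact_support_bounded[OF test_fn_cont_grad[OF assms] K(1,3)] by metis
 ultimately show thesis
  by (intro that[of "max B1 B2"]) (auto simp: le_max_iff_disj)
qed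

lemma test_fn_mono: "test_fn D eta g ==> D <= E ==> test_fn E eta g"
 unfolding test_fn_def by (meson order_trans)

lemma cont_meas:
 fixes f :: "'a::euclidean_space => 'b::euclidean_space"
 shows "continuous_on UNIV f ==> f : borel_measurable (leb D)"
 by (intro measurable_restrict_space1 measurable_completion) (simp add: borel_measurable_continuous_onI)

lemma test_fn_L2:
 assumes "test_fn D eta g" "E : lmeasurable"
 shows "eta : L2 E" "g : L2 E"
proof -
 obtain B where B: "0 < B" "!!x. \<bar>eta x\<bar> <= B" "!!x. norm (g x) <= B"
  using test_fn_bounded[OF assms(1)] by metis
 show "eta : L2 E"
  using B assms by (intro L2_bounded[where B = B] cont_meas test_fn_cont) auto
 show "g : L2 E"
  using B assms by (intro L2_bounded[where B = B] cont_meas test_fn_cont_grad) auto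
qed

lemma test_fn_zero: "test_fn D (%x. 0) (%x. 0)"
proof -
 have "(%y. (0::'a) \<bullet> y) = (%y. 0)" by simp
 thus ?thesis
  unfolding test_fn_def by (intro conjI allI exI[of _ "{}"]) (simp_all only: has_derivative_const, auto)
qed

lemma test_fn_add:
 assumes "test_fn D f g" "test_fn D f' g'"
 shows "test_fn D (%x. f x + f' x) (%x. g x + g' x)"
proof -
 obtain K where K: "compact K" "K <= D" "!!x. x ~: K ==> f x = 0"
  using test_fn_support[OF assms(1)] by metis
 obtain K' where K': "compact K'" "K' <= D" "!!x. x ~: K' ==> f' x = 0"
  using test_fn_support[OF assms(2)] by metis
 show ?thesis
  unfolding test_fn_def
 proof (intro conjI allI exI[of _ "K \<union> K'"])
  fix x
  show "((%x. f x + f' x) has_derivative (%y. (g x + g' x) \<bullet> y)) (at x)"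
   using has_derivative_add[OF test_fn_deriv[OF assms(1)] test_fn_deriv[OF assms(2)], of x]
   by (simp add: inner_add_left)
  show "continuous_on UNIV (%x. g x + g' x)"
   using assms by (intro continuous_intros test_fn_cont_grad)
 qed (use K K' in auto)
qed

lemma test_fn_scale:
 assumes "test_fn D f g"
 shows "test_fn D (%x. c * f x) (%x. c *\<^sub>R g x)"
proof -
 obtain K where K: "compact K" "K <= D" "!!x. x ~: K ==> f x = 0"
  using test_fn_support[OF assms(1)] by metis
 show ?thesis
  unfolding test_fn_def
 proof (intro conjI allI exI[of _ "K"])
  fix x
  show "((%x. c * f x) has_derivative (%y. (c *\<^sub>R g x) \<bullet> y)) (at x)"
   using has_derivative_mult_right[OF test_fn_deriv[OF assms(1)], of c x] by simp
  show "continuous_on UNIV (%x. c *\<^sub>R g x)"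
   using assms by (intro continuous_intros test_fn_cont_grad)
 qed (use K in auto)
qed

lemma test_fn_sum:
 assumes "!!i. i : I ==> test_fn D (f i) (g i)"
 shows "test_fn D (%x. SUM i:I. f i x) (%x. SUM i:I. g i x)"
 using assms
 by (induction I rule: infinite_finite_induct) (auto intro: test_fn_zero test_fn_add)

lemma test_fn_mult:
 assumes "test_fn D f g" "!!x. (p has_derivative (%y. q x \<bullet> y)) (at x)" "continuous_on UNIV q"
 shows "test_fn D (%x. f x * p x) (%x. f x *\<^sub>R q x + p x *\<^sub>R g x)"
proof -
 obtain K where K: "compact K" "K <= D" "!!x. x ~: K ==> f x = 0"
  using test_fn_support[OF assms(1)] by metis
 have "continuous_on UNIV p"
  by (meson continuous_at_imp_continuous_on has_derivative_continuous assms(2))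
 show ?thesis
  unfolding test_fn_def
 proof (intro conjI allI exI[of _ "K"])
  fix x
  show "((%x. f x * p x) has_derivative (%y. (f x *\<^sub>R q x + p x *\<^sub>R g x) \<bullet> y)) (at x)"
   using has_derivative_mult[OF test_fn_deriv[OF assms(1)] assms(2), of x]
   by (simp add: inner_add_left algebra_simps)
  show "continuous_on UNIV (%x. f x *\<^sub>R q x + p x *\<^sub>R g x)"
   by (intro continuous_intros test_fn_cont_grad[OF assms(1)] test_fn_cont[OF assms(1)]
     \<open>continuous_on UNIV p\<close> assms(3))
 qed (use K in auto)
qed

lemma test_fn_translate:
 assumes "test_fn D f g"
 shows "test_fn ((%x. x + z) ` D) (%x. f (x - z)) (%x. g (x - z))"
proof -
 obtain K where K: "compact K" "K <= D" "!!x. x ~: K ==> f x = 0"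
  using test_fn_support[OF assms(1)] by metis
 show ?thesis
  unfolding test_fn_def
 proof (intro conjI allI exI[of _ "(%x. x + z) ` K"] impI)
  fix x
  show "((%x. f (x - z)) has_derivative (%y. g (x - z) \<bullet> y)) (at x)"
   by (rule has_derivative_compose[of "%x. x - z" "%y. y" x UNIV f, unfolded o_def])
     (auto intro!: derivative_eq_intros test_fn_deriv[OF assms])
  show "continuous_on UNIV (%x. g (x - z))"
   by (intro continuous_on_compose2[OF test_fn_cont_grad[OF assms]] continuous_intros) auto
  show "compact ((%x. x + z) ` K)"
   using compact_translation[OF K(1), of z] by (simp add: add.commute[of z])
  show "(%x. x + z) ` K <= (%x. x + z) ` D" using K(2) by auto
  show "f (x - z) = 0" if "x ~: (%x. x + z) ` K"
   using that K(3)[of "x - z"] by (metis diff_add_cancel image_eqI)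
 qed
qed


section \<open>The squared positive part and C^1 bump functions\<close>

definition psq :: "real => real" where "psq t = (max 0 t)^2"

text \<open>Test functions need only be C^1, so the squared positive part can replace the usual
  exponential cut-offs. At 0 its difference quotient is at most \<open>|y|\<close>.\<close>

lemma psq_deriv: "(psq has_real_derivative (2 * max 0 t)) (at t)"
proof (cases t "0::real" rule: linorder_cases)
 case less
 have "((%t. 0) has_real_derivative 0) (at t)" by simp
 hence "(psq has_real_derivative 0) (at t)"
  by (rule has_field_derivative_transform_within_open[where S = "{..<0}"]) (use less in \<open>auto simp: psq_def\<close>)
 thus ?thesis using less by simp
next
 case greater
 have "((%t. t^2) has_real_derivative 2 * t) (at t)"
  by (auto intro!: derivative_eq_intros)
 hence "(psq has_real_derivative 2 * t) (at t)"
  by (rule has_field_derivative_transform_within_open[where S = "{0<..}"]) (use greater in \<open>auto simp: psq_def\<close>)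
 thus ?thesis using greater by simp
next
 case equal
 have "((%y. (psq y - psq 0) / (y - 0)) \<longlongrightarrow> 0) (at 0)"
 proof (rule tendsto_0_le[where K = 1])
  show "((%y::real. y) \<longlongrightarrow> 0) (at 0)" by (rule tendsto_ident_at)
  show "\<forall>\<^sub>F y in at 0. norm ((psq y - psq 0) / (y - 0)) <= norm y * 1"
   by (rule always_eventually) (auto simp: psq_def max_def power2_eq_square)
 qed
 thus ?thesis using equal by (simp add: has_field_derivative_iff)
qed

lemma psq_nonneg [simp]: "0 <= psq t" by (simp add: psq_def)

lemma psq_pos_iff [simp]: "0 < psq t \<longleftrightarrow> 0 < t"
 by (auto simp: psq_def max_def)

lemma psq_nonpos: "t <= 0 ==> psq t = 0" by (simp add: psq_def)

lemma psq_le_1: "t <= 1 ==> psq t <= 1"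
 by (auto simp: psq_def max_def abs_square_le_1)

definition bump :: "'a::euclidean_space => real => 'a => real" where
 "bump c r x = psq (1 - (x - c) \<bullet> (x - c) / r^2)"

definition bump_grad :: "'a::euclidean_space => real => 'a => 'a" where
 "bump_grad c r x = (- 4 * max 0 (1 - (x - c) \<bullet> (x - c) / r^2) / r^2) *\<^sub>R (x - c)"

lemma bump_nonneg [simp]: "0 <= bump c r x" by (simp add: bump_def)

lemma bump_le_1: "bump c r x <= 1" by (simp add: bump_def psq_le_1)

lemma bump_pos_iff:
 assumes "0 < r"
 shows "0 < bump c r x \<longleftrightarrow> x : ball c r"
proof -
 have "0 < bump c r x \<longleftrightarrow> (norm (x - c))^2 < r^2"
  using assms by (simp add: bump_def power2_norm_eq_inner field_simps)
 also have "... \<longleftrightarrow> norm (x - c) < r"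
  using assms by (auto simp: power2_less_imp_less intro: power_strict_mono)
 finally show ?thesis by (simp add: dist_norm norm_minus_commute)
qed

lemma bump_eq_0: "0 < r ==> x ~: ball c r ==> bump c r x = 0"
 using bump_pos_iff[of r c x] bump_nonneg[of c r x] by linarith

lemma bump_ge:
 assumes "norm (x - c) <= r / 2" "0 < r"
 shows "1/2 <= bump c r x"
proof -
 have "(norm (x - c))^2 <= (r/2)^2" using assms by (intro power_mono) auto
 hence "(x - c) \<bullet> (x - c) / r^2 <= 1/4"
  using assms(2) by (simp add: power2_norm_eq_inner power_divide divide_le_eq)
 hence "3/4 <= max 0 (1 - (x - c) \<bullet> (x - c) / r^2)"
  unfolding le_max_iff_disj by linarith
 hence "(3/4)^2 <= bump c r x" unfolding bump_def psq_def by (rule power_mono) simp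
 thus ?thesis by (simp add: power2_eq_square)
qed

lemma bump_deriv: "(bump c r has_derivative (%y. bump_grad c r x \<bullet> y)) (at x)"
proof -
 have "((%x. 1 - (x - c) \<bullet> (x - c) / r^2) has_derivative (%y. - (2 * ((x - c) \<bullet> y)) / r^2)) (at x)"
  by (auto intro!: derivative_eq_intros simp: inner_commute divide_inverse)
 from has_derivative_compose[OF this, where g = psq, OF psq_deriv[unfolded has_field_derivative_def]]
 show ?thesis
  unfolding bump_def[abs_def]
  by (rule has_derivative_eq_rhs) (simp add: bump_grad_def mult_ac)
qed

lemma bump_grad_cont: "continuous_on UNIV (bump_grad c r)"
 unfolding bump_grad_def divide_inverse by (intro continuous_intros)

lemma bump_grad_eq_0:
 assumes "0 < r" "x ~: ball c r"
 shows "bump_grad c r x = 0"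
proof -
 have "\<not> 0 < 1 - (x - c) \<bullet> (x - c) / r^2" using bump_pos_iff[OF assms(1), of c x] assms(2) by (simp add: bump_def)
 hence "max 0 (1 - (x - c) \<bullet> (x - c) / r^2) = 0" by simp
 thus ?thesis by (simp add: bump_grad_def)
qed

lemma bump_grad_le:
 assumes "0 < r"
 shows "norm (bump_grad c r x) <= 4 / r"
proof (cases "x : ball c r")
 case True
 hence n: "norm (x - c) <= r" by (simp add: dist_norm norm_minus_commute)
 have m: "\<bar>max 0 (1 - (x - c) \<bullet> (x - c) / r^2)\<bar> <= 1" by simp
 have "norm (bump_grad c r x) = 4 * \<bar>max 0 (1 - (x - c) \<bullet> (x - c) / r^2)\<bar> / r^2 * norm (x - c)"
  by (simp add: bump_grad_def abs_mult)
 also have "... <= 4 * 1 / r^2 * r"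
  using n m assms by (intro mult_mono divide_right_mono mult_left_mono) auto
 finally show ?thesis using assms by (simp add: power2_eq_square)
next
 case False
 thus ?thesis using assms by (simp add: bump_grad_eq_0)
qed

lemma test_fn_bump:
 assumes "0 < r" "cball c r <= D"
 shows "test_fn D (bump c r) (bump_grad c r)"
 unfolding test_fn_def
 by (intro conjI allI exI[of _ "cball c r"] bump_deriv bump_grad_cont)
   (use assms in \<open>auto intro!: bump_eq_0\<close>)


section \<open>Density of the test functions\<close>

text \<open>The \<open>L2\<close> closure of the test functions, phrased with squared integrals so
  that \<open>integral_norm_sq_add_le\<close> applies directly.\<close>

definition approx :: "'a::euclidean_space set => ('a => real) => bool" where
 "approx D f \<longleftrightarrow> f : L2 D &
   (ALL e>0. EX eta g. test_fn D eta g & lint D (%x. (f x - eta x)^2) < e)"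

lemma approximable_limit:
 assumes D: "D : lmeasurable" and f: "f : L2 D"
  and "!!e. e > 0 ==> EX h. approx D h & lint D (%x. (f x - h x)^2) < e"
 shows "approx D f"
 unfolding approx_def
proof (intro conjI f allI impI)
 fix e :: real assume "e > 0"
 \<comment> \<open>A quarter, since \<open>integral_norm_sq_add_le\<close> bounds the square of a
   sum by twice the sum of the squares.\<close>
 then obtain h where h: "approx D h" "lint D (%x. (f x - h x)^2) < e/4"
  using assms(3)[of "e/4"] by auto
 then obtain eta g where eta: "test_fn D eta g" "lint D (%x. (h x - eta x)^2) < e/4"
  unfolding approx_def using \<open>e > 0\<close> by (meson divide_pos_pos zero_less_numeral)
 have "(%x. f x - h x) : L2 D" "(%x. h x - eta x) : L2 D"
  using f h(1) test_fn_L2[OF eta(1) D] by (auto simp: approx_def intro: L2_diff)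
 from integral_norm_sq_add_le[OF this]
 have "lint D (%x. (f x - eta x)^2)
   <= 2 * lint D (%x. (f x - h x)^2) + 2 * lint D (%x. (h x - eta x)^2)"
  by simp
 with h eta have "lint D (%x. (f x - eta x)^2) < e" by linarith
 with eta show "EX eta g. test_fn D eta g & lint D (%x. (f x - eta x)^2) < e"
  by blast
qed

lemma approximable_test_fn: "D : lmeasurable ==> test_fn D eta g ==> approx D eta"
 unfolding approx_def using test_fn_L2
 by (intro conjI allI impI exI[of _ eta] exI[of _ g]) auto

lemma approximable_add:
 assumes D: "D : lmeasurable" and "approx D f" "approx D h"
 shows "approx D (%x. f x + h x)"
 unfolding approx_def
proof (intro conjI allI impI)
 have L: "f : L2 D" "h : L2 D" using assms by (auto simp: approx_def)
 thus "(%x. f x + h x) : L2 D" by (rule L2_add)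
 fix e :: real assume "e > 0"
 then obtain eta g where eta: "test_fn D eta g" "lint D (%x. (f x - eta x)^2) < e/4"
  using assms(2) unfolding approx_def by (meson divide_pos_pos zero_less_numeral)
 obtain eta' g' where eta': "test_fn D eta' g'" "lint D (%x. (h x - eta' x)^2) < e/4"
  using assms(3) \<open>e > 0\<close> unfolding approx_def by (meson divide_pos_pos zero_less_numeral)
 have "(%x. f x - eta x) : L2 D" "(%x. h x - eta' x) : L2 D"
  using L test_fn_L2[OF eta(1) D] test_fn_L2[OF eta'(1) D] by (auto intro: L2_diff)
 from integral_norm_sq_add_le[OF this] eta eta'
 have "lint D (%x. (f x + h x - (eta x + eta' x))^2) < e"
  by (simp add: algebra_simps)
 thus "EX eta g. test_fn D eta g & lint D (%x. (f x + h x - eta x)^2) < e"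
  using test_fn_add[OF eta(1) eta'(1)] by blast
qed

lemma approximable_scale:
 assumes D: "D : lmeasurable" and "approx D f"
 shows "approx D (%x. c * f x)"
 unfolding approx_def
proof (intro conjI allI impI)
 have L: "f : L2 D" using assms by (auto simp: approx_def)
 thus "(%x. c * f x) : L2 D" by (rule L2_cmult)
 fix e :: real assume "e > 0"
 \<comment> \<open>The 1 in the denominator covers \<open>c = 0\<close>.\<close>
 hence "0 < e / (c^2 + 1)" by (simp add: add_nonneg_pos)
 then obtain eta g where eta: "test_fn D eta g" "lint D (%x. (f x - eta x)^2) < e / (c^2 + 1)"
  using assms(2) unfolding approx_def by blast
 let ?I = "lint D (%x. (f x - eta x)^2)"
 have "lint D (%x. (c * f x - c * eta x)^2) = c^2 * ?I"
  by (simp add: power_mult_distrib flip: right_diff_distrib)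
 also have "... <= (c^2 + 1) * ?I"
  by (intro mult_right_mono) auto
 also have "... < e" using eta(2) by (subst mult.commute, subst (asm) pos_less_divide_eq) (auto simp: add_nonneg_pos)
 finally show "EX eta g. test_fn D eta g & lint D (%x. (c * f x - eta x)^2) < e"
  using test_fn_scale[OF eta(1)] by blast
qed

lemma approximable_sum:
 assumes "D : lmeasurable" "!!i. i : I ==> approx D (f i)"
 shows "approx D (%x. SUM i:I. f i x)"
 using assms(2)
 by (induction I rule: infinite_finite_induct)
   (auto intro: approximable_add[OF assms(1)] approximable_test_fn[OF assms(1) test_fn_zero])

text \<open>Countably many balls exhaust \<open>U\<close>. If \<open>S n\<close> is the sum of the
  first \<open>n\<close> bumps, then \<open>n S n / (1 + n S n)\<close> is again a test function,
  stays between 0 and 1, tends to 1 wherever some bump is positive, and is 0 off \<open>U\<close>;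
  dominated convergence finishes.\<close>

lemma approximable_open:
 assumes D: "D : lmeasurable" and U: "open U" "U <= D"
 shows "approx D (indicator U)"
proof (cases "U = {}")
 case True
 hence "indicator U = (%x::'a. 0::real)" by (auto simp: indicator_def)
 thus ?thesis using approximable_test_fn[OF D test_fn_zero] by simp
next
 case False
 let ?F = "{ball c r | c r. 0 < r & cball c r <= U}"
 have "\<Union>?F = U"
 proof
  show "U <= \<Union>?F"
  proof
   fix x assume "x : U"
   then obtain r where "r > 0" "cball x r <= U"
    using U(1) open_contains_cball by blast
   thus "x : \<Union>?F" by (intro UnionI[of "ball x r"]) auto
  qed
  show "\<Union>?F <= U" using ball_subset_cball by fast
 qed
 moreover obtain F' where F': "F' <= ?F" "countable F'" "\<Union>F' = \<Union>?F"
  by (rule Lindelof[of ?F]) auto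
 ultimately have UF: "\<Union>F' = U" by simp
 hence "F' ~= {}" using False by auto
 \<comment> \<open>If the family is finite, the enumeration repeats balls, which only adds
   nonnegative terms.\<close>
 have "ALL i. EX c r. from_nat_into F' i = ball c r & 0 < r & cball c r <= U"
  using from_nat_into[OF \<open>F' ~= {}\<close>] F'(1) by blast
 then obtain c r where cr: "!!i. from_nat_into F' i = ball (c i) (r i)" "!!i. 0 < r i" "!!i. cball (c i) (r i) <= U"
  by metis
 define S where "S n x = (\<Sum>i<n. bump (c i) (r i) x)" for n :: nat and x
 define dS where "dS n x = (\<Sum>i<n. bump_grad (c i) (r i) x)" for n :: nat and x
 define eta where "eta n x = real n * S n x / (1 + real n * S n x)" for n x
 define g where "g n x = (real n / (1 + real n * S n x)^2) *\<^sub>R dS n x" for n x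
 have S0: "0 <= S n x" for n x unfolding S_def by (intro sum_nonneg) auto
 have pos: "0 < 1 + real n * S n x" for n x using S0[of n x] by (simp add: add_pos_nonneg)
 have Stest: "test_fn U (S n) (dS n)" for n
  unfolding S_def[abs_def] dS_def[abs_def]
  by (intro test_fn_sum test_fn_bump cr)
 have etatest: "test_fn D (eta n) (g n)" for n
 proof -
  obtain K where K: "compact K" "K <= U" "!!x. x ~: K ==> S n x = 0"
   using test_fn_support[OF Stest[of n]] by metis
  show ?thesis
   unfolding test_fn_def
  proof (intro conjI allI exI[of _ K])
   fix x
   have ne: "1 + real n * S n x ~= 0" using pos[of n x] by simp
   have ds: "((%x. real n * S n x) has_derivative (%y. real n * (dS n x \<bullet> y))) (at x)"
    by (intro has_derivative_mult_right test_fn_deriv[OF Stest])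
   have ds1: "((%x. 1 + real n * S n x) has_derivative (%y. real n * (dS n x \<bullet> y))) (at x)"
    using has_derivative_add[OF has_derivative_const ds, of 1] by simp
   have "(eta n has_derivative (%h. - (real n * S n x) * (inverse (1 + real n * S n x) * (real n * (dS n x \<bullet> h)) * inverse (1 + real n * S n x)) +
     real n * (dS n x \<bullet> h) / (1 + real n * S n x))) (at x)"
    unfolding eta_def[abs_def] by (rule has_derivative_divide[OF ds ds1 ne])
   also have "(%h. - (real n * S n x) * (inverse (1 + real n * S n x) * (real n * (dS n x \<bullet> h)) * inverse (1 + real n * S n x)) +
     real n * (dS n x \<bullet> h) / (1 + real n * S n x)) = (%y. g n x \<bullet> y)"
    using ne by (simp add: g_def fun_eq_iff divide_simps power2_eq_square) (simp add: algebra_simps)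
   finally show "(eta n has_derivative (%y. g n x \<bullet> y)) (at x)" .
   show "continuous_on UNIV (g n)"
    unfolding g_def
   proof (intro continuous_intros ballI)
    show "continuous_on UNIV (S n)" by (rule test_fn_cont[OF Stest])
    show "continuous_on UNIV (dS n)" by (rule test_fn_cont_grad[OF Stest])
    show "(1 + real n * S n x)^2 ~= 0" for x using pos[of n x] by simp
   qed
  qed (use K U in \<open>auto simp: eta_def\<close>)
 qed
 have UD: "U : sets (leb D)"
  using U D by (subst sets_restrict_space_iff) (auto simp: fmeasurableD)
 have Um: "indicat_real U : L2 D"
  using UD by (intro L2_bounded[OF D, where B = 1]) (auto simp: indicator_def)
 have lim: "(%n. eta n x) \<longlonglongrightarrow> indicator U x" for x
 proof (cases "x : U")
  case False
  have "S n x = 0" for n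
  proof -
   obtain K where "K <= U" "!!x. x ~: K ==> S n x = 0" using test_fn_support[OF Stest[of n]] by metis
   thus ?thesis using False by blast
  qed
  thus ?thesis using False by (simp add: eta_def)
 next
  case True
  then obtain B where "B : F'" "x : B" using UF by auto
  then obtain i where i: "x : ball (c i) (r i)"
   using cr(1) from_nat_into_surj[OF F'(2)] by metis
  define b where "b = bump (c i) (r i) x"
  have b: "0 < b" unfolding b_def using i cr(2) bump_pos_iff by blast
  have Sb: "b <= S n x" if "i < n" for n
   unfolding S_def b_def using that by (intro member_le_sum) auto
  have "(%n. 1 - eta n x) \<longlonglongrightarrow> 0"
  proof (rule tendsto_sandwich[of "%_. 0" _ _ "%n. inverse b * inverse (real n)"])
   show "\<forall>\<^sub>F n in sequentially. 0 <= 1 - eta n x"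
    using pos by (intro always_eventually allI) (simp add: eta_def field_simps)
   show "\<forall>\<^sub>F n in sequentially. 1 - eta n x <= inverse b * inverse (real n)"
   proof (rule eventually_sequentiallyI[of "Suc i"])
    fix n assume "Suc i <= n"
    hence "i < n" and n: "0 < n" by auto
    have "1 - eta n x = 1 / (1 + real n * S n x)"
     using pos[of n x] by (simp add: eta_def field_simps)
    also have "... <= 1 / (real n * b)"
     using pos[of n x] b n Sb[OF \<open>i < n\<close>] by (intro divide_left_mono) (auto intro: add_increasing mult_left_mono)
    finally show "1 - eta n x <= inverse b * inverse (real n)" by (simp add: divide_inverse mult.commute)
   qed
   show "(%n. inverse b * inverse (real n)) \<longlonglongrightarrow> 0"
    using tendsto_mult_right_zero[OF lim_inverse_n, of "inverse b"] by simp
  qed simp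
  hence "(%n. 1 - (1 - eta n x)) \<longlonglongrightarrow> 1 - 0" by (intro tendsto_intros)
  thus ?thesis using True by simp
 qed
 have eta01: "0 <= eta n x & eta n x <= 1" for n x
  using pos[of n x] S0[of n x] by (simp add: eta_def field_simps)
 have "(%n. lint D (%x. (indicator U x - eta n x)^2)) \<longlonglongrightarrow> lint D (%x. 0)"
 proof (rule integral_dominated_convergence[where w = "%x. 1"])
  show "(%x. (indicat_real U x - eta n x)^2) : borel_measurable (leb D)" for n
   using L2_meas[OF Um] L2_meas[OF test_fn_L2(1)[OF etatest[of n] D]] by measurable
  show "integrable (leb D) (%x. 1::real)"
   using D by (rule int_const)
  show "AE x in leb D. (%n. (indicat_real U x - eta n x)^2) \<longlonglongrightarrow> 0"
  proof (rule AE_I2)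
   fix x
   have "(%n. (indicat_real U x - eta n x)^2) \<longlonglongrightarrow> (indicat_real U x - indicat_real U x)^2"
    by (intro tendsto_intros lim)
   thus "(%n. (indicat_real U x - eta n x)^2) \<longlonglongrightarrow> 0" by simp
  qed
  show "AE x in leb D. norm ((indicat_real U x - eta n x)^2) <= 1" for n
  proof (rule AE_I2)
   fix x
   have "\<bar>indicat_real U x - eta n x\<bar> <= 1" using eta01[of n x] by (auto simp: indicator_def)
   thus "norm ((indicat_real U x - eta n x)^2) <= 1" by (simp add: abs_square_le_1)
  qed
 qed simp
 hence L: "(%n. lint D (%x. (indicator U x - eta n x)^2)) \<longlonglongrightarrow> 0" by simp
 show ?thesis
  unfolding approx_def
 proof (intro conjI Um allI impI)
  fix e :: real assume "e > 0"
  from order_tendstoD(2)[OF L this]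
  obtain n where "lint D (%x. (indicator U x - eta n x)^2) < e"
   by (meson eventually_sequentially order_refl)
  thus "EX eta g. test_fn D eta g & lint D (%x. (indicat_real U x - eta x)^2) < e"
   using etatest by blast
 qed
qed

text \<open>Outer regularity of Lebesgue measure: an open superset of \<open>M\<close> with small
  excess, cut down to \<open>D\<close>, reduces the claim to
  \<open>approximable_open\<close>.\<close>

lemma approximable_indicator:
 assumes D: "open D" "D : lmeasurable" and M: "M <= D" "M : sets lebesgue"
 shows "approx D (indicator M)"
proof (rule approximable_limit[OF D(2)])
 have "M : sets (leb D)"
  using M D by (subst sets_restrict_space_iff) (auto simp: fmeasurableD)
 thus "indicat_real M : L2 D"
  by (intro L2_bounded[OF D(2), where B = 1]) (auto simp: indicator_def)
 fix e :: real assume "e > 0"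
 obtain T where T: "open T" "M <= T" "T - M : lmeasurable" "emeasure lebesgue (T - M) < ennreal e"
  using sets_lebesgue_outer_open[OF M(2) \<open>e > 0\<close>] by metis
 have appr: "approx D (indicator (T Int D))"
  using approximable_open[OF D(2), of "T Int D"] T(1) D(1) by auto
 have TM: "T Int D - M : sets lebesgue"
  using T(1) D(1) M(2) by (intro sets.Diff) (auto intro: sets_completionI_sets)
 have "lint D (%x. (indicat_real M x - indicat_real (T Int D) x)^2)
   = lint D (indicat_real (T Int D - M))"
  by (rule arg_cong[where f = "lint D"])
    (use M T in \<open>auto simp: indicator_def fun_eq_iff\<close>)
 also have "... = integral\<^sup>L lebesgue (indicat_real (T Int D - M))"
 proof -
  have "(%x. indicat_real D x *\<^sub>R indicat_real (T Int D - M) x) = indicat_real (T Int D - M)"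
   by (auto simp: indicator_def)
  thus ?thesis
   using D(2) by (subst integral_restrict_space) (auto simp: fmeasurableD)
 qed
 also have "... = vol (T Int D - M)"
  using TM by simp
 also have "... <= vol (T - M)"
  using T(3) TM by (intro measure_mono_fmeasurable) auto
 also have "... < e"
  using T(3,4) \<open>e > 0\<close> by (simp add: emeasure_eq_measure2 ennreal_less_iff)
 finally show "EX h. approx D h & lint D (%x. (indicat_real M x - h x)^2) < e"
  using appr by blast
qed

text \<open>Simple functions that converge pointwise with \<open>|F i| <= 2 |f|\<close> satisfy
  \<open>(f - F i)^2 <= 9 f^2\<close>, which is the dominating function.\<close>

lemma L2_approximable:
 fixes f :: "'a::euclidean_space => real"
 assumes D: "open D" "bounded D" and f: "f : L2 D"
 shows "approx D f"
proof -
 have Dm: "D : lmeasurable" using D by (simp add: lmeasurable_open)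
 obtain F where F: "!!i. simple_function (leb D) (F i)"
   "!!x. x : D ==> (%i. F i x) \<longlonglongrightarrow> f x"
   "!!i x. x : D ==> dist (F i x) 0 <= 2 * dist (f x) 0"
  using borel_measurable_implies_sequence_metric[OF L2_meas[OF f], of 0]
  by (metis space_lebesgue_on)
 have Fm: "F i : borel_measurable (leb D)" for i
  by (rule borel_measurable_simple_function[OF F(1)])
 have appr: "approx D (F i)" for i
 proof -
  \<comment> \<open>\<open>F i\<close> is controlled on \<open>D\<close> only; \<open>G\<close> is a
    combination of indicators of subsets of \<open>D\<close> and coincides with it there.\<close>
  define G where "G = (%x. SUM y:F i ` D. y * indicator (F i -` {y} Int D) x)"
  have fin: "finite (F i ` D)" using F(1)[of i] by (simp add: simple_function_def)
  have sets: "F i -` {y} Int D : sets lebesgue" if "y : F i ` D" for y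
   using F(1)[of i] Dm that by (auto simp: simple_function_def sets_restrict_space_iff fmeasurableD)
  have G: "approx D G"
   unfolding G_def by (intro approximable_sum[OF Dm] approximable_scale[OF Dm] approximable_indicator D Dm sets) auto
  have eq: "G x = F i x" if "x : D" for x
  proof -
   have "G x = (SUM y:F i ` D. if y = F i x then y else 0)"
    using that unfolding G_def by (intro sum.cong) (auto simp: indicator_def)
   also have "... = F i x" using fin that by (simp add: sum.delta)
   finally show ?thesis .
  qed
  have "F i : L2 D"
  proof (rule L2_cong_AE[of G, OF _ Fm])
   show "G : L2 D" using G by (simp add: approx_def)
   show "AE x in leb D. G x = F i x" by (rule AE_I2) (simp add: eq)
  qed
  thus ?thesis
  proof (rule approximable_limit[OF Dm], intro exI conjI)
   fix e :: real assume "e > 0"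
   have "lint D (%x. (F i x - G x)^2) = lint D (%x. 0)"
    by (intro lint_cong) (auto simp: eq)
   thus "lint D (%x. (F i x - G x)^2) < e" using \<open>e > 0\<close> by simp
  qed (rule G)
 qed
 have "(%i. lint D (%x. (f x - F i x)^2)) \<longlonglongrightarrow> lint D (%x. 0)"
 proof (rule integral_dominated_convergence[where w = "%x. 9 * (f x)^2"])
  show "(%x. (f x - F i x)^2) : borel_measurable (leb D)" for i
   using L2_meas[OF f] Fm[of i] by measurable
  show "integrable (leb D) (%x. 9 * (f x)^2)"
   using L2_sqr_int[OF f] by simp
  show "AE x in leb D. (%i. (f x - F i x)^2) \<longlonglongrightarrow> 0"
  proof (rule AE_I2)
   fix x assume "x : space (leb D)"
   hence "(%i. (f x - F i x)^2) \<longlonglongrightarrow> (f x - f x)^2" by (intro tendsto_intros F) simp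
   thus "(%i. (f x - F i x)^2) \<longlonglongrightarrow> 0" by simp
  qed
  show "AE x in leb D. norm ((f x - F i x)^2) <= 9 * (f x)^2" for i
  proof (rule AE_I2)
   fix x assume "x : space (leb D)"
   hence "\<bar>F i x\<bar> <= 2 * \<bar>f x\<bar>" using F(3)[of x i] by simp
   hence "\<bar>f x - F i x\<bar> <= \<bar>3 * f x\<bar>" by linarith
   hence "(f x - F i x)^2 <= (3 * f x)^2" by (simp add: abs_le_square_iff)
   thus "norm ((f x - F i x)^2) <= 9 * (f x)^2" by (simp add: power_mult_distrib)
  qed
 qed simp
 hence L: "(%i. lint D (%x. (f x - F i x)^2)) \<longlonglongrightarrow> 0" by simp
 show ?thesis
 proof (rule approximable_limit[OF Dm f])
  fix e :: real assume "e > 0"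
  from order_tendstoD(2)[OF L this]
  obtain n where "lint D (%x. (f x - F n x)^2) < e"
   by (meson eventually_sequentially order_refl)
  thus "EX h. approx D h & lint D (%x. (f x - h x)^2) < e"
   using appr by blast
 qed
qed

text \<open>Test with a function at distance at most \<open>e\<close> from \<open>f\<close> itself:
  if \<open>N\<close> is the norm of \<open>f\<close>, this gives
  \<open>N^2 <= C N + e (C + N)\<close>, and \<open>e\<close> tends to 0. It serves both the
  uniqueness of weak gradients and the estimate for translations.\<close>

lemma l2_norm_le_by_testing:
 fixes f :: "'a::euclidean_space => real"
 assumes D: "open D" "bounded D" and f: "f : L2 D" and C: "0 <= C"
  and test: "!!eta g. test_fn D eta g ==> l2_inner D f eta <= C * l2_norm D eta"
 shows "l2_norm D f <= C"
proof -
 have Dm: "D : lmeasurable" using D by (simp add: lmeasurable_open)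
 let ?N = "l2_norm D f"
 have "?N^2 <= C * ?N + e * (C + ?N)" if "e > 0" for e
 proof -
  have "0 < e^2" using that by simp
  then obtain eta g where eta: "test_fn D eta g" "lint D (%x. (f x - eta x)^2) < e^2"
   using L2_approximable[OF D f] unfolding approx_def by blast
  have etaL: "eta : L2 D" using test_fn_L2[OF eta(1) Dm] by simp
  have d: "(%x. f x - eta x) : L2 D" by (rule L2_diff[OF f etaL])
  let ?d = "l2_norm D (%x. f x - eta x)"
  have de: "?d <= e"
  proof -
   have "?d^2 <= e^2" using eta(2) by (simp add: l2_norm_sq)
   thus ?thesis by (rule power2_le_imp_le) (use that in simp)
  qed
  have int: "integrable (leb D) (%x. f x * eta x)" "integrable (leb D) (%x. f x * (f x - eta x))"
   using L2_mult_int[OF f etaL] L2_mult_int[OF f d] by auto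
  have "?N^2 = l2_inner D f eta + l2_inner D f (%x. f x - eta x)"
   unfolding l2_norm_sq l2_inner_def
   by (subst Bochner_Integration.integral_add[OF int, symmetric]) (simp add: power2_eq_square algebra_simps)
  also have "... <= C * l2_norm D eta + ?N * e"
  proof -
   have "l2_inner D f (%x. f x - eta x) <= ?N * ?d"
    using L2_CS[OF f d] by linarith
   also have "... <= ?N * e" by (intro mult_left_mono de) simp
   finally show ?thesis using test[OF eta(1)] by linarith
  qed
  also have "C * l2_norm D eta <= C * (?N + e)"
  proof (rule mult_left_mono[OF _ C])
   have "(l2_norm D eta)^2 = ?N^2 - 2 * l2_inner D f (%x. f x - eta x) + ?d^2"
   proof -
    have "(%x. (eta x)^2) = (%x. (f x)^2 - 2 * (f x * (f x - eta x)) + (f x - eta x)^2)"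
     by (auto simp: power2_eq_square algebra_simps)
    thus ?thesis
     unfolding l2_norm_sq l2_inner_def
     using int L2_sqr_int[OF f] L2_sqr_int[OF d] by simp
   qed
   also have "... <= ?N^2 + 2 * (?N * ?d) + ?d^2"
    using L2_CS[OF f d] by linarith
   also have "... = (?N + ?d)^2" by (simp add: power2_sum)
   finally have "l2_norm D eta <= ?N + ?d" by (rule power2_le_imp_le) simp
   thus "l2_norm D eta <= ?N + e" using de by linarith
  qed
  finally show ?thesis by (simp add: algebra_simps)
 qed
 hence ineq: "?N^2 <= C * ?N + e * (C + ?N)" if "e > 0" for e using that by blast
 have "?N^2 <= C * ?N"
 proof (rule field_le_epsilon)
  fix e :: real assume "e > 0"
  hence "0 < e / (C + ?N + 1)" using C by (simp add: add_nonneg_pos)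
  from ineq[OF this] have "?N^2 <= C * ?N + e / (C + ?N + 1) * (C + ?N)" .
  also have "e / (C + ?N + 1) * (C + ?N) <= e"
  proof -
   have p: "0 < C + ?N + 1" using C by (simp add: add_nonneg_pos)
   have "e * (C + ?N) <= e * (C + ?N + 1)" using \<open>e > 0\<close> by simp
   thus ?thesis using p by (simp add: pos_divide_le_eq)
  qed
  finally show "?N^2 <= C * ?N + e" by simp
 qed
 thus ?thesis
  by (metis C l2_norm_nonneg mult_right_le_imp_le order_le_less power2_eq_square)
qed

section \<open>Weak gradients\<close>

lemma weak_gradient_iff_test_fn:
 "weak_gradient D u G \<longleftrightarrow> (ALL eta g. test_fn D eta g -->
   lint D (%x. u x *\<^sub>R g x) = - lint D (%x. eta x *\<^sub>R G x))"
 unfolding weak_gradient_def test_fn_def by meson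

lemma L2_scaleR_integrable:
 assumes "f : L2 D" "G : L2 D"
 shows "integrable (leb D) (%x. f x *\<^sub>R G x)"
proof -
 have "integrable (leb D) (%x. (f x *\<^sub>R G x) \<bullet> b)" for b
  using L2_mult_int[OF assms(1) L2_dot[OF assms(2)]] by simp
 hence "integrable (leb D) (%x. SUM b:Basis. ((f x *\<^sub>R G x) \<bullet> b) *\<^sub>R b)"
  by (intro Bochner_Integration.integrable_sum integrable_scaleR_left) auto
 thus ?thesis by (simp only: euclidean_representation)
qed

text \<open>Componentwise form: vector-valued integrals become scalar products in \<open>L2\<close>,
  to which Cauchy-Schwarz and the linearity lemmas apply.\<close>

lemma weak_gradient_iff_inner:
 assumes D: "D : lmeasurable" and u: "u : L2 D" and G: "G : L2 D"
 shows "weak_gradient D u G \<longleftrightarrow> (ALL eta g. test_fn D eta g -->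
   (ALL e. l2_inner D u (%x. g x \<bullet> e) = - l2_inner D eta (%x. G x \<bullet> e)))" (is "_ = ?R")
proof -
 have *: "lint D (%x. u x *\<^sub>R g x) \<bullet> e = l2_inner D u (%x. g x \<bullet> e)"
     "lint D (%x. eta x *\<^sub>R G x) \<bullet> e = l2_inner D eta (%x. G x \<bullet> e)"
  if "test_fn D eta g" for eta g e
  using L2_scaleR_integrable[OF u test_fn_L2(2)[OF that D]] L2_scaleR_integrable[OF test_fn_L2(1)[OF that D] G]
  by (simp_all add: l2_inner_def flip: integral_inner_left)
 show ?thesis
 proof
  assume w: "weak_gradient D u G"
  show ?R
  proof (intro allI impI)
   fix eta g e assume t: "test_fn D eta g"
   hence "lint D (%x. u x *\<^sub>R g x) = - lint D (%x. eta x *\<^sub>R G x)"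
    using w by (simp add: weak_gradient_iff_test_fn)
   thus "l2_inner D u (%x. g x \<bullet> e) = - l2_inner D eta (%x. G x \<bullet> e)"
    by (simp flip: *[OF t])
  qed
 next
  assume ?R
  hence R: "l2_inner D u (%x. g x \<bullet> e) = - l2_inner D eta (%x. G x \<bullet> e)"
   if "test_fn D eta g" for eta g e using that by blast
  show "weak_gradient D u G"
   unfolding weak_gradient_iff_test_fn
  proof (intro allI impI, rule euclidean_eqI)
   fix eta :: "'a => real" and g and b :: 'a assume t: "test_fn D eta g"
   hence "l2_inner D u (%x. g x \<bullet> b) = - l2_inner D eta (%x. G x \<bullet> b)" by (rule R)
   thus "lint D (%x. u x *\<^sub>R g x) \<bullet> b
     = (- lint D (%x. eta x *\<^sub>R G x)) \<bullet> b"
    unfolding inner_minus_left *[OF t] .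
  qed
 qed
qed

lemma weak_gradientI:
 assumes "D : lmeasurable" "u : L2 D" "G : L2 D"
  and "!!eta g e. test_fn D eta g ==> l2_inner D u (%x. g x \<bullet> e) = - l2_inner D eta (%x. G x \<bullet> e)"
 shows "weak_gradient D u G"
 using assms weak_gradient_iff_inner by blast

lemma weak_gradientD:
 assumes "weak_gradient D u G" "D : lmeasurable" "u : L2 D" "G : L2 D" "test_fn D eta g"
 shows "l2_inner D u (%x. g x \<bullet> e) = - l2_inner D eta (%x. G x \<bullet> e)"
 using assms weak_gradient_iff_inner by blast

lemma l2_norm_eq_0:
 assumes "f : L2 D" "l2_norm D f = 0"
 shows "AE x in leb D. f x = 0"
proof -
 have "lint D (%x. (norm (f x))^2) = 0"
  using assms(2) by (simp flip: l2_norm_sq)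
 hence "AE x in leb D. (norm (f x))^2 = 0"
  by (subst (asm) integral_nonneg_eq_0_iff_AE) (use L2_sq_int[OF assms(1)] in auto)
 thus ?thesis by simp
qed

lemma L2_eq_0_by_testing:
 fixes f :: "'a::euclidean_space => real"
 assumes "open D" "bounded D" "f : L2 D"
  and "!!eta g. test_fn D eta g ==> l2_inner D f eta = 0"
 shows "AE x in leb D. f x = 0"
proof (rule l2_norm_eq_0[OF assms(3)])
 have "l2_norm D f <= 0"
  by (rule l2_norm_le_by_testing) (use assms in auto)
 thus "l2_norm D f = 0" using l2_norm_nonneg[of D f] by linarith
qed

lemma l2_inner_diff_right:
 assumes "f : L2 D" "g : L2 D" "h : L2 D"
 shows "l2_inner D f (%x. g x - h x) = l2_inner D f g - l2_inner D f h"
 using L2_mult_int[OF assms(1,2)] L2_mult_int[OF assms(1,3)]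
 by (simp add: l2_inner_def right_diff_distrib)

lemma l2_inner_commute: "l2_inner D f g = l2_inner D g f"
 by (simp add: l2_inner_def mult.commute)

text \<open>\<open>wgrad\<close> is an arbitrary choice, so computing an \<open>H1\<close> norm from
  a known gradient rests on this uniqueness. It is the fundamental lemma of the calculus of
  variations, applied to each component of the difference.\<close>

lemma weak_gradient_unique:
 assumes D: "open D" "bounded D" and u: "u : L2 D" and G: "G : L2 D" "G' : L2 D"
  and w: "weak_gradient D u G" "weak_gradient D u G'"
 shows "AE x in leb D. G x = G' x"
proof -
 have Dm: "D : lmeasurable" using D by (simp add: lmeasurable_open)
 have "AE x in leb D. (G x - G' x) \<bullet> b = 0" for b
 proof (rule L2_eq_0_by_testing[OF D])
  show "(%x. (G x - G' x) \<bullet> b) : L2 D"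
   by (intro L2_dot L2_diff G)
  fix eta g assume t: "test_fn D eta g"
  have eta: "eta : L2 D" using test_fn_L2[OF t Dm] by simp
  show "l2_inner D (%x. (G x - G' x) \<bullet> b) eta = 0"
   using weak_gradientD[OF w(1) Dm u G(1) t, of b] weak_gradientD[OF w(2) Dm u G(2) t, of b]
   by (subst l2_inner_commute)
     (simp add: inner_diff_left l2_inner_diff_right[OF eta L2_dot[OF G(1)] L2_dot[OF G(2)]])
 qed
 hence "AE x in leb D. ALL b:Basis. (G x - G' x) \<bullet> b = 0"
  by (intro AE_finite_allI) auto
 thus ?thesis
 proof eventually_elim
  case (elim x)
  show ?case by (rule euclidean_eqI) (use elim in \<open>simp add: inner_diff_left\<close>)
 qed
qed

lemma lint_subset:
 fixes f :: "'a::euclidean_space => real"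
 assumes "E <= D" "E : sets lebesgue" "D : sets lebesgue" "!!x. x : D - E ==> f x = 0"
 shows "lint D f = lint E f"
proof -
 have "lint D f = lint D (%x. if x : E then f x else 0)"
  by (rule lint_cong) (use assms(4) in auto)
 also have "... = lint E f"
  using assms by (intro integral_restrict)
 finally show ?thesis .
qed

text \<open>A test function on \<open>E\<close> is one on \<open>D\<close>, and both it and its
  gradient vanish off \<open>E\<close>, so the integrals over the two sets agree.\<close>

lemma wgrad_subset:
 assumes w: "weak_gradient D u G" and D: "D : lmeasurable" "u : L2 D" "G : L2 D"
  and E: "E <= D" "E : lmeasurable"
 shows "weak_gradient E u G"
proof (rule weak_gradientI[OF E(2)])
 have s: "E : sets lebesgue" "D : sets lebesgue" using D E by (auto simp: fmeasurableD)
 show "u : L2 E" "G : L2 E" using L2_subset D E s by blast+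
 fix eta g e assume t: "test_fn E eta g"
 obtain K where K: "K <= E" "!!x. x ~: K ==> eta x = 0" "!!x. x ~: K ==> g x = 0"
  using test_fn_support[OF t] by metis
 have z: "eta x = 0" "g x = 0" if "x : D - E" for x
  using K(1) K(2)[of x] K(3)[of x] that by auto
 have "l2_inner E u (%x. g x \<bullet> e) = l2_inner D u (%x. g x \<bullet> e)"
  unfolding l2_inner_def by (rule lint_subset[symmetric]) (use E s z in auto)
 also have "... = - l2_inner D eta (%x. G x \<bullet> e)"
  by (rule weak_gradientD[OF w D test_fn_mono[OF t E(1)]])
 also have "l2_inner D eta (%x. G x \<bullet> e) = l2_inner E eta (%x. G x \<bullet> e)"
  unfolding l2_inner_def by (rule lint_subset) (use E s z in auto)
 finally show "l2_inner E u (%x. g x \<bullet> e) = - l2_inner E eta (%x. G x \<bullet> e)" .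
qed

lemma l2_inner_cong_AE:
 assumes "AE x in leb D. f x = f' x" "AE x in leb D. g x = g' x"
  "f : L2 D" "f' : L2 D" "g : L2 D" "g' : L2 D"
 shows "l2_inner D f g = l2_inner D f' g'"
 unfolding l2_inner_def
proof (rule integral_cong_AE)
 show "(%x. f x * g x) : borel_measurable (leb D)" "(%x. f' x * g' x) : borel_measurable (leb D)"
  using assms by (auto simp: L2_def)
 show "AE x in leb D. f x * g x = f' x * g' x"
  using assms(1,2) by eventually_elim simp
qed

lemma weak_gradient_cong_AE:
 assumes w: "weak_gradient D u G" and D: "D : lmeasurable" and L: "u : L2 D" "G : L2 D" "v : L2 D" "H : L2 D"
  and ae: "AE x in leb D. u x = v x" "AE x in leb D. G x = H x"
 shows "weak_gradient D v H"
proof (rule weak_gradientI[OF D L(3,4)])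
 fix eta g e assume t: "test_fn D eta g"
 note tL = test_fn_L2[OF t D]
 have "l2_inner D v (%x. g x \<bullet> e) = l2_inner D u (%x. g x \<bullet> e)"
  using ae(1) by (intro l2_inner_cong_AE) (auto simp: L L2_dot[OF tL(2)] elim: eventually_mono)
 moreover have "l2_inner D eta (%x. H x \<bullet> e) = l2_inner D eta (%x. G x \<bullet> e)"
  using ae(2) by (intro l2_inner_cong_AE) (auto simp: tL L2_dot[OF L(2)] L2_dot[OF L(4)] elim: eventually_mono)
 ultimately show "l2_inner D v (%x. g x \<bullet> e) = - l2_inner D eta (%x. H x \<bullet> e)"
  using weak_gradientD[OF w D L(1,2) t] by simp
qed

lemma l2_inner_lincomb_left:
 assumes "f : L2 D" "g : L2 D" "h : L2 D"
 shows "l2_inner D (%x. a * f x + b * g x) h = a * l2_inner D f h + b * l2_inner D g h"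
proof -
 have "(%x. (a * f x + b * g x) * h x) = (%x. a * (f x * h x) + b * (g x * h x))"
  by (auto simp: algebra_simps)
 thus ?thesis
  using L2_mult_int[OF assms(1,3)] L2_mult_int[OF assms(2,3)]
  by (simp add: l2_inner_def)
qed

lemma l2_inner_lincomb_right:
 assumes "f : L2 D" "g : L2 D" "h : L2 D"
 shows "l2_inner D h (%x. a * f x + b * g x) = a * l2_inner D h f + b * l2_inner D h g"
 using l2_inner_lincomb_left[OF assms] by (simp only: l2_inner_commute[of D h])

lemma weak_gradient_lincomb:
 assumes D: "D : lmeasurable" and L: "u : L2 D" "v : L2 D" "G : L2 D" "H : L2 D"
  and w: "weak_gradient D u G" "weak_gradient D v H"
 shows "weak_gradient D (%x. a * u x + b * v x) (%x. a *\<^sub>R G x + b *\<^sub>R H x)"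
proof (rule weak_gradientI[OF D])
 show "(%x. a * u x + b * v x) : L2 D" "(%x. a *\<^sub>R G x + b *\<^sub>R H x) : L2 D"
  by (intro L2_add L2_cmult L2_scaleR L)+
 fix eta g e assume t: "test_fn D eta g"
 note tL = test_fn_L2[OF t D]
 show "l2_inner D (%x. a * u x + b * v x) (%x. g x \<bullet> e) = - l2_inner D eta (%x. (a *\<^sub>R G x + b *\<^sub>R H x) \<bullet> e)"
  using weak_gradientD[OF w(1) D L(1,3) t, of e] weak_gradientD[OF w(2) D L(2,4) t, of e]
  by (simp add: inner_add_left l2_inner_lincomb_left l2_inner_lincomb_right L L2_dot tL)
qed


lemma borel_imp_lebesgue:
 "f : borel_measurable borel ==> f : borel_measurable lebesgue"
 by (simp add: measurable_completion)

section \<open>Integrals of directional derivatives\<close>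

lemma integral_lebesgue_translate:
 fixes f :: "'a::euclidean_space => real"
 assumes "f : borel_measurable borel"
 shows "integral\<^sup>L lebesgue (%x. f (x + c)) = integral\<^sup>L lebesgue f"
proof -
 have "integral\<^sup>L lborel f = integral\<^sup>L (distr lborel borel ((+) c)) f"
  by (simp add: lborel_distr_plus)
 also have "... = integral\<^sup>L lborel (%x. f (c + x))"
  using assms by (subst integral_distr) auto
 finally show ?thesis
  using assms by (simp add: integral_completion add.commute)
qed

lemma integrable_lebesgue_translate:
 fixes f :: "'a::euclidean_space => real"
 assumes "f : borel_measurable borel" "integrable lebesgue f"
 shows "integrable lebesgue (%x. f (x + c))"
proof -
 have "integrable (distr lborel borel ((+) c)) f"
  using assms by (simp add: lborel_distr_plus integrable_completion)
 hence "integrable lborel (%x. f (c + x))"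
  using assms by (subst (asm) integrable_distr_eq) auto
 thus ?thesis
  using assms by (simp add: integrable_completion add.commute)
qed

text \<open>Differentiation of the translation invariance of the integral.\<close>

lemma integral_directional_derivative_eq_0:
 fixes F F' :: "'a::euclidean_space => real"
 assumes lip: "!!x y. \<bar>F x - F y\<bar> <= L * norm (x - y)"
  and supp: "!!x. x ~: cball 0 R ==> F x = 0"
  and meas: "F' : borel_measurable lebesgue"
  and lim: "AE x in lebesgue. ((%t. F (x + t *\<^sub>R e)) has_real_derivative F' x) (at 0)"
 shows "integral\<^sup>L lebesgue F' = 0"
proof -
 have L: "0 <= L * norm e"
  using lip[of 0 e] by (metis abs_ge_zero norm_minus_commute order_trans diff_zero)
 have "continuous_on UNIV F"
 proof (rule continuous_onI)
  fix x and \<epsilon> :: real assume "\<epsilon> > 0"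
  show "EX d>0. ALL x':UNIV. dist x' x < d --> dist (F x') (F x) <= \<epsilon>"
  proof (intro exI[of _ "\<epsilon> / (\<bar>L\<bar> + 1)"] conjI ballI impI)
   show "\<epsilon> / (\<bar>L\<bar> + 1) > 0" using \<open>\<epsilon> > 0\<close> by (simp add: add_nonneg_pos)
   fix x' assume "dist x' x < \<epsilon> / (\<bar>L\<bar> + 1)"
   hence *: "norm (x' - x) * (\<bar>L\<bar> + 1) < \<epsilon>"
    by (simp add: dist_norm pos_less_divide_eq add_nonneg_pos)
   have "dist (F x') (F x) <= L * norm (x' - x)" using lip by (simp add: dist_real_def)
   also have "... <= (\<bar>L\<bar> + 1) * norm (x' - x)" by (intro mult_right_mono) auto
   finally show "dist (F x') (F x) <= \<epsilon>" using * by (simp add: mult.commute)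
  qed
 qed
 hence Fb: "F : borel_measurable borel" by (rule borel_measurable_continuous_onI)
 obtain B where B: "0 < B" "!!x. norm (F x) <= B"
  using compact_support_bounded[OF \<open>continuous_on UNIV F\<close> compact_cball supp] by metis
 have Fi: "integrable lebesgue F"
 proof (rule Bochner_Integration.integrable_bound)
  show "integrable lebesgue (%x. B * indicator (cball 0 R) x)"
   by (simp flip: lmeasurable_iff_integrable)
  show "F : borel_measurable lebesgue" using Fb by (simp add: measurable_completion)
  show "AE x in lebesgue. norm (F x) <= norm (B * indicat_real (cball 0 R) x)"
   using B supp by (intro AE_I2) (auto simp: indicator_def)
 qed
 define q where "q n x = real (Suc n) * (F (x + (1 / real (Suc n)) *\<^sub>R e) - F x)" for n x
 have q0: "integral\<^sup>L lebesgue (q n) = 0" for n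
  unfolding q_def[abs_def]
  using Fi integrable_lebesgue_translate[OF Fb Fi]
  by (simp add: integral_lebesgue_translate[OF Fb])
 have "(%n. integral\<^sup>L lebesgue (q n)) \<longlonglongrightarrow> integral\<^sup>L lebesgue F'"
 \<comment> \<open>Both \<open>x\<close> and the shifted point avoid the support once
   \<open>x\<close> is outside the ball enlarged by \<open>norm e\<close>; inside it the Lipschitz
   constant bounds the quotient.\<close>
 proof (rule integral_dominated_convergence[where w = "%x. L * norm e * indicator (cball 0 (\<bar>R\<bar> + norm e)) x"])
  show "integrable lebesgue (%x. L * norm e * indicat_real (cball 0 (\<bar>R\<bar> + norm e)) x)"
   by (simp flip: lmeasurable_iff_integrable)
  show "q n : borel_measurable lebesgue" for n
  proof (rule borel_imp_lebesgue)
   have "(%x. F (x + (1 / real (Suc n)) *\<^sub>R e)) : borel_measurable borel"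
    by (rule measurable_compose[OF _ Fb]) measurable
   thus "q n : borel_measurable borel"
    unfolding q_def using Fb by measurable
  qed
  show "AE x in lebesgue. (%n. q n x) \<longlonglongrightarrow> F' x"
   using lim
  proof eventually_elim
   case (elim x)
   have s: "(%n. 1 / real (Suc n)) \<longlonglongrightarrow> 0" using LIMSEQ_inverse_real_of_nat by (simp add: inverse_eq_divide)
   have "(%n. (F (x + (0 + 1 / real (Suc n)) *\<^sub>R e) - F (x + 0 *\<^sub>R e)) / (1 / real (Suc n))) \<longlonglongrightarrow> F' x"
    using elim[unfolded DERIV_def, THEN filterlim_compose, of "%n. 1 / real (Suc n)" sequentially] s
    by (simp add: filterlim_at)
   thus ?case by (simp add: q_def mult.commute)
  qed
  show "AE x in lebesgue. norm (q n x) <= L * norm e * indicat_real (cball 0 (\<bar>R\<bar> + norm e)) x" for n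
  proof (rule AE_I2)
   fix x
   let ?y = "x + (1 / real (Suc n)) *\<^sub>R e"
   have le: "norm ((1 / real (Suc n)) *\<^sub>R e) <= norm e"
    by (simp add: divide_le_eq mult_le_cancel_left1)
   have "norm (q n x) = real (Suc n) * \<bar>F ?y - F x\<bar>" unfolding q_def by (simp add: abs_mult)
   also have "... <= real (Suc n) * (L * norm (?y - x))" by (intro mult_left_mono lip) simp
   also have "... = L * norm e" by (simp add: field_simps)
   finally have "norm (q n x) <= L * norm e" .
   moreover have "q n x = 0" if "x ~: cball 0 (\<bar>R\<bar> + norm e)"
   proof -
    have "norm x > \<bar>R\<bar> + norm e" using that by simp
    moreover have "norm ?y >= norm x - norm ((1 / real (Suc n)) *\<^sub>R e)"
     using norm_triangle_ineq2[of x "- ((1 / real (Suc n)) *\<^sub>R e)"] by simp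
    ultimately have "norm ?y > \<bar>R\<bar>" "norm x > \<bar>R\<bar>" using le norm_ge_zero[of e] by linarith+
    thus ?thesis using supp[of x] supp[of ?y] by (simp add: q_def)
   qed
   ultimately show "norm (q n x) <= L * norm e * indicat_real (cball 0 (\<bar>R\<bar> + norm e)) x"
    by (auto simp: indicator_def)
  qed
 qed (rule meas)
 hence "(%n::nat. 0::real) \<longlonglongrightarrow> integral\<^sup>L lebesgue F'" by (simp add: q0)
 thus ?thesis using LIMSEQ_unique tendsto_const by blast
qed

lemma lipschitz_from_grad_bound:
 assumes "!!x. (eta has_derivative (%y. g x \<bullet> y)) (at x)" "!!x. norm (g x) <= B"
 shows "\<bar>eta x - eta y\<bar> <= B * norm (x - y)"
proof -
 have "norm (eta x - eta y) <= B * norm (x - y)"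
 proof (rule differentiable_bound[of UNIV])
  fix z
  have "onorm (%y. g z \<bullet> y) <= norm (g z)"
   by (rule onorm_bound) (use Cauchy_Schwarz_ineq2 in auto)
  thus "onorm (%y. g z \<bullet> y) <= B" using assms(2) order_trans by blast
 qed (use assms(1) in auto)
 thus ?thesis by simp
qed

lemma has_real_derivative_along:
 assumes "(f has_derivative (%y. g \<bullet> y)) (at (x + t *\<^sub>R e))"
 shows "((%t. f (x + t *\<^sub>R e)) has_real_derivative g \<bullet> e) (at t)"
proof -
 have "((%t. x + t *\<^sub>R e) has_derivative (%s. s *\<^sub>R e)) (at t)"
  by (auto intro!: derivative_eq_intros)
 from has_derivative_compose[OF this assms]
 show ?thesis by (simp add: has_field_derivative_def o_def mult.commute[of _ "g \<bullet> e"] mult_commute_abs)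
qed

text \<open>The divergence theorem for the compactly supported field \<open>eta e\<close>; it is
  what replaces boundary integrals in the sequel.\<close>

lemma test_fn_integral_grad:
 assumes t: "test_fn D eta g" and D: "D : sets lebesgue"
 shows "lint D (%x. g x \<bullet> e) = 0"
proof -
 obtain B where B: "0 < B" "!!x. \<bar>eta x\<bar> <= B" "!!x. norm (g x) <= B" using test_fn_bounded[OF t] by metis
 obtain K where K: "compact K" "K <= D" "!!x. x ~: K ==> eta x = 0" "!!x. x ~: K ==> g x = 0"
  using test_fn_support[OF t] by metis
 obtain R where R: "!!x. x : K ==> norm x <= R"
  using compact_imp_bounded[OF K(1)] unfolding bounded_iff by blast
 have "integral\<^sup>L lebesgue (%x. g x \<bullet> e) = 0"
 proof (rule integral_directional_derivative_eq_0)
  show "\<bar>eta x - eta y\<bar> <= B * norm (x - y)" for x y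
   by (rule lipschitz_from_grad_bound[OF test_fn_deriv[OF t] B(3)])
  show "eta x = 0" if "x ~: cball 0 R" for x
   using K(3)[of x] R[of x] that by auto
  show "(%x. g x \<bullet> e) : borel_measurable lebesgue"
   by (intro borel_imp_lebesgue borel_measurable_continuous_onI continuous_intros test_fn_cont_grad[OF t])
  show "AE x in lebesgue. ((%s. eta (x + s *\<^sub>R e)) has_real_derivative g x \<bullet> e) (at 0)"
   by (intro AE_I2 has_real_derivative_along) (simp add: test_fn_deriv[OF t])
 qed
 thus ?thesis
  using lint_subset[of D UNIV "%x. g x \<bullet> e"] D K(2) K(4)
  by (simp add: lebesgue_on_UNIV_eq subset_iff) (metis inner_zero_left)
qed

text \<open>The product of \<open>eta\<close> and \<open>p\<close> is again a test function, and the
  integral of its gradient vanishes.\<close>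

lemma weak_gradient_C1:
 assumes D: "D : lmeasurable" and p: "!!x. (p has_derivative (%y. q x \<bullet> y)) (at x)" "continuous_on UNIV q"
  and L: "p : L2 D" "q : L2 D"
 shows "weak_gradient D p q"
proof (rule weak_gradientI[OF D L])
 fix eta g e assume t: "test_fn D eta g"
 note tL = test_fn_L2[OF t D]
 have "lint D (%x. (eta x *\<^sub>R q x + p x *\<^sub>R g x) \<bullet> e) = 0"
  by (rule test_fn_integral_grad[OF test_fn_mult[OF t p]]) (use D in \<open>simp add: fmeasurableD\<close>)
 moreover have "(%x. (eta x *\<^sub>R q x + p x *\<^sub>R g x) \<bullet> e) = (%x. eta x * (q x \<bullet> e) + p x * (g x \<bullet> e))"
  by (auto simp: inner_add_left)
 ultimately show "l2_inner D p (%x. g x \<bullet> e) = - l2_inner D eta (%x. q x \<bullet> e)"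
  using L2_mult_int[OF tL(1) L2_dot[OF L(2)]] L2_mult_int[OF L(1) L2_dot[OF tL(2)]]
  by (simp add: l2_inner_def)
qed

lemma cont_L2:
 fixes f :: "'a::euclidean_space => 'b::euclidean_space"
 assumes "continuous_on UNIV f" "bounded D" "D : sets lebesgue"
 shows "f : L2 D"
proof -
 have D: "D : lmeasurable" using assms by (simp add: bounded_set_imp_lmeasurable)
 have "bounded (f ` closure D)"
  using assms by (meson compact_closure compact_continuous_image compact_imp_bounded continuous_on_subset subset_UNIV)
 then obtain B where "!!x. x : closure D ==> norm (f x) <= B" unfolding bounded_iff by blast
 thus ?thesis
  using closure_subset by (intro L2_bounded[OF D cont_meas[OF assms(1)], of B]) blast
qed

lemma weak_gradient_affine:
 assumes "open D" "bounded D"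
 shows "weak_gradient D (%x. a \<bullet> x + b) (%x. a)"
proof (rule weak_gradient_C1)
 have s: "D : sets lebesgue" using assms by (simp add: lmeasurable_open fmeasurableD)
 show "D : lmeasurable" using assms by (simp add: lmeasurable_open)
 show "(%x. a \<bullet> x + b) : L2 D" "(%x. a) : L2 D"
  using assms s by (auto intro!: cont_L2 continuous_intros)
qed (auto intro!: derivative_eq_intros)

section \<open>Poincare inequalities\<close>

text \<open>The Poincare argument substitutes \<open>y = x + z\<close> and swaps integrals over a
  product space. Borel functions survive such compositions; functions that are merely Lebesgue
  measurable need not.\<close>

lemma L2_borel_representative:
 fixes f :: "'a::euclidean_space => real"
 assumes D: "D : sets lebesgue" and f: "f : L2 D"
 obtains f' where "f' : borel_measurable borel" "AE x in leb D. f x = f' x" "f' : L2 D"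
proof -
 have "(%x. if x : D then f x else 0) : borel_measurable lebesgue"
  using L2_meas[OF f] D by (rule borel_measurable_if_I)
 then obtain f' where f': "f' : borel_measurable lborel" "AE x in lborel. (if x : D then f x else 0) = f' x"
  using completion_ex_borel_measurable_real by blast
 have b: "f' : borel_measurable borel" using f'(1) by simp
 have ae: "AE x in leb D. f x = f' x"
 proof -
  have "AE x in lebesgue. (if x : D then f x else 0) = f' x" by (rule AE_completion[OF f'(2)])
  hence "AE x in lebesgue. x : D --> f x = f' x" by eventually_elim auto
  thus ?thesis using D by (simp add: AE_restrict_space_iff)
 qed
 have "f' : L2 D"
  by (rule L2_cong_AE[OF f _ ae]) (intro measurable_restrict_space1 borel_imp_lebesgue b)
 thus thesis using that b ae by blast
qed

text \<open>Differentiation under the integral sign: all dependence on \<open>t\<close> sits in the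
  Lipschitz function \<open>eta\<close>, so \<open>|h| B |z|\<close> dominates the
  quotients.\<close>

lemma translation_deriv:
 fixes h :: "'a::euclidean_space => real"
 assumes h: "h : L2 D" and D: "D : lmeasurable" and t: "test_fn A eta g"
 shows "((%t. l2_inner D h (%x. eta (x - t *\<^sub>R z))) has_real_derivative
      - l2_inner D h (%x. g (x - t *\<^sub>R z) \<bullet> z)) (at t)"
 unfolding DERIV_def
proof (rule iffD2[OF tendsto_at_iff_sequentially], intro allI impI, unfold o_def)
 fix X :: "nat => real"
 assume X: "ALL i. X i : UNIV - {0}" "X \<longlonglongrightarrow> 0"
 obtain B where B: "0 < B" "!!x. norm (g x) <= B" using test_fn_bounded[OF t] by metis
 have tt: "test_fn ((%x. x + s) ` A) (%x. eta (x - s)) (%x. g (x - s))" for s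
  by (rule test_fn_translate[OF t])
 have L: "(%x. eta (x - s)) : L2 D" "(%x. g (x - s) \<bullet> z) : L2 D" for s
  using test_fn_L2[OF tt D] L2_dot by blast+
 have hi: "integrable (leb D) h"
  using L2_mult_int[OF h L2_bounded[OF D, of "%x. 1" 1]] by simp
 define q where "q i x = h x * ((eta (x - (t + X i) *\<^sub>R z) - eta (x - t *\<^sub>R z)) / X i)" for i x
 have eq: "(l2_inner D h (%x. eta (x - (t + X i) *\<^sub>R z)) - l2_inner D h (%x. eta (x - t *\<^sub>R z))) / X i
   = lint D (q i)" for i
  unfolding l2_inner_diff_right[OF h L(1) L(1), symmetric] q_def
  by (simp add: l2_inner_def)
 have "(%i. lint D (q i)) \<longlonglongrightarrow> lint D (%x. h x * (- (g (x - t *\<^sub>R z) \<bullet> z)))"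
 proof (rule integral_dominated_convergence[where w = "%x. \<bar>h x\<bar> * (B * norm z)"])
  show "(%x. h x * (- (g (x - t *\<^sub>R z) \<bullet> z))) : borel_measurable (leb D)"
   using L2_meas[OF h] L2_meas[OF L(2)] by measurable
  show "q i : borel_measurable (leb D)" for i
   unfolding q_def[abs_def] using L2_meas[OF h] L2_meas[OF L(1)[of "(t + X i) *\<^sub>R z"]]
    L2_meas[OF L(1)[of "t *\<^sub>R z"]] by measurable
  show "integrable (leb D) (%x. \<bar>h x\<bar> * (B * norm z))"
   using hi by (intro integrable_mult_left integrable_abs)
  show "AE x in leb D. (%i. q i x) \<longlonglongrightarrow> h x * (- (g (x - t *\<^sub>R z) \<bullet> z))"
  proof (rule AE_I2)
   fix x
   have "((%s. eta (x + s *\<^sub>R (- z))) has_real_derivative g (x - t *\<^sub>R z) \<bullet> (- z)) (at t)"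
    by (rule has_real_derivative_along) (simp add: test_fn_deriv[OF t])
   hence "((%s. (eta (x - (t + s) *\<^sub>R z) - eta (x - t *\<^sub>R z)) / s) \<longlongrightarrow> - (g (x - t *\<^sub>R z) \<bullet> z)) (at 0)"
    by (simp add: DERIV_def)
   hence "(%i. (eta (x - (t + X i) *\<^sub>R z) - eta (x - t *\<^sub>R z)) / X i) \<longlonglongrightarrow> - (g (x - t *\<^sub>R z) \<bullet> z)"
    using X unfolding tendsto_at_iff_sequentially o_def by blast
   thus "(%i. q i x) \<longlonglongrightarrow> h x * (- (g (x - t *\<^sub>R z) \<bullet> z))"
    unfolding q_def by (intro tendsto_intros)
  qed
  show "AE x in leb D. norm (q i x) <= \<bar>h x\<bar> * (B * norm z)" for i
  proof (rule AE_I2)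
   fix x
   have Xi: "X i ~= 0" using X by auto
   have "\<bar>eta (x - (t + X i) *\<^sub>R z) - eta (x - t *\<^sub>R z)\<bar> <= B * norm ((x - (t + X i) *\<^sub>R z) - (x - t *\<^sub>R z))"
    by (rule lipschitz_from_grad_bound[OF test_fn_deriv[OF t] B(2)])
   also have "(x - (t + X i) *\<^sub>R z) - (x - t *\<^sub>R z) = (- X i) *\<^sub>R z" by (simp add: algebra_simps)
   finally have "\<bar>(eta (x - (t + X i) *\<^sub>R z) - eta (x - t *\<^sub>R z)) / X i\<bar> <= B * norm z"
    using Xi by (simp add: field_simps)
   thus "norm (q i x) <= \<bar>h x\<bar> * (B * norm z)"
    unfolding q_def real_norm_def abs_mult[of "h x"] by (rule mult_left_mono) simp
  qed
 qed
 thus "(%i. (l2_inner D h (%x. eta (x - (t + X i) *\<^sub>R z)) - l2_inner D h (%x. eta (x - t *\<^sub>R z))) / X i)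
   \<longlonglongrightarrow> - l2_inner D h (%x. g (x - t *\<^sub>R z) \<bullet> z)"
  unfolding eq by (simp add: l2_inner_def)
qed

lemma L2_translate:
 fixes w :: "'a::euclidean_space => real"
 assumes w: "w : borel_measurable borel" "w : L2 D" and D: "open D" "bounded D"
  and A: "A = D Int (%x. x - z) ` D"
 shows "(%x. w (x + z)) : L2 A"
proof -
 have Am: "A : sets lebesgue" "D : sets lebesgue"
  unfolding A using D open_translation_subtract[OF D(1), of z] by (auto intro!: sets_completionI_sets)
 have m: "(%x. w (x + z)) : borel_measurable borel"
  by (rule measurable_compose[OF _ w(1)]) measurable
 let ?h = "%x. indicator D x * (w x)^2"
 have hb: "?h : borel_measurable borel"
  using w(1) borel_open[OF D(1)] by (intro borel_measurable_times borel_measurable_indicator borel_measurable_power) auto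
 have "integrable lebesgue ?h"
  using L2_sqr_int[OF w(2)] Am by (simp add: integrable_restrict_space)
 hence i: "integrable lebesgue (%x. ?h (x + z))" by (rule integrable_lebesgue_translate[OF hb])
 have "integrable lebesgue (%x. indicator A x *\<^sub>R ?h (x + z))"
  by (rule integrable_mult_indicator[OF Am(1) i])
 also have "(%x. indicator A x *\<^sub>R ?h (x + z)) = (%x. indicator A x *\<^sub>R (norm (w (x + z)))^2)"
 proof
  fix x
  have "x : A ==> x + z : D" unfolding A by auto
  thus "indicator A x *\<^sub>R ?h (x + z) = indicator A x *\<^sub>R (norm (w (x + z)))^2"
   by (cases "x : A") auto
 qed
 finally have "integrable (leb A) (%x. (norm (w (x + z)))^2)"
  using Am by (simp add: integrable_restrict_space)
 moreover have "(%x. w (x + z)) : borel_measurable (leb A)"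
  by (intro measurable_restrict_space1 borel_imp_lebesgue m)
 ultimately show ?thesis by (simp add: L2_def)
qed

text \<open>Testing the difference with \<open>eta\<close> and moving the translation onto \<open>eta\<close> turns the difference into
 the integral of the derivative of \<open>t \<mapsto> \<langle>w, eta(\<cdot> - t z)\<rangle>\<close>, where the weak gradient enters.\<close>

lemma translate_est:
 fixes w :: "'a::euclidean_space => real"
 assumes D: "open D" "bounded D" "convex D" and w: "w : borel_measurable borel" "w : L2 D"
  and G: "G : L2 D" "weak_gradient D w G"
  and A: "A = D Int (%x. x - z) ` D"
 shows "l2_norm A (%x. w (x + z) - w x) <= norm z * l2_norm D G"
proof (rule l2_norm_le_by_testing)
 have Dm: "D : lmeasurable" using D by (simp add: lmeasurable_open)
 have oA: "open A" unfolding A using D open_translation_subtract[OF D(1), of z] by auto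
 thus "open A" .
 show "bounded A" unfolding A using D by (auto intro: bounded_subset)
 hence Am: "A : lmeasurable" using oA by (simp add: lmeasurable_open)
 have As: "A : sets lebesgue" "D : sets lebesgue" using Am Dm by (auto simp: fmeasurableD)
 have AD: "A <= D" unfolding A by auto
 have wA: "w : L2 A" by (rule L2_subset[OF w(2) AD As])
 have wt: "(%x. w (x + z)) : L2 A" by (rule L2_translate[OF w D(1,2) A])
 show "(%x. w (x + z) - w x) : L2 A" by (rule L2_diff[OF wt wA])
 show "0 <= norm z * l2_norm D G" by simp
 fix eta g assume t: "test_fn A eta g"
 note tL = test_fn_L2[OF t]
 obtain K where K: "compact K" "K <= A" "!!x. x ~: K ==> eta x = 0" "!!x. x ~: K ==> g x = 0"
  using test_fn_support[OF t] by metis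
 have etab: "eta : borel_measurable borel" by (rule borel_measurable_continuous_onI[OF test_fn_cont[OF t]])
 define \<Phi> where "\<Phi> s = l2_inner D w (%x. eta (x - s *\<^sub>R z))" for s
 \<comment> \<open>Convexity: a point of \<open>A\<close> and its translate by \<open>z\<close> lie
   in \<open>D\<close>, hence so does the segment between them, and all intermediate translates of
   \<open>eta\<close> are test functions on \<open>D\<close>.\<close>
 have tt: "test_fn D (%x. eta (x - s *\<^sub>R z)) (%x. g (x - s *\<^sub>R z))" if s: "0 <= s" "s <= 1" for s
 proof (rule test_fn_mono[OF test_fn_translate[OF t, of "s *\<^sub>R z"]])
  show "(%x. x + s *\<^sub>R z) ` A <= D"
  proof clarify
   fix x assume "x : A"
   hence "x : D" "x + z : D" unfolding A by auto
   hence "(1 - s) *\<^sub>R x + s *\<^sub>R (x + z) : D" using D(3) s by (intro convexD) auto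
   thus "x + s *\<^sub>R z : D" by (simp add: algebra_simps)
  qed
 qed
 have nrm: "l2_norm D (%x. eta (x - s *\<^sub>R z)) <= l2_norm A eta" for s
 proof -
  have sqb: "(%x. (eta x)^2) : borel_measurable borel" using etab by measurable
  have *: "integral\<^sup>L lebesgue (%x. (eta x)^2) = lint A (%x. (eta x)^2)"
   using lint_subset[of A UNIV "%x. (eta x)^2"] As K(2) K(3)
   by (simp add: lebesgue_on_UNIV_eq subset_iff) (metis zero_eq_power2)
  have i0: "integrable lebesgue (%x. (eta x)^2)"
  proof -
   have "integrable lebesgue (%x. indicator A x *\<^sub>R (eta x)^2)"
    using L2_sqr_int[OF tL(1)[OF Am]] As by (simp add: integrable_restrict_space)
   also have "(%x. indicator A x *\<^sub>R (eta x)^2) = (%x. (eta x)^2)"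
   proof
    fix x
    have "x ~: A ==> eta x = 0" using K(2) K(3)[of x] by auto
    thus "indicator A x *\<^sub>R (eta x)^2 = (eta x)^2" by (cases "x : A") auto
   qed
   finally show ?thesis .
  qed
  have i: "integrable lebesgue (%x. (eta (x - s *\<^sub>R z))^2)"
   using integrable_lebesgue_translate[OF sqb i0, of "- (s *\<^sub>R z)"] by simp
  have "lint D (%x. (eta (x - s *\<^sub>R z))^2) <= integral\<^sup>L lebesgue (%x. (eta (x - s *\<^sub>R z))^2)"
   using lint_mono_set[of UNIV "%x. (eta (x - s *\<^sub>R z))^2" D] i As by (simp add: lebesgue_on_UNIV_eq)
  also have "... = integral\<^sup>L lebesgue (%x. (eta x)^2)"
   using integral_lebesgue_translate[OF sqb, of "- (s *\<^sub>R z)"] by simp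
  finally show ?thesis by (simp add: l2_norm_def *)
 qed
 have der: "(\<Phi> has_real_derivative l2_inner D (%x. eta (x - s *\<^sub>R z)) (%x. G x \<bullet> z)) (at s)" if s: "0 <= s" "s <= 1" for s
  using translation_deriv[OF w(2) Dm t, of z s] weak_gradientD[OF G(2) Dm w(2) G(1) tt[OF s], of z]
  unfolding \<Phi>_def[abs_def] by simp
 \<comment> \<open>The mean value theorem in place of an integral over \<open>s\<close>: one
   intermediate translate and a single Cauchy-Schwarz suffice.\<close>
 have "EX s. 0 < s & s < 1 & \<Phi> 1 - \<Phi> 0 = (1 - 0) * l2_inner D (%x. eta (x - s *\<^sub>R z)) (%x. G x \<bullet> z)"
  by (rule MVT2) (auto intro: der)
 then obtain s where s: "0 < s" "s < 1" "\<Phi> 1 - \<Phi> 0 = l2_inner D (%x. eta (x - s *\<^sub>R z)) (%x. G x \<bullet> z)" by auto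
 have "l2_inner A (%x. w (x + z) - w x) eta = \<Phi> 1 - \<Phi> 0"
 proof -
  let ?h = "%x. indicator D x * (w x * eta (x - z))"
  have hb: "?h : borel_measurable borel"
  proof -
   have "(%x. eta (x - z)) : borel_measurable borel" by (rule measurable_compose[OF _ etab]) measurable
   thus ?thesis
    using w(1) borel_open[OF D(1)] by (intro borel_measurable_times borel_measurable_indicator) auto
  qed
  have "l2_inner A (%x. w (x + z)) eta = integral\<^sup>L lebesgue (%x. indicator A x *\<^sub>R (w (x + z) * eta x))"
   using As by (simp add: l2_inner_def integral_restrict_space)
  also have "... = integral\<^sup>L lebesgue (%x. ?h (x + z))"
  proof (rule lint_cong[OF refl])
   fix x
   show "indicator A x *\<^sub>R (w (x + z) * eta x) = ?h (x + z)"
   proof (cases "x : K")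
    case True
    hence "x : A" using K by auto
    moreover hence "x + z : D" unfolding A by auto
    ultimately show ?thesis by simp
   qed (simp add: K)
  qed
  also have "... = integral\<^sup>L lebesgue ?h" by (rule integral_lebesgue_translate[OF hb])
  also have "... = \<Phi> 1" using As by (simp add: \<Phi>_def l2_inner_def integral_restrict_space)
  finally have 1: "l2_inner A (%x. w (x + z)) eta = \<Phi> 1" .
  have z0: "w x * eta x = 0" if "x : D - A" for x using that K by auto
  have 0: "l2_inner A w eta = \<Phi> 0"
   unfolding \<Phi>_def l2_inner_def using lint_subset[OF AD As z0] by simp
  have "l2_inner A eta (%x. w (x + z) - w x) = l2_inner A eta (%x. w (x + z)) - l2_inner A eta w"
   by (rule l2_inner_diff_right[OF tL(1)[OF Am] wt wA])
  thus ?thesis using 0 1 by (simp add: l2_inner_commute[of A eta])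
 qed
 also have "... <= l2_norm D (%x. eta (x - s *\<^sub>R z)) * l2_norm D (%x. G x \<bullet> z)"
  unfolding s(3) using L2_CS[OF test_fn_L2(1)[OF tt Dm] L2_dot[OF G(1)], of s z] s by auto
 also have "... <= l2_norm A eta * (norm z * l2_norm D G)"
 proof (intro mult_mono nrm)
  have "(l2_norm D (%x. G x \<bullet> z))^2 <= lint D (%x. (norm z)^2 * (norm (G x))^2)"
   unfolding l2_norm_sq
  proof (rule integral_mono)
   show "integrable (leb D) (%x. (norm (G x \<bullet> z))^2)"
    by (rule L2_sq_int[OF L2_dot[OF G(1)]])
   show "integrable (leb D) (%x. (norm z)^2 * (norm (G x))^2)"
    using L2_sq_int[OF G(1)] by simp
   show "(norm (G x \<bullet> z))^2 <= (norm z)^2 * (norm (G x))^2" for x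
    using power_mono[OF Cauchy_Schwarz_ineq2[of "G x" z] abs_ge_zero, of 2] by (simp add: power_mult_distrib mult.commute)
  qed
  also have "... = (norm z * l2_norm D G)^2" by (simp add: l2_norm_sq power_mult_distrib)
  finally show "l2_norm D (%x. G x \<bullet> z) <= norm z * l2_norm D G" by (rule power2_le_imp_le) simp
 qed auto
 finally show "l2_inner A (%x. w (x + z) - w x) eta <= norm z * l2_norm D G * l2_norm A eta"
  by (simp add: mult_ac)
qed

section \<open>Double integrals of squared differences and the resulting Poincare
  inequalities\<close>

lemma nn_integral_lborel_translate:
 fixes f :: "'a::euclidean_space => ennreal"
 assumes "f : borel_measurable borel"
 shows "(\<integral>\<^sup>+x. f (c + x) \<partial>lborel) = integral\<^sup>N lborel f"
proof -
 have "integral\<^sup>N lborel f = integral\<^sup>N (distr lborel borel ((+) c)) f"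
  by (simp add: lborel_distr_plus)
 thus ?thesis using assms by (simp add: nn_integral_distr)
qed

lemma nn_integral_eq_integral_on:
 fixes f :: "'a::euclidean_space => real"
 assumes f: "f : borel_measurable borel" "!!x. 0 <= f x" and i: "integrable (leb D) f" and D: "D : sets borel"
 shows "(\<integral>\<^sup>+x. ennreal (indicator D x * f x) \<partial>lborel) = ennreal (lint D f)"
proof -
 have b: "(%x. indicator D x * f x) : borel_measurable borel" using f D by measurable
 have Ds: "D : sets lebesgue" using D by (simp add: sets_completionI_sets)
 have il: "integrable lborel (%x. indicator D x * f x)"
  using i b Ds by (simp add: integrable_restrict_space integrable_completion)
 have "(\<integral>\<^sup>+x. ennreal (indicator D x * f x) \<partial>lborel) = ennreal (integral\<^sup>L lborel (%x. indicator D x * f x))"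
  by (rule nn_integral_eq_integral[OF il]) (use f in \<open>auto simp: indicator_def\<close>)
 also have "integral\<^sup>L lborel (%x. indicator D x * f x) = lint D f"
  using b Ds by (simp add: integral_restrict_space integral_completion)
 finally show ?thesis .
qed

text \<open>Substitute \<open>y = x + z\<close> and integrate over \<open>x\<close> first. For fixed
  \<open>z\<close> the points with \<open>x\<close> and \<open>x + z\<close> in \<open>D\<close>
  form the set of \<open>translate_est\<close>, and only \<open>z\<close> in the ball of radius
  \<open>rho\<close> contribute. With nonnegative integrals the exchange asks for measurability
  alone.\<close>

lemma double_difference_bound:
 fixes w :: "'a::euclidean_space => real"
 assumes D: "open D" "bounded D" "convex D" and w: "w : borel_measurable borel" "w : L2 D"
  and G: "G : L2 D" "weak_gradient D w G"
  and rho: "!!x y. x : D ==> y : D ==> norm (x - y) <= rho" "0 <= rho"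
 shows "(\<integral>\<^sup>+x. \<integral>\<^sup>+y. ennreal (indicator D x * indicator D y * (w y - w x)^2) \<partial>lborel \<partial>lborel)
  <= ennreal (rho^2 * (l2_norm D G)^2 * vol (cball (0::'a) rho))"
proof -
 note [measurable] = w(1) borel_open[OF D(1)]
 have Ds: "D : sets lebesgue" using D by (simp add: lmeasurable_open fmeasurableD)
 let ?F = "%x y. ennreal (indicator D x * indicator D y * (w y - w x)^2)"
 have "(\<integral>\<^sup>+x. \<integral>\<^sup>+y. ?F x y \<partial>lborel \<partial>lborel) = (\<integral>\<^sup>+x. \<integral>\<^sup>+z. ?F x (x + z) \<partial>lborel \<partial>lborel)"
  by (intro nn_integral_cong nn_integral_lborel_translate[symmetric]) measurable
 also have "... = (\<integral>\<^sup>+z. \<integral>\<^sup>+x. ?F x (x + z) \<partial>lborel \<partial>lborel)"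
  by (rule lborel_pair.Fubini'[symmetric]) measurable
 also have "... <= (\<integral>\<^sup>+z. ennreal (rho^2 * (l2_norm D G)^2) * indicator (cball (0::'a) rho) z \<partial>lborel)"
 proof (rule nn_integral_mono)
  fix z :: 'a
  define A where "A = D Int (%x. x - z) ` D"
  have oA: "open A" unfolding A_def using D open_translation_subtract[OF D(1), of z] by auto
  have As: "A : sets lebesgue" using oA by (auto intro: sets_completionI_sets)
  have ind: "indicator D x * indicator D (x + z) = (indicator A x :: real)" for x
   unfolding A_def by (auto simp: indicator_def image_iff)
  show "(\<integral>\<^sup>+x. ?F x (x + z) \<partial>lborel) <= ennreal (rho^2 * (l2_norm D G)^2) * indicator (cball 0 rho) z"
  proof (cases "A = {}")
   case True
   thus ?thesis by (simp add: ind)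
  next
   case False
   then obtain x where "x : A" by auto
   hence "x : D" "x + z : D" unfolding A_def by auto
   hence nz: "norm z <= rho" using rho(1)[of "x + z" x] by simp
   have L: "(%x. w (x + z) - w x) : L2 A"
    by (intro L2_diff L2_translate[OF w D(1,2) A_def] L2_subset[OF w(2) _ As Ds]) (auto simp: A_def)
   have "(\<integral>\<^sup>+x. ?F x (x + z) \<partial>lborel) = (\<integral>\<^sup>+x. ennreal (indicator A x * (w (x + z) - w x)^2) \<partial>lborel)"
    by (simp add: ind)
   also have "... = ennreal (lint A (%x. (w (x + z) - w x)^2))"
    by (rule nn_integral_eq_integral_on) (use L2_sqr_int[OF L] oA in auto)
   also have "lint A (%x. (w (x + z) - w x)^2) = (l2_norm A (%x. w (x + z) - w x))^2"
    by (simp add: l2_norm_sq)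
   also have "... <= (norm z * l2_norm D G)^2"
    by (intro power_mono translate_est[OF D w G A_def]) simp
   also have "... <= rho^2 * (l2_norm D G)^2"
    unfolding power_mult_distrib using nz by (intro mult_right_mono power_mono) auto
   finally show ?thesis using nz by (simp add: ennreal_leI)
  qed
 qed
 also have "... = ennreal (rho^2 * (l2_norm D G)^2) * emeasure lborel (cball (0::'a) rho)"
  by (subst nn_integral_cmult_indicator) auto
 also have "emeasure lborel (cball (0::'a) rho) = ennreal (vol (cball (0::'a) rho))"
  using emeasure_bounded_finite[of "cball (0::'a) rho"] by (auto simp: emeasure_eq_ennreal_measure)
 finally show ?thesis by (simp add: ennreal_mult)
qed

lemma const_L2: "D : lmeasurable ==> (%x. c) : L2 D"
 by (rule L2_bounded[where B = "norm c"]) auto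

text \<open>Integrate \<open>(v y)^2 <= 2 (v x)^2 + 2 (v y - v x)^2\<close> over \<open>x\<close> in
  \<open>A\<close> and \<open>y\<close> in \<open>D\<close>. Smallness on a part of \<open>D\<close>
  thus spreads to all of \<open>D\<close>, which is how estimates cross facets.\<close>

lemma poincare_part:
 fixes w :: "'a::euclidean_space => real"
 assumes D: "open D" "bounded D" "convex D" and w: "w : L2 D"
  and G: "G : L2 D" "weak_gradient D w G"
  and rho: "!!x y. x : D ==> y : D ==> norm (x - y) <= rho" "0 <= rho"
  and A: "A <= D" "A : sets borel"
 shows "vol A * lint D (%x. (w x)^2)
   <= 2 * vol D * lint A (%x. (w x)^2)
    + 2 * rho^2 * vol (cball (0::'a) rho) * (l2_norm D G)^2"
proof -
 have Dm: "D : lmeasurable" using D by (simp add: lmeasurable_open)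
 have Ds: "D : sets lebesgue" "A : sets lebesgue" using Dm A by (auto simp: fmeasurableD sets_completionI_sets)
 have Am: "A : lmeasurable" using A D by (meson Ds(2) bounded_set_imp_lmeasurable bounded_subset)
 obtain v where v: "v : borel_measurable borel" "AE x in leb D. w x = v x" "v : L2 D"
  using L2_borel_representative[OF Ds(1) w] by metis
 have vA: "v : L2 A" "w : L2 A" using L2_subset[OF v(3) A(1) Ds(2,1)] L2_subset[OF w A(1) Ds(2,1)] .
 have Gv: "weak_gradient D v G"
  by (rule weak_gradient_cong_AE[OF G(2) Dm w G(1) v(3) G(1) v(2)]) simp
 have "AE x in leb A. w x = v x"
  using v(2) A(1) Ds by (auto simp: AE_restrict_space_iff elim: eventually_mono)
 hence eqA: "lint A (%x. (w x)^2) = lint A (%x. (v x)^2)"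
  by (intro integral_cong_AE) (use vA[THEN L2_meas] in \<open>auto elim: eventually_mono\<close>)
 have eqD: "lint D (%x. (w x)^2) = lint D (%x. (v x)^2)"
  by (intro integral_cong_AE)
    (use v(2) v(3)[THEN L2_meas] w[THEN L2_meas] in \<open>auto elim: eventually_mono\<close>)
 note [measurable] = v(1) borel_open[OF D(1)] A(2)
 let ?ID = "lint D (%x. (v x)^2)" and ?IA = "lint A (%x. (v x)^2)"
 have nD: "(\<integral>\<^sup>+y. ennreal (indicator D y * (v y)^2) \<partial>lborel) = ennreal ?ID"
  by (rule nn_integral_eq_integral_on) (use L2_sqr_int[OF v(3)] in auto)
 have nA: "(\<integral>\<^sup>+y. ennreal (indicator A y * (v y)^2) \<partial>lborel) = ennreal ?IA"
  by (rule nn_integral_eq_integral_on) (use L2_sqr_int[OF vA(1)] in auto)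
 have mm: "emeasure lborel A = ennreal (vol A)" "emeasure lborel D = ennreal (vol D)"
  using emeasure_bounded_finite[of A] emeasure_bounded_finite[of D] D(2) A(1) bounded_subset[of D A]
  by (auto simp: emeasure_eq_ennreal_measure)
 have "ennreal (vol A * ?ID) = (\<integral>\<^sup>+x. ennreal ?ID * indicator A x \<partial>lborel)"
  by (subst nn_integral_cmult_indicator) (auto simp: mm ennreal_mult mult.commute)
 also have "... = (\<integral>\<^sup>+x. \<integral>\<^sup>+y. ennreal (indicator A x * (indicator D y * (v y)^2)) \<partial>lborel \<partial>lborel)"
  by (intro nn_integral_cong) (auto simp: indicator_def nD[symmetric])
 also have "... <= (\<integral>\<^sup>+x. \<integral>\<^sup>+y. ennreal (2 * (indicator A x * (v x)^2)) * indicator D y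
   + 2 * ennreal (indicator D x * indicator D y * (v y - v x)^2) \<partial>lborel \<partial>lborel)"
 proof (intro nn_integral_mono)
  fix x y
  \<comment> \<open>The difference of the two sides is \<open>(2 v x - v y)^2\<close>.\<close>
  have "(v y)^2 <= 2 * (v x)^2 + 2 * (v y - v x)^2"
   using zero_le_power2[of "2 * v x - v y"] by (simp add: power2_eq_square algebra_simps)
  hence "indicator A x * (indicator D y * (v y)^2) <=
    2 * (indicator A x * (v x)^2) * indicator D y + 2 * (indicator D x * indicator D y * (v y - v x)^2)"
   using A(1) by (auto simp: indicator_def)
  hence "ennreal (indicator A x * (indicator D y * (v y)^2)) <=
    ennreal (2 * (indicator A x * (v x)^2) * indicator D y + 2 * (indicator D x * indicator D y * (v y - v x)^2))"
   by (rule ennreal_leI)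
  also have "... = ennreal (2 * (indicator A x * (v x)^2)) * indicator D y
   + 2 * ennreal (indicator D x * indicator D y * (v y - v x)^2)"
   by (subst ennreal_plus) (auto simp: ennreal_mult ennreal_indicator)
  finally show "ennreal (indicator A x * (indicator D y * (v y)^2)) <= ..." .
 qed
 also have "... = (\<integral>\<^sup>+x. ennreal (2 * (indicator A x * (v x)^2)) * ennreal (vol D)
   + 2 * (\<integral>\<^sup>+y. ennreal (indicator D x * indicator D y * (v y - v x)^2) \<partial>lborel) \<partial>lborel)"
  by (intro nn_integral_cong, subst nn_integral_add)
    (auto simp: nn_integral_cmult_indicator nn_integral_cmult mm)
 also have "... = 2 * ennreal ?IA * ennreal (vol D)
   + 2 * (\<integral>\<^sup>+x. \<integral>\<^sup>+y. ennreal (indicator D x * indicator D y * (v y - v x)^2) \<partial>lborel \<partial>lborel)"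
 proof (subst nn_integral_add)
  have "ennreal (2 * (indicator A x * (v x)^2)) = 2 * ennreal (indicator A x * (v x)^2)" for x
   by (subst ennreal_mult) auto
  hence "(\<integral>\<^sup>+x. ennreal (2 * (indicator A x * (v x)^2)) * ennreal (vol D) \<partial>lborel)
    = 2 * ennreal ?IA * ennreal (vol D)"
   by (simp only:) (subst nn_integral_multc, simp, subst nn_integral_cmult, simp, simp only: nA)
  moreover have "(\<integral>\<^sup>+x. 2 * (\<integral>\<^sup>+y. ennreal (indicator D x * indicator D y * (v y - v x)^2) \<partial>lborel) \<partial>lborel)
    = 2 * (\<integral>\<^sup>+x. \<integral>\<^sup>+y. ennreal (indicator D x * indicator D y * (v y - v x)^2) \<partial>lborel \<partial>lborel)"
   by (rule nn_integral_cmult) measurable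
  ultimately show "(\<integral>\<^sup>+x. ennreal (2 * (indicator A x * (v x)^2)) * ennreal (vol D) \<partial>lborel) +
    (\<integral>\<^sup>+x. 2 * (\<integral>\<^sup>+y. ennreal (indicator D x * indicator D y * (v y - v x)^2) \<partial>lborel) \<partial>lborel) =
    2 * ennreal ?IA * ennreal (vol D) +
    2 * (\<integral>\<^sup>+x. \<integral>\<^sup>+y. ennreal (indicator D x * indicator D y * (v y - v x)^2) \<partial>lborel \<partial>lborel)"
   by simp
 qed (measurable, measurable)
 also have "... <= 2 * ennreal ?IA * ennreal (vol D)
   + 2 * ennreal (rho^2 * (l2_norm D G)^2 * vol (cball (0::'a) rho))"
  by (intro add_left_mono mult_left_mono double_difference_bound[OF D v(1,3) G(1) Gv rho]) auto
 also have "... = ennreal (2 * ?IA * vol D + 2 * (rho^2 * (l2_norm D G)^2 * vol (cball (0::'a) rho)))"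
  by (subst ennreal_plus) (auto simp: ennreal_mult integral_nonneg_AE)
 finally have "vol A * ?ID <= 2 * ?IA * vol D + 2 * (rho^2 * (l2_norm D G)^2 * vol (cball (0::'a) rho))"
  by (subst (asm) ennreal_le_iff) (auto simp: integral_nonneg_AE)
 thus ?thesis by (simp add: eqA eqD mult_ac)
qed

lemma mean_minimizes:
 fixes w :: "'a::euclidean_space => real"
 assumes D: "D : lmeasurable" "vol D > 0" and w: "w : L2 D"
  and m: "m = lint D w / vol D"
 shows "lint D (%x. (w x - m)^2) <= lint D (%x. (w x - c)^2)"
proof -
 have i: "integrable (leb D) w"
  using L2_mult_int[OF w const_L2[OF D(1), of 1]] by simp
 have Ds: "D : sets lebesgue" using D by (simp add: fmeasurableD)
 have mD: "measure (leb D) D = vol D"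
  using Ds by (simp add: measure_restrict_space)
 have c1: "lint D (%x. k) = k * vol D" for k :: real
  by (simp add: mD)
 have "lint D (%x. (w x - c)^2) =
   lint D (%x. (w x - m)^2 + (2 * (m - c) * w x + (c^2 - m^2)))"
  by (rule arg_cong[where f = "lint D"]) (auto simp: power2_eq_square algebra_simps)
 also have "... = lint D (%x. (w x - m)^2) + (2 * (m - c) * lint D w + (c^2 - m^2) * vol D)"
  using L2_sqr_int[OF L2_diff[OF w const_L2[OF D(1), of m]]] i int_const[OF D(1), of "c^2 - m^2"]
  by (simp add: mD)
 also have "lint D w = m * vol D" using m D by simp
 also have "2 * (m - c) * (m * vol D) + (c^2 - m^2) * vol D = (m - c)^2 * vol D"
  by (simp add: power2_eq_square algebra_simps)
 finally show ?thesis by (simp add: D)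
qed

text \<open>The mean minimizes the squared distance to constants, so it does at least as well as the
  constant \<open>v x\<close> for every \<open>x\<close>; integrating over \<open>x\<close> in
  \<open>D\<close> leaves the double integral.\<close>

lemma poincare_mean:
 fixes w :: "'a::euclidean_space => real"
 assumes D: "open D" "bounded D" "convex D" "D ~= {}" and w: "w : L2 D"
  and G: "G : L2 D" "weak_gradient D w G"
  and rho: "!!x y. x : D ==> y : D ==> norm (x - y) <= rho" "0 <= rho"
  and m: "m = lint D w / vol D"
 shows "vol D * lint D (%x. (w x - m)^2)
   <= rho^2 * vol (cball (0::'a) rho) * (l2_norm D G)^2"
proof -
 have Dm: "D : lmeasurable" using D by (simp add: lmeasurable_open)
 have Ds: "D : sets lebesgue" using Dm by (auto simp: fmeasurableD)
 have Dpos: "vol D > 0"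
  using D by (metis Dm interior_open zero_less_measure_iff negligible_iff_measure0 open_not_negligible)
 obtain v where v: "v : borel_measurable borel" "AE x in leb D. w x = v x" "v : L2 D"
  using L2_borel_representative[OF Ds(1) w] by metis
 have Gv: "weak_gradient D v G"
  by (rule weak_gradient_cong_AE[OF G(2) Dm w G(1) v(3) G(1) v(2)]) simp
 have mv: "m = lint D v / vol D"
  unfolding m by (rule arg_cong[where f = "%t. t / vol D"], rule integral_cong_AE)
   (use v w in \<open>auto intro: L2_meas\<close>)
 have d: "(%x. v x - c) : L2 D" "(%x. w x - c) : L2 D" for c by (intro L2_diff v(3) w const_L2 Dm)+
 let ?I = "%c. lint D (%x. (v x - c)^2)"
 have eqD: "lint D (%x. (w x - m)^2) = ?I m"
  by (intro integral_cong_AE) (use v(2) d[of m, THEN L2_meas] in \<open>auto elim: eventually_mono\<close>)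
 note [measurable] = v(1) borel_open[OF D(1)]
 have nD: "(\<integral>\<^sup>+y. ennreal (indicator D y * (v y - c)^2) \<partial>lborel) = ennreal (?I c)" for c
  by (rule nn_integral_eq_integral_on) (use L2_sqr_int[OF d(1)[of c]] in auto)
 have mm: "emeasure lborel D = ennreal (vol D)"
  using emeasure_bounded_finite[OF D(2)] by (auto simp: emeasure_eq_ennreal_measure)
 have "ennreal (vol D * ?I m) = (\<integral>\<^sup>+x. ennreal (?I m) * indicator D x \<partial>lborel)"
  by (subst nn_integral_cmult_indicator) (auto simp: mm ennreal_mult mult.commute)
 also have "... <= (\<integral>\<^sup>+x. ennreal (?I (v x)) * indicator D x \<partial>lborel)"
  by (intro nn_integral_mono mult_right_mono ennreal_leI mean_minimizes[OF Dm Dpos v(3) mv]) auto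
 also have "... = (\<integral>\<^sup>+x. \<integral>\<^sup>+y. ennreal (indicator D x * indicator D y * (v y - v x)^2) \<partial>lborel \<partial>lborel)"
  by (intro nn_integral_cong) (auto simp: indicator_def nD[symmetric])
 also have "... <= ennreal (rho^2 * (l2_norm D G)^2 * vol (cball (0::'a) rho))"
  by (rule double_difference_bound[OF D(1-3) v(1,3) G(1) Gv rho])
 finally have "vol D * ?I m <= rho^2 * (l2_norm D G)^2 * vol (cball (0::'a) rho)"
  by (subst (asm) ennreal_le_iff) auto
 thus ?thesis by (simp add: eqD mult_ac)
qed

section \<open>The Sobolev spaces and the dual norm\<close>

lemma H1_L2: "u : H1 Om ==> u : L2 Om"
 by (simp add: H1_def)

lemma wgrad_props:
 assumes "u : H1 Om"
 shows "wgrad Om u : L2 Om" "weak_gradient Om u (wgrad Om u)"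
proof -
 have "EX G. G : L2 Om & weak_gradient Om u G" using assms by (auto simp: H1_def)
 from someI_ex[OF this] show "wgrad Om u : L2 Om" "weak_gradient Om u (wgrad Om u)"
  by (simp_all add: wgrad_def)
qed

lemma H1I: "u : L2 Om ==> G : L2 Om ==> weak_gradient Om u G ==> u : H1 Om"
 by (auto simp: H1_def)

lemma H1_0_H1: "u : H1_0 Om gam ==> u : H1 Om"
 by (simp add: H1_0_def)

lemma h1_norm_nonneg [simp]: "0 <= h1_norm Om u"
 by (simp add: h1_norm_def)

lemma h1_norm_sq: "(h1_norm Om u)^2 = (l2_norm Om u)^2 + (l2_norm Om (wgrad Om u))^2"
 by (simp add: h1_norm_def)

lemma l2_norm_le_h1_norm: "l2_norm Om u <= h1_norm Om u" "l2_norm Om (wgrad Om u) <= h1_norm Om u"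
 by (auto simp: h1_norm_def intro!: real_le_rsqrt)

context
 fixes Om :: "'a::euclidean_space set"
 assumes Om: "open Om" "bounded Om"
begin

lemma wgrad_eq_AE:
 assumes "u : L2 Om" "G : L2 Om" "weak_gradient Om u G"
 shows "AE x in leb Om. wgrad Om u x = G x"
 using weak_gradient_unique[OF Om assms(1) _ assms(2) _ assms(3)] wgrad_props H1I[OF assms] by blast

lemma h1_norm_sq_eq:
 assumes "u : L2 Om" "G : L2 Om" "weak_gradient Om u G"
 shows "(h1_norm Om u)^2 = (l2_norm Om u)^2 + (l2_norm Om G)^2"
 using l2_norm_cong_AE[OF _ assms(2) wgrad_eq_AE[OF assms]] wgrad_props(1)[OF H1I[OF assms]]
 by (simp add: h1_norm_sq)

lemma lmeasurable_domain: "Om : lmeasurable"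
 using Om by (simp add: lmeasurable_open)

lemma H1_lincomb:
 assumes "u : H1 Om" "v : H1 Om"
 shows "(%x. a * u x + b * v x) : H1 Om"
  "weak_gradient Om (%x. a * u x + b * v x) (%x. a *\<^sub>R wgrad Om u x + b *\<^sub>R wgrad Om v x)"
proof -
 note L = assms[THEN H1_L2] wgrad_props(1)[OF assms(1)] wgrad_props(1)[OF assms(2)]
 show "weak_gradient Om (%x. a * u x + b * v x) (%x. a *\<^sub>R wgrad Om u x + b *\<^sub>R wgrad Om v x)"
  by (rule weak_gradient_lincomb[OF lmeasurable_domain L wgrad_props(2)[OF assms(1)] wgrad_props(2)[OF assms(2)]])
 thus "(%x. a * u x + b * v x) : H1 Om"
  by (intro H1I) (auto intro!: L2_add L2_cmult L2_scaleR L)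
qed

lemma l2_norm_sq_lincomb_le:
 fixes f g :: "'a => 'b::euclidean_space"
 assumes "f : L2 D" "g : L2 D"
 shows "(l2_norm D (%x. a *\<^sub>R f x + b *\<^sub>R g x))^2 <= 2 * a^2 * (l2_norm D f)^2 + 2 * b^2 * (l2_norm D g)^2"
 using integral_norm_sq_add_le[OF L2_scaleR[OF assms(1), of a] L2_scaleR[OF assms(2), of b]]
 by (simp add: l2_norm_sq power_mult_distrib)

text \<open>A quadratic substitute for the triangle inequality; the factors 2 are absorbed in the
  choice of \<open>d\<close> in \<open>H1_0_lincomb\<close>.\<close>

lemma h1_norm_sq_lincomb_le:
 assumes "u : H1 Om" "v : H1 Om"
 shows "(h1_norm Om (%x. a * u x + b * v x))^2 <= 2 * a^2 * (h1_norm Om u)^2 + 2 * b^2 * (h1_norm Om v)^2"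
proof -
 note L = assms[THEN H1_L2] wgrad_props(1)[OF assms(1)] wgrad_props(1)[OF assms(2)]
 have "(h1_norm Om (%x. a * u x + b * v x))^2 = (l2_norm Om (%x. a *\<^sub>R u x + b *\<^sub>R v x))^2
   + (l2_norm Om (%x. a *\<^sub>R wgrad Om u x + b *\<^sub>R wgrad Om v x))^2"
  by (subst h1_norm_sq_eq[OF _ _ H1_lincomb(2)[OF assms]]) (auto intro!: L2_add L2_cmult L2_scaleR L)
 also have "... <= (2 * a^2 * (l2_norm Om u)^2 + 2 * b^2 * (l2_norm Om v)^2)
  + (2 * a^2 * (l2_norm Om (wgrad Om u))^2 + 2 * b^2 * (l2_norm Om (wgrad Om v))^2)"
  by (intro add_mono l2_norm_sq_lincomb_le L)
 finally show ?thesis by (simp add: h1_norm_sq algebra_simps)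
qed

lemma h1_norm_scale:
 assumes "u : H1 Om"
 shows "h1_norm Om (%x. a * u x) = \<bar>a\<bar> * h1_norm Om u"
proof -
 note L = H1_L2[OF assms] wgrad_props(1)[OF assms]
 have w: "weak_gradient Om (%x. a * u x) (%x. a *\<^sub>R wgrad Om u x)"
  using H1_lincomb(2)[OF assms assms, of a 0] by simp
 have "(h1_norm Om (%x. a * u x))^2 = (l2_norm Om (%x. a * u x))^2 + (l2_norm Om (%x. a *\<^sub>R wgrad Om u x))^2"
  by (rule h1_norm_sq_eq[OF _ _ w]) (auto intro!: L2_cmult L2_scaleR L)
 also have "... = (\<bar>a\<bar> * h1_norm Om u)^2"
  by (simp add: power_mult_distrib h1_norm_sq l2_norm_sq distrib_left)
 finally show ?thesis by (simp add: power2_eq_iff_nonneg)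
qed

lemma zero_H1: "(%x. 0) : H1 Om" "h1_norm Om (%x. 0) = 0"
proof -
 have w: "weak_gradient Om (%x. 0) (%x. 0)"
  by (simp add: weak_gradient_def)
 thus "(%x. 0) : H1 Om" by (intro H1I) auto
 have "(h1_norm Om (%x. 0))^2 = 0" by (subst h1_norm_sq_eq[OF _ _ w]) (auto simp: l2_norm_def)
 thus "h1_norm Om (%x. 0) = 0" by simp
qed

lemma H1_0I:
 assumes "u : H1 Om" "continuous_on (closure Om) u" "!!x. x : gam ==> u x = 0"
 shows "u : H1_0 Om gam"
 unfolding H1_0_def using assms zero_H1(2) by (auto intro!: bexI[of _ u])

lemma H1_0_lincomb:
 assumes "u : H1_0 Om gam" "v : H1_0 Om gam"
 shows "(%x. a * u x + b * v x) : H1_0 Om gam"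
proof -
 note uv = H1_0_H1[OF assms(1)] H1_0_H1[OF assms(2)]
 show ?thesis
  unfolding H1_0_def
 proof (safe intro!: H1_lincomb uv)
  fix e :: real assume "e > 0"
  \<comment> \<open>With both approximation errors below \<open>d\<close> the squared error is at
    most \<open>2 (a^2 + b^2) d^2\<close>, which this choice keeps below \<open>e^2\<close>.\<close>
  define d where "d = e / (2 * (\<bar>a\<bar> + \<bar>b\<bar> + 1))"
  have d: "d > 0" using \<open>e > 0\<close> by (simp add: d_def add_nonneg_pos)
  obtain u' where u': "u' : H1 Om" "continuous_on (closure Om) u'" "ALL x:gam. u' x = 0" "h1_norm Om (%x. u x - u' x) < d"
   using assms(1) d unfolding H1_0_def by blast
  obtain v' where v': "v' : H1 Om" "continuous_on (closure Om) v'" "ALL x:gam. v' x = 0" "h1_norm Om (%x. v x - v' x) < d"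
   using assms(2) d unfolding H1_0_def by blast
  have diff: "(%x. u x - u' x) : H1 Om" "(%x. v x - v' x) : H1 Om"
   using H1_lincomb(1)[OF uv(1) u'(1), of 1 "-1"] H1_lincomb(1)[OF uv(2) v'(1), of 1 "-1"] by simp_all
  have "(h1_norm Om (%x. a * (u x - u' x) + b * (v x - v' x)))^2
    <= 2 * a^2 * (h1_norm Om (%x. u x - u' x))^2 + 2 * b^2 * (h1_norm Om (%x. v x - v' x))^2"
   by (rule h1_norm_sq_lincomb_le[OF diff])
  also have "... <= 2 * a^2 * d^2 + 2 * b^2 * d^2"
   using u'(4) v'(4) by (intro add_mono mult_left_mono power_mono) auto
  also have "... = 2 * (a^2 + b^2) * d^2" by (simp add: algebra_simps)
  also have "... < 4 * (\<bar>a\<bar> + \<bar>b\<bar> + 1)^2 * d^2"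
  proof (rule mult_strict_right_mono)
   have "(\<bar>a\<bar> + \<bar>b\<bar> + 1)^2 = a^2 + b^2 + 1 + 2 * (\<bar>a\<bar> * \<bar>b\<bar>) + 2 * \<bar>a\<bar> + 2 * \<bar>b\<bar>"
    by (simp add: power2_eq_square algebra_simps)
   hence "a^2 + b^2 + 1 <= (\<bar>a\<bar> + \<bar>b\<bar> + 1)^2" by simp
   moreover have "0 <= a^2 + b^2" by simp
   moreover have "2 * t < 4 * X" if "t + 1 <= X" "0 <= t" for t X :: real using that by linarith
   ultimately show "2 * (a^2 + b^2) < 4 * (\<bar>a\<bar> + \<bar>b\<bar> + 1)^2" by blast
   show "0 < d^2" using d by simp
  qed
  also have "... = (2 * (\<bar>a\<bar> + \<bar>b\<bar> + 1) * d)^2" by (simp only: power_mult_distrib) simp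
  also have "2 * (\<bar>a\<bar> + \<bar>b\<bar> + 1) * d = e"
   unfolding d_def using add_nonneg_pos[of "\<bar>a\<bar> + \<bar>b\<bar>" 1] by (simp add: field_simps)
  finally have "h1_norm Om (%x. a * (u x - u' x) + b * (v x - v' x)) < e"
   using \<open>e > 0\<close> by (simp add: power2_less_imp_less)
  also have "(%x. a * (u x - u' x) + b * (v x - v' x)) = (%x. a * u x + b * v x - (a * u' x + b * v' x))"
   by (auto simp: algebra_simps)
  finally show "EX w:H1 Om. continuous_on (closure Om) w & (ALL x:gam. w x = 0) &
    h1_norm Om (%x. a * u x + b * v x - w x) < e"
   using u' v' by (intro bexI[of _ "%x. a * u' x + b * v' x"] conjI H1_lincomb continuous_intros) auto
 qed
qed

lemma zero_H1_0: "(%x. 0) : H1_0 Om gam"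
 by (rule H1_0I[OF zero_H1(1)]) auto

lemma dual_norm_le:
 assumes "!!v. v : H1_0 Om gam ==> \<bar>F v\<bar> <= C * h1_norm Om v" "0 <= C"
 shows "dual_norm Om gam F <= C"
 unfolding dual_norm_def
proof (rule cSup_least)
 show "{\<bar>F v\<bar> |v. v : H1_0 Om gam & h1_norm Om v <= 1} ~= {}"
  using zero_H1_0 zero_H1(2) by force
 fix t assume "t : {\<bar>F v\<bar> |v. v : H1_0 Om gam & h1_norm Om v <= 1}"
 then obtain v where v: "t = \<bar>F v\<bar>" "v : H1_0 Om gam" "h1_norm Om v <= 1" by auto
 hence "t <= C * h1_norm Om v" using assms(1) by simp
 also have "... <= C" using v(3) assms(2) by (simp add: mult_left_le)
 finally show "t <= C" .
qed

text \<open>Normalize \<open>v\<close>. The supremum is meaningful because membership in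
  \<open>H1_0_dual\<close> provides a bound; if the norm of \<open>v\<close> is zero, the same bound
  gives \<open>F v = 0\<close>.\<close>

lemma dual_norm_apply:
 assumes F: "F : H1_0_dual Om gam" and v: "v : H1_0 Om gam"
 shows "\<bar>F v\<bar> <= dual_norm Om gam F * h1_norm Om v"
proof -
 obtain C where C: "!!v. v : H1_0 Om gam ==> \<bar>F v\<bar> <= C * h1_norm Om v"
  using F unfolding H1_0_dual_def by blast
 show ?thesis
 proof (cases "h1_norm Om v = 0")
  case True
  thus ?thesis using C[OF v] by simp
 next
  case False
  hence pos: "h1_norm Om v > 0" using h1_norm_nonneg[of Om v] by linarith
  let ?c = "inverse (h1_norm Om v)"
  have w: "(%x. ?c * v x) : H1_0 Om gam" using H1_0_lincomb[OF v v, of ?c 0] by simp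
  have "h1_norm Om (%x. ?c * v x) = 1"
   using pos by (simp add: h1_norm_scale[OF H1_0_H1[OF v]])
  moreover have "F (%x. ?c * v x + 0 * v x) = ?c * F v + 0 * F v"
   using F v unfolding H1_0_dual_def by blast
  ultimately have "\<bar>?c * F v\<bar> : {\<bar>F v\<bar> |v. v : H1_0 Om gam & h1_norm Om v <= 1}"
   using w by force
  moreover have "bdd_above {\<bar>F v\<bar> |v. v : H1_0 Om gam & h1_norm Om v <= 1}"
  proof (rule bdd_aboveI)
   fix t assume "t : {\<bar>F v\<bar> |v. v : H1_0 Om gam & h1_norm Om v <= 1}"
   then obtain v where v: "t = \<bar>F v\<bar>" "v : H1_0 Om gam" "h1_norm Om v <= 1" by auto
   have "t <= C * h1_norm Om v" using C v by simp
   also have "... <= \<bar>C\<bar> * 1" using v(3) by (intro mult_mono) auto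
   finally show "t <= \<bar>C\<bar>" by simp
  qed
  ultimately have "\<bar>?c * F v\<bar> <= dual_norm Om gam F"
   unfolding dual_norm_def by (rule cSup_upper)
  thus ?thesis using pos by (simp add: abs_mult field_simps)
 qed
qed

lemma dual_embed_bound:
 assumes "f : L2 Om" "v : H1_0 Om gam"
 shows "\<bar>dual_embed Om f v\<bar> <= l2_norm Om f * h1_norm Om v"
proof -
 have "\<bar>dual_embed Om f v\<bar> <= l2_norm Om f * l2_norm Om v"
  unfolding dual_embed_def by (rule L2_CS[OF assms(1) H1_L2[OF H1_0_H1[OF assms(2)]]])
 also have "... <= l2_norm Om f * h1_norm Om v"
  by (intro mult_left_mono l2_norm_le_h1_norm) simp
 finally show ?thesis .
qed

lemma dual_embed_in_dual:
 assumes "f : L2 Om"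
 shows "dual_embed Om f : H1_0_dual Om gam" "dual_norm Om gam (dual_embed Om f) <= l2_norm Om f"
proof -
 show "dual_norm Om gam (dual_embed Om f) <= l2_norm Om f"
  by (intro dual_norm_le dual_embed_bound assms) auto
 show "dual_embed Om f : H1_0_dual Om gam"
  unfolding H1_0_dual_def
 proof (intro CollectI conjI ballI allI exI[of _ "l2_norm Om f"])
  fix u v and a b :: real assume uv: "u : H1_0 Om gam" "v : H1_0 Om gam"
  show "dual_embed Om f (%x. a * u x + b * v x) = a * dual_embed Om f u + b * dual_embed Om f v"
   unfolding dual_embed_def
   by (rule l2_inner_lincomb_right[OF H1_L2[OF H1_0_H1[OF uv(1)]] H1_L2[OF H1_0_H1[OF uv(2)]] assms])
 qed (rule dual_embed_bound[OF assms])
qed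

end


section \<open>Traces on hyperplanes\<close>

lemma l2_norm_le_bounded:
 fixes f :: "'a::euclidean_space => real"
 assumes D: "D : lmeasurable" and f: "f : L2 D" and M: "AE x in leb D. \<bar>f x\<bar> <= M"
 shows "(l2_norm D f)^2 <= M^2 * vol D"
proof -
 have "(l2_norm D f)^2 <= lint D (%x. M^2)"
  unfolding l2_norm_sq
 proof (rule integral_mono_AE[OF L2_sq_int[OF f] int_const[OF D]])
  show "AE x in leb D. (norm (f x))^2 <= M^2"
   using M
  proof eventually_elim
   case (elim x)
   thus ?case using power_mono[of "\<bar>f x\<bar>" M 2] by simp
  qed
 qed
 thus ?thesis using D by (simp add: measure_restrict_space fmeasurableD mult.commute)
qed

text \<open>The ball of half the radius around the midpoint of the radius in direction
  \<open>n\<close> lies in the open half ball.\<close>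

lemma half_ball_measure:
 fixes x0 :: "'a::euclidean_space"
 assumes "0 < s" "n ~= 0"
 shows "vol (ball x0 s) / 2 ^ DIM('a) <= vol (ball x0 s Int {x. 0 < n \<bullet> (x - x0)})"
proof -
 define c where "c = x0 + (s / (2 * norm n)) *\<^sub>R n"
 have sub: "ball c (s/2) <= ball x0 s Int {x. 0 < n \<bullet> (x - x0)}"
 proof
  fix x assume "x : ball c (s/2)"
  hence x: "norm (x - c) < s/2" by (simp add: dist_norm norm_minus_commute)
  have nc: "norm (c - x0) = s/2" using assms by (simp add: c_def)
  have "norm (x - x0) <= norm (x - c) + norm (c - x0)" using norm_triangle_ineq[of "x - c" "c - x0"] by simp
  hence 1: "x : ball x0 s" using x nc by (simp add: dist_norm norm_minus_commute)
  have "\<bar>n \<bullet> (x - c)\<bar> < norm n * (s/2)"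
   using Cauchy_Schwarz_ineq2[of n "x - c"] x assms by (smt (verit) mult_strict_left_mono zero_less_norm_iff)
  moreover have "n \<bullet> (c - x0) = norm n * (s/2)"
   using assms by (simp add: c_def flip: power2_norm_eq_inner) (simp add: power2_eq_square)
  moreover have "n \<bullet> (x - x0) = n \<bullet> (x - c) + n \<bullet> (c - x0)" by (simp add: algebra_simps)
  ultimately have "0 < n \<bullet> (x - x0)" by linarith
  with 1 show "x : ball x0 s Int {x. 0 < n \<bullet> (x - x0)}" by simp
 qed
 have "open {x. 0 < n \<bullet> (x - x0)}"
  by (intro open_Collect_less continuous_intros)
 hence m: "ball x0 s Int {x. 0 < n \<bullet> (x - x0)} : lmeasurable"
  by (intro lmeasurable_open) auto
 have "vol (ball x0 s) / 2 ^ DIM('a) = vol (ball c (s/2))"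
  using assms by (simp add: content_ball power_divide)
 also have "... <= vol (ball x0 s Int {x. 0 < n \<bullet> (x - x0)})"
  by (intro measure_mono_fmeasurable sub m) auto
 finally show ?thesis .
qed

lemma hyperplane_null:
 fixes n :: "'a::euclidean_space"
 assumes "n ~= 0"
 shows "AE x in lebesgue. n \<bullet> (x - x0) ~= 0"
proof -
 have "negligible {x. n \<bullet> x = n \<bullet> x0}" using assms by (intro negligible_hyperplane) auto
 hence "{x. n \<bullet> x = n \<bullet> x0} : null_sets lebesgue" by (simp add: negligible_iff_null_sets)
 thus ?thesis
  by (rule AE_I'[rotated 0]) (auto simp: inner_diff_right)
qed

lemma AE_leb:
 "D : sets lebesgue ==> (AE x in leb D. P x) \<longleftrightarrow> (AE x in lebesgue. x : D --> P x)"
 by (simp add: AE_restrict_space_iff)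

lemma l2_norm_sq_real: "(l2_norm D f)^2 = lint D (%x. (f x :: real)^2)"
 by (simp add: l2_norm_sq)

text \<open>\<open>poincare_part\<close> divided by volumes: \<open>\<alpha>\<close> bounds from
  below the fraction of \<open>D\<close> that \<open>A\<close> fills, and \<open>\<beta>\<close>
  compares \<open>D\<close> with a ball whose radius is the diameter bound, so the constants do not
  depend on scale.\<close>

lemma poincare_rel:
 fixes w :: "'a::euclidean_space => real"
 assumes D: "open D" "bounded D" "convex D" "D ~= {}" and w: "w : L2 D"
  and G: "G : L2 D" "weak_gradient D w G"
  and rho: "!!x y. x : D ==> y : D ==> norm (x - y) <= rho" "0 <= rho"
  and A: "A <= D" "A : sets borel" "0 < \<alpha>" "\<alpha> * vol D <= vol A"
  and \<beta>: "vol (cball (0::'a) rho) <= \<beta> * vol D"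
 shows "(l2_norm D w)^2 <= 2 / \<alpha> * (l2_norm A w)^2 + 2 * \<beta> * rho^2 / \<alpha> * (l2_norm D G)^2"
proof -
 define V where "V = vol D"
 have V: "0 < V"
  using D(1,2,4) unfolding V_def
  by (metis bounded_set_imp_lmeasurable lmeasurable_open negligible_iff_measure0 open_not_negligible zero_less_measure_iff)
 let ?I = "(l2_norm D w)^2" and ?J = "(l2_norm A w)^2" and ?g = "(l2_norm D G)^2"
 have "\<alpha> * V * ?I <= vol A * ?I" using A(4) by (intro mult_right_mono) (auto simp: V_def)
 also have "... <= 2 * V * ?J + 2 * rho^2 * vol (cball (0::'a) rho) * ?g"
  using poincare_part[OF D(1-3) w G rho A(1,2)] by (simp add: l2_norm_sq_real V_def)
 also have "2 * rho^2 * vol (cball (0::'a) rho) * ?g <= 2 * rho^2 * (\<beta> * V) * ?g"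
  using \<beta> by (intro mult_right_mono mult_left_mono) (auto simp: V_def)
 finally have "\<alpha> * V * ?I <= \<alpha> * V * (2 / \<alpha> * ?J + 2 * \<beta> * rho^2 / \<alpha> * ?g)"
  using A(3) by (simp add: algebra_simps)
 thus ?thesis using V A(3) by (simp add: mult_le_cancel_left_pos)
qed

text \<open>\<open>poincare_rel\<close> with diameter bound \<open>2 s\<close>: the half ball fills
  at least the fraction \<open>2^-d\<close>, and the ball of radius \<open>2 s\<close> is
  \<open>2^d\<close> times larger.\<close>

lemma poincare_half_ball:
 fixes w :: "'a::euclidean_space => real"
 assumes s: "0 < s" and n: "n ~= 0" and w: "w : L2 (ball x0 s)"
  and G: "G : L2 (ball x0 s)" "weak_gradient (ball x0 s) w G"
 shows "(l2_norm (ball x0 s) w)^2 <= 2 * 2 ^ DIM('a) * (l2_norm (ball x0 s Int {x. 0 < n \<bullet> (x - x0)}) w)^2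
  + 8 * 4 ^ DIM('a) * s^2 * (l2_norm (ball x0 s) G)^2"
proof -
 have diam: "norm (x - y) <= 2 * s" if "x : ball x0 s" "y : ball x0 s" for x y
  using that norm_triangle_ineq4[of "x - x0" "y - x0"] by (simp add: dist_norm norm_minus_commute)
 have "{x. 0 < n \<bullet> (x - x0)} = {x. n \<bullet> x0 < n \<bullet> x}" by (auto simp: inner_diff_right)
 hence bm: "ball x0 s Int {x. 0 < n \<bullet> (x - x0)} : sets borel" by (auto simp: open_halfspace_gt intro!: borel_open open_Int)
 have "(l2_norm (ball x0 s) w)^2 <= 2 / (1 / 2 ^ DIM('a)) * (l2_norm (ball x0 s Int {x. 0 < n \<bullet> (x - x0)}) w)^2
  + 2 * 2 ^ DIM('a) * (2 * s)^2 / (1 / 2 ^ DIM('a)) * (l2_norm (ball x0 s) G)^2"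
  by (rule poincare_rel[OF _ _ _ _ w G diam _ _ bm])
    (use s half_ball_measure[OF s n, of x0] in \<open>auto simp: content_ball content_cball power_mult_distrib\<close>)
 moreover have "2 * 2 ^ DIM('a) * (2 * s)^2 / (1 / 2 ^ DIM('a)) = 8 * 4 ^ DIM('a) * s^2"
 proof -
  have "(4::real) ^ DIM('a) = 2 ^ DIM('a) * 2 ^ DIM('a)" by (simp flip: power_mult_distrib)
  thus ?thesis by (simp add: power_mult_distrib)
 qed
 moreover have "2 / (1 / 2 ^ DIM('a)) = (2::real) * 2 ^ DIM('a)" by simp
 ultimately show ?thesis by (simp only:)
qed

text \<open>The weak gradient of a function that is affine on either side of a hyperplane is bounded, so on
 small balls the Poincare inequality leaves no room for a jump.\<close>

lemma jump_zero:
 fixes x0 :: "'a::euclidean_space"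
 assumes r: "0 < r" and n: "n ~= 0" and u: "u : L2 (ball x0 r)" "G : L2 (ball x0 r)" "weak_gradient (ball x0 r) u G"
  and ae: "AE x in leb (ball x0 r). 0 < n \<bullet> (x - x0) --> u x = a1 \<bullet> x + b1"
   "AE x in leb (ball x0 r). n \<bullet> (x - x0) < 0 --> u x = a2 \<bullet> x + b2"
 shows "a1 \<bullet> x0 + b1 = a2 \<bullet> x0 + b2"
proof (rule ccontr)
 assume neq: "a1 \<bullet> x0 + b1 ~= a2 \<bullet> x0 + b2"
 let ?D = "ball x0 r"
 have Dm: "?D : lmeasurable" "?D : sets lebesgue" by auto
 \<comment> \<open>After the second affine function is subtracted, \<open>w\<close> equals
   \<open>p\<close> on the positive side and 0 on the negative one; the jump at \<open>x0\<close> is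
   \<open>p x0\<close>.\<close>
 define p where "p x = (a1 - a2) \<bullet> x + (b1 - b2)" for x
 define w where "w x = u x - (a2 \<bullet> x + b2)" for x
 define H where "H x = G x - a2" for x
 have aff: "(%x. a \<bullet> x + b) : L2 ?D" for a b by (intro cont_L2 continuous_intros) auto
 have w: "w : L2 ?D" and H: "H : L2 ?D"
  unfolding w_def[abs_def] H_def[abs_def] by (intro L2_diff u aff const_L2 Dm)+
 have wg: "weak_gradient ?D w H"
  using weak_gradient_lincomb[OF Dm(1) u(1) aff u(2) const_L2[OF Dm(1)] u(3) weak_gradient_affine[of ?D a2 b2], of 1 "-1"]
  by (simp add: w_def[abs_def] H_def[abs_def] algebra_simps)
 define Dp where "Dp = ?D Int {x. 0 < n \<bullet> (x - x0)}"
 define Dn where "Dn = ?D Int {x. n \<bullet> (x - x0) < 0}"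
 have op: "open Dp" "open Dn"
  unfolding Dp_def Dn_def by (auto intro!: open_Int open_Collect_less continuous_intros)
 have bd: "bounded Dp" "bounded Dn" unfolding Dp_def Dn_def by (auto intro: bounded_subset[OF bounded_ball])
 have sm: "Dp : lmeasurable" "Dn : lmeasurable" using op bd by (auto intro: lmeasurable_open)
 have ss: "Dp : sets lebesgue" "Dn : sets lebesgue" using sm by (auto simp: fmeasurableD)
 have sub: "Dp <= ?D" "Dn <= ?D" unfolding Dp_def Dn_def by auto
 have wp: "AE x in leb Dp. w x = p x"
  using ae(1) unfolding AE_leb[OF Dm(2)] AE_leb[OF ss(1)]
  by eventually_elim (auto simp: Dp_def w_def p_def inner_diff_left)
 have wn: "AE x in leb Dn. w x = 0"
  using ae(2) unfolding AE_leb[OF Dm(2)] AE_leb[OF ss(2)]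
  by eventually_elim (auto simp: Dn_def w_def)
 have affp: "p : L2 Dp" unfolding p_def[abs_def] using bd(1) ss(1) by (intro cont_L2 continuous_intros)
 have Hp: "AE x in leb Dp. H x = a1 - a2"
 proof (rule weak_gradient_unique[OF op(1) bd(1) affp])
  show "H : L2 Dp" by (rule L2_subset[OF H sub(1) ss(1) Dm(2)])
  show "weak_gradient Dp p H"
   by (rule weak_gradient_cong_AE[OF wgrad_subset[OF wg Dm(1) w H sub(1) sm(1)] sm(1)])
    (use wp affp L2_subset[OF H sub(1) ss(1) Dm(2)] L2_subset[OF w sub(1) ss(1) Dm(2)] in auto)
  show "weak_gradient Dp p (%x. a1 - a2)"
   unfolding p_def[abs_def] by (rule weak_gradient_affine[OF op(1) bd(1)])
 qed (rule const_L2[OF sm(1)])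
 have Hn: "AE x in leb Dn. H x = 0"
 proof (rule weak_gradient_unique[OF op(2) bd(2) L2_zero])
  show "H : L2 Dn" by (rule L2_subset[OF H sub(2) ss(2) Dm(2)])
  show "weak_gradient Dn (%x. 0) H"
   by (rule weak_gradient_cong_AE[OF wgrad_subset[OF wg Dm(1) w H sub(2) sm(2)] sm(2)])
    (use wn L2_subset[OF H sub(2) ss(2) Dm(2)] L2_subset[OF w sub(2) ss(2) Dm(2)] in auto)
  show "weak_gradient Dn (%x. 0) (%x. 0)" by (simp add: weak_gradient_def)
 qed auto
 define M where "M = norm (a1 - a2)"
 have HM: "AE x in lebesgue. x : ?D --> (norm (H x))^2 <= M^2"
  using Hp[unfolded AE_leb[OF ss(1)]] Hn[unfolded AE_leb[OF ss(2)]] hyperplane_null[OF n, of x0]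
 proof eventually_elim
  case (elim x)
  thus ?case by (cases "0 < n \<bullet> (x - x0)") (auto simp: Dp_def Dn_def M_def)
 qed
 define \<delta> where "\<delta> = \<bar>p x0\<bar> / 2"
 have \<delta>: "0 < \<delta>" using neq by (auto simp: \<delta>_def p_def inner_diff_left)
 have "isCont p x0" unfolding p_def by (intro continuous_intros)
 then obtain s0 where s0: "s0 > 0" "!!x. norm (x - x0) < s0 ==> \<bar>p x - p x0\<bar> < \<delta>"
  using \<delta> unfolding continuous_at_eps_delta dist_norm real_norm_def by blast
 \<comment> \<open>\<open>k\<close> collects the constants of \<open>poincare_half_ball\<close>: on
   a ball of radius \<open>s\<close> one obtains \<open>\<delta>^2 <= k s^2\<close>, while
   \<open>s (1 + k) <= \<delta>\<close> would then force \<open>(1 + k)^2 <= k\<close>.\<close>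
 define k where "k = 8 * 8 ^ DIM('a) * M^2"
 have k0: "0 <= k" by (simp add: k_def)
 define s where "s = min (min s0 r) (\<delta> / (1 + k))"
 have s: "0 < s" "s <= s0" "s <= r" "s <= \<delta> / (1 + k)"
  using s0(1) r \<delta> k0 by (auto simp: s_def)
 let ?B = "ball x0 s"
 have BD: "?B <= ?D" using s by (auto simp: ball_subset_ball_iff)
 have Bm: "?B : lmeasurable" "?B : sets lebesgue" by auto
 have wB: "w : L2 ?B" "H : L2 ?B" using L2_subset[OF w BD Bm(2) Dm(2)] L2_subset[OF H BD Bm(2) Dm(2)] .
 define A where "A = ?B Int {x. 0 < - n \<bullet> (x - x0)}"
 define P where "P = ?B Int {x. 0 < n \<bullet> (x - x0)}"
 have "open A" "open P" unfolding A_def P_def by (auto intro!: open_Int open_Collect_less continuous_intros)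
 moreover have "bounded A" "bounded P" unfolding A_def P_def by (auto intro: bounded_subset[OF bounded_ball])
 ultimately have sAP: "A : sets lebesgue" "P : sets lebesgue" by (auto simp: lmeasurable_open fmeasurableD)
 define V where "V = vol ?B"
 have V: "V > 0" using s by (simp add: V_def content_ball unit_ball_vol_pos)
 have HB: "(l2_norm ?B H)^2 <= M^2 * V"
 proof -
  have "(l2_norm ?B H)^2 <= lint ?B (%x. M^2)"
   unfolding l2_norm_sq
  proof (rule integral_mono_AE[OF L2_sq_int[OF wB(2)] int_const[OF Bm(1)]])
   show "AE x in leb ?B. (norm (H x))^2 <= M^2"
    using HM unfolding AE_leb[OF Bm(2)] by eventually_elim (use BD in auto)
  qed
  thus ?thesis by (simp add: V_def measure_restrict_space mult.commute)
 qed
 have "\<delta>^2 * (V / 2 ^ DIM('a)) <= \<delta>^2 * vol P"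
  using half_ball_measure[OF s(1) n, of x0] by (intro mult_left_mono) (auto simp: V_def P_def)
 also have "... = lint P (%x. \<delta>^2)" using sAP by (simp add: measure_restrict_space mult.commute)
 also have "... <= (l2_norm ?B w)^2"
  unfolding l2_norm_sq_real
 proof (rule integral_mono_lebesgue_on_AE[OF L2_sqr_int[OF wB(1)]])
  show "AE x in leb P. \<delta>^2 <= (w x)^2"
   using wp unfolding AE_leb[OF ss(1)] AE_leb[OF sAP(2)]
  proof eventually_elim
   case (elim x)
   show ?case
   proof
    assume x: "x : P"
    hence "w x = p x" using elim BD by (auto simp: P_def Dp_def)
    moreover have "\<bar>p x - p x0\<bar> < \<delta>" using x s by (intro s0(2)) (auto simp: P_def dist_norm norm_minus_commute)
    ultimately have "\<delta> <= \<bar>w x\<bar>" unfolding \<delta>_def by linarith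
    thus "\<delta>^2 <= (w x)^2" using \<delta> by (metis abs_of_pos abs_le_square_iff)
   qed
  qed
 qed (use sAP in \<open>auto simp: P_def\<close>)
 also have "... <= 2 * 2 ^ DIM('a) * (l2_norm A w)^2 + 8 * 4 ^ DIM('a) * s^2 * (l2_norm ?B H)^2"
  unfolding A_def by (rule poincare_half_ball[OF s(1) _ wB wgrad_subset[OF wg Dm(1) w H BD Bm(1)]]) (use n in simp)
 also have "(l2_norm A w)^2 = 0"
 proof -
  have "AE x in leb A. (w x)^2 = 0"
   using wn unfolding AE_leb[OF ss(2)] AE_leb[OF sAP(1)]
   by eventually_elim (use BD in \<open>auto simp: A_def Dn_def\<close>)
  thus ?thesis unfolding l2_norm_sq_real by (rule integral_eq_zero_AE)
 qed
 also have "2 * 2 ^ DIM('a) * 0 + 8 * 4 ^ DIM('a) * s^2 * (l2_norm ?B H)^2 <= 8 * 4 ^ DIM('a) * s^2 * (M^2 * V)"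
  using mult_left_mono[OF HB, of "8 * 4 ^ DIM('a) * s^2"] by simp
 finally have "\<delta>^2 * (V / 2 ^ DIM('a)) <= 8 * 4 ^ DIM('a) * s^2 * (M^2 * V)" .
 moreover have "(8::real) ^ DIM('a) = 4 ^ DIM('a) * 2 ^ DIM('a)" by (simp flip: power_mult_distrib)
 ultimately have "V * \<delta>^2 <= V * (k * s^2)" by (simp add: k_def pos_divide_le_eq mult_ac)
 hence 1: "\<delta>^2 <= k * s^2" using V by simp
 have "s * (1 + k) <= \<delta>" using s(4) k0 by (simp add: pos_le_divide_eq)
 hence "(s * (1 + k))^2 <= \<delta>^2" using s k0 by (intro power_mono) auto
 hence "s^2 * (1 + 2 * k + k^2) <= \<delta>^2" by (simp add: power2_eq_square algebra_simps)
 with 1 have "s^2 * (1 + 2 * k + k^2) <= s^2 * k" by (simp add: mult.commute)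
 moreover have "0 < s^2" using s by simp
 ultimately have "1 + 2 * k + k^2 <= k" using mult_le_cancel_left_pos by blast
 thus False using k0 zero_le_power2[of k] by linarith
qed

section \<open>A C^1 cut-off and the extension by zero across a hyperplane\<close>

definition cutoff :: "real => real" where
 "cutoff s = 1 - psq (1 - psq (s - 1))"

definition cutoff_deriv :: "real => real" where
 "cutoff_deriv s = 4 * max 0 (1 - psq (s - 1)) * max 0 (s - 1)"

text \<open>Of the two nested squared positive parts, the inner one makes the cut-off leave 0 with
  zero slope at \<open>s = 1\<close>, and the outer one makes it reach 1 with zero slope at
  \<open>s = 2\<close>; so it is C^1 and nondecreasing.\<close>

lemma cutoff_has_derivative: "(cutoff has_real_derivative cutoff_deriv s) (at s)"
proof -
 have "((%s. psq (s - 1)) has_real_derivative (2 * max 0 (s - 1)) * 1) (at s)"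
  by (rule DERIV_chain2[OF psq_deriv]) (auto intro!: derivative_eq_intros)
 hence "((%s. 1 - psq (s - 1)) has_real_derivative - (2 * max 0 (s - 1))) (at s)"
  by (auto intro!: derivative_eq_intros)
 from DERIV_chain2[OF psq_deriv this]
 show ?thesis
  unfolding cutoff_def[abs_def] cutoff_deriv_def by (auto intro!: derivative_eq_intros)
qed

lemma psq_continuous: "continuous_on S psq"
 unfolding psq_def[abs_def] by (intro continuous_intros)

lemma cutoff_d_cont: "continuous_on UNIV cutoff_deriv"
 unfolding cutoff_deriv_def[abs_def]
 by (intro continuous_intros continuous_on_compose2[OF psq_continuous[of UNIV]]) auto

lemma cutoff_bounds: "0 <= cutoff s" "cutoff s <= 1" "0 <= cutoff_deriv s"
 by (auto simp: cutoff_def cutoff_deriv_def psq_le_1)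

lemma cutoff_le_1: "s <= 1 ==> cutoff s = 0" "s <= 1 ==> cutoff_deriv s = 0"
 by (auto simp: cutoff_def cutoff_deriv_def psq_def)

lemma cutoff_ge_2:
 assumes "2 <= s"
 shows "cutoff s = 1" "cutoff_deriv s = 0"
proof -
 have "1 <= psq (s - 1)" using assms by (simp add: psq_def one_le_power)
 thus "cutoff s = 1" "cutoff_deriv s = 0" by (auto simp: cutoff_def cutoff_deriv_def psq_nonpos)
qed

lemma has_derivative_real_compose:
 assumes "(f has_derivative (%y. g \<bullet> y)) (at x)" "(h has_real_derivative h') (at (f x))"
 shows "((%x. h (f x)) has_derivative (%y. (h' *\<^sub>R g) \<bullet> y)) (at x)"
 using has_derivative_compose[OF assms(1) assms(2)[unfolded has_field_derivative_def]] by (simp add: mult.commute)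

text \<open>For an approximant that is continuous up to \<open>gam\<close> and vanishes there, testing with \<open>eta\<close> times a
 cut-off away from the hyperplane leaves an error term in which the derivative of the cut-off is
 paired with small values; its total mass is bounded by applying the divergence theorem to a bump
 that dominates \<open>eta\<close>.\<close>

lemma zero_extension_continuous:
 fixes Om :: "'a::euclidean_space set" and n x0 :: 'a
 assumes Om: "open Om" "bounded Om" and n: "n ~= 0" and r: "0 < r"
  and E: "E = ball x0 r Int {x. 0 < n \<bullet> (x - x0)}" "E <= Om"
  and gam: "ball x0 r Int {x. n \<bullet> (x - x0) = 0} <= gam" "gam <= closure Om"
  and v: "v : L2 Om" "G : L2 Om" "weak_gradient Om v G" "continuous_on (closure Om) v" "!!x. x : gam ==> v x = 0"
  and t: "test_fn (ball x0 r) eta g"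
 shows "l2_inner E v (%x. g x \<bullet> e) + l2_inner E eta (%x. G x \<bullet> e) = 0"
proof -
 define l where "l x = n \<bullet> (x - x0)" for x
 have E': "E = ball x0 r Int {x. 0 < l x}" by (simp add: E(1) l_def)
 have Omm: "Om : lmeasurable" using Om by (simp add: lmeasurable_open)
 have "open E" unfolding E(1) by (auto intro!: open_Int open_Collect_less continuous_intros)
 moreover have "bounded E" using E(2) Om(2) bounded_subset by blast
 ultimately have Em: "E : lmeasurable" by (simp add: lmeasurable_open)
 have Es: "E : sets lebesgue" "Om : sets lebesgue" using Em Omm by (auto simp: fmeasurableD)
 have vE: "v : L2 E" "G : L2 E" using L2_subset[OF v(1) E(2) Es] L2_subset[OF v(2) E(2) Es] .
 obtain K where K: "compact K" "K <= ball x0 r" "!!x. x ~: K ==> eta x = 0" "!!x. x ~: K ==> g x = 0"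
  using test_fn_support[OF t] by metis
 obtain B where B: "0 < B" "!!x. \<bar>eta x\<bar> <= B" "!!x. norm (g x) <= B" using test_fn_bounded[OF t] by metis
 have l_deriv: "(l has_derivative (%y. n \<bullet> y)) (at x)" for x
  unfolding l_def[abs_def] by (auto intro!: derivative_eq_intros)
 have l_cont: "continuous_on S l" for S unfolding l_def[abs_def] by (intro continuous_intros)
 define ch where "ch k x = cutoff (real k * l x)" for k x
 define dch where "dch k x = real k * cutoff_deriv (real k * l x)" for k x
 have ch_deriv: "(ch k has_derivative (%y. (dch k x *\<^sub>R n) \<bullet> y)) (at x)" for k x
 proof -
  have "((%x. real k * l x) has_derivative (%y. (real k *\<^sub>R n) \<bullet> y)) (at x)"
   using has_derivative_mult_right[OF l_deriv, of "real k" x] by simp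
  from has_derivative_real_compose[OF this cutoff_has_derivative]
  show ?thesis unfolding ch_def[abs_def] dch_def by (simp add: mult.commute)
 qed
 have dch_cont: "continuous_on UNIV (%x. dch k x *\<^sub>R n)" for k
  unfolding dch_def
  by (intro continuous_intros continuous_on_compose2[OF cutoff_d_cont] l_cont) auto
 have chb: "0 <= ch k x" "ch k x <= 1" "0 <= dch k x" for k x
  by (auto simp: ch_def dch_def cutoff_bounds)
 have ch0: "ch k x = 0" "dch k x = 0" if "l x <= 0" for k x
 proof -
  have "real k * l x <= 1" using that by (smt (verit) mult_nonneg_nonpos of_nat_0_le_iff)
  thus "ch k x = 0" "dch k x = 0" by (auto simp: ch_def dch_def cutoff_le_1)
 qed
 have dch2: "dch k x = 0" if "2 <= real k * l x" for k x
  using that by (simp add: dch_def cutoff_ge_2)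
 have ch_test: "test_fn E (%x. f x * ch k x) (%x. f x *\<^sub>R (dch k x *\<^sub>R n) + ch k x *\<^sub>R f' x)"
  if f: "test_fn (ball x0 r) f f'" for f f' k
 proof -
  have m: "test_fn (ball x0 r) (%x. f x * ch k x) (%x. f x *\<^sub>R (dch k x *\<^sub>R n) + ch k x *\<^sub>R f' x)"
   by (rule test_fn_mult[OF f ch_deriv dch_cont])
  obtain L where L: "compact L" "L <= ball x0 r" "!!x. x ~: L ==> f x = 0" using test_fn_support[OF f] by metis
  have "closed {x. 1 <= real k * l x}" by (intro closed_Collect_le continuous_intros l_cont)
  hence "compact (L Int {x. 1 <= real k * l x})" using L(1) by blast
  moreover have "L Int {x. 1 <= real k * l x} <= E"
  proof
   fix x assume x: "x : L Int {x. 1 <= real k * l x}"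
   hence "\<not> l x <= 0" by (smt (verit) IntD2 mem_Collect_eq mult_nonneg_nonpos of_nat_0_le_iff)
   thus "x : E" using x L(2) by (auto simp: E')
  qed
  moreover have "f x * ch k x = 0" if "x ~: L Int {x. 1 <= real k * l x}" for x
   using that L(3)[of x] cutoff_le_1(1)[of "real k * l x"] by (auto simp: ch_def)
  ultimately show ?thesis using m unfolding test_fn_def by blast
 qed
 have nn: "n \<bullet> n > 0" using n by simp
 obtain M where M: "0 <= M" "!!k. lint E (%x. \<bar>eta x\<bar> * dch k x) <= M"
 proof (cases "K = {}")
  case True
  thus ?thesis using K that[of 0] by simp
 next
  case False
  have "continuous_on K (%x. dist x0 x)" by (intro continuous_intros)
  then obtain y where y: "y : K" "!!x. x : K ==> dist x0 x <= dist x0 y"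
   using continuous_attains_sup[OF K(1) False] by blast
  have "dist x0 y < r" using y K(2) by auto
  \<comment> \<open>There is room between the compact support and the ball: the bump on this
    slightly smaller ball still has a positive minimum \<open>m\<close> on \<open>K\<close>.\<close>
  then obtain r' where r': "dist x0 y < r'" "r' < r" using dense by blast
  have r'0: "0 < r'" using r' zero_le_dist[of x0 y] by linarith
  have bt: "test_fn (ball x0 r) (bump x0 r') (bump_grad x0 r')"
   by (rule test_fn_bump[OF r'0]) (use r' in auto)
  have "continuous_on K (bump x0 r')" using test_fn_cont[OF bt] continuous_on_subset by blast
  then obtain z where z: "z : K" "!!x. x : K ==> bump x0 r' z <= bump x0 r' x"
   using continuous_attains_inf[OF K(1) False] by blast
  define m where "m = bump x0 r' z"
  have m: "0 < m" unfolding m_def using y(2)[OF z(1)] r' bump_pos_iff[OF r'0, of x0 z] by auto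
  have dom: "\<bar>eta x\<bar> <= B / m * bump x0 r' x" for x
  proof (cases "x : K")
   case True
   hence "1 <= bump x0 r' x / m" using z(2)[of x] m by (simp add: m_def)
   hence "B * 1 <= B * (bump x0 r' x / m)" using B(1) by (intro mult_left_mono) auto
   thus ?thesis using B(2)[of x] by simp
  next
   case False
   thus ?thesis using K(3) B m by simp
  qed
  have int: "integrable (leb E) (%x. bump x0 r' x * dch k x)" "integrable (leb E) (%x. \<bar>eta x\<bar> * dch k x)"
    "integrable (leb E) (%x. ch k x * (bump_grad x0 r' x \<bullet> n))" for k
  proof -
   have c: "continuous_on UNIV (%x. dch k x)"
    unfolding dch_def
    by (intro continuous_intros continuous_on_compose2[OF cutoff_d_cont] l_cont) auto
   have c2: "continuous_on UNIV (ch k)"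
    by (meson continuous_at_imp_continuous_on has_derivative_continuous ch_deriv)
   have 1: "integrable (leb E) f" if "continuous_on UNIV f" for f :: "'a => real"
    using L2_mult_int[OF cont_L2[OF that \<open>bounded E\<close> Es(1)] const_L2[OF Em, of 1]] by simp
   show "integrable (leb E) (%x. bump x0 r' x * dch k x)" "integrable (leb E) (%x. \<bar>eta x\<bar> * dch k x)"
    "integrable (leb E) (%x. ch k x * (bump_grad x0 r' x \<bullet> n))"
    by (intro 1 continuous_intros c c2 test_fn_cont[OF bt] test_fn_cont[OF t] bump_grad_cont)+
  qed
  have bound: "lint E (%x. bump x0 r' x * dch k x) <= (4 / r' * norm n * vol E) / (n \<bullet> n)" for k
  proof -
   have "lint E (%x. (bump x0 r' x *\<^sub>R (dch k x *\<^sub>R n) + ch k x *\<^sub>R bump_grad x0 r' x) \<bullet> n) = 0"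
    by (rule test_fn_integral_grad[OF ch_test[OF bt] Es(1)])
   also have "(%x. (bump x0 r' x *\<^sub>R (dch k x *\<^sub>R n) + ch k x *\<^sub>R bump_grad x0 r' x) \<bullet> n)
     = (%x. bump x0 r' x * dch k x * (n \<bullet> n) + ch k x * (bump_grad x0 r' x \<bullet> n))"
    by (auto simp: inner_add_left)
   finally have "lint E (%x. bump x0 r' x * dch k x) * (n \<bullet> n)
     = lint E (%x. - (ch k x * (bump_grad x0 r' x \<bullet> n)))"
    using int by simp
   also have "... <= lint E (%x. 4 / r' * norm n)"
   proof (rule integral_mono)
    fix x
    have "\<bar>ch k x * (bump_grad x0 r' x \<bullet> n)\<bar> <= 1 * (norm (bump_grad x0 r' x) * norm n)"
     unfolding abs_mult using chb[of k x] by (intro mult_mono Cauchy_Schwarz_ineq2) auto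
    also have "... <= 4 / r' * norm n" using mult_right_mono[OF bump_grad_le[OF r'0, of x0 x] norm_ge_zero[of n]] by simp
    finally show "- (ch k x * (bump_grad x0 r' x \<bullet> n)) <= 4 / r' * norm n" by linarith
   qed (use int(3)[of k] int_const[OF Em] in auto)
   also have "... = 4 / r' * norm n * vol E" using Es by (simp add: measure_restrict_space)
   finally show ?thesis by (rule mult_imp_le_div_pos[OF nn])
  qed
  let ?M = "B / m * ((4 / r' * norm n * vol E) / (n \<bullet> n))"
  show ?thesis
  proof (rule that[of ?M])
   show "0 <= ?M" using B m r'0 nn by auto
   fix k
   have "lint E (%x. \<bar>eta x\<bar> * dch k x) <= lint E (%x. B / m * (bump x0 r' x * dch k x))"
   proof (rule integral_mono)
    show "\<bar>eta x\<bar> * dch k x <= B / m * (bump x0 r' x * dch k x)" for x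
     using mult_right_mono[OF dom chb(3), of x k x] by (simp add: mult.assoc)
   qed (use int in auto)
   also have "... = B / m * lint E (%x. bump x0 r' x * dch k x)" by simp
   also have "... <= ?M" using B m by (intro mult_left_mono bound) auto
   finally show "lint E (%x. \<bar>eta x\<bar> * dch k x) <= ?M" .
  qed
 qed
 note tL = test_fn_L2[OF t Em]
 let ?J = "%x. v x * (g x \<bullet> e) + eta x * (G x \<bullet> e)"
 have Ji: "integrable (leb E) ?J"
  by (intro Bochner_Integration.integrable_add L2_mult_int vE L2_dot tL)
 have chm: "ch k : borel_measurable (leb E)" "dch k : borel_measurable (leb E)" for k
 proof -
  have c2: "continuous_on UNIV (ch k)"
   by (meson continuous_at_imp_continuous_on has_derivative_continuous ch_deriv)
  have c: "continuous_on UNIV (dch k)"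
   unfolding dch_def[abs_def]
   by (intro continuous_intros continuous_on_compose2[OF cutoff_d_cont] l_cont) auto
  show "ch k : borel_measurable (leb E)" "dch k : borel_measurable (leb E)"
   by (rule cont_meas[OF c2], rule cont_meas[OF c])
 qed
 have err_int: "integrable (leb E) (%x. v x * (eta x * dch k x))" for k
 proof -
  have "continuous_on UNIV (%x. eta x * dch k x)"
   unfolding dch_def
   by (intro continuous_intros continuous_on_compose2[OF cutoff_d_cont] l_cont test_fn_cont[OF t]) auto
  from L2_mult_int[OF vE(1) cont_L2[OF this \<open>bounded E\<close> Es(1)]] show ?thesis by simp
 qed
 have main: "lint E (%x. ch k x * ?J x) = - (n \<bullet> e) * lint E (%x. v x * (eta x * dch k x))" for k
 proof -
  have vEw: "weak_gradient E v G" by (rule wgrad_subset[OF v(3) Omm v(1,2) E(2) Em])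
  have "l2_inner E v (%x. (eta x *\<^sub>R (dch k x *\<^sub>R n) + ch k x *\<^sub>R g x) \<bullet> e) = - l2_inner E (%x. eta x * ch k x) (%x. G x \<bullet> e)"
   by (rule weak_gradientD[OF vEw Em vE ch_test[OF t]])
  moreover have "(%x. v x * ((eta x *\<^sub>R (dch k x *\<^sub>R n) + ch k x *\<^sub>R g x) \<bullet> e))
    = (%x. (v x * (eta x * dch k x)) * (n \<bullet> e) + ch k x * (v x * (g x \<bullet> e)))"
   by (auto simp: inner_add_left algebra_simps)
  moreover have "(%x. eta x * ch k x * (G x \<bullet> e)) = (%x. ch k x * (eta x * (G x \<bullet> e)))" by auto
  moreover have "integrable (leb E) (%x. ch k x * (v x * (g x \<bullet> e)))"
  proof -
   have "(%x. ch k x * v x) : L2 E" by (rule L2_mult_bounded[OF vE(1) chm(1), where B = 1]) (use chb in auto)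
   from L2_mult_int[OF this L2_dot[OF tL(2)]] show ?thesis by (simp add: mult.assoc)
  qed
  moreover have "integrable (leb E) (%x. ch k x * (eta x * (G x \<bullet> e)))"
  proof -
   have "(%x. ch k x * eta x) : L2 E" by (rule L2_mult_bounded[OF tL(1) chm(1), where B = 1]) (use chb in auto)
   from L2_mult_int[OF this L2_dot[OF vE(2)]] show ?thesis by (simp add: mult.assoc)
  qed
  ultimately show ?thesis
   using err_int[of k] by (simp add: l2_inner_def distrib_left mult.commute[of _ "n \<bullet> e"])
 qed
 have lim1: "(%k. lint E (%x. ch k x * ?J x)) \<longlonglongrightarrow> lint E ?J"
 proof (rule integral_dominated_convergence[where w = "%x. \<bar>?J x\<bar>"])
  show "?J : borel_measurable (leb E)" using Ji by (rule borel_measurable_integrable)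
  thus "(%x. ch k x * ?J x) : borel_measurable (leb E)" for k using chm(1) by measurable
  show "integrable (leb E) (%x. \<bar>?J x\<bar>)" using Ji by (rule integrable_abs)
  show "AE x in leb E. (%k. ch k x * ?J x) \<longlonglongrightarrow> ?J x"
  proof (rule AE_I2)
   fix x assume "x : space (leb E)"
   hence lx: "0 < l x" by (simp add: E')
   obtain N where N: "2 / l x <= real N" using real_arch_simple by blast
   have "\<forall>\<^sub>F k in sequentially. ch k x * ?J x = ?J x"
   proof (rule eventually_sequentiallyI[of N])
    fix k assume "N <= k"
    hence "2 / l x <= real k" using N by linarith
    hence "2 <= real k * l x" using lx by (simp add: pos_divide_le_eq)
    thus "ch k x * ?J x = ?J x" by (simp add: ch_def cutoff_ge_2)
   qed
   thus "(%k. ch k x * ?J x) \<longlonglongrightarrow> ?J x" by (rule tendsto_eventually)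
  qed
  show "AE x in leb E. norm (ch k x * ?J x) <= \<bar>?J x\<bar>" for k
   by (rule AE_I2) (use chb in \<open>auto simp: abs_mult intro: mult_left_le_one_le\<close>)
 qed
 have lim2: "(%k. lint E (%x. v x * (eta x * dch k x))) \<longlonglongrightarrow> 0"
 proof (rule LIMSEQ_I)
  fix \<epsilon> :: real assume "\<epsilon> > 0"
  define d where "d = \<epsilon> / (M + 1)"
  have d: "d > 0" using \<open>\<epsilon> > 0\<close> M(1) by (simp add: d_def)
  \<comment> \<open>On \<open>S\<close> the function \<open>l\<close> has a positive minimum
    \<open>mu\<close>, because \<open>v\<close> vanishes on the hyperplane. For
    \<open>k >= 2 / mu\<close> the derivative of the cut-off is zero on \<open>S\<close>, and
    elsewhere on the support the factor \<open>v\<close> is below \<open>d\<close>.\<close>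
  define S where "S = {x : K Int {x. 0 <= l x}. d <= \<bar>v x\<bar>}"
  have Kl: "compact (K Int {x. 0 <= l x})"
  proof -
   have "closed {x. 0 <= l x}" by (intro closed_Collect_le continuous_intros l_cont)
   thus ?thesis using K(1) by blast
  qed
  have Kcl: "K Int {x. 0 <= l x} <= closure Om"
  proof
   fix x assume x: "x : K Int {x. 0 <= l x}"
   show "x : closure Om"
   proof (cases "l x = 0")
    case True
    thus ?thesis using x K(2) gam by (auto simp: l_def)
   next
    case False
    hence "x : E" using x K(2) by (auto simp: E')
    thus ?thesis using E(2) closure_subset by blast
   qed
  qed
  have "compact S"
  proof -
   have "continuous_on (K Int {x. 0 <= l x}) (%x. \<bar>v x\<bar>)"
    by (intro continuous_intros continuous_on_subset[OF v(4) Kcl])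
   hence "closedin (top_of_set (K Int {x. 0 <= l x})) ((K Int {x. 0 <= l x}) Int (%x. \<bar>v x\<bar>) -` {d..})"
    by (rule continuous_closedin_preimage) simp
   hence "compact ((K Int {x. 0 <= l x}) Int (%x. \<bar>v x\<bar>) -` {d..})"
    using Kl closedin_compact by blast
   moreover have "(K Int {x. 0 <= l x}) Int (%x. \<bar>v x\<bar>) -` {d..} = S" by (auto simp: S_def)
   ultimately show ?thesis by simp
  qed
  have Spos: "0 < l x" if "x : S" for x
  proof (rule ccontr)
   assume "\<not> 0 < l x"
   hence "l x = 0" using that by (simp add: S_def)
   hence "x : gam" using that K(2) gam(1) by (auto simp: S_def l_def)
   thus False using that v(5) d by (simp add: S_def)
  qed
  obtain mu where mu: "0 < mu" "!!x. x : S ==> mu <= l x"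
  proof (cases "S = {}")
   case True
   thus ?thesis using that[of 1] by simp
  next
   case False
   then obtain y where "y : S" "!!x. x : S ==> l y <= l x"
    using continuous_attains_inf[OF \<open>compact S\<close> _ l_cont] by blast
   thus ?thesis using that[of "l y"] Spos by blast
  qed
  obtain N where N: "2 / mu <= real N" using real_arch_simple by blast
  show "EX no. ALL k>=no. norm (lint E (%x. v x * (eta x * dch k x)) - 0) < \<epsilon>"
  proof (intro exI[of _ N] allI impI)
   fix k assume "N <= k"
   hence k: "2 / mu <= real k" using N by linarith
   have pw: "\<bar>v x * (eta x * dch k x)\<bar> <= d * (\<bar>eta x\<bar> * dch k x)" if x: "x : E" for x
   proof (cases "eta x * dch k x = 0")
    case False
    hence xK: "x : K" and "dch k x ~= 0" using K(3) by auto
    hence lt: "real k * l x < 2" using dch2 by force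
    have "x ~: S"
    proof
     assume "x : S"
     hence "2 / mu * mu <= real k * l x" using mu k by (intro mult_mono) auto
     thus False using lt mu(1) by simp
    qed
    hence "\<bar>v x\<bar> < d" using xK x by (auto simp: S_def E')
    thus ?thesis using chb(3)[of k x] by (simp add: abs_mult mult_right_mono)
   qed (use d chb in auto)
   have "norm (lint E (%x. v x * (eta x * dch k x))) <= lint E (%x. d * (\<bar>eta x\<bar> * dch k x))"
   proof (rule order_trans[OF integral_norm_bound integral_mono[OF integrable_norm[OF err_int]]])
    have c: "continuous_on UNIV (%x. d * (\<bar>eta x\<bar> * dch k x))"
     unfolding dch_def
     by (intro continuous_intros continuous_on_compose2[OF cutoff_d_cont] l_cont test_fn_cont[OF t]) auto
    show "integrable (leb E) (%x. d * (\<bar>eta x\<bar> * dch k x))"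
     using L2_mult_int[OF cont_L2[OF c \<open>bounded E\<close> Es(1)] const_L2[OF Em, of 1]] by simp
   qed (use pw in auto)
   also have "... = d * lint E (%x. \<bar>eta x\<bar> * dch k x)" by simp
   also have "... <= d * M" using d by (intro mult_left_mono M(2)) simp
   also have "... < \<epsilon>" using \<open>\<epsilon> > 0\<close> M(1) by (simp add: d_def field_simps)
   finally show "norm (lint E (%x. v x * (eta x * dch k x)) - 0) < \<epsilon>" by simp
  qed
 qed
 have "(%k. - (n \<bullet> e) * lint E (%x. v x * (eta x * dch k x))) \<longlonglongrightarrow> - (n \<bullet> e) * 0"
  by (intro tendsto_intros lim2)
 hence "lint E ?J = 0"
  using LIMSEQ_unique[OF lim1[unfolded main]] by simp
 thus ?thesis
  using L2_mult_int[OF vE(1) L2_dot[OF tL(2)], of e] L2_mult_int[OF tL(1) L2_dot[OF vE(2)], of e]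
  by (simp add: l2_inner_def)
qed

lemma L2_zero_extension:
 fixes u :: "'a::euclidean_space => 'b::euclidean_space"
 assumes "u : L2 E" "E <= D" "E : sets lebesgue" "D : sets lebesgue"
 shows "(%x. if x : E then u x else 0) : L2 D"
proof -
 have "(%x. if x : E then u x else 0) : borel_measurable lebesgue"
  using L2_meas[OF assms(1)] assms(3) by (rule borel_measurable_if_I)
 hence m: "(%x. if x : E then u x else 0) : borel_measurable (leb D)"
  by (rule measurable_restrict_space1)
 have "integrable lebesgue (%x. if x : E then (norm (u x))^2 else 0)"
  using L2_sq_int[OF assms(1)] assms(3) by (simp add: Lebesgue_Measure.integrable_restrict_UNIV)
 also have "(%x. if x : E then (norm (u x))^2 else 0) = (%x. indicator D x *\<^sub>R (norm (if x : E then u x else 0))^2)"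
  using assms(2) by (auto simp: indicator_def fun_eq_iff)
 finally show ?thesis using m assms(4) by (simp add: L2_def integrable_restrict_space)
qed

text \<open>\<open>I w\<close>, the defect in the integration by parts, is continuous in the
  \<open>H1\<close> norm and vanishes for the continuous approximants from the definition of
  \<open>H1_0\<close>, hence also for \<open>u\<close>.\<close>

lemma zero_extension:
 fixes Om :: "'a::euclidean_space set" and n x0 :: 'a
 assumes Om: "open Om" "bounded Om" and n: "n ~= 0" and r: "0 < r"
  and E: "E = ball x0 r Int {x. 0 < n \<bullet> (x - x0)}" "E <= Om"
  and gam: "ball x0 r Int {x. n \<bullet> (x - x0) = 0} <= gam" "gam <= closure Om"
  and u: "u : H1_0 Om gam"
 shows "weak_gradient (ball x0 r) (%x. if x : E then u x else 0) (%x. if x : E then wgrad Om u x else 0)"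
  "(%x. if x : E then u x else 0) : L2 (ball x0 r)" "(%x. if x : E then wgrad Om u x else 0) : L2 (ball x0 r)"
proof -
 have Omm: "Om : lmeasurable" using Om by (simp add: lmeasurable_open)
 have "open E" unfolding E(1) by (auto intro!: open_Int open_Collect_less continuous_intros)
 moreover have "bounded E" using E(2) Om(2) bounded_subset by blast
 ultimately have Em: "E : lmeasurable" by (simp add: lmeasurable_open)
 have Es: "E : sets lebesgue" "Om : sets lebesgue" "ball x0 r : sets lebesgue" using Em Omm by (auto simp: fmeasurableD)
 have EB: "E <= ball x0 r" using E(1) by auto
 have uH: "u : H1 Om" by (rule H1_0_H1[OF u])
 have uE: "u : L2 E" "wgrad Om u : L2 E"
  using L2_subset[OF H1_L2[OF uH] E(2) Es(1,2)] L2_subset[OF wgrad_props(1)[OF uH] E(2) Es(1,2)] .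
 show 1: "(%x. if x : E then u x else 0) : L2 (ball x0 r)" "(%x. if x : E then wgrad Om u x else 0) : L2 (ball x0 r)"
  using L2_zero_extension[OF uE(1) EB Es(1,3)] L2_zero_extension[OF uE(2) EB Es(1,3)] .
 show "weak_gradient (ball x0 r) (%x. if x : E then u x else 0) (%x. if x : E then wgrad Om u x else 0)"
 proof (rule weak_gradientI[OF _ 1])
  fix eta g e assume t: "test_fn (ball x0 r) eta g"
  note tL = test_fn_L2[OF t Em]
  define I where "I w = l2_inner E w (%x. g x \<bullet> e) + l2_inner E eta (%x. wgrad Om w x \<bullet> e)" for w
  have bound: "\<bar>I w\<bar> <= (l2_norm E (%x. g x \<bullet> e) + l2_norm E eta * norm e) * h1_norm Om w" if w: "w : H1 Om" for w
  proof -
   have wE: "w : L2 E" "wgrad Om w : L2 E"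
    using L2_subset[OF H1_L2[OF w] E(2) Es(1,2)] L2_subset[OF wgrad_props(1)[OF w] E(2) Es(1,2)] .
   have n1: "l2_norm E w <= h1_norm Om w"
   proof -
    have "l2_norm E w <= l2_norm Om w"
     unfolding l2_norm_def
     by (intro real_sqrt_le_mono lint_mono_set L2_sq_int H1_L2[OF w] E Es) auto
    thus ?thesis using l2_norm_le_h1_norm(1)[of Om w] by linarith
   qed
   have n2: "l2_norm E (%x. wgrad Om w x \<bullet> e) <= norm e * h1_norm Om w"
   proof -
    have "(l2_norm E (%x. wgrad Om w x \<bullet> e))^2 <= lint E (%x. (norm e)^2 * (norm (wgrad Om w x))^2)"
     unfolding l2_norm_sq
    proof (rule integral_mono)
     show "integrable (leb E) (%x. (norm (wgrad Om w x \<bullet> e))^2)"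
      by (rule L2_sq_int[OF L2_dot[OF wE(2)]])
     show "integrable (leb E) (%x. (norm e)^2 * (norm (wgrad Om w x))^2)"
      using L2_sq_int[OF wE(2)] by simp
     show "(norm (wgrad Om w x \<bullet> e))^2 <= (norm e)^2 * (norm (wgrad Om w x))^2" for x
      using power_mono[OF Cauchy_Schwarz_ineq2[of "wgrad Om w x" e] abs_ge_zero, of 2] by (simp add: power_mult_distrib mult.commute)
    qed
    also have "... = (norm e)^2 * lint E (%x. (norm (wgrad Om w x))^2)" by simp
    also have "... <= (norm e)^2 * (l2_norm Om (wgrad Om w))^2"
     unfolding l2_norm_sq
     by (intro mult_left_mono lint_mono_set L2_sq_int wgrad_props(1)[OF w] E Es) auto
    also have "... = (norm e * l2_norm Om (wgrad Om w))^2" by (simp add: power_mult_distrib)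
    finally have "l2_norm E (%x. wgrad Om w x \<bullet> e) <= norm e * l2_norm Om (wgrad Om w)" by (rule power2_le_imp_le) simp
    also have "... <= norm e * h1_norm Om w" by (intro mult_left_mono l2_norm_le_h1_norm) simp
    finally show ?thesis .
   qed
   have "\<bar>I w\<bar> <= l2_norm E w * l2_norm E (%x. g x \<bullet> e) + l2_norm E eta * l2_norm E (%x. wgrad Om w x \<bullet> e)"
    using L2_CS[OF wE(1) L2_dot[OF tL(2)], of e] L2_CS[OF tL(1) L2_dot[OF wE(2)], of e]
    unfolding I_def by linarith
   also have "... <= h1_norm Om w * l2_norm E (%x. g x \<bullet> e) + l2_norm E eta * (norm e * h1_norm Om w)"
    by (intro add_mono mult_right_mono mult_left_mono n1 n2) auto
   finally show ?thesis by (simp add: algebra_simps)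
  qed
  define C where "C = l2_norm E (%x. g x \<bullet> e) + l2_norm E eta * norm e"
  have C0: "0 <= C" by (simp add: C_def)
  have "\<bar>I u\<bar> <= 0"
  proof (rule field_le_epsilon)
   fix \<epsilon> :: real assume "\<epsilon> > 0"
   hence "0 < \<epsilon> / (C + 1)" using C0 by simp
   then obtain v where v: "v : H1 Om" "continuous_on (closure Om) v" "!!x. x : gam ==> v x = 0"
     "h1_norm Om (%x. u x - v x) < \<epsilon> / (C + 1)"
    using u unfolding H1_0_def by blast
   have Iv: "I v = 0"
    unfolding I_def
    by (rule zero_extension_continuous[OF Om n r E gam H1_L2[OF v(1)] wgrad_props[OF v(1)] v(2,3) t])
   have d: "(%x. u x - v x) : H1 Om" "weak_gradient Om (%x. u x - v x) (%x. wgrad Om u x - wgrad Om v x)"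
    using H1_lincomb[OF Om uH v(1), of 1 "-1"] by simp_all
   have vE: "v : L2 E" "wgrad Om v : L2 E"
    using L2_subset[OF H1_L2[OF v(1)] E(2) Es(1,2)] L2_subset[OF wgrad_props(1)[OF v(1)] E(2) Es(1,2)] .
   have "AE x in leb Om. wgrad Om (%x. u x - v x) x = wgrad Om u x - wgrad Om v x"
    by (rule wgrad_eq_AE[OF Om H1_L2[OF d(1)] _ d(2)]) (intro L2_diff wgrad_props uH v)
   hence ae: "AE x in leb E. wgrad Om (%x. u x - v x) x \<bullet> e = wgrad Om u x \<bullet> e - wgrad Om v x \<bullet> e"
    unfolding AE_leb[OF Es(1)] AE_leb[OF Es(2)]
    by eventually_elim (use E(2) in \<open>auto simp: inner_diff_left\<close>)
   have "l2_inner E eta (%x. wgrad Om (%x. u x - v x) x \<bullet> e) = l2_inner E eta (%x. wgrad Om u x \<bullet> e - wgrad Om v x \<bullet> e)"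
    by (rule l2_inner_cong_AE[OF _ ae])
     (auto intro!: tL L2_diff L2_dot uE vE L2_subset[OF wgrad_props(1)[OF d(1)] E(2) Es(1,2)])
   hence "I (%x. u x - v x) = I u - I v"
    unfolding I_def
    by (simp add: l2_inner_diff_right[OF tL(1) L2_dot[OF uE(2)] L2_dot[OF vE(2)]]
      l2_inner_commute[of E _ "%x. g x \<bullet> e"] l2_inner_diff_right[OF L2_dot[OF tL(2)] uE(1) vE(1)])
   hence "\<bar>I u\<bar> = \<bar>I (%x. u x - v x)\<bar>" using Iv by simp
   also have "... <= C * h1_norm Om (%x. u x - v x)" unfolding C_def by (rule bound[OF d(1)])
   also have "... <= C * (\<epsilon> / (C + 1))" using v(4) C0 by (intro mult_left_mono) auto
   also have "... <= \<epsilon>" using C0 \<open>\<epsilon> > 0\<close> by (simp add: field_simps)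
   finally show "\<bar>I u\<bar> <= 0 + \<epsilon>" by simp
  qed
  hence I0: "I u = 0" by simp
  have "l2_inner (ball x0 r) (%x. if x : E then u x else 0) (%x. g x \<bullet> e) = l2_inner E u (%x. g x \<bullet> e)"
   unfolding l2_inner_def
   by (subst lint_subset[OF EB Es(1,3)]) (auto intro!: lint_cong)
  moreover have "l2_inner (ball x0 r) eta (%x. (if x : E then wgrad Om u x else 0) \<bullet> e) = l2_inner E eta (%x. wgrad Om u x \<bullet> e)"
   unfolding l2_inner_def
   by (subst lint_subset[OF EB Es(1,3)]) (auto intro!: lint_cong)
  ultimately show "l2_inner (ball x0 r) (%x. if x : E then u x else 0) (%x. g x \<bullet> e)
    = - l2_inner (ball x0 r) eta (%x. (if x : E then wgrad Om u x else 0) \<bullet> e)"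
   using I0 unfolding I_def by linarith
 qed simp
qed

section \<open>Barycentric coordinates\<close>

definition is_affine :: "('a::euclidean_space => real) => bool" where
 "is_affine f \<longleftrightarrow> (EX a b. ALL x. f x = a \<bullet> x + b)"

lemma affine_cont: "is_affine f ==> continuous_on S f"
 unfolding is_affine_def fun_eq_iff[symmetric] by (auto intro!: continuous_intros)

lemma is_affine_lincomb:
 assumes "is_affine f" "is_affine g"
 shows "is_affine (%x. c * f x + d * g x)"
proof -
 obtain a b a' b' where "!!x. f x = a \<bullet> x + b" "!!x. g x = a' \<bullet> x + b'"
  using assms unfolding is_affine_def by metis
 hence "c * f x + d * g x = (c *\<^sub>R a + d *\<^sub>R a') \<bullet> x + (c * b + d * b')" for x
  by (simp add: algebra_simps inner_add_left)
 thus ?thesis unfolding is_affine_def by blast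
qed

lemma is_affine_const: "is_affine (%x. c)"
 unfolding is_affine_def by (intro exI[of _ 0] exI[of _ c]) simp

lemma is_affine_scale: "is_affine f ==> is_affine (%x. c * f x)"
 using is_affine_lincomb[of f "%x. 0" c 0] is_affine_const[of 0] by simp

lemma is_affine_sum: "(!!i. i : I ==> is_affine (f i)) ==> is_affine (%x. SUM i:I. f i x)"
proof (induction I rule: infinite_finite_induct)
 case (insert i I)
 thus ?case using is_affine_lincomb[of "f i" "%x. SUM i:I. f i x" 1 1] by simp
qed (auto intro: is_affine_const)

lemma is_affine_combination:
 assumes "is_affine f" "finite S" "sum u S = 1"
 shows "f (SUM v:S. u v *\<^sub>R v) = (SUM v:S. u v * f v)"
proof -
 obtain a b where f: "!!x. f x = a \<bullet> x + b" using assms(1) unfolding is_affine_def by metis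
 have "(SUM v:S. u v * (a \<bullet> v + b)) = (SUM v:S. u v * (a \<bullet> v)) + b * sum u S"
  by (simp add: distrib_left sum.distrib sum_distrib_left mult.commute)
 thus ?thesis using assms(3) by (simp add: f inner_sum_right)
qed

lemma is_affine_at_convex:
 assumes "is_affine f"
 shows "f ((1 - t) *\<^sub>R x + t *\<^sub>R y) = (1 - t) * f x + t * f y"
proof -
 obtain a b where f: "!!x. f x = a \<bullet> x + b" using assms(1) unfolding is_affine_def by metis
 show ?thesis by (simp add: f inner_add_right algebra_simps)
qed

text \<open>At the two ends of the diameter in the direction of the gradient \<open>a\<close> the
  values differ by \<open>2 r |a|\<close>, and by at most 1.\<close>

lemma affine_Lipschitz_on_ball:
 assumes f: "is_affine f" and c: "0 < r" "!!x. x : cball c r ==> 0 <= f x & f x <= 1"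
 shows "\<bar>f x - f y\<bar> <= norm (x - y) / (2 * r)"
proof -
 obtain a b where f: "!!x. f x = a \<bullet> x + b" using assms(1) unfolding is_affine_def by metis
 have "norm a * (2 * r) <= 1"
 proof (cases "a = 0")
  case False
  define e where "e = (r / norm a) *\<^sub>R a"
  have ne: "norm e = r" using False c by (simp add: e_def)
  have "a \<bullet> e = r * norm a" using False by (simp add: e_def power2_norm_eq_inner[symmetric] power2_eq_square)
  moreover have "c + e : cball c r" "c - e : cball c r" using ne by (simp_all add: dist_norm)
  hence "f (c + e) <= 1" "0 <= f (c - e)" using c(2) by blast+
  ultimately show ?thesis by (simp add: f inner_simps algebra_simps)
 qed simp
 hence a: "norm a <= 1 / (2 * r)" using c(1) by (simp add: pos_le_divide_eq)
 have "\<bar>f x - f y\<bar> = \<bar>a \<bullet> (x - y)\<bar>" by (simp add: f inner_diff_right)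
 also have "... <= norm a * norm (x - y)" by (rule Cauchy_Schwarz_ineq2)
 also have "... <= 1 / (2 * r) * norm (x - y)" using a by (rule mult_right_mono) simp
 finally show ?thesis by simp
qed

section \<open>Barycentric coordinates of a full-dimensional simplex\<close>

abbreviation full_simplex :: "'a::euclidean_space set => bool" where
 "full_simplex T \<equiv> int DIM('a) simplex T"

lemma simplex_verts:
 fixes T :: "'a::euclidean_space set"
 assumes "n simplex T"
 shows "\<not> affine_dependent (verts T)" "T = convex hull (verts T)" "finite (verts T)" "int (card (verts T)) = n + 1"
proof -
 obtain C where C: "\<not> affine_dependent C" "int (card C) = n + 1" "T = convex hull C"
  using assms unfolding simplex_def by auto
 hence "verts T = C"
  by (auto simp: verts_def extreme_point_of_convex_hull_affine_independent)
 thus "\<not> affine_dependent (verts T)" "T = convex hull (verts T)" "finite (verts T)" "int (card (verts T)) = n + 1"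
  using C aff_independent_finite by auto
qed

lemma verts_subset: "verts T <= T"
 by (auto simp: verts_def extreme_point_of_def)

lemma simplex_card: "full_simplex (T::'a::euclidean_space set) ==> card (verts T) = Suc DIM('a)"
 using simplex_verts(4)[of "int DIM('a)" T] by simp

lemma full_simplex_affine_hull: "full_simplex (T::'a::euclidean_space set) ==> affine hull verts T = UNIV"
 by (intro affine_independent_span_eq simplex_card simplex_verts(1))

lemma simplex_compact: "n simplex T ==> compact T"
 using simplex_verts(2,3)[of n T] by (metis finite_imp_compact_convex_hull)

lemma simplex_convex: "n simplex T ==> convex T"
 using simplex_verts(2)[of n T] by (metis convex_convex_hull)

text \<open>Relative to \<open>v0\<close> the other vertices are linearly independent, so the
  prescribed differences extend to a linear functional, whose gradient is
  \<open>adjoint g 1\<close>.\<close>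

lemma affine_interpolation:
 fixes T :: "'a::euclidean_space set"
 assumes T: "n simplex T"
 shows "EX f. is_affine f & (ALL v:verts T. f v = \<phi> v)"
proof (cases "verts T = {}")
 case True
 thus ?thesis using is_affine_const by blast
next
 case False
 then obtain v0 where v0: "v0 : verts T" by blast
 let ?B = "(%x. - v0 + x) ` (verts T - {v0})"
 have "independent ?B"
  using simplex_verts(1)[OF T] affine_dependent_iff_dependent2[OF v0] by blast
 then obtain g where g: "linear g" "!!x. x : ?B ==> g x = \<phi> (x + v0) - \<phi> v0"
  using linear_independent_extend[of ?B "%x. \<phi> (x + v0) - \<phi> v0"] by blast
 have gv: "g (v - v0) = \<phi> v - \<phi> v0" if "v : verts T" for v
 proof (cases "v = v0")
  case True
  thus ?thesis using g(1) by (simp add: linear_0)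
 next
  case False
  hence "- v0 + v : ?B" using that by blast
  from g(2)[OF this] show ?thesis by simp
 qed
 have ga: "g x = adjoint g 1 \<bullet> x" for x
  using adjoint_works[OF g(1), of x 1] by (simp add: inner_commute)
 define f where "f x = adjoint g 1 \<bullet> x + (\<phi> v0 - adjoint g 1 \<bullet> v0)" for x
 have "is_affine f" unfolding is_affine_def f_def by blast
 moreover have "f v = \<phi> v" if "v : verts T" for v
  using gv[OF that] by (simp add: f_def ga inner_diff_right)
 ultimately show ?thesis by blast
qed

text \<open>Affine on the whole space, so that its sign also locates points outside
  \<open>T\<close>. If \<open>nu\<close> is not a vertex, all prescribed values are 0; on a full
  simplex this gives the zero function and lets sums over nodes restrict to vertices.\<close>

definition bary :: "'a::euclidean_space set => 'a => 'a => real" where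
 "bary T nu = (SOME f. is_affine f & (ALL nu':verts T. f nu' = (if nu' = nu then 1 else 0)))"

context
 fixes T :: "'a::euclidean_space set"
 assumes T: "full_simplex T"
begin

lemma bary_affine: "is_affine (bary T nu)"
 and bary_vert: "nu' : verts T ==> bary T nu nu' = (if nu' = nu then 1 else 0)"
 using someI_ex[OF affine_interpolation[OF T, of "%nu'. if nu' = nu then 1 else 0"], folded bary_def] by auto

lemma bary_of_combination:
 assumes "sum u (verts T) = 1" "nu : verts T"
 shows "bary T nu (SUM v:verts T. u v *\<^sub>R v) = u nu"
proof -
 have "bary T nu (SUM v:verts T. u v *\<^sub>R v) = (SUM v:verts T. u v * bary T nu v)"
  by (rule is_affine_combination[OF bary_affine simplex_verts(3)[OF T] assms(1)])
 also have "... = (SUM v:verts T. if v = nu then u v else 0)"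
  by (intro sum.cong) (auto simp: bary_vert)
 finally show ?thesis using assms(2) simplex_verts(3)[OF T] by (simp add: sum.delta)
qed

lemma bary_sum: "(SUM nu:verts T. bary T nu x) = 1"
 and bary_rep: "(SUM nu:verts T. bary T nu x *\<^sub>R nu) = x"
proof -
 have "x : affine hull verts T" by (simp add: full_simplex_affine_hull[OF T])
 then obtain u where u: "sum u (verts T) = 1" "(SUM v:verts T. u v *\<^sub>R v) = x"
  unfolding affine_hull_finite[OF simplex_verts(3)[OF T]] by blast
 have "bary T nu x = u nu" if "nu : verts T" for nu
  using bary_of_combination[OF u(1) that] u(2) by simp
 thus "(SUM nu:verts T. bary T nu x) = 1" "(SUM nu:verts T. bary T nu x *\<^sub>R nu) = x" using u by simp_all
qed

lemma affine_bary: "is_affine f ==> f x = (SUM nu:verts T. f nu * bary T nu x)"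
 using is_affine_combination[of f "verts T" "%nu. bary T nu x"] simplex_verts(3)[OF T] bary_sum bary_rep
 by (simp add: mult.commute)

lemma affine_eqI: "is_affine f ==> is_affine g ==> (!!nu. nu : verts T ==> f nu = g nu) ==> f x = g x"
 using affine_bary[of f x] affine_bary[of g x] by simp

lemma bary_non_vert: "nu ~: verts T ==> bary T nu x = 0"
 by (rule affine_eqI[OF bary_affine is_affine_const]) (auto simp: bary_vert)

lemma mem_simplex_iff: "x : T \<longleftrightarrow> (ALL nu:verts T. 0 <= bary T nu x)"
proof
 assume "x : T"
 hence "x : convex hull verts T" using simplex_verts(2)[OF T] by simp
 then obtain u where u: "ALL x:verts T. 0 <= u x" "sum u (verts T) = 1" "(SUM v:verts T. u v *\<^sub>R v) = x"
  unfolding convex_hull_finite[OF simplex_verts(3)[OF T]] by blast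
 thus "ALL nu:verts T. 0 <= bary T nu x" using bary_of_combination[OF u(2)] by auto
next
 assume "ALL nu:verts T. 0 <= bary T nu x"
 hence "x : convex hull verts T"
  unfolding convex_hull_finite[OF simplex_verts(3)[OF T]] using bary_sum[of x] bary_rep[of x]
  by (intro CollectI exI[of _ "%nu. bary T nu x"]) auto
 thus "x : T" using simplex_verts(2)[OF T] by simp
qed

lemma mem_interior_simplex_iff: "x : interior T \<longleftrightarrow> (ALL nu:verts T. 0 < bary T nu x)"
proof -
 have "interior (convex hull verts T) = {y. EX u. (ALL x:verts T. 0 < u x) & sum u (verts T) = 1 & (SUM x:verts T. u x *\<^sub>R x) = y}"
  using interior_convex_hull_explicit_minimal[OF simplex_verts(1)[OF T]] simplex_card[OF T] by simp
 hence i: "interior T = {y. EX u. (ALL x:verts T. 0 < u x) & sum u (verts T) = 1 & (SUM x:verts T. u x *\<^sub>R x) = y}"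
  using simplex_verts(2)[OF T] by simp
 show ?thesis
 proof
  assume "x : interior T"
  then obtain u where u: "ALL x:verts T. 0 < u x" "sum u (verts T) = 1" "(SUM v:verts T. u v *\<^sub>R v) = x"
   unfolding i by blast
  thus "ALL nu:verts T. 0 < bary T nu x" using bary_of_combination[OF u(2)] by auto
 next
  assume "ALL nu:verts T. 0 < bary T nu x"
  thus "x : interior T" unfolding i using bary_sum[of x] bary_rep[of x]
   by (intro CollectI exI[of _ "%nu. bary T nu x"]) auto
 qed
qed

lemma bary_le_1: "x : T ==> bary T nu x <= 1" and bary_nonneg: "x : T ==> 0 <= bary T nu x"
proof -
 assume x: "x : T"
 show 0: "0 <= bary T nu x" using x mem_simplex_iff by (cases "nu : verts T") (auto simp: bary_non_vert)
 show "bary T nu x <= 1"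
 proof (cases "nu : verts T")
  case True
  hence "bary T nu x <= (SUM nu:verts T. bary T nu x)"
   using x mem_simplex_iff simplex_verts(3)[OF T] by (intro member_le_sum) auto
  thus ?thesis by (simp add: bary_sum)
 qed (simp add: bary_non_vert)
qed

lemma bary_Lipschitz:
 assumes "0 < r" "cball c r <= T"
 shows "\<bar>bary T nu x - bary T nu y\<bar> <= norm (x - y) / (2 * r)"
 using assms bary_le_1 bary_nonneg by (intro affine_Lipschitz_on_ball[OF bary_affine, of r c]) auto

lemma interior_nonempty: "interior T ~= {}"
proof -
 let ?x = "SUM v:verts T. (1 / real (card (verts T))) *\<^sub>R v"
 have "(SUM v:verts T. 1 / real (card (verts T))) = 1" using simplex_card[OF T] by simp
 from bary_of_combination[OF this] have "?x : interior T"
  unfolding mem_interior_simplex_iff using simplex_card[OF T] by auto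
 thus ?thesis by blast
qed

lemma simplex_closure_interior: "closure (interior T) = T"
 using convex_closure_interior[OF simplex_convex[OF T] interior_nonempty]
  compact_imp_closed[OF simplex_compact[OF T]] by (simp add: closure_closed)

lemma simplex_boundary_null: "AE x in lebesgue. x : T --> x : interior T"
proof -
 have "negligible (frontier T)" by (rule negligible_convex_frontier[OF simplex_convex[OF T]])
 hence "frontier T : null_sets lebesgue" by (simp add: negligible_iff_null_sets)
 thus ?thesis
  by (rule AE_I'[rotated 0]) (use closure_subset in \<open>auto simp: frontier_def\<close>)
qed

lemma simplex_meas: "T : lmeasurable" "interior T : lmeasurable" "T : sets borel"
 using simplex_compact[OF T] compact_imp_bounded[OF simplex_compact[OF T]]
 by (auto simp: lmeasurable_compact lmeasurable_interior borel_compact)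

lemma vol_interior: "vol (interior T) = vol T"
 using negligible_convex_frontier[OF simplex_convex[OF T]] compact_imp_bounded[OF simplex_compact[OF T]]
 by (simp only: measure_interior)

lemma vol_pos: "0 < vol T"
proof -
 obtain c r where "r > 0" "ball c r <= T" using interior_nonempty mem_interior by blast
 hence "vol (ball c r) <= vol T"
  using simplex_meas by (intro measure_mono_fmeasurable) auto
 moreover have "0 < vol (ball c r)" using \<open>r > 0\<close> by (simp add: content_ball unit_ball_vol_pos)
 ultimately show ?thesis by linarith
qed

lemma face_verts:
 assumes "E face_of T"
 shows "verts E = verts T Int E" "E = convex hull verts E"
proof -
 show "verts E = verts T Int E" using extreme_point_of_face[OF assms] by (auto simp: verts_def)
 have "compact E" using face_of_imp_compact assms simplex_compact[OF T] simplex_convex[OF T] by blast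
 thus "E = convex hull verts E"
  using Krein_Milman_Minkowski[OF _ face_of_imp_convex[OF assms]] by (simp add: verts_def)
qed

lemma affine_eq_on_face:
 assumes "E face_of T" "is_affine f" "is_affine g" "!!nu. nu : verts E ==> f nu = g nu" "x : E"
 shows "f x = g x"
proof -
 have fin: "finite (verts E)" using face_verts(1)[OF assms(1)] simplex_verts(3)[OF T] by simp
 have "x : convex hull verts E" using face_verts(2)[OF assms(1)] assms(5) by simp
 then obtain u where u: "sum u (verts E) = 1" "(SUM v:verts E. u v *\<^sub>R v) = x"
  unfolding convex_hull_finite[OF fin] by blast
 show ?thesis
  using is_affine_combination[OF assms(2) fin u(1)] is_affine_combination[OF assms(3) fin u(1)] u(2) assms(4) by simp
qed

lemma facet_opposite_vertex:
 assumes "F facet_of T"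
 obtains a where "a : verts T" "verts F = verts T - {a}" "F = {x : T. bary T a x = 0}"
proof -
 have "F facet_of (convex hull verts T)" using assms simplex_verts(2)[OF T] by simp
 then obtain a where a: "a : verts T" "F = convex hull (verts T - {a})"
  unfolding facet_of_convex_hull_affine_independent[OF simplex_verts(1)[OF T]] by blast
 have vF: "verts F = verts T - {a}"
 proof -
  have "\<not> affine_dependent (verts T - {a})" using simplex_verts(1)[OF T] affine_independent_Diff by blast
  thus ?thesis unfolding a(2) by (auto simp: verts_def extreme_point_of_convex_hull_affine_independent)
 qed
 have Ff: "F face_of T" using assms by (simp add: facet_of_def)
 have "F = {x : T. bary T a x = 0}"
 proof
  show "F <= {x : T. bary T a x = 0}"
  proof
   fix x assume x: "x : F"
   have "bary T a x = 0"
    by (rule affine_eq_on_face[OF Ff bary_affine is_affine_const _ x]) (auto simp: vF bary_vert)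
   thus "x : {x : T. bary T a x = 0}" using x face_of_imp_subset[OF Ff] by auto
  qed
  show "{x : T. bary T a x = 0} <= F"
  proof clarify
   fix x assume x: "x : T" "bary T a x = 0"
   have fin: "finite (verts T - {a})" using simplex_verts(3)[OF T] by simp
   have "(SUM nu:verts T - {a}. bary T nu x) = 1" "(SUM nu:verts T - {a}. bary T nu x *\<^sub>R nu) = x"
    using bary_sum[of x] bary_rep[of x] x(2) simplex_verts(3)[OF T] a(1) by (simp_all add: sum_diff1)
   moreover have "ALL nu:verts T - {a}. 0 <= bary T nu x" using x mem_simplex_iff by auto
   ultimately show "x : F" unfolding a(2) convex_hull_finite[OF fin]
    by (intro CollectI exI[of _ "%nu. bary T nu x"]) auto
  qed
 qed
 with a(1) vF show thesis by (rule that)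
qed

text \<open>Puts a coordinate into the form in which the lemmas about hyperplanes are
  stated.\<close>

lemma bary_form:
 assumes "a : verts T" "bary T a x0 = 0"
 obtains n where "n ~= 0" "!!x. bary T a x = n \<bullet> (x - x0)"
proof -
 obtain n b where n: "!!x. bary T a x = n \<bullet> x + b" using bary_affine unfolding is_affine_def by metis
 have 1: "bary T a x = n \<bullet> (x - x0)" for x using n[of x] n[of x0] assms(2) by (simp add: inner_diff_right)
 moreover have "n ~= 0" using 1[of a] bary_vert[OF assms(1), of a] by auto
 ultimately show thesis using that by blast
qed

text \<open>Around a point of a facet whose coordinates with respect to the vertices of the facet are at
 least \<open>m\<close>, a ball of radius \<open>2 r m\<close> sees only that facet of the simplex.\<close>

lemma facet_ball:
 assumes r: "0 < r" "cball c r <= T" and a: "a : verts T"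
  and x0: "!!nu. nu : verts T - {a} ==> m <= bary T nu x0" and x: "x : ball x0 (2 * r * m)"
 shows "0 < bary T a x ==> x : interior T" "0 <= bary T a x ==> x : T"
proof -
 have pos: "0 < bary T nu x" if "nu : verts T - {a}" for nu
 proof -
  have "\<bar>bary T nu x0 - bary T nu x\<bar> <= norm (x0 - x) / (2 * r)" by (rule bary_Lipschitz[OF r])
  also have "... < m" using x r(1) by (simp add: dist_norm pos_divide_less_eq mult.commute)
  finally show ?thesis using x0[OF that] by linarith
 qed
 thus "0 < bary T a x ==> x : interior T" "0 <= bary T a x ==> x : T"
  unfolding mem_interior_simplex_iff mem_simplex_iff by (metis DiffI less_imp_le singletonD)+
qed

end


section \<open>Conforming meshes\<close>

text \<open>Stated for arbitrary cells because it serves both the mesh and its second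
  refinement.\<close>

lemma integral_cells:
 fixes f :: "'a::euclidean_space => real"
 assumes f: "integrable (leb D) f" and D: "D : sets lebesgue" and fin: "finite \<C>"
  and sub: "!!T. T : \<C> ==> interior T <= D"
  and disj: "!!T T'. T : \<C> ==> T' : \<C> ==> T ~= T' ==> interior T Int interior T' = {}"
  and cov: "AE x in lebesgue. x : D --> (EX T:\<C>. x : interior T)"
 shows "lint D f = (SUM T:\<C>. lint (interior T) f)"
proof -
 have s: "interior T : sets lebesgue" for T :: "'a set" by (simp add: sets_completionI_sets)
 have fT: "integrable (leb D) (%x. if x : interior T then f x else 0)" if "T : \<C>" for T
 proof -
  have "integrable (leb D) (%x. indicator (interior T) x *\<^sub>R f x)"
   by (rule integrable_mult_indicator[OF _ f]) (use s D sub[OF that] in \<open>simp add: sets_restrict_space_iff\<close>)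
  also have "(%x. indicator (interior T) x *\<^sub>R f x) = (%x. if x : interior T then f x else 0)"
   by (auto simp: indicator_def)
  finally show ?thesis .
 qed
 have "lint D f = lint D (%x. SUM T:\<C>. if x : interior T then f x else 0)"
 proof (rule integral_cong_AE)
  show "f : borel_measurable (leb D)" "(%x. SUM T:\<C>. if x : interior T then f x else 0) : borel_measurable (leb D)"
   using f fT by (auto intro!: borel_measurable_sum borel_measurable_integrable)
  show "AE x in leb D. f x = (SUM T:\<C>. if x : interior T then f x else 0)"
   unfolding AE_leb[OF D] using cov
  proof eventually_elim
   case (elim x)
   show ?case
   proof
    assume "x : D"
    then obtain T where T: "T : \<C>" "x : interior T" using elim by blast
    have "(if x : interior T' then f x else 0) = (if T' = T then f x else 0)" if "T' : \<C>" for T'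
     using disj[OF T(1) that] T(2) by auto
    thus "f x = (SUM T:\<C>. if x : interior T then f x else 0)" using T fin by (simp add: sum.delta)
   qed
  qed
 qed
 also have "... = (SUM T:\<C>. lint D (%x. if x : interior T then f x else 0))"
  by (rule Bochner_Integration.integral_sum) (rule fT)
 also have "... = (SUM T:\<C>. lint (interior T) f)"
  by (intro sum.cong refl integral_restrict sub s D)
 finally show ?thesis .
qed

section \<open>Conforming meshes and their hat functions\<close>

locale mesh =
 fixes Om :: "'a::euclidean_space set" and \<T> :: "'a set set"
 assumes dom: "polytopal_domain Om" and part: "conforming_partition Om \<T>"
begin

lemma domain_open: "open Om" and domain_bounded: "bounded Om" and domain_regular: "interior (closure Om) = Om"
 using dom by (auto simp: polytopal_domain_def)

lemma fin: "finite \<T>" and simplex: "T : \<T> ==> full_simplex T" and cover: "\<Union>\<T> = closure Om"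
 and conform: "T : \<T> ==> T' : \<T> ==> T Int T' face_of T"
 using part by (auto simp: conforming_partition_def triangulation_def)

lemma conform': "T : \<T> ==> T' : \<T> ==> T Int T' face_of T'"
 using conform[of T' T] by (simp add: Int_commute)

lemma simplex_subset: "T : \<T> ==> T <= closure Om"
 using cover by blast

lemma cell_subset: "T : \<T> ==> interior T <= Om"
 using interior_mono[OF simplex_subset] domain_regular by blast

lemma dom_meas: "Om : lmeasurable"
 using domain_open domain_bounded by (simp add: lmeasurable_open)

lemma cell_sets: "T : \<T> ==> interior T : sets lebesgue" "Om : sets lebesgue"
 using dom_meas by (auto simp: fmeasurableD sets_completionI_sets)

lemma neq_not_subset:
 assumes "T : \<T>" "T' : \<T>" "T ~= T'"
 shows "T Int T' ~= T"
proof
 assume "T Int T' = T"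
 hence "T face_of T'" using conform'[OF assms(1,2)] by simp
 hence "aff_dim T < aff_dim T'"
  using face_of_aff_dim_lt simplex_convex[OF simplex[OF assms(2)]] assms(3) by blast
 thus False using aff_dim_simplex[OF simplex[OF assms(1)]] aff_dim_simplex[OF simplex[OF assms(2)]] by simp
qed

text \<open>The intersection is a proper face of \<open>T\<close>, hence disjoint from the interior
  of \<open>T\<close>. So the interior of one simplex misses the other one including its boundary,
  which makes the location of an interior point unambiguous.\<close>

lemma interior_disjoint:
 assumes "T : \<T>" "T' : \<T>" "T ~= T'"
 shows "interior T Int T' = {}"
 using face_of_disjoint_interior[OF conform[OF assms(1,2)] neq_not_subset[OF assms]] interior_subset[of T] by blast

lemma AE_interior: "AE x in lebesgue. x : closure Om --> (EX T:\<T>. x : interior T)"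
proof -
 have "AE x in lebesgue. ALL T:\<T>. x : T --> x : interior T"
  using fin simplex_boundary_null[OF simplex] by (intro AE_finite_allI)
 thus ?thesis by eventually_elim (use cover in blast)
qed

lemma integral_mesh_sum:
 fixes f :: "'a => real"
 assumes f: "integrable (leb Om) f"
 shows "lint Om f = (SUM T:\<T>. lint (interior T) f)"
proof (rule integral_cells[OF f cell_sets(2) fin cell_subset])
 show "interior T Int interior T' = {}" if "T : \<T>" "T' : \<T>" "T ~= T'" for T T'
  using interior_disjoint[OF that] interior_subset by blast
 show "AE x in lebesgue. x : Om --> (EX T:\<T>. x : interior T)"
  using AE_interior by eventually_elim (use closure_subset in blast)
qed

lemma L2_interior: "f : L2 Om ==> T : \<T> ==> f : L2 (interior T)"
 using L2_subset cell_subset cell_sets by blast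

lemma l2_norm_sq_mesh:
 fixes f :: "'a => 'b::euclidean_space"
 assumes "f : L2 Om"
 shows "(l2_norm Om f)^2 = (SUM T:\<T>. (cnorm T f)^2)"
 unfolding l2_norm_sq by (rule integral_mesh_sum[OF L2_sq_int[OF assms]])

lemma l2_inner_mesh:
 assumes "f : L2 Om" "g : L2 Om"
 shows "l2_inner Om f g = (SUM T:\<T>. l2_inner (interior T) f g)"
 unfolding l2_inner_def by (rule integral_mesh_sum[OF L2_mult_int[OF assms]])

lemma finite_nodes: "finite (nodes \<T>)"
 unfolding nodes_def using fin simplex_verts(3)[OF simplex] by blast

text \<open>There are no hanging nodes: the node is a vertex of the common face of two simplices,
  and the vertices of a face are vertices of both.\<close>

lemma node_vert:
 assumes "nu : nodes \<T>" "T : \<T>" "nu : T"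
 shows "nu : verts T"
proof -
 obtain T' where T': "T' : \<T>" "nu : verts T'" using assms(1) by (auto simp: nodes_def)
 have "nu : verts (T' Int T)"
  using face_verts(1)[OF simplex[OF T'(1)] conform[OF T'(1) assms(2)]] T'(2) assms(3) verts_subset by blast
 thus ?thesis using face_verts(1)[OF simplex[OF assms(2)] conform'[OF T'(1) assms(2)]] by simp
qed

lemma vert_node: "T : \<T> ==> nu : verts T ==> nu : nodes \<T>"
 by (auto simp: nodes_def)

text \<open>On the common face both sides are affine, and they agree at its vertices. This includes
  a \<open>nu\<close> that is a vertex of only one of the two simplices, where both sides are 0 on
  the face.\<close>

lemma bary_consistent:
 assumes "T : \<T>" "T' : \<T>" "x : T" "x : T'"
 shows "bary T nu x = bary T' nu x"
proof -
 show ?thesis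
 proof (rule affine_eq_on_face[OF simplex[OF assms(1)] conform[OF assms(1,2)]
    bary_affine[OF simplex[OF assms(1)]] bary_affine[OF simplex[OF assms(2)]]])
  fix nu' assume v: "nu' : verts (T Int T')"
  have "nu' : verts T" "nu' : verts T'"
   using v face_verts(1)[OF simplex[OF assms(1)] conform[OF assms(1,2)]]
    face_verts(1)[OF simplex[OF assms(2)] conform'[OF assms(1,2)]] by blast+
  thus "bary T nu nu' = bary T' nu nu'"
   using bary_vert[OF simplex[OF assms(1)]] bary_vert[OF simplex[OF assms(2)]] by simp
 qed (use assms in simp)
qed

text \<open>\<open>hat\<close> is a definite description. The candidate evaluates
  \<open>bary\<close> in some simplex containing the point, which is unambiguous by
  \<open>bary_consistent\<close>; uniqueness holds because an affine function is determined by its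
  values at the vertices.\<close>

lemma hat_eq_bary: "T : \<T> ==> x : T ==> hat \<T> nu x = bary T nu x"
 and hat_outside: "y ~: closure Om ==> hat \<T> nu y = 0"
proof -
 let ?P = "%f. (ALL T:\<T>. EX a b. ALL x:T. f x = a \<bullet> x + b) & (ALL nu':nodes \<T>. f nu' = (if nu' = nu then 1 else 0)) &
   (ALL x. x ~: \<Union>\<T> --> f x = 0)"
 define f where "f x = (if x : \<Union>\<T> then bary (SOME T. T : \<T> & x : T) nu x else 0)" for x
 have fT: "f x = bary T nu x" if "T : \<T>" "x : T" for T x
 proof -
  have s: "(SOME T. T : \<T> & x : T) : \<T> & x : (SOME T. T : \<T> & x : T)"
   by (rule someI[of "%T. T : \<T> & x : T" T]) (use that in blast)
  have "f x = bary (SOME T. T : \<T> & x : T) nu x" using that by (auto simp: f_def)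
  also have "... = bary T nu x" by (rule bary_consistent) (use s that in auto)
  finally show ?thesis .
 qed
 have Pf: "?P f"
 proof (intro conjI ballI allI impI)
  fix T assume T: "T : \<T>"
  show "EX a b. ALL x:T. f x = a \<bullet> x + b"
   using bary_affine[OF simplex[OF T], of nu] fT[OF T] unfolding is_affine_def by auto
 next
  fix nu' assume "nu' : nodes \<T>"
  then obtain T where T: "T : \<T>" "nu' : verts T" by (auto simp: nodes_def)
  thus "f nu' = (if nu' = nu then 1 else 0)"
   using fT[OF T(1)] bary_vert[OF simplex[OF T(1)] T(2)] verts_subset[of T] by auto
 qed (auto simp: f_def)
 have uniq: "g = f" if P: "?P g" for g
 proof
  fix x
  from P have g1: "ALL T:\<T>. EX a b. ALL x:T. g x = a \<bullet> x + b" by (rule conjunct1)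
  from P have g2: "ALL nu':nodes \<T>. g nu' = (if nu' = nu then 1 else 0)" by (rule conjunct1[OF conjunct2])
  from P have g3: "ALL x. x ~: \<Union>\<T> --> g x = 0" by (rule conjunct2[OF conjunct2])
  show "g x = f x"
  proof (cases "x : \<Union>\<T>")
   case True
   then obtain T where T: "T : \<T>" "x : T" by blast
   from bspec[OF g1 T(1)] obtain a b where ab: "!!x. x : T ==> g x = a \<bullet> x + b" by auto
   have "a \<bullet> x + b = bary T nu x"
   proof (rule affine_eqI[OF simplex[OF T(1)] _ bary_affine[OF simplex[OF T(1)]]])
    show "is_affine (%x. a \<bullet> x + b)" unfolding is_affine_def by blast
    fix nu' assume v: "nu' : verts T"
    have "g nu' = (if nu' = nu then 1 else 0)" by (rule bspec[OF g2 vert_node[OF T(1) v]])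
    thus "a \<bullet> nu' + b = bary T nu nu'"
     using ab[of nu'] v verts_subset[of T] bary_vert[OF simplex[OF T(1)] v] by auto
   qed
   thus ?thesis using ab[OF T(2)] fT[OF T] by simp
  next
   case False
   thus ?thesis using g3 by (simp add: f_def)
  qed
 qed
 have "hat \<T> nu = f" unfolding hat_def
 proof (rule the_equality)
  show "?P f" by (rule Pf)
  show "!!g. ?P g ==> g = f" by (rule uniq)
 qed
 thus "T : \<T> ==> x : T ==> hat \<T> nu x = bary T nu x" "y ~: closure Om ==> hat \<T> nu y = 0"
  using fT[of T x] by (auto simp: f_def cover)
qed

end

section \<open>Facet connectivity of vertex stars\<close>

text \<open>Otherwise the union of the sets with the value \<open>f T\<close> and the union of the
  remaining ones would be closed sets that separate \<open>S\<close>.\<close>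

lemma connected_cover_const:
 assumes S: "connected S" "S <= \<Union>\<T>" and fin: "finite \<T>" and cl: "!!T. T : \<T> ==> closed T"
  and eq: "!!T T'. T : \<T> ==> T' : \<T> ==> T Int T' Int S ~= {} ==> f T = f T'"
  and T: "T : \<T>" "T Int S ~= {}" and T': "T' : \<T>" "T' Int S ~= {}"
 shows "f T = f T'"
proof (rule ccontr)
 assume neq: "f T ~= f T'"
 let ?A = "\<Union>{U\<in>\<T>. f U = f T}" and ?B = "\<Union>{U\<in>\<T>. f U ~= f T}"
 have "closed ?A" "closed ?B" using fin cl by (auto intro!: closed_Union)
 moreover have "S <= ?A \<union> ?B" using S(2) by blast
 moreover have "?A Int ?B Int S = {}"
 proof (rule ccontr)
  assume "?A Int ?B Int S ~= {}"
  then obtain x U U' where "x : S" "x : U" "x : U'" "U : \<T>" "U' : \<T>" "f U = f T" "f U' ~= f T" by blast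
  thus False using eq[of U U'] by auto
 qed
 moreover have "?A Int S ~= {}" using T by blast
 moreover have "?B Int S ~= {}" using T' neq by force
 ultimately show False using S(1) unfolding connected_closed by blast
qed

lemma negligible_low_aff_dim:
 fixes S :: "'a::euclidean_space set"
 assumes "aff_dim S < int DIM('a)"
 shows "negligible S"
 using aff_lowdim_subset_hyperplane[OF assms] negligible_hyperplane negligible_subset by metis

text \<open>In a finite relation a chain needs at most \<open>card R\<close> steps, so iterating the
  step inequality costs factors that depend on \<open>K\<close> and \<open>M\<close> only, not on
  the chain.\<close>

lemma rtrancl_bound:
 fixes F :: "'b => real"
 assumes "(x, y) : R\<^sup>*" "finite R" "card R <= M" "1 <= K" "0 <= e" "!!z. 0 <= F z"
  and step: "!!a b. (a, b) : R ==> F b <= K * F a + e"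
 shows "F y <= K ^ M * (F x + real M * e)"
proof -
 obtain n where n: "n <= card R" "(x, y) : R ^^ n"
  using rtrancl_finite_eq_relpow[OF assms(2)] assms(1) by auto
 have "F y <= K ^ n * (F x + real n * e)" using n(2)
 proof (induction n arbitrary: y)
  case (Suc n)
  then obtain z where z: "(x, z) : R ^^ n" "(z, y) : R" by auto
  have "F y <= K * F z + e" by (rule step[OF z(2)])
  also have "... <= K * (K ^ n * (F x + real n * e)) + K ^ Suc n * e"
  proof (rule add_mono)
   show "K * F z <= K * (K ^ n * (F x + real n * e))" using Suc.IH[OF z(1)] assms(4) by (intro mult_left_mono) auto
   show "e <= K ^ Suc n * e" using one_le_power[OF assms(4), of "Suc n"] assms(5) by (simp add: mult_le_cancel_right1)
  qed
  also have "... = K ^ Suc n * (F x + real (Suc n) * e)" by (simp add: algebra_simps)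
  finally show ?case .
 qed simp
 also have "... <= K ^ M * (F x + real M * e)"
  using n(1) assms by (intro mult_mono power_increasing add_left_mono mult_right_mono) auto
 finally show ?thesis .
qed

context mesh
begin

definition adj :: "'a set => 'a set => bool" where
 "adj T T' \<longleftrightarrow> T : \<T> & T' : \<T> & T ~= T' & T Int T' facet_of T"

lemma adj_sym: "adj T T' ==> adj T' T"
 unfolding adj_def facet_of_def
 using conform' aff_dim_simplex[OF simplex] by (auto simp: Int_commute)

definition star :: "'a => 'a set set" where
 "star nu = {T : \<T>. nu : T}"

definition adj_rel :: "'a => ('a set \<times> 'a set) set" where
 "adj_rel nu = {(T, T'). adj T T' & T : star nu & T' : star nu}"

lemma finite_star: "finite (star nu)"
 unfolding star_def using fin by simp

lemma simplex_closed: "T : \<T> ==> closed T"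
 using simplex_compact[OF simplex] compact_imp_closed by blast

text \<open>The endpoint can be chosen off the finitely many hyperplanes spanned by the starting point and
 the faces of codimension at least two.\<close>

lemma generic_segment:
 assumes z: "0 < e" "T : \<T>" "T' : \<T>" "z : T" "z : T'"
 obtains a b where "a : interior T" "b : interior T'" "a : ball z e" "b : ball z e"
  "!!T1 T2. T1 : \<T> ==> T2 : \<T> ==> T1 ~= T2 ==> T1 Int T2 Int closed_segment a b ~= {} ==> adj T1 T2"
proof -
 have ex: "ball z e Int interior T ~= {}" if "T : \<T>" "z : T" for T
 proof -
  have "z : closure (interior T)" using simplex_closure_interior[OF simplex[OF that(1)]] that(2) by simp
  hence "ball z e Int closure (interior T) ~= {}" using z(1) centre_in_ball by blast
  thus ?thesis using open_Int_closure_eq_empty[of "ball z e" "interior T"] by simp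
 qed
 obtain a where a: "a : ball z e" "a : interior T" using ex[OF z(2,4)] by blast
 define P where "P = {(T1, T2). T1 : \<T> & T2 : \<T> & aff_dim (T1 Int T2) <= int DIM('a) - 2}"
 define N where "N = (\<Union>(T1, T2)\<in>P. affine hull (insert a (T1 Int T2)))"
 have finP: "finite P"
  by (rule finite_subset[of _ "\<T> \<times> \<T>"]) (use fin in \<open>auto simp: P_def\<close>)
 have "negligible N"
  unfolding N_def
 proof (intro negligible_Union finite_imageI finP, clarify)
  fix T1 T2 assume "(T1, T2) : P"
  hence "aff_dim (T1 Int T2) <= int DIM('a) - 2" by (simp add: P_def)
  \<comment> \<open>One further point raises the dimension by at most one, so codimension two leaves
    a null set.\<close>
  hence "aff_dim (affine hull (insert a (T1 Int T2))) < int DIM('a)"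
   using aff_dim_insert[of a "T1 Int T2"] by (auto split: if_splits)
  thus "negligible (affine hull (insert a (T1 Int T2)))" by (rule negligible_low_aff_dim)
 qed
 moreover have "\<not> negligible (ball z e Int interior T')"
  using ex[OF z(3,5)] by (intro open_not_negligible) auto
 ultimately have "\<not> (ball z e Int interior T' <= N)" using negligible_subset by blast
 then obtain b where b: "b : ball z e" "b : interior T'" "b ~: N" by blast
 show thesis
 proof (rule that[OF a(2) b(2) a(1) b(1)])
  fix T1 T2 assume T: "T1 : \<T>" "T2 : \<T>" "T1 ~= T2" "T1 Int T2 Int closed_segment a b ~= {}"
  then obtain y where y: "y : T1 Int T2" "y : closed_segment a b" by blast
  have proper: "T1 Int T2 ~= T1" by (rule neq_not_subset[OF T(1-3)])
  have lt: "aff_dim (T1 Int T2) < int DIM('a)"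
   using face_of_aff_dim_lt[OF simplex_convex[OF simplex[OF T(1)]] conform[OF T(1,2)] proper]
    aff_dim_simplex[OF simplex[OF T(1)]] by simp
  have "y ~= a"
  proof
   assume "y = a"
   hence "T1 = T" "T2 = T"
    using y(1) a(2) interior_disjoint[OF z(2) T(1)] interior_disjoint[OF z(2) T(2)] by blast+
   thus False using T(3) by simp
  qed
  obtain t where t: "0 <= t" "t <= 1" "y = (1 - t) *\<^sub>R a + t *\<^sub>R b" using y(2) by (auto simp: in_segment)
  have t0: "t ~= 0" using \<open>y ~= a\<close> t(3) by auto
  \<comment> \<open>\<open>b\<close> is on the line through \<open>a\<close> and the intersection
    point \<open>y\<close>; for a common face of codimension two or more, \<open>b\<close> would lie
    in the excluded set \<open>N\<close>.\<close>
  have "b = (1 - 1 / t) *\<^sub>R a + (1 / t) *\<^sub>R y"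
   using t0 unfolding t(3) by (simp add: algebra_simps divide_inverse)
  moreover have "(1 - 1 / t) *\<^sub>R a + (1 / t) *\<^sub>R y : affine hull (insert a (T1 Int T2))"
   by (rule mem_affine[OF affine_affine_hull]) (use y(1) in \<open>auto intro: hull_inc\<close>)
  ultimately have "b : affine hull (insert a (T1 Int T2))" by simp
  hence "(T1, T2) ~: P" using b(3) unfolding N_def by blast
  hence "aff_dim (T1 Int T2) = int DIM('a) - 1" using lt T(1,2) by (simp add: P_def)
  hence "T1 Int T2 facet_of T1"
   unfolding facet_of_def using conform[OF T(1,2)] y(1) aff_dim_simplex[OF simplex[OF T(1)]] by auto
  thus "adj T1 T2" using T by (simp add: adj_def)
 qed
qed

text \<open>The clause on frontier points in \<open>polytopal_domain\<close> enters here: a boundary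
  point has arbitrarily small neighbourhoods that meet the domain in a connected set. Smallness
  excludes the simplices that do not contain \<open>nu\<close>.\<close>

lemma star_neighbourhood:
 assumes "nu : closure Om"
 obtains V where "open V" "nu : V" "connected (V Int Om)" "!!T. T : \<T> ==> T Int V ~= {} ==> nu : T"
proof -
 have "closed (\<Union>{T\<in>\<T>. nu ~: T})" using fin simplex_closed by (auto intro!: closed_Union)
 hence "open (- \<Union>{T\<in>\<T>. nu ~: T})" by (rule open_Compl)
 moreover have "nu : - \<Union>{T\<in>\<T>. nu ~: T}" by blast
 ultimately obtain e where e: "0 < e" "ball nu e <= - \<Union>{T\<in>\<T>. nu ~: T}"
  using open_contains_ball by meson
 have far: "nu : T" if "T : \<T>" "T Int V ~= {}" "V <= ball nu e" for T V
  using that e(2) by blast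
 show thesis
 proof (cases "nu : Om")
  case True
  then obtain e' where e': "0 < e'" "ball nu e' <= Om" using domain_open open_contains_ball by meson
  show thesis
  proof (rule that[of "ball nu (min e e')"])
   have "ball nu (min e e') Int Om = ball nu (min e e')" using e'(2) by auto
   thus "connected (ball nu (min e e') Int Om)" by simp
   show "nu : T" if "T : \<T>" "T Int ball nu (min e e') ~= {}" for T
    by (rule far[OF that]) auto
  qed (use e e' in auto)
 next
  case False
  hence "nu : frontier Om" using assms domain_open by (simp add: frontier_def interior_open)
  then obtain V where "open V" "nu : V" "V <= ball nu e" "connected (V Int Om)"
   using dom e(1) unfolding polytopal_domain_def by blast
  thus thesis using that[of V] far by blast
 qed
qed

text \<open>\<open>f T\<close> is the class of \<open>T\<close> under facet steps. Simplices that
  share a point of \<open>V Int Om\<close> have the same class: a generic segment in a small ball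
  around that point leads from one to the other and changes simplices only across facets.
  Connectedness of \<open>V Int Om\<close> then makes the class constant on the star. Both passages
  use \<open>connected_cover_const\<close>.\<close>

lemma star_connected:
 assumes T: "T : star nu" "T' : star nu"
 shows "(T, T') : (adj_rel nu)\<^sup>*"
proof -
 let ?R = "adj_rel nu"
 define f where "f T = ?R\<^sup>* `` {T}" for T
 have symR: "sym ?R" unfolding sym_def adj_rel_def using adj_sym by blast
 have f_adj: "f T1 = f T2" if "(T1, T2) : ?R" for T1 T2
 proof -
  have "(T2, T1) : ?R" using that symR by (meson symD)
  thus ?thesis
   unfolding f_def using that by (auto intro: converse_rtrancl_into_rtrancl)
 qed
 have "nu : closure Om" using T cover by (auto simp: star_def)
 then obtain V where V: "open V" "nu : V" "connected (V Int Om)" "!!T. T : \<T> ==> T Int V ~= {} ==> nu : T"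
  using star_neighbourhood by metis
 have meets: "T Int (V Int Om) ~= {}" if "T : star nu" for T
 proof -
  have TT: "T : \<T>" "nu : T" using that by (auto simp: star_def)
  hence "nu : closure (interior T)" using simplex_closure_interior[OF simplex] by simp
  hence "V Int interior T ~= {}" using open_Int_closure_eq_empty[OF V(1), of "interior T"] V(2) by auto
  thus ?thesis using cell_subset[OF TT(1)] interior_subset by blast
 qed
 have "f T = f T'"
 proof (rule connected_cover_const[OF V(3) _ fin simplex_closed _ _ meets[OF T(1)] _ meets[OF T(2)]])
  show "V Int Om <= \<Union>\<T>" using cover closure_subset by blast
  fix T1 T2 assume T12: "T1 : \<T>" "T2 : \<T>" "T1 Int T2 Int (V Int Om) ~= {}"
  then obtain z where z: "z : T1" "z : T2" "z : V Int Om" by blast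
  have "open (V Int Om)" using V(1) domain_open by blast
  then obtain e where e: "0 < e" "ball z e <= V Int Om" using z(3) open_contains_ball by meson
  obtain a b where ab: "a : interior T1" "b : interior T2" "a : ball z e" "b : ball z e"
   "!!T1 T2. T1 : \<T> ==> T2 : \<T> ==> T1 ~= T2 ==> T1 Int T2 Int closed_segment a b ~= {} ==> adj T1 T2"
   using generic_segment[OF e(1) T12(1,2) z(1,2)] by metis
  have seg: "closed_segment a b <= V Int Om"
   using closed_segment_subset[OF ab(3,4) convex_ball] e(2) by blast
  show "f T1 = f T2"
  proof (rule connected_cover_const[OF _ _ fin simplex_closed _ T12(1) _ T12(2)])
   show "connected (closed_segment a b)" by simp
   show "closed_segment a b <= \<Union>\<T>" using seg cover closure_subset by blast
   show "T1 Int closed_segment a b ~= {}" "T2 Int closed_segment a b ~= {}"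
    using ab(1,2) interior_subset by auto
   fix U U' assume U: "U : \<T>" "U' : \<T>" "U Int U' Int closed_segment a b ~= {}"
   show "f U = f U'"
   proof (cases "U = U'")
    case False
    hence "adj U U'" using ab(5) U by blast
    moreover have "U : star nu" "U' : star nu" using U V(4)[of U] V(4)[of U'] seg by (auto simp: star_def)
    ultimately have "(U, U') : ?R" by (simp add: adj_rel_def)
    thus ?thesis by (rule f_adj)
   qed simp
  qed
 qed (use T in \<open>auto simp: star_def\<close>)
 moreover have "T' : f T'" by (simp add: f_def)
 ultimately have "T' : f T" by simp
 thus ?thesis by (simp add: f_def)
qed

text \<open>The two simplices at a facet lie on opposite sides of it, so that a ball around a point of the
 facet is covered by them.\<close>

lemma facet_neighbour_ball:
 assumes "adj T T'"
 obtains a a' where "a : verts T" "a' : verts T'" "verts (T Int T') = verts T - {a}" "verts (T Int T') = verts T' - {a'}"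
  "T Int T' = {x : T. bary T a x = 0}"
  "!!r c r' c' m x0. 0 < r ==> cball c r <= T ==> 0 < r' ==> cball c' r' <= T' ==> 0 < m ==> x0 : T Int T' ==>
    (!!nu. nu : verts (T Int T') ==> m <= bary T nu x0) ==>
    ball x0 (2 * min r r' * m) <= Om & (ALL x:ball x0 (2 * min r r' * m).
     (0 < bary T a x --> x : interior T) & (bary T a x < 0 --> x : interior T'))"
proof -
 have T: "T : \<T>" "T' : \<T>" "T ~= T'" and F: "T Int T' facet_of T" using assms by (auto simp: adj_def)
 have F': "T Int T' facet_of T'" using adj_sym[OF assms] by (simp add: adj_def Int_commute)
 obtain a where a: "a : verts T" "verts (T Int T') = verts T - {a}" "T Int T' = {x : T. bary T a x = 0}"
  using facet_opposite_vertex[OF simplex[OF T(1)] F] by metis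
 obtain a' where a': "a' : verts T'" "verts (T Int T') = verts T' - {a'}" "T Int T' = {x : T'. bary T' a' x = 0}"
  using facet_opposite_vertex[OF simplex[OF T(2)] F'] by metis
 define \<kappa> where "\<kappa> = bary T' a' a"
 \<comment> \<open>Both coordinates vanish at the vertices of the common facet, so they are
   proportional.\<close>
 have proport: "bary T' a' x = \<kappa> * bary T a x" for x
 proof (rule affine_eqI[OF simplex[OF T(1)] bary_affine[OF simplex[OF T(2)]] is_affine_scale[OF bary_affine[OF simplex[OF T(1)]]]])
  fix nu assume v: "nu : verts T"
  show "bary T' a' nu = \<kappa> * bary T a nu"
  proof (cases "nu = a")
   case True
   thus ?thesis using bary_vert[OF simplex[OF T(1)] a(1)] by (simp add: \<kappa>_def)
  next
   case False
   hence "nu : verts T' - {a'}" using v a(2) a'(2) by blast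
   thus ?thesis using bary_vert[OF simplex[OF T(2)], of nu a'] bary_vert[OF simplex[OF T(1)] v, of a] False by auto
  qed
 qed
 have \<kappa>0: "\<kappa> ~= 0"
  using proport[of a'] bary_vert[OF simplex[OF T(2)] a'(1), of a'] by auto
 have balls: "(0 < bary T a x --> x : interior T) & (0 <= bary T a x --> x : T) &
   (0 < bary T' a' x --> x : interior T') & (0 <= bary T' a' x --> x : T')"
  if r: "0 < r" "cball c r <= T" "0 < r'" "cball c' r' <= T'" "0 < m" "x0 : T Int T'"
   "!!nu. nu : verts (T Int T') ==> m <= bary T nu x0" and x: "x : ball x0 (2 * min r r' * m)" for r c r' c' m x0 x
 proof -
  have "2 * min r r' * m <= 2 * r * m" "2 * min r r' * m <= 2 * r' * m" using r(5) by auto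
  hence xx: "x : ball x0 (2 * r * m)" "x : ball x0 (2 * r' * m)" using x by auto
  have m: "m <= bary T nu x0" if "nu : verts T - {a}" for nu using that a(2) r(7) by simp
  have m': "m <= bary T' nu x0" if "nu : verts T' - {a'}" for nu
   using that a'(2) r(7)[of nu] bary_consistent[OF T(1,2), of x0 nu] r(6) by simp
  show ?thesis
   using facet_ball[OF simplex[OF T(1)] r(1,2) a(1) m xx(1)] facet_ball[OF simplex[OF T(2)] r(3,4) a'(1) m' xx(2)] by blast
 qed
 have main: "ball x0 (2 * min r r' * m) <= Om & (ALL x:ball x0 (2 * min r r' * m).
     (0 < bary T a x --> x : interior T) & (bary T a x < 0 --> x : interior T'))"
  if r: "0 < r" "cball c r <= T" "0 < r'" "cball c' r' <= T'" "0 < m" "x0 : T Int T'"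
   "!!nu. nu : verts (T Int T') ==> m <= bary T nu x0" for r c r' c' m x0
 proof -
  let ?B = "ball x0 (2 * min r r' * m)"
  have b: "(0 < bary T a x --> x : interior T) & (0 <= bary T a x --> x : T) &
   (0 < bary T' a' x --> x : interior T') & (0 <= bary T' a' x --> x : T')" if "x : ?B" for x
   by (rule balls[OF r(1-6) _ that]) (rule r(7))
  have rho: "0 < 2 * min r r' * m" using r by simp
  \<comment> \<open>With a positive ratio, points near \<open>x0\<close> in the interior of
    \<open>T\<close> would be interior to \<open>T'\<close> as well.\<close>
  have "\<kappa> < 0"
  proof (rule ccontr)
   assume "\<not> \<kappa> < 0"
   hence \<kappa>: "\<kappa> > 0" using \<kappa>0 by simp
   have "x0 : closure (interior T)" using simplex_closure_interior[OF simplex[OF T(1)]] r(6) by simp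
   hence "?B Int closure (interior T) ~= {}" using rho centre_in_ball by blast
   hence "?B Int interior T ~= {}" using open_Int_closure_eq_empty[of ?B "interior T"] by simp
   then obtain x where x: "x : ?B" "x : interior T" by blast
   hence "0 < bary T a x" using mem_interior_simplex_iff[OF simplex[OF T(1)]] a(1) by blast
   hence "0 < bary T' a' x" using proport \<kappa> by simp
   hence "x : interior T'" using b[OF x(1)] by blast
   thus False using x(2) interior_disjoint[OF T] interior_subset by blast
  qed
  have neg: "x : interior T'" if "x : ?B" "bary T a x < 0" for x
   using b[OF that(1)] that(2) proport[of x] \<open>\<kappa> < 0\<close> by (simp add: mult_neg_neg)
  have "?B <= T \<union> T'"
  proof
   fix x assume x: "x : ?B"
   show "x : T \<union> T'"
    using b[OF x] neg[OF x] interior_subset[of T'] by (cases "bary T a x < 0") auto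
  qed
  hence "?B <= closure Om" using simplex_subset[OF T(1)] simplex_subset[OF T(2)] by blast
  \<comment> \<open>The ball is an open subset of the closure, and the domain is the interior of its
    closure.\<close>
  hence "?B <= Om" using interior_maximal[of ?B "closure Om"] domain_regular by simp
  thus ?thesis using b neg by blast
 qed
 show thesis by (rule that[OF a(1) a'(1) a(2) a'(2) a(3) main])
qed

end

section \<open>Shape regularity\<close>

text \<open>Comparability of sizes is assumed in dimension one only, where neighbours share a single
  point; in higher dimensions \<open>adj_size\<close> derives it across facets from the shape
  ratio.\<close>

locale regular_mesh = mesh +
 fixes sig \<kappa> :: real
 assumes shape: "T : \<T> ==> EX c r. 0 < r & cball c r <= T & diameter T <= sig * r"
  and comparable_1: "DIM('a) = 1 ==> T : \<T> ==> T' : \<T> ==> T Int T' ~= {} ==> hsize T <= \<kappa> * hsize T'"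

lemma cball_diameter:
 fixes T :: "'a::euclidean_space set"
 assumes "0 < r" "cball c r <= T" "bounded T"
 shows "2 * r <= diameter T"
 using diameter_subset[OF assms(2,3)] assms(1) by simp

lemma simplex_bounded: "full_simplex (T::'a::euclidean_space set) ==> bounded T"
 by (rule compact_imp_bounded[OF simplex_compact])

context
 fixes T :: "'a::euclidean_space set" and c r
 assumes T: "full_simplex T" and cr: "0 < r" "cball c r <= T"
begin

lemma simplex_measure_le: "vol T <= unit_ball_vol (real DIM('a)) * diameter T ^ DIM('a)"
proof -
 have "c : T" using cr by auto
 hence "T <= cball c (diameter T)"
  using diameter_bounded_bound[OF simplex_bounded[OF T]] by auto
 hence "vol T <= vol (cball c (diameter T))"
  using simplex_meas(1)[OF T] by (intro measure_mono_fmeasurable) (auto simp: fmeasurableD)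
 thus ?thesis using diameter_ge_0[OF simplex_bounded[OF T]] by (simp add: content_cball)
qed

lemma simplex_measure_ge: "unit_ball_vol (real DIM('a)) * r ^ DIM('a) <= vol T"
proof -
 have "vol (cball c r) <= vol T"
  using simplex_meas(1)[OF T] cr by (intro measure_mono_fmeasurable) (auto simp: fmeasurableD)
 thus ?thesis using cr by (simp add: content_cball)
qed

lemma simplex_size_bounds:
 "root DIM('a) (unit_ball_vol (real DIM('a))) * r <= hsize T"
 "hsize T <= root DIM('a) (unit_ball_vol (real DIM('a))) * diameter T"
proof -
 have "root DIM('a) (unit_ball_vol (real DIM('a)) * r ^ DIM('a)) <= hsize T"
  unfolding simplex_size_def by (intro real_root_le_mono simplex_measure_ge) simp
 thus "root DIM('a) (unit_ball_vol (real DIM('a))) * r <= hsize T"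
  using cr by (simp add: real_root_mult real_root_power_cancel)
 have "hsize T <= root DIM('a) (unit_ball_vol (real DIM('a)) * diameter T ^ DIM('a))"
  unfolding simplex_size_def by (intro real_root_le_mono simplex_measure_le) simp
 thus "hsize T <= root DIM('a) (unit_ball_vol (real DIM('a))) * diameter T"
  using diameter_ge_0[OF simplex_bounded[OF T]] by (simp add: real_root_mult real_root_power_cancel)
qed

end

lemma root_unit_ball_vol_pos: "0 < root DIM('a::euclidean_space) (unit_ball_vol (real DIM('a)))"
 by (simp add: unit_ball_vol_pos)

context regular_mesh
begin

lemma inball:
 assumes "T : \<T>"
 obtains c r where "0 < r" "cball c r <= T" "diameter T <= sig * r"
 using shape[OF assms] by blast

lemma sigma_ge_2:
 assumes "T : \<T>"
 shows "2 <= sig"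
proof -
 obtain c r where cr: "0 < r" "cball c r <= T" "diameter T <= sig * r" using inball[OF assms] .
 have "2 * r <= sig * r"
  using cball_diameter[OF cr(1,2) simplex_bounded[OF simplex[OF assms]]] cr(3) by linarith
 thus ?thesis using cr(1) by simp
qed

text \<open>Packing argument. Shrink each simplex towards \<open>nu\<close> until its diameter is
  the smallest one occurring, \<open>rho\<close>. By convexity the copy stays inside the simplex; it
  contains a ball of radius \<open>rho / sig\<close> and lies in the ball of radius
  \<open>rho\<close> around \<open>nu\<close>. Disjointness bounds the number without any comparison
  of sizes.\<close>

lemma card_star: "real (card (star nu)) <= sig ^ DIM('a)"
proof (cases "star nu = {}")
 case False
 then obtain T0 where "T0 : \<T>" by (auto simp: star_def)
 hence sig: "2 <= sig" by (rule sigma_ge_2)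
 have dpos: "0 < diameter T" if "T : star nu" for T
 proof -
  have TT: "T : \<T>" using that by (simp add: star_def)
  obtain c r where cr: "0 < r" "cball c r <= T" "diameter T <= sig * r" using inball[OF TT] .
  thus ?thesis using cball_diameter[OF cr(1,2) simplex_bounded[OF simplex[OF TT]]] by linarith
 qed
 define rho where "rho = Min (diameter ` star nu)"
 have rho: "0 < rho" "!!T. T : star nu ==> rho <= diameter T"
  using False finite_star dpos by (auto simp: rho_def)
 have ex: "EX y. ball y (rho / sig) <= interior T Int cball nu rho" if T: "T : star nu" for T
 proof -
  have TT: "T : \<T>" "nu : T" using T by (auto simp: star_def)
  obtain c r where cr: "0 < r" "cball c r <= T" "diameter T <= sig * r" using inball[OF TT(1)] .
  define t where "t = rho / diameter T"
  have t: "0 < t" "t <= 1" using rho(1) rho(2)[OF T] dpos[OF T] by (auto simp: t_def)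
  have tr: "rho / sig <= t * r"
   using cr dpos[OF T] rho sig by (simp add: t_def field_simps)
  define y where "y = nu + t *\<^sub>R (c - nu)"
  have sub: "EX w:T. x = nu + t *\<^sub>R (w - nu)" if x: "x : ball y (rho / sig)" for x
  proof
   let ?w = "nu + (1 / t) *\<^sub>R (x - nu)"
   have "norm (?w - c) = norm ((1 / t) *\<^sub>R (x - y))"
    unfolding y_def using t by (simp add: algebra_simps)
   also have "... = norm (x - y) / t" using t by simp
   also have "... <= r" using x tr t by (simp add: pos_divide_le_eq dist_norm norm_minus_commute mult.commute)
   finally show "?w : T" using cr(2) by (auto simp: dist_norm norm_minus_commute)
   show "x = nu + t *\<^sub>R (?w - nu)" using t by simp
  qed
  have "ball y (rho / sig) <= T"
  proof
   fix x assume "x : ball y (rho / sig)"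
   then obtain w where w: "w : T" "x = nu + t *\<^sub>R (w - nu)" using sub by blast
   have "(1 - t) *\<^sub>R nu + t *\<^sub>R w : T" using simplex_convex[OF simplex[OF TT(1)]] TT(2) w(1) t by (intro convexD) auto
   thus "x : T" unfolding w(2) by (simp add: algebra_simps)
  qed
  hence "ball y (rho / sig) <= interior T" by (rule interior_maximal) simp
  moreover have "ball y (rho / sig) <= cball nu rho"
  proof
   fix x assume "x : ball y (rho / sig)"
   then obtain w where w: "w : T" "x = nu + t *\<^sub>R (w - nu)" using sub by blast
   have "norm (w - nu) <= diameter T"
    using diameter_bounded_bound[OF simplex_bounded[OF simplex[OF TT(1)]] w(1) TT(2)] by (simp add: dist_norm)
   hence "t * norm (w - nu) <= t * diameter T" using t by simp
   also have "... = rho" using dpos[OF T] by (simp add: t_def)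
   finally show "x : cball nu rho" using t by (simp add: w(2) dist_norm)
  qed
  ultimately show ?thesis by blast
 qed
 then obtain y where y: "!!T. T : star nu ==> ball (y T) (rho / sig) <= interior T Int cball nu rho" by metis
 have "vol (\<Union>T\<in>star nu. ball (y T) (rho / sig)) = (SUM T:star nu. vol (ball (y T) (rho / sig)))"
 proof (rule measure_UNION'[OF finite_star])
  show "pairwise (%T T'. disjnt (ball (y T) (rho / sig)) (ball (y T') (rho / sig))) (star nu)"
   unfolding pairwise_def disjnt_def
  proof (intro ballI impI)
   fix T T' assume T: "T : star nu" "T' : star nu" "T ~= T'"
   hence "interior T Int T' = {}" by (intro interior_disjoint) (auto simp: star_def)
   thus "ball (y T) (rho / sig) Int ball (y T') (rho / sig) = {}"
    using y[OF T(1)] y[OF T(2)] interior_subset[of T'] by blast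
  qed
 qed auto
 moreover have "vol (\<Union>T\<in>star nu. ball (y T) (rho / sig)) <= vol (cball nu rho)"
  using y by (intro measure_mono_fmeasurable) (auto intro!: sets.finite_UN finite_star)
 ultimately have "real (card (star nu)) * (unit_ball_vol (real DIM('a)) * (rho / sig) ^ DIM('a)) <= unit_ball_vol (real DIM('a)) * rho ^ DIM('a)"
  using rho sig by (simp add: content_ball content_cball)
 hence "real (card (star nu)) * (rho / sig) ^ DIM('a) <= rho ^ DIM('a)"
  using unit_ball_vol_pos[of "real DIM('a)"] by (simp add: mult.left_commute)
 thus ?thesis using rho sig by (simp add: power_divide field_simps)
next
 case True
 thus ?thesis
 proof (cases "\<T> = {}")
  case True
  hence "closure Om = {}" using cover by simp
  thus ?thesis using dom by (simp add: polytopal_domain_def)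
 next
  case False
  hence "0 <= sig" using sigma_ge_2 by force
  thus ?thesis using \<open>star nu = {}\<close> by simp
 qed
qed

text \<open>In dimension at least two the common facet has an edge. A coordinate of \<open>T\<close>
  drops from 1 to 0 along it, so its length is at least \<open>2 r\<close>, and it is at most the
  diameter of \<open>T'\<close>. This gives one factor \<open>sig\<close>; the passage from the
  inradius to the diameter of \<open>T\<close> gives the other.\<close>

lemma adj_size:
 assumes "adj T T'"
 shows "hsize T <= max \<kappa> (sig^2) * hsize T'"
proof -
 have T: "T : \<T>" "T' : \<T>" "T ~= T'" and F: "T Int T' facet_of T" using assms by (auto simp: adj_def)
 have pos: "0 <= hsize T'" by (simp add: simplex_size_def)
 show ?thesis
 proof (cases "DIM('a) = 1")
  case True
  have "hsize T <= \<kappa> * hsize T'"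
   by (rule comparable_1[OF True T(1,2)]) (use F in \<open>auto simp: facet_of_def\<close>)
  also have "... <= max \<kappa> (sig^2) * hsize T'" using pos by (intro mult_right_mono) auto
  finally show ?thesis .
 next
  case False
  have "0 < DIM('a)" by simp
  with False have d2: "2 <= DIM('a)" by linarith
  obtain a where a: "a : verts T" "verts (T Int T') = verts T - {a}"
   using facet_opposite_vertex[OF simplex[OF T(1)] F] by metis
  have "card (verts T - {a}) = DIM('a)" using a(1) simplex_card[OF simplex[OF T(1)]] simplex_verts(3)[OF simplex[OF T(1)]] by simp
  hence "2 <= card (verts T - {a})" using d2 by simp
  then obtain p q where pq: "p : verts T - {a}" "q : verts T - {a}" "p ~= q"
   by (metis card_le_Suc0_iff_eq finite_Diff not_less_eq_eq numeral_2_eq_2 simplex_verts(3) simplex T(1))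
  have pqT: "p : T" "q : T" "p : T'" "q : T'" using pq a(2) verts_subset[of "T Int T'"] by blast+
  obtain c r where cr: "0 < r" "cball c r <= T" "diameter T <= sig * r" using inball[OF T(1)] .
  obtain c' r' where cr': "0 < r'" "cball c' r' <= T'" "diameter T' <= sig * r'" using inball[OF T(2)] .
  have "\<bar>bary T p p - bary T p q\<bar> <= norm (p - q) / (2 * r)" by (rule bary_Lipschitz[OF simplex[OF T(1)] cr(1,2)])
  hence "2 * r <= norm (p - q)"
   using pq bary_vert[OF simplex[OF T(1)], of p p] bary_vert[OF simplex[OF T(1)], of q p] cr(1)
   by (auto simp: pos_le_divide_eq)
  also have "... <= diameter T'"
   using diameter_bounded_bound[OF simplex_bounded[OF simplex[OF T(2)]] pqT(3,4)] by (simp add: dist_norm)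
  finally have rr: "r <= sig * r'" using cr' cr(1) by linarith
  have sig: "2 <= sig" using sigma_ge_2[OF T(1)] .
  let ?k = "root DIM('a) (unit_ball_vol (real DIM('a)))"
  have k: "0 < ?k" by (rule root_unit_ball_vol_pos)
  have "hsize T <= ?k * diameter T" by (rule simplex_size_bounds(2)[OF simplex[OF T(1)] cr(1,2)])
  also have "... <= ?k * (sig * (sig * r'))"
  proof (intro mult_left_mono)
   have "sig * r <= sig * (sig * r')" using rr sig by (intro mult_left_mono) auto
   thus "diameter T <= sig * (sig * r')" using cr(3) by linarith
  qed (use k in simp)
  also have "... = sig^2 * (?k * r')" by (simp add: power2_eq_square)
  also have "... <= sig^2 * hsize T'"
   by (intro mult_left_mono simplex_size_bounds(1)[OF simplex[OF T(2)] cr'(1,2)]) simp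
  also have "... <= max \<kappa> (sig^2) * hsize T'" using pos by (intro mult_right_mono) auto
  finally show ?thesis .
 qed
qed

end

section \<open>The finite element space\<close>

context mesh
begin

definition cell_sum :: "('a set => 'b) => 'a => 'b::comm_monoid_add" where
 "cell_sum a x = (SUM T:\<T>. if x : interior T then a T else 0)"

lemma cell_sum_eq:
 assumes "T : \<T>" "x : interior T"
 shows "cell_sum a x = a T"
proof -
 have "(if x : interior T' then a T' else 0) = (if T' = T then a T' else 0)" if "T' : \<T>" for T'
  using interior_disjoint[OF assms(1) that] interior_subset[of T'] assms(2) by auto
 thus ?thesis using assms fin by (simp add: cell_sum_def sum.delta)
qed

lemma cell_sum_measurable:
 fixes a :: "'a set => 'b::euclidean_space"
 shows "cell_sum a : borel_measurable borel"
 unfolding cell_sum_def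
proof (intro borel_measurable_sum measurable_If)
 fix T
 show "{x : space borel. x : interior T} : sets borel" by simp
qed auto

lemma cell_sum_L2:
 fixes a :: "'a set => 'b::euclidean_space"
 shows "cell_sum a : L2 Om"
proof (rule L2_bounded[OF dom_meas])
 show "cell_sum a : borel_measurable (leb Om)"
  by (intro measurable_restrict_space1 borel_imp_lebesgue cell_sum_measurable)
 show "norm (cell_sum a x) <= (SUM T:\<T>. norm (a T))" for x
  unfolding cell_sum_def by (rule order_trans[OF norm_sum sum_mono]) auto
qed

lemma continuous_on_domain:
 assumes "!!T. T : \<T> ==> continuous_on T f"
 shows "continuous_on (closure Om) f"
 unfolding cover[symmetric]
 using continuous_on_closed_Union[OF fin, of "%T. T" f] assms simplex_closed by simp

lemma closure_continuous_L2:
 fixes f :: "'a => real"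
 assumes "continuous_on (closure Om) f"
 shows "f : L2 Om"
proof -
 have "compact (f ` closure Om)"
  using assms domain_bounded by (intro compact_continuous_image) auto
 hence "bounded (f ` closure Om)" by (rule compact_imp_bounded)
 then obtain B where B: "!!x. x : closure Om ==> norm (f x) <= B"
  by (auto simp: bounded_iff)
 have "f : borel_measurable (leb Om)"
  by (rule continuous_imp_measurable_on_sets_lebesgue[OF continuous_on_subset[OF assms closure_subset] cell_sets(2)])
 thus ?thesis using B closure_subset by (intro L2_bounded[OF dom_meas, of f B]) auto
qed

text \<open>Instead of integrating by parts on each simplex and cancelling facet terms,
  \<open>f eta\<close> is extended by zero. It is Lipschitz and differentiable almost everywhere, so
  \<open>integral_directional_derivative_eq_0\<close> applies. Continuity of \<open>f\<close> enters
  through the global Lipschitz bound.\<close>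

lemma piecewise_affine_weak_gradient:
 assumes f: "continuous_on (closure Om) f" and p: "!!T x. T : \<T> ==> x : T ==> f x = a T \<bullet> x + b T"
 shows "weak_gradient Om f (cell_sum a)"
proof (rule weak_gradientI[OF dom_meas closure_continuous_L2[OF f] cell_sum_L2])
 fix eta g e assume t: "test_fn Om eta g"
 note tL = test_fn_L2[OF t dom_meas]
 obtain K where K: "compact K" "K <= Om" "!!x. x ~: K ==> eta x = 0" "!!x. x ~: K ==> g x = 0"
  using test_fn_support[OF t] by metis
 obtain B where B: "0 < B" "!!x. \<bar>eta x\<bar> <= B" "!!x. norm (g x) <= B" using test_fn_bounded[OF t] by metis
 have "compact (f ` closure Om)" using f domain_bounded by (intro compact_continuous_image) auto
 hence "bounded (f ` closure Om)" by (rule compact_imp_bounded)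
 then obtain C where C: "!!x. x : closure Om ==> \<bar>f x\<bar> <= C"
  by (auto simp: bounded_iff)
 define A where "A = (SUM T:\<T>. norm (a T))"
 have A: "norm (a T) <= A" if "T : \<T>" for T
  unfolding A_def using that fin by (intro member_le_sum) auto
 define F where "F x = (if x : Om then f x * eta x else 0)" for x
 have Fcl: "F x = f x * eta x" if "x : closure Om" for x
  using K(2) K(3)[of x] by (auto simp: F_def)
 have FK: "F x = 0" if "x ~: K" for x using K(3)[OF that] by (simp add: F_def)
 define L where "L = \<bar>C\<bar> * B + A * B"
 have L0: "0 <= L" unfolding L_def A_def using B by (intro add_nonneg_nonneg mult_nonneg_nonneg sum_nonneg) auto
 have LT: "\<bar>F x - F y\<bar> <= L * norm (x - y)" if T: "T : \<T>" "x : T" "y : T" for T x y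
 proof -
  have cl: "x : closure Om" "y : closure Om" using T simplex_subset by blast+
  have "F x - F y = f x * (eta x - eta y) + (f x - f y) * eta y" by (simp add: Fcl cl algebra_simps)
  also have "\<bar>...\<bar> <= \<bar>f x\<bar> * \<bar>eta x - eta y\<bar> + \<bar>f x - f y\<bar> * \<bar>eta y\<bar>"
   unfolding abs_mult[symmetric] by (rule abs_triangle_ineq)
  also have "... <= \<bar>C\<bar> * (B * norm (x - y)) + (A * norm (x - y)) * B"
  proof (intro add_mono mult_mono)
   show "\<bar>f x\<bar> <= \<bar>C\<bar>" using C[OF cl(1)] by linarith
   show "\<bar>eta x - eta y\<bar> <= B * norm (x - y)" by (rule lipschitz_from_grad_bound[OF test_fn_deriv[OF t] B(3)])
   have "\<bar>f x - f y\<bar> = \<bar>a T \<bullet> (x - y)\<bar>" using p T by (simp add: inner_diff_right)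
   also have "... <= norm (a T) * norm (x - y)" by (rule Cauchy_Schwarz_ineq2)
   also have "... <= A * norm (x - y)" by (intro mult_right_mono A T) simp
   finally show "\<bar>f x - f y\<bar> <= A * norm (x - y)" .
   show "\<bar>eta y\<bar> <= B" by (rule B(2))
   show "0 <= A * norm (x - y)" unfolding A_def by (intro mult_nonneg_nonneg sum_nonneg) auto
  qed auto
  also have "... = L * norm (x - y)" by (simp add: L_def algebra_simps)
  finally show ?thesis .
 qed
 have Lip: "\<bar>F x - F y\<bar> <= L * norm (x - y)" for x y
 proof -
  let ?s = "%t::real. x + t *\<^sub>R (y - x)"
  define U where "U S = {t. ?s t : S}" for S
  have cont: "continuous_on UNIV ?s" by (intro continuous_intros)
  \<comment> \<open>Along the segment from \<open>x\<close> to \<open>y\<close> the closed pieces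
    are the preimages of the simplices and of the complement of \<open>Om\<close>, where
    \<open>F\<close> is zero.\<close>
  have "(L * norm (x - y))-lipschitz_on {0..1} (%t. F (?s t))"
  proof (rule lipschitz_on_closed_Union[where I = "insert (- Om) \<T>" and U = U])
   fix S assume S: "S : insert (- Om) \<T>"
   have "closed S" using S simplex_closed domain_open by auto
   hence "closed (?s -` S)" by (rule continuous_closed_vimage) (intro continuous_intros)
   thus "closed (U S)" by (simp add: U_def vimage_def)
   show "(L * norm (x - y))-lipschitz_on (U S) (%t. F (?s t))"
   proof (rule lipschitz_onI)
    fix r r' assume r: "r : U S" "r' : U S"
    have "\<bar>F (?s r) - F (?s r')\<bar> <= L * norm (?s r - ?s r')"
    proof (cases "S : \<T>")
     case True
     show ?thesis by (rule LT[OF True]) (use r in \<open>simp_all add: U_def\<close>)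
    next
     case False
     hence "F (?s r) = 0" "F (?s r') = 0" using S r by (auto simp: U_def F_def)
     thus ?thesis using L0 by simp
    qed
    also have "?s r - ?s r' = (r - r') *\<^sub>R (y - x)" by (simp add: algebra_simps)
    finally show "dist (F (?s r)) (F (?s r')) <= L * norm (x - y) * dist r r'"
     by (simp add: dist_real_def norm_minus_commute mult_ac)
   qed (use L0 in simp)
  next
   show "{0..1} <= (\<Union>S\<in>insert (- Om) \<T>. U S)"
    using cover closure_subset[of Om] by (auto simp: U_def)
  qed (use fin L0 in auto)
  from lipschitz_onD[OF this, of 0 1] show ?thesis by (simp add: dist_real_def)
 qed
 define F' where "F' x = indicator Om x *\<^sub>R (f x * (g x \<bullet> e) + eta x * (cell_sum a x \<bullet> e))" for x
 have i: "integrable (leb Om) (%x. f x * (g x \<bullet> e))" "integrable (leb Om) (%x. eta x * (cell_sum a x \<bullet> e))"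
  by (intro L2_mult_int closure_continuous_L2[OF f] L2_dot tL cell_sum_L2)+
 have F'm: "integrable lebesgue F'"
  using Bochner_Integration.integrable_add[OF i] cell_sets(2) by (simp add: F'_def[abs_def] integrable_restrict_space)
 obtain R where R: "!!x. x : K ==> norm x <= R"
  using compact_imp_bounded[OF K(1)] unfolding bounded_iff by blast
 have "integral\<^sup>L lebesgue F' = 0"
 proof (rule integral_directional_derivative_eq_0[OF Lip])
  show "F x = 0" if "x ~: cball 0 R" for x
   using FK[of x] R[of x] that by auto
  show "F' : borel_measurable lebesgue" using F'm by (rule borel_measurable_integrable)
  show "AE x in lebesgue. ((%s. F (x + s *\<^sub>R e)) has_real_derivative F' x) (at 0)"
   using AE_interior
  proof eventually_elim
   case (elim x)
   have "(F has_derivative (%y. (if x : K then f x *\<^sub>R g x + eta x *\<^sub>R cell_sum a x else 0) \<bullet> y)) (at x)"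
   proof (cases "x : K")
    case False
    have "open (- K)" using K(1) by (simp add: compact_imp_closed open_Compl)
    hence "(F has_derivative (%y. 0)) (at x)"
     by (rule has_derivative_transform_within_open[OF has_derivative_const[of 0]]) (use False FK in auto)
    thus ?thesis using False by simp
   next
    case True
    hence "x : closure Om" using K(2) closure_subset by blast
    then obtain T where T: "T : \<T>" "x : interior T" using elim by blast
    have xT: "x : T" using T(2) interior_subset by blast
    have ad: "((%x. a T \<bullet> x + b T) has_derivative (%y. a T \<bullet> y)) (at x)"
     by (auto intro!: derivative_eq_intros)
    have "((%x. (a T \<bullet> x + b T) * eta x) has_derivative (%y. (a T \<bullet> x + b T) * (g x \<bullet> y) + a T \<bullet> y * eta x)) (at x)"
     by (rule has_derivative_mult[OF ad test_fn_deriv[OF t]])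
    hence "(F has_derivative (%y. (a T \<bullet> x + b T) * (g x \<bullet> y) + a T \<bullet> y * eta x)) (at x)"
    proof (rule has_derivative_transform_within_open[OF _ open_interior T(2)])
     fix y assume "y : interior T"
     hence "y : T" using interior_subset by blast
     thus "(a T \<bullet> y + b T) * eta y = F y" using Fcl p T(1) simplex_subset[OF T(1)] by auto
    qed
    thus ?thesis
     using True p[OF T(1) xT] by (simp add: cell_sum_eq[OF T] inner_add_left mult.commute)
   qed
   from has_real_derivative_along[where t = 0 and x = x and e = e, simplified, OF this]
   have "((%s. F (x + s *\<^sub>R e)) has_real_derivative ((if x : K then f x *\<^sub>R g x + eta x *\<^sub>R cell_sum a x else 0) \<bullet> e)) (at 0)" .
   moreover have "(if x : K then f x *\<^sub>R g x + eta x *\<^sub>R cell_sum a x else 0) \<bullet> e = F' x"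
    using K(2) K(3,4)[of x] by (auto simp: F'_def inner_add_left)
   ultimately show ?case by simp
  qed
 qed
 hence "lint Om (%x. f x * (g x \<bullet> e) + eta x * (cell_sum a x \<bullet> e)) = 0"
  using cell_sets(2) by (simp add: F'_def[abs_def] integral_restrict_space)
 thus "l2_inner Om f (%x. g x \<bullet> e) = - l2_inner Om eta (%x. cell_sum a x \<bullet> e)"
  using i by (simp add: l2_inner_def)
qed

lemma hat_continuous: "continuous_on (closure Om) (hat \<T> nu)"
proof (rule continuous_on_domain)
 fix T assume T: "T : \<T>"
 show "continuous_on T (hat \<T> nu)"
  using affine_cont[OF bary_affine[OF simplex[OF T]]] hat_eq_bary[OF T]
  by (metis (no_types, lifting) continuous_on_cong)
qed

lemma hat_L2: "hat \<T> nu : L2 Om"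
 by (rule closure_continuous_L2[OF hat_continuous])

lemma hat_H1: "hat \<T> nu : H1 Om"
proof -
 have "ALL T:\<T>. EX ab. ALL x:T. hat \<T> nu x = fst ab \<bullet> x + snd ab"
 proof
  fix T assume T: "T : \<T>"
  obtain a b where "!!x. bary T nu x = a \<bullet> x + b" using bary_affine[OF simplex[OF T]] unfolding is_affine_def by metis
  thus "EX ab. ALL x:T. hat \<T> nu x = fst ab \<bullet> x + snd ab"
   using hat_eq_bary[OF T] by (intro exI[of _ "(a, b)"]) simp
 qed
 then obtain ab where ab: "!!T x. T : \<T> ==> x : T ==> hat \<T> nu x = fst (ab T) \<bullet> x + snd (ab T)" by metis
 show ?thesis
  by (rule H1I[OF hat_L2 cell_sum_L2 piecewise_affine_weak_gradient[OF hat_continuous ab]])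
qed

end

text \<open>The coordinates of the centroid \<open>x\<^sub>F\<close> of a facet and of the midpoint of \<open>x\<^sub>F\<close> and a point of the
 facet are bounded away from zero; an affine function that vanishes at both also vanishes at the point.\<close>

lemma facet_centroid:
 fixes T :: "'a::euclidean_space set"
 assumes T: "full_simplex T" and a: "a : verts T"
 defines "xF \<equiv> (SUM v:verts T - {a}. (1 / real DIM('a)) *\<^sub>R v)"
 shows "bary T a xF = 0" "nu : verts T - {a} ==> bary T nu xF = 1 / real DIM('a)" "xF : T"
proof -
 have fin: "finite (verts T)" by (rule simplex_verts(3)[OF T])
 have card: "card (verts T - {a}) = DIM('a)" using a simplex_card[OF T] fin by simp
 define u where "u v = (if v = a then 0 else 1 / real DIM('a))" for v
 have "sum u (verts T) = (SUM v:verts T - {a}. 1 / real DIM('a))"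
  using fin a by (subst sum.remove[OF fin a]) (auto simp: u_def intro!: sum.cong)
 hence s: "sum u (verts T) = 1" using card by simp
 have xF: "xF = (SUM v:verts T. u v *\<^sub>R v)"
  unfolding xF_def by (subst sum.remove[OF fin a]) (auto simp: u_def intro!: sum.cong)
 have b: "bary T nu xF = u nu" if "nu : verts T" for nu
  unfolding xF by (rule bary_of_combination[OF T s that])
 show "bary T a xF = 0" "nu : verts T - {a} ==> bary T nu xF = 1 / real DIM('a)" using b a by (auto simp: u_def)
 show "xF : T" unfolding mem_simplex_iff[OF T] using b by (auto simp: u_def)
qed

lemma facet_vanishing:
 fixes T :: "'a::euclidean_space set"
 assumes T: "full_simplex T" and a: "a : verts T" and q: "is_affine q"
  and z: "!!x m. 0 < m ==> x : T ==> bary T a x = 0 ==> (!!nu. nu : verts T - {a} ==> m <= bary T nu x) ==> q x = 0"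
  and y: "y : T" "bary T a y = 0"
 shows "q y = 0"
proof -
 define xF where "xF = (SUM v:verts T - {a}. (1 / real DIM('a)) *\<^sub>R v)"
 note c = facet_centroid[OF T a, folded xF_def]
 have q1: "q xF = 0" by (rule z[of "1 / real DIM('a)"]) (use c in auto)
 let ?w = "(1 - 1/2) *\<^sub>R xF + (1/2::real) *\<^sub>R y"
 have bw: "bary T nu ?w = (1 - 1/2) * bary T nu xF + (1/2) * bary T nu y" for nu
  by (rule is_affine_at_convex[OF bary_affine[OF T]])
 have q2: "q ?w = 0"
 proof (rule z[of "1 / (2 * real DIM('a))"])
  show "?w : T" using simplex_convex[OF T] c(3) y(1) by (intro convexD) auto
  show "bary T a ?w = 0" using bw c(1) y(2) by simp
  show "1 / (2 * real DIM('a)) <= bary T nu ?w" if "nu : verts T - {a}" for nu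
   unfolding bw c(2)[OF that] using bary_nonneg[OF T y(1), of nu] by simp
 qed simp
 have "q ?w = (1 - 1/2) * q xF + (1/2) * q y" by (rule is_affine_at_convex[OF q])
 thus ?thesis using q1 q2 by simp
qed

section \<open>Boundary conditions and the nodal basis of the finite element space\<close>

locale mesh_bc = mesh +
 fixes gam :: "'a set"
 assumes gam_frontier: "gam <= frontier Om"
  and gam_facets: "EX \<F>. (ALL F:\<F>. EX T:\<T>. F facet_of T) & gam = \<Union>\<F>"
begin

abbreviation N0 :: "'a set" where "N0 \<equiv> free_nodes gam \<T>"

lemma finite_N0: "finite N0"
 using finite_nodes by (simp add: free_nodes_def)

lemma gam_closure: "gam <= closure Om"
 using gam_frontier by (auto simp: frontier_def)

lemma gam_facet:
 assumes "x : gam"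
 obtains T F a where "T : \<T>" "F facet_of T" "x : F" "F <= gam" "a : verts T" "verts F = verts T - {a}" "F = {x : T. bary T a x = 0}"
proof -
 obtain \<F> where \<F>: "ALL F:\<F>. EX T:\<T>. F facet_of T" "gam = \<Union>\<F>" using gam_facets by blast
 then obtain F T where F: "F : \<F>" "x : F" "T : \<T>" "F facet_of T" using assms by blast
 obtain a where "a : verts T" "verts F = verts T - {a}" "F = {x : T. bary T a x = 0}"
  using facet_opposite_vertex[OF simplex[OF F(3)] F(4)] by metis
 thus thesis using that F \<F>(2) by blast
qed

lemma hat_vanishes:
 assumes "nu : N0" "x : gam"
 shows "hat \<T> nu x = 0"
proof -
 obtain T F a where F: "T : \<T>" "F facet_of T" "x : F" "F <= gam" using gam_facet[OF assms(2)] by metis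
 have face: "F face_of T" using F(2) by (simp add: facet_of_def)
 have "bary T nu x = 0"
 proof (rule affine_eq_on_face[OF simplex[OF F(1)] face bary_affine[OF simplex[OF F(1)]] is_affine_const _ F(3)])
  fix nu' assume v: "nu' : verts F"
  hence "nu' : gam" using F(4) verts_subset by blast
  hence "nu' ~= nu" using assms(1) by (auto simp: free_nodes_def)
  moreover have "nu' : verts T" using face_verts(1)[OF simplex[OF F(1)] face] v by blast
  ultimately show "bary T nu nu' = 0" using bary_vert[OF simplex[OF F(1)]] by simp
 qed
 moreover have "x : T" using F(3) face_of_imp_subset[OF face] by blast
 ultimately show ?thesis using hat_eq_bary[OF F(1)] by simp
qed

lemma hat_H1_0: "nu : N0 ==> hat \<T> nu : H1_0 Om gam"
 by (rule H1_0I[OF domain_open domain_bounded hat_H1 hat_continuous hat_vanishes])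

lemma hat_U: "nu : N0 ==> hat \<T> nu : U_space Om gam \<T>"
 unfolding U_space_def
proof (intro CollectI conjI ballI hat_H1_0)
 fix T assume T: "T : \<T>"
 obtain a b where "!!x. bary T nu x = a \<bullet> x + b" using bary_affine[OF simplex[OF T]] unfolding is_affine_def by metis
 hence "AE x in leb Om. x : T --> hat \<T> nu x = a \<bullet> x + b"
  using hat_eq_bary[OF T] by (intro AE_I2) simp
 thus "EX a b. AE x in leb Om. x : T --> hat \<T> nu x = a \<bullet> x + b" by blast
qed

lemma U_L2: "u : U_space Om gam \<T> ==> u : L2 Om"
 unfolding U_space_def using H1_L2 H1_0_H1 by blast

lemma U_lincomb:
 assumes "u : U_space Om gam \<T>" "v : U_space Om gam \<T>"
 shows "(%x. c * u x + d * v x) : U_space Om gam \<T>"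
 unfolding U_space_def
proof (intro CollectI conjI ballI)
 show "(%x. c * u x + d * v x) : H1_0 Om gam"
  using assms by (intro H1_0_lincomb[OF domain_open domain_bounded]) (auto simp: U_space_def)
 fix T assume T: "T : \<T>"
 obtain a b where 1: "AE x in leb Om. x : T --> u x = a \<bullet> x + b"
  using assms(1) T unfolding U_space_def by blast
 obtain a' b' where 2: "AE x in leb Om. x : T --> v x = a' \<bullet> x + b'"
  using assms(2) T unfolding U_space_def by blast
 from 1 2 have "AE x in leb Om. x : T --> c * u x + d * v x = (c *\<^sub>R a + d *\<^sub>R a') \<bullet> x + (c * b + d * b')"
  by eventually_elim (auto simp: inner_add_left algebra_simps)
 thus "EX a b. AE x in leb Om. x : T --> c * u x + d * v x = a \<bullet> x + b" by blast
qed

lemma zero_U: "(%x. 0) : U_space Om gam \<T>"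
proof -
 have "EX a b. AE x in leb Om. x : T --> (0::real) = a \<bullet> x + b" for T
  by (intro exI[of _ 0]) simp
 thus ?thesis
  unfolding U_space_def using zero_H1_0[OF domain_open domain_bounded] by blast
qed

lemma U_sum:
 assumes "!!i. i : I ==> f i : U_space Om gam \<T>"
 shows "(%x. SUM i:I. c i * f i x) : U_space Om gam \<T>"
 using assms
proof (induction I rule: infinite_finite_induct)
 case (insert i I)
 thus ?case using U_lincomb[of "f i" "%x. SUM i:I. c i * f i x" "c i" 1] by simp
qed (auto intro: zero_U)

lemma U_subspace: "L2_subspace Om (U_space Om gam \<T>)"
 unfolding L2_subspace_def using U_L2 zero_U U_lincomb by blast

text \<open>A small ball around a facet point with coordinates bounded below sees only the two
  simplices, and \<open>jump_zero\<close> gives equality at that point;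
  \<open>facet_vanishing\<close> extends it to the rest of the facet.\<close>

lemma U_facet_continuous:
 assumes u: "u : U_space Om gam \<T>" and adj: "adj T T'"
  and p: "is_affine p" "AE x in leb Om. x : T --> u x = p x"
  and p': "is_affine p'" "AE x in leb Om. x : T' --> u x = p' x"
  and y: "y : T Int T'"
 shows "p y = p' y"
proof -
 have T: "T : \<T>" "T' : \<T>" using adj by (auto simp: adj_def)
 have uH: "u : H1 Om" using u H1_0_H1 unfolding U_space_def by blast
 obtain a a' where a: "a : verts T" "a' : verts T'" "verts (T Int T') = verts T - {a}" "verts (T Int T') = verts T' - {a'}"
  "T Int T' = {x : T. bary T a x = 0}"
  "!!r c r' c' m x0. 0 < r ==> cball c r <= T ==> 0 < r' ==> cball c' r' <= T' ==> 0 < m ==> x0 : T Int T' ==>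
    (!!nu. nu : verts (T Int T') ==> m <= bary T nu x0) ==>
    ball x0 (2 * min r r' * m) <= Om & (ALL x:ball x0 (2 * min r r' * m).
     (0 < bary T a x --> x : interior T) & (bary T a x < 0 --> x : interior T'))"
  using facet_neighbour_ball[OF adj] by blast
 obtain c r where cr: "0 < r" "cball c r <= T"
  using interior_nonempty[OF simplex[OF T(1)]] unfolding mem_interior_cball by (metis all_not_in_conv mem_interior_cball)
 obtain c' r' where cr': "0 < r'" "cball c' r' <= T'"
  using interior_nonempty[OF simplex[OF T(2)]] by (metis all_not_in_conv mem_interior_cball)
 obtain pa pb where pp: "!!x. p x = pa \<bullet> x + pb" using p(1) unfolding is_affine_def by metis
 obtain pa' pb' where pp': "!!x. p' x = pa' \<bullet> x + pb'" using p'(1) unfolding is_affine_def by metis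
 have "1 * p y + (-1) * p' y = 0"
 proof (rule facet_vanishing[OF simplex[OF T(1)] a(1)])
  show "is_affine (%y. 1 * p y + (-1) * p' y)" by (rule is_affine_lincomb[OF p(1) p'(1)])
  show "y : T" "bary T a y = 0" using y a(5) by auto
  fix x0 m assume m: "0 < m" "x0 : T" "bary T a x0 = 0" "!!nu. nu : verts T - {a} ==> m <= bary T nu x0"
  define rho where "rho = 2 * min r r' * m"
  have rho: "0 < rho" using m cr cr' by (simp add: rho_def)
  have x0: "x0 : T Int T'" using m a(5) by blast
  have "ball x0 rho <= Om & (ALL x:ball x0 rho. (0 < bary T a x --> x : interior T) & (bary T a x < 0 --> x : interior T'))"
   unfolding rho_def by (rule a(6)[OF cr cr' m(1) x0]) (use m(4) a(3) in blast)
  hence B: "ball x0 rho <= Om" "!!x. x : ball x0 rho ==> 0 < bary T a x ==> x : interior T"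
   "!!x. x : ball x0 rho ==> bary T a x < 0 ==> x : interior T'" by blast+
  obtain n where n: "n ~= 0" "!!x. bary T a x = n \<bullet> (x - x0)" using bary_form[OF simplex[OF T(1)] a(1) m(3)] by metis
  have bs: "ball x0 rho : sets lebesgue" by simp
  have "pa \<bullet> x0 + pb = pa' \<bullet> x0 + pb'"
  proof (rule jump_zero[OF rho n(1)])
   show "u : L2 (ball x0 rho)" by (rule L2_subset[OF H1_L2[OF uH] B(1) bs cell_sets(2)])
   show "wgrad Om u : L2 (ball x0 rho)" by (rule L2_subset[OF wgrad_props(1)[OF uH] B(1) bs cell_sets(2)])
   show "weak_gradient (ball x0 rho) u (wgrad Om u)"
    by (rule wgrad_subset[OF wgrad_props(2)[OF uH] dom_meas H1_L2[OF uH] wgrad_props(1)[OF uH] B(1)]) simp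
   show "AE x in leb (ball x0 rho). 0 < n \<bullet> (x - x0) --> u x = pa \<bullet> x + pb"
    using p(2) unfolding AE_leb[OF bs] AE_leb[OF cell_sets(2)]
   proof eventually_elim
    case (elim x)
    thus ?case using B(1) B(2)[of x] n(2)[of x] interior_subset[of T] by (auto simp: pp)
   qed
   show "AE x in leb (ball x0 rho). n \<bullet> (x - x0) < 0 --> u x = pa' \<bullet> x + pb'"
    using p'(2) unfolding AE_leb[OF bs] AE_leb[OF cell_sets(2)]
   proof eventually_elim
    case (elim x)
    thus ?case using B(1) B(3)[of x] n(2)[of x] interior_subset[of T'] by (auto simp: pp')
   qed
  qed
  thus "1 * p x0 + (-1) * p' x0 = 0" by (simp add: pp pp')
 qed
 thus ?thesis by simp
qed

text \<open>Only the simplex behind the facet matters, which keeps the size of the ball uniform.\<close>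

lemma gam_facet_extension:
 assumes T: "T : \<T>" and a: "a : verts T" and F: "{x : T. bary T a x = 0} <= gam"
  and cr: "0 < r" "cball c r <= T" and m: "0 < m" "bary T a x0 = 0" "!!nu. nu : verts T - {a} ==> m <= bary T nu x0"
  and u: "u : H1_0 Om gam"
 defines "B \<equiv> ball x0 (2 * r * m)" and "E \<equiv> ball x0 (2 * r * m) Int interior T"
 shows "weak_gradient B (%x. if x : E then u x else 0) (%x. if x : E then wgrad Om u x else 0)"
  "(%x. if x : E then u x else 0) : L2 B" "(%x. if x : E then wgrad Om u x else 0) : L2 B"
  "E = B Int {x. 0 < bary T a x}"
proof -
 note fb = facet_ball[OF simplex[OF T] cr a m(3)]
 show E: "E = B Int {x. 0 < bary T a x}"
  unfolding E_def B_def using fb(1) mem_interior_simplex_iff[OF simplex[OF T]] a by blast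
 obtain n where n: "n ~= 0" "!!x. bary T a x = n \<bullet> (x - x0)" using bary_form[OF simplex[OF T] a m(2)] by metis
 have gamB: "B Int {x. n \<bullet> (x - x0) = 0} <= gam"
  using fb(2) F n(2) unfolding B_def by force
 have EOm: "E <= Om" unfolding E_def using cell_subset[OF T] by blast
 have En: "E = B Int {x. 0 < n \<bullet> (x - x0)}" using E n(2) by simp
 have "0 < 2 * r * m" using cr m by simp
 from zero_extension[OF domain_open domain_bounded n(1) this En[unfolded B_def] EOm gamB[unfolded B_def] gam_closure u]
 show "weak_gradient B (%x. if x : E then u x else 0) (%x. if x : E then wgrad Om u x else 0)"
  "(%x. if x : E then u x else 0) : L2 B" "(%x. if x : E then wgrad Om u x else 0) : L2 B"
  unfolding B_def .
qed

text \<open>The extension by zero has a weak gradient on a ball around a facet point, so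
  \<open>jump_zero\<close> applies with the zero function on the outer side.\<close>

lemma U_vanishes:
 assumes u: "u : U_space Om gam \<T>" and T: "T : \<T>" and a: "a : verts T" and F: "{x : T. bary T a x = 0} <= gam"
  and p: "is_affine p" "AE x in leb Om. x : T --> u x = p x"
  and y: "y : T" "bary T a y = 0"
 shows "p y = 0"
proof (rule facet_vanishing[OF simplex[OF T] a p(1) _ y])
 have u0: "u : H1_0 Om gam" using u unfolding U_space_def by blast
 obtain c r where cr: "0 < r" "cball c r <= T"
  using interior_nonempty[OF simplex[OF T]] by (metis all_not_in_conv mem_interior_cball)
 obtain pa pb where pp: "!!x. p x = pa \<bullet> x + pb" using p(1) unfolding is_affine_def by metis
 fix x0 m assume m: "0 < m" "x0 : T" "bary T a x0 = 0" "!!nu. nu : verts T - {a} ==> m <= bary T nu x0"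
 obtain n where n: "n ~= 0" "!!x. bary T a x = n \<bullet> (x - x0)" using bary_form[OF simplex[OF T] a m(3)] by metis
 have rho: "0 < 2 * r * m" using cr m by simp
 define E where "E = ball x0 (2 * r * m) Int interior T"
 note ext = gam_facet_extension[OF T a F cr m(1,3) m(4) u0, folded E_def]
 have Eiff: "x : E \<longleftrightarrow> x : ball x0 (2 * r * m) & 0 < n \<bullet> (x - x0)" for x
  using ext(4) n(2)[of x] by auto
 have bs: "ball x0 (2 * r * m) : sets lebesgue" by simp
 have "pa \<bullet> x0 + pb = 0 \<bullet> x0 + 0"
 proof (rule jump_zero[OF rho n(1) ext(2,3,1)])
  show "AE x in leb (ball x0 (2 * r * m)). 0 < n \<bullet> (x - x0) --> (if x : E then u x else 0) = pa \<bullet> x + pb"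
   using p(2) unfolding AE_leb[OF bs] AE_leb[OF cell_sets(2)]
  proof eventually_elim
   case (elim x)
   show ?case
   proof (intro impI)
    assume "x : ball x0 (2 * r * m)" "0 < n \<bullet> (x - x0)"
    hence xE: "x : E" unfolding Eiff by blast
    hence "x : interior T" unfolding E_def by blast
    hence "x : Om" "x : T" using cell_subset[OF T] interior_subset by blast+
    thus "(if x : E then u x else 0) = pa \<bullet> x + pb" using xE elim by (simp add: pp)
   qed
  qed
  show "AE x in leb (ball x0 (2 * r * m)). n \<bullet> (x - x0) < 0 --> (if x : E then u x else 0) = 0 \<bullet> x + 0"
   by (rule AE_I2) (auto simp: Eiff)
 qed
 thus "p x0 = 0" by (simp add: pp)
qed

lemma affine_cell_sum:
 assumes T: "T : \<T>" "x : T"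
 shows "(SUM nu:N0. c nu * hat \<T> nu x) = (SUM nu:verts T Int N0. c nu * bary T nu x)"
proof -
 have "(SUM nu:N0. c nu * hat \<T> nu x) = (SUM nu:N0. c nu * bary T nu x)" using hat_eq_bary[OF T] by simp
 also have "... = (SUM nu:verts T Int N0. c nu * bary T nu x)"
  by (rule sum.mono_neutral_right) (use finite_N0 bary_non_vert[OF simplex[OF T(1)]] in auto)
 finally show ?thesis .
qed

text \<open>By \<open>star_connected\<close> the affine pieces around a node have one common value
  at it, which is the coefficient; on \<open>gam\<close> it is 0. For independence, a vanishing
  combination is affine on each simplex and zero almost everywhere in its interior, hence zero up to
  the vertices.\<close>

lemma U_basis: "L2_basis Om (U_space Om gam \<T>) N0 (hat \<T>)"
 unfolding L2_basis_def
proof (intro conjI ballI allI impI finite_N0 hat_U)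
 fix u assume u: "u : U_space Om gam \<T>"
 have "ALL T:\<T>. EX p. is_affine p & (AE x in leb Om. x : T --> u x = p x)"
 proof
  fix T assume "T : \<T>"
  then obtain a b where "AE x in leb Om. x : T --> u x = a \<bullet> x + b" using u unfolding U_space_def by blast
  moreover have "is_affine (%x. a \<bullet> x + b)" unfolding is_affine_def by blast
  ultimately show "EX p. is_affine p & (AE x in leb Om. x : T --> u x = p x)" by blast
 qed
 then obtain p where p: "!!T. T : \<T> ==> is_affine (p T)" "!!T. T : \<T> ==> AE x in leb Om. x : T --> u x = p T x"
  by metis
 have star_eq: "p T nu = p T' nu" if "T : star nu" "T' : star nu" for T T' nu
  using star_connected[OF that]
 proof (induction rule: rtrancl_induct)
  case (step U U')
  hence a: "adj U U'" "U : \<T>" "U' : \<T>" "nu : U Int U'" by (auto simp: adj_rel_def star_def)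
  have "p U nu = p U' nu"
   by (rule U_facet_continuous[OF u a(1) p(1)[OF a(2)] p(2)[OF a(2)] p(1)[OF a(3)] p(2)[OF a(3)] a(4)])
  thus ?case using step.IH by simp
 qed simp
 define c where "c nu = p (SOME T. T : star nu) nu" for nu
 have c: "p T nu = c nu" if "T : star nu" for T nu
  unfolding c_def by (rule star_eq[OF that]) (rule someI, rule that)
 have c0: "c nu = 0" if nu: "nu : gam" for nu
 proof -
  obtain T F a where F: "T : \<T>" "F facet_of T" "nu : F" "F <= gam" "a : verts T"
   "verts F = verts T - {a}" "F = {x : T. bary T a x = 0}" by (rule gam_facet[OF nu])
  have Fs: "{x : T. bary T a x = 0} <= gam" and nuT: "nu : T" "bary T a nu = 0" using F(3,4,7) by auto
  have "p T nu = 0"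
   by (rule U_vanishes[OF u F(1,5) Fs p(1)[OF F(1)] p(2)[OF F(1)] nuT])
  moreover have "T : star nu" using F(1) nuT(1) by (simp add: star_def)
  ultimately show ?thesis using c[of T nu] by simp
 qed
 have "AE x in leb Om. ALL T:\<T>. x : T --> u x = p T x"
  using fin p(2) by (intro AE_finite_allI) auto
 hence "AE x in leb Om. u x = (SUM nu:N0. c nu * hat \<T> nu x)"
  unfolding AE_leb[OF cell_sets(2)]
 proof eventually_elim
  case (elim x)
  show ?case
  proof
   assume "x : Om"
   then obtain T where T: "T : \<T>" "x : T" using cover closure_subset by blast
   have "u x = p T x" using elim T \<open>x : Om\<close> by blast
   also have "... = (SUM nu:verts T. p T nu * bary T nu x)" by (rule affine_bary[OF simplex[OF T(1)] p(1)[OF T(1)]])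
   also have "... = (SUM nu:verts T. c nu * bary T nu x)"
   proof (rule sum.cong[OF refl])
    fix nu assume "nu : verts T"
    hence "T : star nu" using T(1) verts_subset by (auto simp: star_def)
    thus "p T nu * bary T nu x = c nu * bary T nu x" using c by simp
   qed
   also have "... = (SUM nu:verts T Int N0. c nu * bary T nu x)"
    by (rule sum.mono_neutral_right)
     (use simplex_verts(3)[OF simplex[OF T(1)]] c0 vert_node[OF T(1)] in \<open>auto simp: free_nodes_def\<close>)
   finally show "u x = (SUM nu:N0. c nu * hat \<T> nu x)" using affine_cell_sum[OF T] by simp
  qed
 qed
 thus "EX c. ae_eq Om u (%x. SUM i:N0. c i * hat \<T> i x)" unfolding ae_eq_def by blast
next
 fix c nu assume z: "ae_eq Om (%x. SUM i:N0. c i * hat \<T> i x) (%x. 0)" and nu: "nu : N0"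
 then obtain T where T: "T : \<T>" "nu : verts T" by (auto simp: free_nodes_def nodes_def)
 define q where "q x = (SUM nu:verts T Int N0. c nu * bary T nu x)" for x
 have qa: "is_affine q" unfolding q_def[abs_def] by (intro is_affine_sum is_affine_scale bary_affine simplex T)
 have qh: "(SUM i:N0. c i * hat \<T> i x) = q x" if "x : T" for x
  unfolding q_def by (rule affine_cell_sum[OF T(1) that])
 have op: "open (interior T Int {x. q x ~= 0})"
  by (intro open_Int open_interior open_Collect_neq affine_cont[OF qa] continuous_intros)
 have "AE x in lebesgue. \<not> (x : interior T Int {x. q x ~= 0})"
  using z unfolding ae_eq_def AE_leb[OF cell_sets(2)]
 proof eventually_elim
  case (elim x)
  thus ?case using cell_subset[OF T(1)] interior_subset[of T] qh[of x] by auto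
 qed
 hence "negligible (interior T Int {x. q x ~= 0})"
  using op by (simp add: negligible_iff_null_sets AE_iff_null_sets sets_completionI_sets)
 hence "interior T Int {x. q x ~= 0} = {}" using op open_not_negligible by blast
 hence "q x = 0" if "x : interior T" for x using that by blast
 hence "q x = 0" if "x : closure (interior T)" for x
  by (rule continuous_constant_on_closure[OF affine_cont[OF qa] _ that])
 hence "q nu = 0" using simplex_closure_interior[OF simplex[OF T(1)]] T(2) verts_subset by blast
 moreover have "q nu = (SUM nu':verts T Int N0. if nu' = nu then c nu' else 0)"
  unfolding q_def by (intro sum.cong) (auto simp: bary_vert[OF simplex[OF T(1)] T(2)])
 ultimately show "c nu = 0" using nu T(2) finite_N0 by (simp add: sum.delta)
qed

end

section \<open>Integrals over simplices and their corners\<close>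

definition shrink :: "real => 'a::euclidean_space => 'a set => 'a set" where
 "shrink t nu T = (%x. nu + t *\<^sub>R (x - nu)) ` T"

lemma shrink_measure:
 assumes "0 <= t"
 shows "emeasure lebesgue (shrink t nu T) = ennreal (t ^ DIM('a)) * emeasure lebesgue (T :: 'a::euclidean_space set)"
  "vol (shrink t nu T) = t ^ DIM('a) * vol T"
proof -
 have "shrink t nu T = (%x. t *\<^sub>R x + (1 - t) *\<^sub>R nu) ` T"
  unfolding shrink_def by (intro image_cong) (auto simp: algebra_simps)
 thus "emeasure lebesgue (shrink t nu T) = ennreal (t ^ DIM('a)) * emeasure lebesgue T"
  "vol (shrink t nu T) = t ^ DIM('a) * vol T"
  using emeasure_lebesgue_affine[of t "(1 - t) *\<^sub>R nu" T] measure_lebesgue_affine[of t "(1 - t) *\<^sub>R nu" T] assms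
  by (simp_all add: ennreal_power)
qed

lemma shrink_shrink: "shrink s nu (shrink t nu T) = shrink (s * t) nu T"
 unfolding shrink_def by (simp add: image_image)

context
 fixes T :: "'a::euclidean_space set"
 assumes T: "full_simplex T"
begin

lemma bary_shrink_point:
 assumes "nu : verts T"
 shows "bary T nu' (nu + t *\<^sub>R (x - nu)) = (1 - t) * (if nu = nu' then 1 else 0) + t * bary T nu' x"
proof -
 have "nu + t *\<^sub>R (x - nu) = (1 - t) *\<^sub>R nu + t *\<^sub>R x" by (simp add: algebra_simps)
 thus ?thesis
  using is_affine_at_convex[OF bary_affine[OF T], of nu' t nu x] bary_vert[OF T assms, of nu'] by simp
qed

text \<open>Corners become superlevel sets of one barycentric coordinate, the form in which their
  indicators are handled from here on.\<close>

lemma shrink_eq: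
 assumes nu: "nu : verts T" and t: "0 < t" "t <= 1"
 shows "shrink t nu T = {x : T. 1 - t <= bary T nu x}"
proof (intro equalityI subsetI)
 fix x assume "x : shrink t nu T"
 then obtain y where y: "y : T" "x = nu + t *\<^sub>R (y - nu)" unfolding shrink_def by blast
 have b: "bary T nu' x = (1 - t) * (if nu = nu' then 1 else 0) + t * bary T nu' y" for nu'
  unfolding y(2) by (rule bary_shrink_point[OF nu])
 have "x : T" unfolding mem_simplex_iff[OF T] b using t bary_nonneg[OF T y(1)] by auto
 moreover have "1 - t <= bary T nu x" unfolding b using t bary_nonneg[OF T y(1)] by auto
 ultimately show "x : {x : T. 1 - t <= bary T nu x}" by blast
next
 fix x assume x: "x : {x : T. 1 - t <= bary T nu x}"
 define y where "y = nu + (1 / t) *\<^sub>R (x - nu)"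
 have b: "bary T nu' y = (1 - 1 / t) * (if nu = nu' then 1 else 0) + (1 / t) * bary T nu' x" for nu'
  unfolding y_def by (rule bary_shrink_point[OF nu])
 have "y : T"
  unfolding mem_simplex_iff[OF T]
 proof
  fix nu' assume "nu' : verts T"
  show "0 <= bary T nu' y"
  proof (cases "nu = nu'")
   case True
   have "(1 - 1 / t) + (1 / t) * bary T nu' x = (bary T nu x - (1 - t)) / t"
    using t True by (simp add: field_simps)
   also have "... >= 0" using x t by (intro divide_nonneg_pos) auto
   finally show ?thesis unfolding b using True by simp
  next
   case False
   thus ?thesis unfolding b using t bary_nonneg[OF T] x by auto
  qed
 qed
 moreover have "x = nu + t *\<^sub>R (y - nu)" using t by (simp add: y_def)
 ultimately show "x : shrink t nu T" unfolding shrink_def by blast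
qed

lemma shrink_subset: "nu : verts T ==> 0 < t ==> t <= 1 ==> shrink t nu T <= T"
 by (simp add: shrink_eq)

lemma bary_measurable: "bary T nu : borel_measurable borel"
 by (rule borel_measurable_continuous_onI[OF affine_cont[OF bary_affine[OF T]]])

text \<open>All barycentric coordinates have the same distribution, since their superlevel sets are
 homothetic images of the simplex.\<close>

lemma bary_superlevel_measure:
 assumes nu: "nu : verts T" and s: "0 <= s"
 shows "emeasure lborel {x : interior T. s <= bary T nu x} = (if s < 1 then ennreal ((1 - s) ^ DIM('a) * vol T) else 0)"
proof (cases "s < 1")
 case True
 have sets: "{x : interior T. s <= bary T nu x} : sets borel" "{x : T. s <= bary T nu x} : sets borel"
  using bary_measurable simplex_meas(3)[OF T] by measurable
 have "emeasure lborel {x : interior T. s <= bary T nu x} = emeasure lebesgue {x : interior T. s <= bary T nu x}"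
  using sets by simp
 also have "... = emeasure lebesgue {x : T. s <= bary T nu x}"
 proof (rule emeasure_eq_AE)
  show "AE x in lebesgue. x : {x : interior T. s <= bary T nu x} \<longleftrightarrow> x : {x : T. s <= bary T nu x}"
   using simplex_boundary_null[OF T] by eventually_elim (use interior_subset in auto)
 qed (use sets in \<open>auto intro: sets_completionI_sets\<close>)
 also have "{x : T. s <= bary T nu x} = shrink (1 - s) nu T"
  using shrink_eq[OF nu, of "1 - s"] True s by simp
 also have "emeasure lebesgue (shrink (1 - s) nu T) = ennreal ((1 - s) ^ DIM('a) * vol T)"
  using True simplex_meas(1)[OF T]
  by (subst shrink_measure) (auto simp: emeasure_eq_measure2 ennreal_mult)
 finally show ?thesis using True by simp
next
 case False
 have empty: "{x : interior T. s <= bary T nu x} = {}"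
 proof -
  have "bary T nu x < 1" if x: "x : interior T" for x
  proof -
   have fin: "finite (verts T)" by (rule simplex_verts(3)[OF T])
   have "card (verts T - {nu}) = DIM('a)" using nu simplex_card[OF T] fin by simp
   hence "card (verts T - {nu}) ~= 0" by simp
   then obtain w where w: "w : verts T - {nu}" by (metis card.empty ex_in_conv)
   have "0 < bary T w x" using w x mem_interior_simplex_iff[OF T] by blast
   also have "... <= (SUM v:verts T - {nu}. bary T v x)"
    using w fin x mem_interior_simplex_iff[OF T] by (intro member_le_sum) (auto simp: less_imp_le)
   also have "... = 1 - bary T nu x" using bary_sum[OF T, of x] fin nu by (simp add: sum_diff1)
   finally show ?thesis by simp
  qed
  thus ?thesis using False by force
 qed
 show ?thesis unfolding empty using False by simp
qed

lemma bary_integrable: "integrable (leb (interior T)) (bary T nu)"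
proof -
 have "bary T nu : L2 (interior T)"
  using simplex_meas(2)[OF T] bounded_subset[OF simplex_bounded[OF T] interior_subset]
  by (intro cont_L2 affine_cont bary_affine[OF T]) (auto simp: fmeasurableD)
 from L2_mult_int[OF this const_L2[OF simplex_meas(2)[OF T], of 1]] show ?thesis by simp
qed

text \<open>The integral is the measure of the region \<open>W\<close> under the graph, sliced the
  other way. What matters is that the result does not depend on \<open>nu\<close>.\<close>

lemma bary_integral_layer_cake:
 assumes nu: "nu : verts T"
 shows "ennreal (lint (interior T) (bary T nu))
  = (\<integral>\<^sup>+s. indicator {0..} s * (if s < 1 then ennreal ((1 - s) ^ DIM('a) * vol T) else 0) \<partial>lborel)"
proof -
 define W where "W = {p :: 'a \<times> real. fst p : interior T} Int {p. snd p <= bary T nu (fst p)} Int {p. 0 <= snd p}"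
 have "open {p :: 'a \<times> real. fst p : interior T}"
  using open_vimage_fst[OF open_interior[of T]] by (simp add: vimage_def)
 moreover have "closed {p :: 'a \<times> real. snd p <= bary T nu (fst p)}"
  by (intro closed_Collect_le continuous_intros continuous_on_compose2[OF affine_cont[OF bary_affine[OF T], of UNIV]]) auto
 moreover have "closed {p :: 'a \<times> real. 0 <= snd p}" by (intro closed_Collect_le continuous_intros)
 ultimately have W: "W : sets borel" unfolding W_def by (intro sets.Int borel_open borel_closed)
 have ms: "{x : interior T. s <= bary T nu x} : sets borel" for s
  using bary_measurable by measurable
 have "ennreal (lint (interior T) (bary T nu))
   = ennreal (lint (interior T) (%x. max 0 (bary T nu x)))"
  by (intro arg_cong[where f = ennreal] lint_cong)
    (use interior_subset[of T] bary_nonneg[OF T] in \<open>auto simp: max_def\<close>)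
 also have "... = (\<integral>\<^sup>+x. ennreal (indicator (interior T) x * max 0 (bary T nu x)) \<partial>lborel)"
  by (rule nn_integral_eq_integral_on[symmetric]) (use bary_integrable bary_measurable in \<open>auto intro!: integrable_max borel_measurable_max\<close>)
 also have "... = (\<integral>\<^sup>+x. \<integral>\<^sup>+s. indicator W (x, s) \<partial>lborel \<partial>lborel)"
 proof (rule nn_integral_cong)
  fix x
  have "(\<integral>\<^sup>+s. indicator W (x, s) \<partial>lborel)
    = (\<integral>\<^sup>+s. indicator (interior T) x * indicator {0..bary T nu x} s \<partial>lborel)"
   by (rule nn_integral_cong) (auto simp: indicator_def W_def)
  also have "... = indicator (interior T) x * emeasure lborel {0..bary T nu x}"
   by (rule nn_integral_cmult_indicator) simp
  also have "... = ennreal (indicator (interior T) x * max 0 (bary T nu x))"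
   by (auto simp: indicator_def max_def)
  finally show "ennreal (indicator (interior T) x * max 0 (bary T nu x))
    = (\<integral>\<^sup>+s. indicator W (x, s) \<partial>lborel)" by simp
 qed
 also have "... = (\<integral>\<^sup>+s. \<integral>\<^sup>+x. indicator W (x, s) \<partial>lborel \<partial>lborel)"
  by (rule lborel_pair.Fubini'[symmetric]) (use W in \<open>simp add: lborel_prod\<close>)
 also have "... = (\<integral>\<^sup>+s. indicator {0..} s * emeasure lborel {x : interior T. s <= bary T nu x} \<partial>lborel)"
 proof (intro nn_integral_cong)
  fix s :: real
  have "(\<integral>\<^sup>+x. indicator W (x, s) \<partial>lborel)
    = (\<integral>\<^sup>+x. indicator {0..} s * indicator {x : interior T. s <= bary T nu x} x \<partial>lborel)"
   by (rule nn_integral_cong) (auto simp: indicator_def W_def)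
  also have "... = indicator {0..} s * emeasure lborel {x : interior T. s <= bary T nu x}"
   by (rule nn_integral_cmult_indicator) (simp add: ms)
  finally show "(\<integral>\<^sup>+x. indicator W (x, s) \<partial>lborel)
    = indicator {0..} s * emeasure lborel {x : interior T. s <= bary T nu x}" .
 qed
 also have "... = (\<integral>\<^sup>+s. indicator {0..} s * (if s < 1 then ennreal ((1 - s) ^ DIM('a) * vol T) else 0) \<partial>lborel)"
  by (intro nn_integral_cong) (auto simp: indicator_def bary_superlevel_measure[OF nu])
 finally show ?thesis .
qed

text \<open>The \<open>d + 1\<close> coordinates have equal integrals and add up to 1, so each
  receives the same share of the volume; no integral has to be evaluated.\<close>

lemma bary_integral:
 assumes nu: "nu : verts T"
 shows "lint (interior T) (bary T nu) = vol T / (real DIM('a) + 1)"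
proof -
 let ?I = "%nu. lint (interior T) (bary T nu)"
 have pos: "0 <= ?I nu'" for nu'
  by (rule integral_nonneg_AE, rule AE_I2) (use interior_subset[of T] bary_nonneg[OF T] in auto)
 have eq: "?I nu' = ?I nu" if "nu' : verts T" for nu'
 proof -
  have "ennreal (?I nu') = ennreal (?I nu)"
   unfolding bary_integral_layer_cake[OF that] bary_integral_layer_cake[OF nu] ..
  thus ?thesis by (subst (asm) ennreal_inj) (use pos in auto)
 qed
 have "real (card (verts T)) * ?I nu = (SUM nu':verts T. ?I nu')" using eq by simp
 also have "... = lint (interior T) (%x. SUM nu':verts T. bary T nu' x)"
  by (rule Bochner_Integration.integral_sum[symmetric]) (rule bary_integrable)
 also have "... = vol T"
  using simplex_meas(2)[OF T] vol_interior[OF T]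
  by (simp add: bary_sum[OF T] measure_restrict_space fmeasurableD)
 finally show ?thesis using simplex_card[OF T] by (simp add: field_simps)
qed

lemma affine_integral:
 assumes f: "is_affine f"
 shows "lint (interior T) f = vol T / (real DIM('a) + 1) * (SUM nu:verts T. f nu)"
proof -
 have "lint (interior T) f = lint (interior T) (%x. SUM nu:verts T. f nu * bary T nu x)"
  by (simp flip: affine_bary[OF T f])
 also have "... = (SUM nu:verts T. lint (interior T) (%x. f nu * bary T nu x))"
  by (rule Bochner_Integration.integral_sum) (intro integrable_mult_right bary_integrable)
 also have "... = (SUM nu:verts T. f nu * (vol T / (real DIM('a) + 1)))"
  by (intro sum.cong refl) (simp add: bary_integral)
 finally show ?thesis unfolding sum_distrib_right[symmetric] by (simp only: mult.commute)
qed

lemma shrink_verts: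
 assumes nu: "nu : verts T" and t: "0 < t" and S: "full_simplex (shrink t nu T)"
 shows "verts (shrink t nu T) = (%x. nu + t *\<^sub>R (x - nu)) ` verts T" "inj (%x. nu + t *\<^sub>R (x - nu))"
proof -
 let ?h = "%x. nu + t *\<^sub>R (x - nu)"
 show inj: "inj ?h" using t by (auto simp: inj_on_def)
 have h: "?h = (%x. (1 - t) *\<^sub>R nu + t *\<^sub>R x)" by (auto simp: algebra_simps)
 have "shrink t nu T = convex hull (?h ` verts T)"
 proof -
  have "shrink t nu T = ?h ` (convex hull verts T)" unfolding shrink_def using simplex_verts(2)[OF T] by simp
  also have "... = convex hull (?h ` verts T)" unfolding h by (rule convex_hull_affinity[symmetric])
  finally show ?thesis .
 qed
 hence sub: "verts (shrink t nu T) <= ?h ` verts T"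
  unfolding verts_def using extreme_point_of_convex_hull by auto
 have "card (?h ` verts T) = card (verts T)" by (rule card_image[OF inj_on_subset[OF inj]]) auto
 hence "card (?h ` verts T) = card (verts (shrink t nu T))" using simplex_card[OF T] simplex_card[OF S] by simp
 thus "verts (shrink t nu T) = ?h ` verts T"
  using sub simplex_verts(3)[OF T] by (intro card_subset_eq) auto
qed

end

text \<open>An affine function integrates to the volume times its average over the vertices. Those
  of the corner are \<open>nu\<close> and the midpoints of the edges at \<open>nu\<close>, so the
  values of a coordinate at them add up to \<open>1/2\<close>, or to \<open>(d + 2) / 2\<close> if
  it is the coordinate of \<open>nu\<close>.\<close>

lemma corner_bary_integral:
 fixes T :: "'a::euclidean_space set"
 assumes T: "full_simplex T" and nu: "nu : verts T" and S: "full_simplex (shrink (1/2) nu T)" and nu': "nu' : verts T"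
 shows "lint (interior (shrink (1/2) nu T)) (bary T nu')
  = vol T / (2 * 2 ^ DIM('a) * (real DIM('a) + 1)) * ((if nu = nu' then real DIM('a) + 1 else 0) + 1)"
proof -
 have card: "card (verts T) = Suc DIM('a)" by (rule simplex_card[OF T])
 have fin: "finite (verts T)" by (rule simplex_verts(3)[OF T])
 have inj: "inj_on (%x. nu + (1/2::real) *\<^sub>R (x - nu)) (verts T)"
  using shrink_verts(2)[OF T nu _ S] inj_on_subset by force
 have "(SUM v:verts (shrink (1/2) nu T). bary T nu' v) = (SUM v:verts T. bary T nu' (nu + (1/2) *\<^sub>R (v - nu)))"
  unfolding shrink_verts(1)[OF T nu half_gt_zero[OF zero_less_one] S] by (rule sum.reindex_cong[OF inj]) auto
 also have "... = (SUM v:verts T. (1/2) * (if nu = nu' then 1 else 0) + (1/2) * (if v = nu' then 1 else 0))"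
  unfolding bary_shrink_point[OF T nu] by (intro sum.cong refl) (auto simp: bary_vert[OF T])
 also have "... = real (card (verts T)) * ((1/2) * (if nu = nu' then 1 else 0)) + (1/2) * (SUM v:verts T. if v = nu' then 1 else 0)"
  by (simp only: sum.distrib sum_distrib_left[symmetric] sum_constant)
 also have "... = ((if nu = nu' then real DIM('a) + 1 else 0) + 1) / 2"
  using fin nu' card by (simp add: sum.delta)
 finally have s: "(SUM v:verts (shrink (1/2) nu T). bary T nu' v) = ((if nu = nu' then real DIM('a) + 1 else 0) + 1) / 2" .
 show ?thesis
  unfolding affine_integral[OF S bary_affine[OF T]] s by (simp add: shrink_measure power_divide)
qed

section \<open>The biorthogonal projector\<close>

text \<open>As a function of a barycentric coordinate this is the indicator of a corner, with
  \<open>s = 1/2\<close> for the first refinement and \<open>s = 3/4\<close> for the second.\<close>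

definition step :: "real => real => real" where
 "step s t = (if s <= t then 1 else 0)"

lemma step_cases: "step s t = 0 \<or> step s t = 1"
 by (simp add: step_def)

lemma AE_bary_neq:
 fixes T :: "'a::euclidean_space set"
 assumes T: "full_simplex T" and mu: "mu : verts T"
 shows "AE x in lebesgue. bary T mu x ~= s"
proof -
 obtain a b where ab: "!!x. bary T mu x = a \<bullet> x + b" using bary_affine[OF T] unfolding is_affine_def by metis
 have fin: "finite (verts T)" by (rule simplex_verts(3)[OF T])
 have "card (verts T - {mu}) = DIM('a)" using mu simplex_card[OF T] fin by simp
 hence "card (verts T - {mu}) ~= 0" by simp
 then obtain w where w: "w : verts T - {mu}" by (metis card.empty ex_in_conv)
 have "a ~= 0"
  using ab[of mu] ab[of w] bary_vert[OF T mu, of mu] bary_vert[OF T, of w mu] w by auto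
 hence "negligible {x. a \<bullet> x = s - b}" by (intro negligible_hyperplane) auto
 hence "{x. a \<bullet> x = s - b} : null_sets lebesgue" by (simp add: negligible_iff_null_sets)
 thus ?thesis by (rule AE_I'[rotated 0]) (auto simp: ab)
qed

lemma step_measurable:
 assumes "full_simplex T"
 shows "(%x. step s (bary T nu x)) : borel_measurable borel"
 unfolding step_def using bary_measurable[OF assms] by measurable

lemma red_refD:
 fixes A B :: "'a::euclidean_space set set"
 assumes "red_refinement A B"
 shows "S : B ==> full_simplex S" "S : B ==> EX T:A. S <= T"
  "S : B ==> S' : B ==> S ~= S' ==> interior S Int interior S' = {}"
  "T : A ==> card {S : B. S <= T} = 2 ^ DIM('a)" "T : A ==> \<Union>{S\<in>B. S <= T} = T"
  "T : A ==> S : B ==> S <= T ==> vol S = vol T / 2 ^ DIM('a)"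
  "T : A ==> nu : verts T ==> {S : B. S <= T & nu : S} = {shrink (1/2) nu T}"
proof -
 note d = assms[unfolded red_refinement_def, folded shrink_def]
 note d1 = conjunct1[OF d] and d2 = conjunct1[OF conjunct2[OF d]] and d3 = conjunct2[OF conjunct2[OF d]]
 show "S : B ==> full_simplex S" "S : B ==> EX T:A. S <= T" using bspec[OF d1] by blast+
 show "S : B ==> S' : B ==> S ~= S' ==> interior S Int interior S' = {}" using bspec[OF d2] by blast
 show "T : A ==> card {S : B. S <= T} = 2 ^ DIM('a)" by (drule bspec[OF d3]) (elim conjE)
 show "T : A ==> \<Union>{S\<in>B. S <= T} = T" by (drule bspec[OF d3]) (elim conjE)
 show "T : A ==> S : B ==> S <= T ==> vol S = vol T / 2 ^ DIM('a)"
  by (drule bspec[OF d3]) (elim conjE, drule(1) bspec, erule(1) mp)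
 show "T : A ==> nu : verts T ==> {S : B. S <= T & nu : S} = {shrink (1/2) nu T}"
  by (drule bspec[OF d3]) (elim conjE, erule(1) bspec)
qed

section \<open>Corners, patches and dual functions on a refined mesh\<close>

locale refined_mesh = mesh_bc +
 fixes \<S> \<S>' :: "'a set set"
 assumes ref: "red_refinement \<T> \<S>" and ref': "red_refinement \<S> \<S>'"
begin

lemma corner_set:
 assumes "T : \<T>" "nu : verts T"
 shows "{S : \<S>. S <= T & nu : S} = {shrink (1/2) nu T}"
 by (rule red_refD(7)[OF ref assms])

lemma corner_mem:
 assumes "T : \<T>" "nu : verts T"
 shows "shrink (1/2) nu T : \<S>" "nu : shrink (1/2) nu T"
 using corner_set[OF assms] by auto

lemma corner_eq:
 assumes "T : \<T>" "nu : verts T"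
 shows "corner \<S> T nu = shrink (1/2) nu T"
 unfolding corner_def by (rule the_equality) (use corner_set[OF assms] in auto)

lemma corner_simplex:
 assumes "T : \<T>" "nu : verts T"
 shows "full_simplex (shrink (1/2) nu T)"
 by (rule red_refD(1)[OF ref corner_mem(1)[OF assms]])

lemmas refine_parent = red_refD(2)[OF ref] red_refD(2)[OF ref']
lemmas refine_simplex = red_refD(1)[OF ref] red_refD(1)[OF ref']

lemma finite_children:
 fixes A B :: "'a set set"
 assumes "red_refinement A B" "finite A"
 shows "finite B"
proof -
 have "finite {S : B. S <= T}" if "T : A" for T
 proof (rule ccontr)
  assume "infinite {S : B. S <= T}"
  hence "card {S : B. S <= T} = 0" by simp
  moreover have "card {S : B. S <= T} = 2 ^ DIM('a)" by (rule red_refD(4)[OF assms(1) that])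
  ultimately show False by simp
 qed
 hence "finite (\<Union>T\<in>A. {S : B. S <= T})" using assms(2) by blast
 moreover have "B <= (\<Union>T\<in>A. {S : B. S <= T})" using red_refD(2)[OF assms(1)] by blast
 ultimately show ?thesis by (rule finite_subset[rotated])
qed

lemma finite_refine: "finite \<S>" "finite \<S>'"
 using finite_children[OF ref fin] finite_children[OF ref'] by blast+

lemma N0_node: "nu : N0 ==> nu : nodes \<T>"
 by (simp add: free_nodes_def)

lemma refined_corner:
 assumes "S : \<S>" "nu : S" "nu : nodes \<T>"
 obtains T where "T : \<T>" "nu : verts T" "S = shrink (1/2) nu T"
proof -
 obtain T where T: "T : \<T>" "S <= T" using refine_parent(1)[OF assms(1)] by blast
 hence v: "nu : verts T" using node_vert[OF assms(3)] assms(2) by blast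
 have "S : {S : \<S>. S <= T & nu : S}" using assms T by blast
 hence "S = shrink (1/2) nu T" using corner_set[OF T(1) v] by blast
 thus thesis using that T v by blast
qed

lemma refined_corner':
 assumes "S' : \<S>'" "nu : S'" "nu : nodes \<T>"
 obtains T where "T : \<T>" "nu : verts T" "S' = shrink (1/4) nu T"
proof -
 obtain S where S: "S : \<S>" "S' <= S" using refine_parent(2)[OF assms(1)] by blast
 obtain T where T: "T : \<T>" "nu : verts T" "S = shrink (1/2) nu T"
  using refined_corner[OF S(1) _ assms(3)] assms(2) S(2) by blast
 \<comment> \<open>An extreme point of \<open>T\<close> is an extreme point of every subset that
   contains it, so the second refinement has a corner at \<open>nu\<close> as well.\<close>
 have "nu : verts S"
  using T(2) corner_mem(2)[OF T(1,2)] shrink_subset[OF simplex[OF T(1)] T(2), of "1/2"] unfolding T(3) verts_def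
  by (auto simp: extreme_point_of_def)
 hence "{S' : \<S>'. S' <= S & nu : S'} = {shrink (1/2) nu S}"
  by (rule red_refD(7)[OF ref' S(1)])
 hence "S' = shrink (1/2) nu S" using assms S(2) by blast
 hence "S' = shrink (1/4) nu T" unfolding T(3) shrink_shrink by simp
 with T show thesis using that by blast
qed

lemma corner_mem':
 assumes "T : \<T>" "nu : verts T"
 shows "shrink (1/4) nu T : \<S>'" "nu : shrink (1/4) nu T"
proof -
 let ?S = "shrink (1/2) nu T"
 have "nu : verts ?S"
  using assms(2) corner_mem(2)[OF assms] shrink_subset[OF simplex[OF assms(1)] assms(2), of "1/2"] unfolding verts_def
  by (auto simp: extreme_point_of_def)
 hence "{S' : \<S>'. S' <= ?S & nu : S'} = {shrink (1/2) nu ?S}"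
  by (rule red_refD(7)[OF ref' corner_mem(1)[OF assms]])
 thus "shrink (1/4) nu T : \<S>'" "nu : shrink (1/4) nu T" unfolding shrink_shrink by auto
qed

text \<open>By conformity a refined simplex that contains a coarse node is a corner of a coarse
  simplex; the homothety ratios 1/2 and 1/4 give the heights \<open>1 - 1/2\<close> and
  \<open>1 - 1/4\<close>.\<close>

lemma patch_refined_iff:
 assumes T: "T : \<T>" "x : interior T" and nu: "nu : nodes \<T>"
 shows "x : patch \<S> nu \<longleftrightarrow> nu : verts T & 1/2 <= bary T nu x"
  "x : patch \<S>' nu \<longleftrightarrow> nu : verts T & 3/4 <= bary T nu x"
proof -
 have xT: "x : T" using T(2) interior_subset by blast
 have same: "T' = T" if "T' : \<T>" "x : T'" for T'
  using interior_disjoint[OF T(1) that(1)] T(2) that(2) by blast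
 show "x : patch \<S> nu \<longleftrightarrow> nu : verts T & 1/2 <= bary T nu x"
 proof
  assume "x : patch \<S> nu"
  then obtain S where S: "S : \<S>" "nu : S" "x : S" unfolding patch_def by blast
  obtain T' where T': "T' : \<T>" "nu : verts T'" "S = shrink (1/2) nu T'" using refined_corner[OF S(1,2) nu] by blast
  have "x : T'" "1 - 1/2 <= bary T' nu x" using S(3) shrink_eq[OF simplex[OF T'(1)] T'(2), of "1/2"] T'(3) by auto
  thus "nu : verts T & 1/2 <= bary T nu x" using same[OF T'(1)] T'(2) by simp
 next
  assume a: "nu : verts T & 1/2 <= bary T nu x"
  hence "x : shrink (1/2) nu T" using shrink_eq[OF simplex[OF T(1)], of nu "1/2"] xT by simp
  thus "x : patch \<S> nu" using corner_mem[OF T(1)] a unfolding patch_def by blast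
 qed
 show "x : patch \<S>' nu \<longleftrightarrow> nu : verts T & 3/4 <= bary T nu x"
 proof
  assume "x : patch \<S>' nu"
  then obtain S where S: "S : \<S>'" "nu : S" "x : S" unfolding patch_def by blast
  obtain T' where T': "T' : \<T>" "nu : verts T'" "S = shrink (1/4) nu T'" using refined_corner'[OF S(1,2) nu] by blast
  have "x : T'" "1 - 1/4 <= bary T' nu x" using S(3) shrink_eq[OF simplex[OF T'(1)] T'(2), of "1/4"] T'(3) by auto
  thus "nu : verts T & 3/4 <= bary T nu x" using same[OF T'(1)] T'(2) by simp
 next
  assume a: "nu : verts T & 3/4 <= bary T nu x"
  hence "x : shrink (1/4) nu T" using shrink_eq[OF simplex[OF T(1)], of nu "1/4"] xT by simp
  thus "x : patch \<S>' nu" using corner_mem'[OF T(1)] a unfolding patch_def by blast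
 qed
qed

text \<open>\<open>dual_hat\<close> sums over the simplices contained in a patch; an interior point
  identifies each of them as a member of the star.\<close>

lemma star_patch:
 assumes "nu : nodes \<T>"
 shows "{T : \<T>. T <= patch \<T> nu} = star nu"
proof (intro equalityI subsetI)
 fix T assume "T : {T : \<T>. T <= patch \<T> nu}"
 hence T: "T : \<T>" "T <= patch \<T> nu" by auto
 obtain x where x: "x : interior T" using interior_nonempty[OF simplex[OF T(1)]] by blast
 then obtain T' where "T' : \<T>" "nu : T'" "x : T'" using T(2) interior_subset unfolding patch_def by blast
 thus "T : star nu" using interior_disjoint[OF T(1), of T'] x by (auto simp: star_def)
qed (auto simp: star_def patch_def)

lemma star_verts: "nu : nodes \<T> ==> T : star nu \<longleftrightarrow> T : \<T> & nu : verts T"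
 using node_vert verts_subset by (auto simp: star_def)

definition dual_local :: "'a set => 'a => 'a => real" where
 "dual_local T nu x = 1 / (real DIM('a) + 1) *
   (1 + real DIM('a) * 2 ^ (1 + DIM('a)) / (real DIM('a) + 1) * step (1/2) (bary T nu x)
   - 2 ^ (1 + DIM('a)) / (real DIM('a) + 1) * (SUM nu':verts T - {nu}. step (1/2) (bary T nu' x)))"

lemma dual_hat_on:
 assumes T: "T : \<T>" "x : interior T" and nu: "nu : nodes \<T>"
 shows "dual_hat \<T> \<S> nu x = (if nu : verts T then dual_local T nu x else 0)"
proof -
 have xT: "x : T" using T(2) interior_subset by blast
 have not: "x ~: T'" if "T' : \<T>" "T' ~= T" for T'
  using interior_disjoint[OF T(1) that(1)] T(2) that(2) by blast
 have corner_out: "x ~: corner \<S> T' nu'" if "T' : \<T>" "T' ~= T" "nu' : verts T'" for T' nu'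
  using not[OF that(1,2)] shrink_subset[OF simplex[OF that(1)] that(3), of "1/2"] by (auto simp: corner_eq[OF that(1,3)])
 have corner_in: "indicator (corner \<S> T nu') x = step (1/2) (bary T nu' x)" if "nu' : verts T" for nu'
  using shrink_eq[OF simplex[OF T(1)] that, of "1/2"] xT by (simp add: corner_eq[OF T(1) that] step_def indicator_def)
 define t where "t T' = indicator T' x
    + real DIM('a) * 2 ^ (1 + DIM('a)) / (real DIM('a) + 1) * indicator (corner \<S> T' nu) x
    - 2 ^ (1 + DIM('a)) / (real DIM('a) + 1) *
      (SUM nu':verts T' - {nu}. indicator (corner \<S> T' nu') x)" for T'
 have d: "dual_hat \<T> \<S> nu x = 1 / (real DIM('a) + 1) * (SUM T':star nu. t T')"
  unfolding dual_hat_def star_patch[OF nu] t_def ..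
 have t0: "t T' = 0" if "T' : star nu" "T' ~= T" for T'
 proof -
  have T': "T' : \<T>" "nu : verts T'" using that(1) star_verts[OF nu] by auto
  show ?thesis unfolding t_def using not[OF T'(1) that(2)] corner_out[OF T'(1) that(2)] T'(2) by simp
 qed
 show ?thesis
 proof (cases "nu : verts T")
  case True
  hence "T : star nu" using star_verts[OF nu] T(1) by simp
  hence "(SUM T':star nu. t T') = t T"
   using t0 by (subst sum.remove[OF finite_star]) auto
  also have "t T = 1 + real DIM('a) * 2 ^ (1 + DIM('a)) / (real DIM('a) + 1) * step (1/2) (bary T nu x)
   - 2 ^ (1 + DIM('a)) / (real DIM('a) + 1) * (SUM nu':verts T - {nu}. step (1/2) (bary T nu' x))"
  proof -
   have "(SUM nu':verts T - {nu}. indicator (corner \<S> T nu') x) = (SUM nu':verts T - {nu}. step (1/2) (bary T nu' x))"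
    by (intro sum.cong refl corner_in) auto
   thus ?thesis unfolding t_def corner_in[OF True] using xT by simp
  qed
  finally show ?thesis using True unfolding d dual_local_def by simp
 next
  case False
  hence "T ~: star nu" using star_verts[OF nu] by simp
  hence "(SUM T':star nu. t T') = 0" using t0 by (intro sum.neutral) auto
  thus ?thesis using False d by simp
 qed
qed

definition theta_local :: "'a set => 'a => 'a => real" where
 "theta_local T nu x = 2 ^ (DIM('a) + 2) / (real DIM('a) + 2) *
   (2 ^ DIM('a) * step (3/4) (bary T nu x) - step (1/2) (bary T nu x))"

lemma theta_on:
 assumes T: "T : \<T>" "x : interior T" and nu: "nu : nodes \<T>"
 shows "theta \<S> \<S>' nu x = (if nu : verts T then theta_local T nu x else 0)"
 unfolding theta_def theta_local_def using patch_refined_iff[OF assms] by (simp add: indicator_def step_def)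

lemma theta_local_nonzero: "theta_local T nu x ~= 0 ==> 1/2 <= bary T nu x"
 by (auto simp: theta_local_def step_def split: if_splits)

lemma patch_borel: "patch \<S> nu : sets borel" "patch \<S>' nu : sets borel"
 unfolding patch_def using finite_refine simplex_compact[OF refine_simplex(1)] simplex_compact[OF refine_simplex(2)]
 by (auto intro!: sets.finite_Union borel_compact)

lemma theta_measurable: "theta \<S> \<S>' nu : borel_measurable borel"
 unfolding theta_def[abs_def] using patch_borel[of nu] by measurable

lemma theta_L2: "theta \<S> \<S>' nu : L2 Om"
proof (rule L2_bounded[OF dom_meas])
 show "theta \<S> \<S>' nu : borel_measurable (leb Om)"
  by (intro measurable_restrict_space1 borel_imp_lebesgue theta_measurable)
 show "norm (theta \<S> \<S>' nu x) <= 2 ^ (DIM('a) + 2) / (real DIM('a) + 2) * 2 ^ DIM('a)" for x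
 proof -
  have "\<bar>(2::real) ^ DIM('a) * indicator (patch \<S>' nu) x - indicator (patch \<S> nu) x\<bar> <= 2 ^ DIM('a)"
   using one_le_power[of "2::real" "DIM('a)"] by (auto simp: indicator_def)
  thus ?thesis unfolding theta_def real_norm_def abs_mult by (intro mult_mono) auto
 qed
qed

lemma dual_local_bound:
 assumes T: "T : \<T>" and nu: "nu : verts T"
 shows "\<bar>dual_local T nu x\<bar> <= 1 + 4 * 2 ^ DIM('a)"
proof -
 let ?D = "real DIM('a) + 1" and ?P = "(2::real) ^ DIM('a)"
 have fin: "finite (verts T)" by (rule simplex_verts(3)[OF simplex[OF T]])
 have card: "card (verts T - {nu}) = DIM('a)" using nu simplex_card[OF simplex[OF T]] fin by simp
 have s: "0 <= step (1/2) t" "step (1/2) t <= 1" for t by (auto simp: step_def)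
 have sum: "0 <= (SUM nu':verts T - {nu}. step (1/2) (bary T nu' x))" "(SUM nu':verts T - {nu}. step (1/2) (bary T nu' x)) <= real DIM('a)"
  using s sum_bounded_above[of "verts T - {nu}" "%nu'. step (1/2) (bary T nu' x)" 1] card by (auto intro: sum_nonneg)
 have dD: "real DIM('a) / ?D <= 1" "1 / ?D <= 1" "0 < ?D" by auto
 define A where "A = real DIM('a) * 2 ^ (1 + DIM('a)) / ?D * step (1/2) (bary T nu x)"
 define B where "B = 2 ^ (1 + DIM('a)) / ?D * (SUM nu':verts T - {nu}. step (1/2) (bary T nu' x))"
 have A: "0 <= A" "A <= 2 * ?P"
 proof -
  show "0 <= A" unfolding A_def using s by simp
  have "A = (real DIM('a) / ?D) * step (1/2) (bary T nu x) * (2 * ?P)" by (simp add: A_def)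
  also have "... <= 1 * 1 * (2 * ?P)" using dD s by (intro mult_mono) auto
  finally show "A <= 2 * ?P" by simp
 qed
 have B: "0 <= B" "B <= 2 * ?P"
 proof -
  show "0 <= B" unfolding B_def using sum by simp
  have "B <= 2 ^ (1 + DIM('a)) / ?D * real DIM('a)" unfolding B_def using sum by (intro mult_left_mono) auto
  also have "... = (real DIM('a) / ?D) * (2 * ?P)" by simp
  also have "... <= 1 * (2 * ?P)" using dD by (intro mult_right_mono) auto
  finally show "B <= 2 * ?P" by simp
 qed
 have "\<bar>dual_local T nu x\<bar> = \<bar>1 / ?D\<bar> * \<bar>1 + A - B\<bar>" unfolding dual_local_def A_def B_def by (rule abs_mult)
 also have "... <= 1 * (1 + 4 * ?P)" using A B dD by (intro mult_mono) auto
 finally show ?thesis by simp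
qed

lemma AE_cells: "AE x in leb Om. EX T:\<T>. x : interior T"
 unfolding AE_leb[OF cell_sets(2)] using AE_interior by eventually_elim (use closure_subset in blast)

lemma dual_hat_measurable:
 assumes "nu : nodes \<T>"
 shows "dual_hat \<T> \<S> nu : borel_measurable borel"
proof -
 have m: "T : sets borel" "!!nu'. nu' : verts T ==> corner \<S> T nu' : sets borel" "nu : verts T" if "T : star nu" for T
  using that simplex_meas(3)[OF simplex] simplex_meas(3)[OF corner_simplex] star_verts[OF assms] corner_eq
  by auto
 show ?thesis
  unfolding dual_hat_def[abs_def] star_patch[OF assms]
  by (intro borel_measurable_times borel_measurable_sum borel_measurable_add borel_measurable_diff
    borel_measurable_const borel_measurable_indicator m) (use m in auto)
qed

lemma dual_hat_bound: "nu : nodes \<T> ==> AE x in leb Om. \<bar>dual_hat \<T> \<S> nu x\<bar> <= 1 + 4 * 2 ^ DIM('a)"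
 using AE_cells
proof eventually_elim
 case (elim x)
 then obtain T where T: "T : \<T>" "x : interior T" by blast
 show ?case
  using dual_hat_on[OF T elim(1)] dual_local_bound[OF T(1), of nu x] by simp
qed

lemma dual_hat_L2:
 assumes "nu : nodes \<T>"
 shows "dual_hat \<T> \<S> nu : L2 Om"
proof -
 have m: "dual_hat \<T> \<S> nu : borel_measurable (leb Om)"
  by (intro measurable_restrict_space1 borel_imp_lebesgue dual_hat_measurable assms)
 have "integrable (leb Om) (%x. (norm (dual_hat \<T> \<S> nu x))^2)"
 proof (rule Bochner_Integration.integrable_bound[OF int_const[OF dom_meas, of "(1 + 4 * 2 ^ DIM('a))^2 :: real"]])
  show "(%x. (norm (dual_hat \<T> \<S> nu x))^2) : borel_measurable (leb Om)" using m by measurable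
  show "AE x in leb Om. norm ((norm (dual_hat \<T> \<S> nu x))^2) <= norm ((1 + 4 * 2 ^ DIM('a))^2 :: real)"
   using dual_hat_bound[OF assms]
  proof eventually_elim
   case (elim x)
   hence "\<bar>dual_hat \<T> \<S> nu x\<bar>^2 <= (1 + 4 * 2 ^ DIM('a))^2" by (intro power_mono) auto
   thus ?case by simp
  qed
 qed
 thus ?thesis using m by (simp add: L2_def)
qed

lemma corner_step_integral:
 assumes T: "T : \<T>" and mu: "mu : verts T" and f: "is_affine f"
 shows "lint (interior T) (%x. step (1/2) (bary T mu x) * f x)
   = lint (interior (shrink (1/2) mu T)) f"
  "integrable (leb (interior T)) (%x. step (1/2) (bary T mu x) * f x)"
proof -
 let ?H = "shrink (1/2) mu T"
 have HT: "?H <= T" by (rule shrink_subset[OF simplex[OF T] mu]) auto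
 hence sub: "interior ?H <= interior T" by (rule interior_mono)
 have L: "f : L2 (interior T)"
  using bounded_subset[OF simplex_bounded[OF simplex[OF T]] interior_subset] cell_sets(1)[OF T]
  by (intro cont_L2 affine_cont f)
 have sm: "(%x. step (1/2) (bary T mu x)) : borel_measurable (leb (interior T))"
  by (intro measurable_restrict_space1 borel_imp_lebesgue step_measurable[OF simplex[OF T]])
 have L2: "(%x. step (1/2) (bary T mu x) * f x) : L2 (interior T)"
  by (rule L2_mult_bounded[OF L sm, of 1]) (auto simp: step_def)
 show "integrable (leb (interior T)) (%x. step (1/2) (bary T mu x) * f x)"
  using L2_mult_int[OF L2 const_L2[OF simplex_meas(2)[OF simplex[OF T]], of 1]] by simp
 have Hs: "interior ?H : sets lebesgue" by (auto intro: sets_completionI_sets)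
 have "lint (interior T) (%x. step (1/2) (bary T mu x) * f x)
   = lint (interior T) (%x. if x : interior ?H then f x else 0)"
 proof (rule integral_cong_AE)
  show "(%x. step (1/2) (bary T mu x) * f x) : borel_measurable (leb (interior T))" by (rule L2_meas[OF L2])
  have "(%x. if x : interior ?H then f x else 0) : borel_measurable borel"
   using borel_measurable_continuous_onI[OF affine_cont[OF f]] by measurable
  thus "(%x. if x : interior ?H then f x else 0) : borel_measurable (leb (interior T))"
   by (intro measurable_restrict_space1 borel_imp_lebesgue)
  show "AE x in leb (interior T). step (1/2) (bary T mu x) * f x = (if x : interior ?H then f x else 0)"
   unfolding AE_leb[OF cell_sets(1)[OF T]] using simplex_boundary_null[OF corner_simplex[OF T mu]]
  proof eventually_elim
   case (elim x)
   show ?case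
   proof
    assume "x : interior T"
    hence "x : T" using interior_subset by blast
    hence "1/2 <= bary T mu x \<longleftrightarrow> x : ?H" using shrink_eq[OF simplex[OF T] mu, of "1/2"] by simp
    thus "step (1/2) (bary T mu x) * f x = (if x : interior ?H then f x else 0)"
     using elim interior_subset[of ?H] by (auto simp: step_def)
   qed
  qed
 qed
 also have "... = lint (interior ?H) f"
  by (rule integral_restrict[OF sub Hs cell_sets(1)[OF T]])
 finally show "lint (interior T) (%x. step (1/2) (bary T mu x) * f x) = ..." .
qed

text \<open>In units of \<open>vol T / (d + 1)^3\<close> the indicator of \<open>T\<close>
  contributes \<open>d + 1\<close>. The corners contribute \<open>d - (d + 1) - d = -(d + 1)\<close>
  for distinct vertices and \<open>d (d + 2) - d = d (d + 1)\<close> for equal ones, so the totals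
  are 0 and \<open>(d + 1)^2\<close>.\<close>

lemma biorthogonal_local:
 assumes T: "T : \<T>" and nu: "nu : verts T" "nu' : verts T"
 shows "lint (interior T) (%x. dual_local T nu x * bary T nu' x)
  = (if nu = nu' then vol T / (real DIM('a) + 1) else 0)"
proof -
 let ?D = "real DIM('a) + 1" and ?P = "(2::real) ^ DIM('a)" and ?A = "vol T"
 let ?I = "%mu. lint (interior T) (%x. step (1/2) (bary T mu x) * bary T nu' x)"
 have fin: "finite (verts T)" by (rule simplex_verts(3)[OF simplex[OF T]])
 have card: "card (verts T - {nu}) = DIM('a)" using nu simplex_card[OF simplex[OF T]] fin by simp
 note ba = bary_affine[OF simplex[OF T], of nu']
 have I: "?I mu = ?A / (2 * ?P * ?D) * ((if mu = nu' then ?D else 0) + 1)" if "mu : verts T" for mu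
  using corner_step_integral(1)[OF T that ba] corner_bary_integral[OF simplex[OF T] that corner_simplex[OF T that] nu(2)] by simp
 have int: "integrable (leb (interior T)) (%x. step (1/2) (bary T mu x) * bary T nu' x)" if "mu : verts T" for mu
  by (rule corner_step_integral(2)[OF T that ba])
 define p q where "p = real DIM('a) * 2 ^ (1 + DIM('a)) / ?D" and "q = 2 ^ (1 + DIM('a)) / ?D"
 have "(%x. dual_local T nu x * bary T nu' x) = (%x. 1 / ?D *
   (bary T nu' x + p * (step (1/2) (bary T nu x) * bary T nu' x)
   - q * (SUM mu:verts T - {nu}. step (1/2) (bary T mu x) * bary T nu' x)))"
  unfolding dual_local_def p_def[symmetric] q_def[symmetric] sum_distrib_right[symmetric] by (auto simp: fun_eq_iff algebra_simps)
 moreover have "integrable (leb (interior T)) (%x. SUM mu:verts T - {nu}. step (1/2) (bary T mu x) * bary T nu' x)"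
  by (intro Bochner_Integration.integrable_sum int) auto
 moreover have "lint (interior T) (%x. SUM mu:verts T - {nu}. step (1/2) (bary T mu x) * bary T nu' x) = (SUM mu:verts T - {nu}. ?I mu)"
  by (intro Bochner_Integration.integral_sum int) auto
 ultimately have "lint (interior T) (%x. dual_local T nu x * bary T nu' x)
  = 1 / ?D * (?A / ?D + p * ?I nu - q * (SUM mu:verts T - {nu}. ?I mu))"
  using int[OF nu(1)] bary_integrable[OF simplex[OF T], of nu'] bary_integral[OF simplex[OF T] nu(2)]
  by simp
 hence "lint (interior T) (%x. dual_local T nu x * bary T nu' x)
  = 1 / ?D * (?A / ?D + real DIM('a) * 2 ^ (1 + DIM('a)) / ?D * ?I nu
    - 2 ^ (1 + DIM('a)) / ?D * (SUM mu:verts T - {nu}. ?I mu))"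
  unfolding p_def q_def .
 also have "(SUM mu:verts T - {nu}. ?I mu) = ?A / (2 * ?P * ?D) * ((if nu = nu' then 0 else ?D) + real DIM('a))"
 proof -
  have "(SUM mu:verts T - {nu}. ?I mu) = (SUM mu:verts T - {nu}. ?A / (2 * ?P * ?D) * ((if mu = nu' then ?D else 0) + 1))"
   by (intro sum.cong refl I) auto
  also have "... = ?A / (2 * ?P * ?D) * ((SUM mu:verts T - {nu}. if mu = nu' then ?D else 0) + real (card (verts T - {nu})))"
   unfolding sum_distrib_left[symmetric] sum.distrib by simp
  also have "(SUM mu:verts T - {nu}. if mu = nu' then ?D else 0) = (if nu = nu' then 0 else ?D)"
   using fin nu by (simp add: sum.delta)
  finally show ?thesis unfolding card .
 qed
 also have "?I nu = ?A / (2 * ?P * ?D) * ((if nu = nu' then ?D else 0) + 1)" by (rule I[OF nu(1)])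
 also have "1 / ?D * (?A / ?D + real DIM('a) * 2 ^ (1 + DIM('a)) / ?D * (?A / (2 * ?P * ?D) * ((if nu = nu' then ?D else 0) + 1))
    - 2 ^ (1 + DIM('a)) / ?D * (?A / (2 * ?P * ?D) * ((if nu = nu' then 0 else ?D) + real DIM('a))))
   = (if nu = nu' then ?A / ?D else 0)"
 proof -
  have DD: "?D ~= 0" and PP: "?P ~= 0" by auto
  have c: "2 ^ (1 + DIM('a)) / ?D * (?A / (2 * ?P * ?D) * t) = ?A * t / (?D * ?D)"
      "real DIM('a) * 2 ^ (1 + DIM('a)) / ?D * (?A / (2 * ?P * ?D) * t) = real DIM('a) * (?A * t / (?D * ?D))" for t
   using PP by (simp_all add: divide_simps)
  show ?thesis unfolding c using DD by (simp add: divide_simps) (simp add: algebra_simps)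
 qed
 finally show ?thesis .
qed

lemma patch_measure:
 assumes "nu : nodes \<T>"
 shows "vol (patch \<T> nu) = (SUM T:star nu. vol T)"
proof -
 have p: "patch \<T> nu = \<Union>(star nu)" by (auto simp: patch_def star_def)
 have "vol (\<Union>(star nu)) = (SUM T:star nu. vol T)"
 proof (rule measure_negligible_finite_Union[OF finite_star])
  show "!!T. T : star nu ==> T : lmeasurable"
   using simplex_meas(1)[OF simplex] by (auto simp: star_def)
  show "pairwise (%S T. negligible (S Int T)) (star nu)"
   unfolding pairwise_def
  proof (intro ballI impI)
   fix S T assume ST: "S : star nu" "T : star nu" "S ~= T"
   hence S: "S : \<T>" "T : \<T>" by (auto simp: star_def)
   have "S Int T <= frontier S"
    using interior_disjoint[OF S ST(3)] closure_subset by (auto simp: frontier_def)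
   thus "negligible (S Int T)"
    using negligible_convex_frontier[OF simplex_convex[OF simplex[OF S(1)]]] negligible_subset by blast
  qed
 qed
 thus ?thesis by (simp add: p)
qed

lemma star_nonempty: "nu : nodes \<T> ==> star nu ~= {}"
 using verts_subset by (fastforce simp: nodes_def star_def)

lemma patch_measure_ge:
 assumes "nu : nodes \<T>" "T : star nu"
 shows "vol T <= vol (patch \<T> nu)"
 unfolding patch_measure[OF assms(1)] by (rule member_le_sum[OF assms(2)]) (auto simp: finite_star)

lemma patch_pos:
 assumes "nu : nodes \<T>"
 shows "0 < vol (patch \<T> nu)"
proof -
 obtain T where T: "T : star nu" using star_nonempty[OF assms] by blast
 hence "0 < vol T" using vol_pos[OF simplex] by (auto simp: star_def)
 thus ?thesis using patch_measure_ge[OF assms T] by linarith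
qed

lemma l2_inner_cell_cong:
 assumes "!!x. x : interior T ==> f x * g x = h x"
 shows "l2_inner (interior T) f g = lint (interior T) h"
 unfolding l2_inner_def by (rule lint_cong) (use assms in auto)

lemma biorthogonal:
 assumes nu: "nu : nodes \<T>" "nu' : nodes \<T>"
 shows "l2_inner Om (dual_hat \<T> \<S> nu) (hat \<T> nu') = (if nu = nu' then vol (patch \<T> nu) / (real DIM('a) + 1) else 0)"
proof -
 have loc: "l2_inner (interior T) (dual_hat \<T> \<S> nu) (hat \<T> nu') = (if nu = nu' & nu : verts T then vol T / (real DIM('a) + 1) else 0)"
  if T: "T : \<T>" for T
 proof -
  have h: "hat \<T> nu' x = bary T nu' x" if "x : interior T" for x
   using hat_eq_bary[OF T] interior_subset that by blast
  show ?thesis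
  proof (cases "nu : verts T & nu' : verts T")
   case True
   have "l2_inner (interior T) (dual_hat \<T> \<S> nu) (hat \<T> nu') = lint (interior T) (%x. dual_local T nu x * bary T nu' x)"
    by (rule l2_inner_cell_cong) (use True in \<open>simp add: h dual_hat_on[OF T _ nu(1)]\<close>)
   thus ?thesis using biorthogonal_local[OF T, of nu nu'] True by simp
  next
   case False
   have "l2_inner (interior T) (dual_hat \<T> \<S> nu) (hat \<T> nu') = lint (interior T) (%x. 0)"
    by (rule l2_inner_cell_cong) (use False in \<open>auto simp: h dual_hat_on[OF T _ nu(1)] bary_non_vert[OF simplex[OF T]]\<close>)
   thus ?thesis using False by auto
  qed
 qed
 have "l2_inner Om (dual_hat \<T> \<S> nu) (hat \<T> nu') = (SUM T:\<T>. if nu = nu' & nu : verts T then vol T / (real DIM('a) + 1) else 0)"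
  unfolding l2_inner_mesh[OF dual_hat_L2[OF nu(1)] hat_L2] by (intro sum.cong refl loc)
 also have "... = (if nu = nu' then (SUM T:{T\<in>\<T>. nu : verts T}. vol T / (real DIM('a) + 1)) else 0)"
  using fin by (simp add: sum.inter_filter)
 also have "{T : \<T>. nu : verts T} = star nu" using star_verts[OF nu(1)] by blast
 finally show ?thesis by (simp add: patch_measure[OF nu(1)] patch_measure[OF nu(2)] flip: sum_divide_distrib)
qed

text \<open>Two coordinates add up to at most 1 on the simplex, so both can reach 1/2 only on a null
  set where they equal 1/2.\<close>

lemma AE_corners_disjoint:
 assumes T: "T : \<T>"
 shows "AE x in lebesgue. x : interior T -->
  (ALL mu:verts T. ALL nu:verts T. mu ~= nu --> 1/2 <= bary T nu x --> bary T mu x < 1/2)"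
proof -
 have fin: "finite (verts T)" by (rule simplex_verts(3)[OF simplex[OF T]])
 have "AE x in lebesgue. ALL mu:verts T. bary T mu x ~= 1/2"
  using fin AE_bary_neq[OF simplex[OF T]] by (intro AE_finite_allI)
 thus ?thesis
 proof eventually_elim
  case (elim x)
  show ?case
  proof (intro impI ballI)
   fix mu nu assume x: "x : interior T" and v: "mu : verts T" "nu : verts T" "mu ~= nu" and b: "1/2 <= bary T nu x"
   have "x : T" using x interior_subset by blast
   hence "(SUM w:{mu, nu}. bary T w x) <= (SUM w:verts T. bary T w x)"
    using fin v bary_nonneg[OF simplex[OF T]] by (intro sum_mono2) auto
   hence "bary T mu x + bary T nu x <= 1" using v(3) by (simp add: bary_sum[OF simplex[OF T]])
   thus "bary T mu x < 1/2" using b bspec[OF elim v(1)] by linarith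
  qed
 qed
qed

text \<open>The factor \<open>2^d\<close> in \<open>theta\<close> compensates the volume ratio of
  the corners with homothety ratios 1/4 and 1/2.\<close>

lemma theta_integral_local:
 assumes T: "T : \<T>" and nu: "nu : verts T"
 shows "lint (interior T) (theta_local T nu) = 0" "integrable (leb (interior T)) (theta_local T nu)"
proof -
 have st: "lint (interior T) (%x. step s (bary T nu x)) = (1 - s) ^ DIM('a) * vol T"
    "integrable (leb (interior T)) (%x. step s (bary T nu x))" if s: "0 <= s" "s < 1" for s
 proof -
  have sets: "{x : interior T. s <= bary T nu x} : sets borel" using bary_measurable[OF simplex[OF T]] by measurable
  have i: "(%x. indicator (interior T) x *\<^sub>R step s (bary T nu x)) = indicat_real {x : interior T. s <= bary T nu x}"
   by (auto simp: indicator_def step_def)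
  have em: "emeasure lebesgue {x : interior T. s <= bary T nu x} = ennreal ((1 - s) ^ DIM('a) * vol T)"
   using bary_superlevel_measure[OF simplex[OF T] nu s(1)] s(2) sets by simp
  have me: "vol {x : interior T. s <= bary T nu x} = (1 - s) ^ DIM('a) * vol T"
   unfolding measure_def[of lebesgue "{x : interior T. s <= bary T nu x}"] em using s by simp
  show "lint (interior T) (%x. step s (bary T nu x)) = (1 - s) ^ DIM('a) * vol T"
  proof -
   have "lint (interior T) (%x. step s (bary T nu x))
     = integral\<^sup>L lebesgue (%x. indicator (interior T) x *\<^sub>R step s (bary T nu x))"
    using cell_sets(1)[OF T] by (intro integral_restrict_space) simp
   also have "... = vol {x : interior T. s <= bary T nu x}"
    unfolding i using sets by (simp add: sets_completionI_sets)
   finally show ?thesis unfolding me .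
  qed
  show "integrable (leb (interior T)) (%x. step s (bary T nu x))"
  proof -
   have "integrable lebesgue (%x. indicator (interior T) x *\<^sub>R step s (bary T nu x))"
    unfolding i
   proof (rule integrable_real_indicator)
    show "{x : interior T. s <= bary T nu x} : sets lebesgue" using sets by (simp add: sets_completionI_sets)
    show "emeasure lebesgue {x : interior T. s <= bary T nu x} < \<infinity>" unfolding em by simp
   qed
   thus ?thesis
    using cell_sets(1)[OF T] by (subst integrable_restrict_space) simp_all
  qed
 qed
 show "integrable (leb (interior T)) (theta_local T nu)"
  unfolding theta_local_def[abs_def] using st(2)[of "3/4"] st(2)[of "1/2"] by simp
 have "lint (interior T) (theta_local T nu) = 2 ^ (DIM('a) + 2) / (real DIM('a) + 2) *
   (2 ^ DIM('a) * ((1 - 3/4) ^ DIM('a) * vol T) - (1 - 1/2) ^ DIM('a) * vol T)"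
  unfolding theta_local_def[abs_def] using st[of "3/4"] st[of "1/2"] by simp
 also have "... = 0"
 proof -
  have "(2::real) ^ DIM('a) * (1/4) ^ DIM('a) = (1/2) ^ DIM('a)" by (simp flip: power_mult_distrib)
  thus ?thesis by (simp add: mult.assoc[symmetric])
 qed
 finally show "lint (interior T) (theta_local T nu) = 0" .
qed

text \<open>Where \<open>\<theta>\<^sub>nu\<close> does not vanish, the dual function is constant.\<close>

lemma theta_dual_orthogonal:
 assumes nu: "nu : nodes \<T>" "nu' : nodes \<T>"
 shows "l2_inner Om (theta \<S> \<S>' nu) (dual_hat \<T> \<S> nu') = 0"
 unfolding l2_inner_mesh[OF theta_L2 dual_hat_L2[OF nu(2)]]
proof (rule sum.neutral, rule ballI)
 fix T assume T: "T : \<T>"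
 show "l2_inner (interior T) (theta \<S> \<S>' nu) (dual_hat \<T> \<S> nu') = 0"
 proof (cases "nu : verts T & nu' : verts T")
  case False
  have "l2_inner (interior T) (theta \<S> \<S>' nu) (dual_hat \<T> \<S> nu') = lint (interior T) (%x. 0)"
   by (rule l2_inner_cell_cong) (use False in \<open>auto simp: theta_on[OF T _ nu(1)] dual_hat_on[OF T _ nu(2)]\<close>)
  thus ?thesis by simp
 next
  case True
  have fin: "finite (verts T)" by (rule simplex_verts(3)[OF simplex[OF T]])
  \<comment> \<open>The value of \<open>dual_local T nu'\<close> on the corner at \<open>nu\<close>:
    the other corners are disjoint from it almost everywhere, so \<open>step\<close> is 1 for
    \<open>nu\<close> and 0 for the other vertices.\<close>
  define k where "k = 1 / (real DIM('a) + 1) *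
   (1 + real DIM('a) * 2 ^ (1 + DIM('a)) / (real DIM('a) + 1) * (if nu' = nu then 1 else 0)
   - 2 ^ (1 + DIM('a)) / (real DIM('a) + 1) * (SUM mu:verts T - {nu'}. if mu = nu then 1 else 0))"
  have L: "theta \<S> \<S>' nu : L2 (interior T)" "dual_hat \<T> \<S> nu' : L2 (interior T)"
   using L2_interior[OF theta_L2 T] L2_interior[OF dual_hat_L2[OF nu(2)] T] .
  have "l2_inner (interior T) (theta \<S> \<S>' nu) (dual_hat \<T> \<S> nu') = lint (interior T) (%x. k * theta_local T nu x)"
   unfolding l2_inner_def
  proof (rule integral_cong_AE)
   show "(%x. theta \<S> \<S>' nu x * dual_hat \<T> \<S> nu' x) : borel_measurable (leb (interior T))"
    using L[THEN L2_meas] by measurable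
   show "(%x. k * theta_local T nu x) : borel_measurable (leb (interior T))"
    using theta_integral_local(2)[OF T] True by (intro borel_measurable_times borel_measurable_const borel_measurable_integrable) auto
   show "AE x in leb (interior T). theta \<S> \<S>' nu x * dual_hat \<T> \<S> nu' x = k * theta_local T nu x"
    unfolding AE_leb[OF cell_sets(1)[OF T]] using AE_corners_disjoint[OF T]
   proof eventually_elim
    case (elim x)
    show ?case
    proof
     assume x: "x : interior T"
     have "theta_local T nu x * dual_local T nu' x = k * theta_local T nu x"
     proof (cases "theta_local T nu x = 0")
      case False
      hence b: "1/2 <= bary T nu x" by (rule theta_local_nonzero)
      have s: "step (1/2) (bary T mu x) = (if mu = nu then 1 else 0)" if "mu : verts T" for mu
      proof -
       have "mu ~= nu ==> bary T mu x < 1/2" using elim x that True b by blast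
       thus ?thesis using b by (cases "mu = nu") (auto simp: step_def)
      qed
      have "(SUM mu:verts T - {nu'}. step (1/2) (bary T mu x)) = (SUM mu:verts T - {nu'}. if mu = nu then 1 else 0)"
       by (intro sum.cong refl s) auto
      hence "dual_local T nu' x = k" unfolding dual_local_def k_def using s[of nu'] True by simp
      thus ?thesis by simp
     qed simp
     thus "theta \<S> \<S>' nu x * dual_hat \<T> \<S> nu' x = k * theta_local T nu x"
      using True by (simp add: theta_on[OF T x nu(1)] dual_hat_on[OF T x nu(2)])
    qed
   qed
  qed
  also have "... = k * 0" using theta_integral_local(1)[OF T] True by simp
  finally show ?thesis by simp
 qed
qed

lemma theta_disjoint:
 assumes nu: "nu : nodes \<T>" "nu' : nodes \<T>" "nu ~= nu'"
 shows "AE x in leb Om. theta \<S> \<S>' nu x * theta \<S> \<S>' nu' x = 0"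
proof -
 have "AE x in lebesgue. ALL T:\<T>. x : interior T -->
  (ALL mu:verts T. ALL nu:verts T. mu ~= nu --> 1/2 <= bary T nu x --> bary T mu x < 1/2)"
  using fin AE_corners_disjoint by (intro AE_finite_allI)
 thus ?thesis
  unfolding AE_leb[OF cell_sets(2)] using AE_interior
 proof eventually_elim
  case (elim x)
  show ?case
  proof
   assume "x : Om"
   then obtain T where T: "T : \<T>" "x : interior T" using elim(2) closure_subset by blast
   have "bary T nu' x < 1/2" if "nu : verts T" "nu' : verts T" "1/2 <= bary T nu x"
    using elim(1) T that nu(3) by metis
   thus "theta \<S> \<S>' nu x * theta \<S> \<S>' nu' x = 0"
    using theta_local_nonzero[of T nu x] theta_local_nonzero[of T nu' x]
    by (force simp: theta_on[OF T nu(1)] theta_on[OF T nu(2)])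
  qed
 qed
qed

end

lemma L2_basis_coeff_fun:
 assumes "finite I" "i : I"
 shows "(%x. SUM j:I. (if j = i then 1 else 0) * f j x) = (f i :: 'a => real)"
proof
 fix x
 have "(SUM j:I. (if j = i then 1 else 0) * f j x) = (SUM j:I. if j = i then f j x else 0)"
  by (intro sum.cong) auto
 thus "(SUM j:I. (if j = i then 1 else 0) * f j x) = f i x" using assms by (simp add: sum.delta)
qed

lemma l2_inner_sum_left:
 fixes f :: "'i => 'a::euclidean_space => real"
 assumes "!!i. i : I ==> f i : L2 D" "g : L2 D"
 shows "l2_inner D (%x. SUM i:I. c i * f i x) g = (SUM i:I. c i * l2_inner D (f i) g)"
proof -
 have "l2_inner D (%x. SUM i:I. c i * f i x) g = lint D (%x. SUM i:I. c i * (f i x * g x))"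
  unfolding l2_inner_def by (simp add: sum_distrib_right mult.assoc)
 also have "... = (SUM i:I. c i * l2_inner D (f i) g)"
  unfolding l2_inner_def
  by (subst Bochner_Integration.integral_sum) (auto intro!: L2_mult_int assms)
 finally show ?thesis .
qed

lemma sum_sq_le_card:
 fixes f :: "'i => real"
 shows "(SUM i:I. f i)^2 <= real (card I) * (SUM i:I. (f i)^2)"
 using Cauchy_Schwarz_ineq_sum[of "%_. 1" f I] by simp

section \<open>Algebraic properties of the projector and its stability constants on patches\<close>

context refined_mesh
begin

abbreviation Q :: "('a => real) => 'a => real" where "Q \<equiv> biorth_proj Om gam \<T> \<S>"
abbreviation dual :: "'a => 'a => real" where "dual \<equiv> dual_hat \<T> \<S>"
abbreviation \<theta> :: "'a => 'a => real" where "\<theta> \<equiv> theta \<S> \<S>'"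
abbreviation om :: "'a => real" where "om nu \<equiv> vol (patch \<T> nu)"

text \<open>The quotient in \<open>biorth_proj\<close> with its denominator evaluated by
  \<open>biorthogonal\<close>.\<close>

definition coef :: "'a => ('a => real) => real" where
 "coef nu u = (real DIM('a) + 1) / om nu * l2_inner Om u (dual nu)"

lemma Q_eq: "Q u x = (SUM nu:N0. coef nu u * hat \<T> nu x)"
 unfolding biorth_proj_def
proof (rule sum.cong[OF refl])
 fix nu assume "nu : N0"
 hence "l2_inner Om (hat \<T> nu) (dual nu) = om nu / (real DIM('a) + 1)"
  using biorthogonal[of nu nu] N0_node by (simp add: l2_inner_commute[of Om "hat \<T> nu"])
 thus "l2_inner Om u (dual nu) / l2_inner Om (hat \<T> nu) (dual nu) * hat \<T> nu x = coef nu u * hat \<T> nu x"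
  by (simp add: coef_def)
qed

lemma Q_fun: "Q u = (%x. SUM nu:N0. coef nu u * hat \<T> nu x)"
 using Q_eq by blast

lemma coef_lincomb:
 "u : L2 Om ==> v : L2 Om ==> nu : N0 ==> coef nu (%x. a * u x + b * v x) = a * coef nu u + b * coef nu v"
 unfolding coef_def using l2_inner_lincomb_left[OF _ _ dual_hat_L2[OF N0_node]] by (simp add: algebra_simps)

lemma coef_cong: "u : L2 Om ==> v : L2 Om ==> ae_eq Om u v ==> nu : N0 ==> coef nu u = coef nu v"
 unfolding coef_def ae_eq_def by (subst l2_inner_cong_AE[OF _ _ _ _ dual_hat_L2[OF N0_node] dual_hat_L2[OF N0_node]]) auto

lemma coef_hat_sum:
 assumes "nu : N0"
 shows "coef nu (%x. SUM i:N0. c i * hat \<T> i x) = c nu"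
proof -
 have "l2_inner Om (%x. SUM i:N0. c i * hat \<T> i x) (dual nu) = (SUM i:N0. c i * l2_inner Om (hat \<T> i) (dual nu))"
  by (intro l2_inner_sum_left hat_L2 dual_hat_L2 N0_node assms)
 also have "... = (SUM i:N0. if i = nu then c i * (om nu / (real DIM('a) + 1)) else 0)"
 proof (rule sum.cong[OF refl])
  fix i assume "i : N0"
  thus "c i * l2_inner Om (hat \<T> i) (dual nu) = (if i = nu then c i * (om nu / (real DIM('a) + 1)) else 0)"
   using biorthogonal[of nu i] N0_node assms by (simp add: l2_inner_commute[of Om "hat \<T> i"])
 qed
 also have "... = c nu * (om nu / (real DIM('a) + 1))" using assms finite_N0 by (simp add: sum.delta)
 finally show ?thesis unfolding coef_def using patch_pos[OF N0_node[OF assms]] by simp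
qed

lemma coef_theta_sum:
 assumes "nu : N0"
 shows "coef nu (%x. SUM i:N0. c i * \<theta> i x) = 0"
proof -
 have "l2_inner Om (%x. SUM i:N0. c i * \<theta> i x) (dual nu) = (SUM i:N0. c i * l2_inner Om (\<theta> i) (dual nu))"
  by (intro l2_inner_sum_left theta_L2 dual_hat_L2 N0_node assms)
 also have "... = 0" using theta_dual_orthogonal N0_node assms by (intro sum.neutral) auto
 finally show ?thesis by (simp add: coef_def)
qed

lemma Q_U: "Q u : U_space Om gam \<T>"
 unfolding Q_fun by (intro U_sum hat_U)

lemma Q_L2: "Q u : L2 Om"
 by (rule U_L2[OF Q_U])

lemma Q_Q: "Q (Q u) = Q u"
proof -
 have "coef nu (Q u) = coef nu u" if "nu : N0" for nu
  using coef_hat_sum[OF that, of "%i. coef i u"] unfolding Q_fun[of u] .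
 hence "Q (Q u) x = Q u x" for x unfolding Q_eq[of "Q u"] Q_eq[of u x] by (intro sum.cong) auto
 thus ?thesis by blast
qed

lemma Q_lincomb:
 assumes "u : L2 Om" "v : L2 Om"
 shows "Q (%x. a * u x + b * v x) = (%x. a * Q u x + b * Q v x)"
 unfolding Q_fun
 using coef_lincomb[OF assms] by (auto simp: fun_eq_iff algebra_simps sum.distrib sum_distrib_left intro!: sum.cong)

lemma Q_on_U:
 assumes "u : U_space Om gam \<T>"
 shows "ae_eq Om u (Q u)"
proof -
 obtain c where c: "ae_eq Om u (%x. SUM i:N0. c i * hat \<T> i x)"
  using U_basis assms unfolding L2_basis_def by blast
 have "coef nu u = c nu" if "nu : N0" for nu
  using coef_cong[OF U_L2[OF assms] _ c that] coef_hat_sum[OF that] L2_lincomb[of N0 "hat \<T>" Om c] hat_L2 by simp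
 hence "Q u = (%x. SUM i:N0. c i * hat \<T> i x)" unfolding Q_fun by (auto intro!: ext sum.cong)
 thus ?thesis using c by simp
qed

lemma B_form: "b : B_space gam \<T> \<S> \<S>' \<longleftrightarrow> (EX c. b = (%x. SUM i:N0. c i * \<theta> i x))"
 unfolding B_space_def fun_span_def by auto

lemma B_L2: "b : B_space gam \<T> \<S> \<S>' ==> b : L2 Om"
 unfolding B_form by (auto intro!: L2_lincomb theta_L2)

lemma Q_on_B: "b : B_space gam \<T> \<S> \<S>' ==> Q b = (%x. 0)"
 unfolding B_form Q_fun by (auto intro!: ext sum.neutral simp: coef_theta_sum)

lemma theta_B: "nu : N0 ==> \<theta> nu : B_space gam \<T> \<S> \<S>'"
 unfolding B_form using L2_basis_coeff_fun[OF finite_N0, of nu \<theta>] by metis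

lemma B_subspace: "L2_subspace Om (B_space gam \<T> \<S> \<S>')"
 unfolding L2_subspace_def
proof (intro conjI ballI allI)
 show "B_space gam \<T> \<S> \<S>' <= L2 Om" using B_L2 by blast
 show "B_space gam \<T> \<S> \<S>' ~= {}" using B_form by blast
 fix u v and a b :: real assume "u : B_space gam \<T> \<S> \<S>'" "v : B_space gam \<T> \<S> \<S>'"
 then obtain c c' where "u = (%x. SUM i:N0. c i * \<theta> i x)" "v = (%x. SUM i:N0. c' i * \<theta> i x)" unfolding B_form by blast
 hence "(%x. a * u x + b * v x) = (%x. SUM i:N0. (a * c i + b * c' i) * \<theta> i x)"
  by (auto simp: fun_eq_iff algebra_simps sum.distrib sum_distrib_left)
 thus "(%x. a * u x + b * v x) : B_space gam \<T> \<S> \<S>'" unfolding B_form by (rule exI[of _ "%i. a * c i + b * c' i"])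
qed

lemma W_subset_Z: "W_space gam \<T> \<S> \<S>' <= Z_space Om gam \<T> \<S> \<S>'"
proof
 fix w assume "w : W_space gam \<T> \<S> \<S>'"
 then obtain c where "w = (%x. SUM i:N0. c i * psi \<T> \<S> \<S>' i x)" unfolding W_space_def fun_span_def by blast
 hence "w = (%x. (SUM i:N0. c i * hat \<T> i x) + (SUM i:N0. c i * \<theta> i x))"
  by (simp add: psi_def distrib_left sum.distrib)
 moreover have "(%x. SUM i:N0. c i * hat \<T> i x) : U_space Om gam \<T>" by (intro U_sum hat_U)
 moreover have "(%x. SUM i:N0. c i * \<theta> i x) : B_space gam \<T> \<S> \<S>'" unfolding B_form by blast
 ultimately show "w : Z_space Om gam \<T> \<S> \<S>'" unfolding Z_space_def mem_Collect_eq by (intro exI conjI)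
qed

lemma Z_L2: "z : Z_space Om gam \<T> \<S> \<S>' ==> z : L2 Om"
 unfolding Z_space_def using U_L2 B_L2 L2_add by blast

lemma Q_psi:
 assumes "nu : N0"
 shows "Q (psi \<T> \<S> \<S>' nu) = hat \<T> nu"
proof -
 have h: "Q (hat \<T> nu) = hat \<T> nu"
  unfolding Q_fun using coef_hat_sum[of _ "%j. if j = nu then 1 else 0"]
  unfolding L2_basis_coeff_fun[OF finite_N0 assms] using L2_basis_coeff_fun[OF finite_N0 assms, of "hat \<T>"]
  by (simp cong: sum.cong)
 have "psi \<T> \<S> \<S>' nu = (%x. 1 * hat \<T> nu x + 1 * \<theta> nu x)" by (auto simp: psi_def)
 hence "Q (psi \<T> \<S> \<S>' nu) = (%x. 1 * Q (hat \<T> nu) x + 1 * Q (\<theta> nu) x)"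
  using Q_lincomb[OF hat_L2 theta_L2] by metis
 thus ?thesis using h Q_on_B[OF theta_B[OF assms]] by simp
qed

lemma Q_ranges:
 "L2_linear Om Q" "L2_projector Om Q" "U_space Om gam \<T> <= L2_range Om Q"
 "B_space gam \<T> \<S> \<S>' <= L2_range Om (%u x. u x - Q u x)"
 "L2_subspace Om (L2_range Om Q)" "L2_subspace Om (L2_range Om (%u x. u x - Q u x))"
proof -
 show "L2_linear Om Q" unfolding L2_linear_def ae_eq_def using Q_lincomb by auto
 show "L2_projector Om Q" unfolding L2_projector_def ae_eq_def using Q_L2 Q_Q by auto
 show "U_space Om gam \<T> <= L2_range Om Q" unfolding L2_range_def using Q_on_U U_L2 by blast
 show "B_space gam \<T> \<S> \<S>' <= L2_range Om (%u x. u x - Q u x)"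
 proof
  fix b assume b: "b : B_space gam \<T> \<S> \<S>'"
  thus "b : L2_range Om (%u x. u x - Q u x)"
   unfolding L2_range_def ae_eq_def using B_L2[OF b] Q_on_B[OF b] by (auto intro!: bexI[of _ b])
 qed
 have gen: "L2_subspace Om (L2_range Om A)"
  if lin: "!!u v a b. u : L2 Om ==> v : L2 Om ==> A (%x. a * u x + b * v x) = (%x. a * A u x + b * A v x)"
  for A :: "('a => real) => 'a => real"
  unfolding L2_subspace_def
 proof (intro conjI ballI allI)
  show "L2_range Om A <= L2 Om" unfolding L2_range_def by blast
  have "A (%x. 0) = (%x. 0)" using lin[OF L2_zero L2_zero, of 0 0] by simp
  hence "(%x. 0) : L2_range Om A" unfolding L2_range_def ae_eq_def by (auto intro!: bexI[of _ "%x. 0"])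
  thus "L2_range Om A ~= {}" by blast
  fix u v and a b :: real assume "u : L2_range Om A" "v : L2_range Om A"
  then obtain u' v' where u': "u : L2 Om" "u' : L2 Om" "AE x in leb Om. u x = A u' x"
   and v': "v : L2 Om" "v' : L2 Om" "AE x in leb Om. v x = A v' x" unfolding L2_range_def ae_eq_def by blast
  have "AE x in leb Om. a * u x + b * v x = A (%x. a * u' x + b * v' x) x"
   using u'(3) v'(3) by eventually_elim (simp add: lin[OF u'(2) v'(2)])
  moreover have "(%x. a * u x + b * v x) : L2 Om" "(%x. a * u' x + b * v' x) : L2 Om" by (intro L2_add L2_cmult u' v')+
  ultimately show "(%x. a * u x + b * v x) : L2_range Om A" unfolding L2_range_def ae_eq_def by blast
 qed
 show "L2_subspace Om (L2_range Om Q)" by (rule gen[OF Q_lincomb])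
 show "L2_subspace Om (L2_range Om (%u x. u x - Q u x))"
  by (rule gen) (simp add: Q_lincomb fun_eq_iff algebra_simps)
qed

text \<open>On the corner of one simplex at \<open>nu\<close> the \<open>theta\<close> of other
  nodes vanish almost everywhere, while that of \<open>nu\<close> takes only nonzero values there,
  multiples of \<open>2^d - 1\<close> and of -1.\<close>

lemma theta_basis: "L2_basis Om (B_space gam \<T> \<S> \<S>') N0 \<theta>"
 unfolding L2_basis_def
proof (intro conjI ballI allI impI finite_N0 theta_B)
 fix u assume "u : B_space gam \<T> \<S> \<S>'"
 thus "EX c. ae_eq Om u (%x. SUM i:N0. c i * \<theta> i x)" unfolding B_form ae_eq_def by auto
next
 fix c nu assume z: "ae_eq Om (%x. SUM i:N0. c i * \<theta> i x) (%x. 0)" and nu: "nu : N0"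
 obtain T where T: "T : \<T>" "nu : verts T" using N0_node[OF nu] by (auto simp: nodes_def)
 show "c nu = 0"
 proof (rule ccontr)
  assume c: "c nu ~= 0"
  let ?M = "{x : interior T. 1/2 <= bary T nu x}"
  have "AE x in lebesgue. \<not> (x : ?M)"
   using z[unfolded ae_eq_def AE_leb[OF cell_sets(2)]] AE_corners_disjoint[OF T(1)]
  proof eventually_elim
   case (elim x)
   show ?case
   proof
    assume "x : ?M"
    hence x: "x : interior T" "1/2 <= bary T nu x" by auto
    hence xOm: "x : Om" using cell_subset[OF T(1)] by blast
    have "\<theta> i x = 0" if i: "i : N0" "i ~= nu" for i
    proof (cases "i : verts T")
     case True
     hence "bary T i x < 1/2" using elim(2) x T(2) i(2) by blast
     thus ?thesis using theta_on[OF T(1) x(1) N0_node[OF i(1)]] theta_local_nonzero[of T i x] by force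
    next
     case False
     thus ?thesis using theta_on[OF T(1) x(1) N0_node[OF i(1)]] by simp
    qed
    hence "(SUM i:N0. c i * \<theta> i x) = c nu * \<theta> nu x"
     using nu finite_N0 by (subst sum.remove[OF finite_N0 nu]) (auto intro!: sum.neutral)
    hence "\<theta> nu x = 0" using elim(1) xOm c by simp
    moreover have "\<theta> nu x = theta_local T nu x" using theta_on[OF T(1) x(1) N0_node[OF nu]] T(2) by simp
    moreover have "theta_local T nu x ~= 0"
    proof -
     have "(2::real) ^ DIM('a) * step (3/4) (bary T nu x) - 1 ~= 0"
     proof -
      have "(1::real) < 2 ^ DIM('a)" by (rule one_less_power) auto
      hence "(2::real) ^ DIM('a) ~= 1" by (rule less_imp_neq[symmetric])
      moreover have "step (3/4) (bary T nu x) = 0 \<or> step (3/4) (bary T nu x) = 1" by (rule step_cases)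
      ultimately show ?thesis by (elim disjE) simp_all
     qed
     thus ?thesis using x(2) by (simp add: theta_local_def step_def add_eq_0_iff)
    qed
    ultimately show False by simp
   qed
  qed
  moreover have Ms: "?M : sets borel" using bary_measurable[OF simplex[OF T(1)]] by measurable
  ultimately have "emeasure lebesgue ?M = 0"
   by (subst (asm) AE_iff_measurable[of ?M]) (auto simp: sets_completionI_sets)
  moreover have "emeasure lebesgue ?M = ennreal ((1 - 1/2) ^ DIM('a) * vol T)"
   using bary_superlevel_measure[OF simplex[OF T(1)] T(2), of "1/2"] Ms by simp
  moreover have "0 < (1 - 1/2) ^ DIM('a) * vol T" using vol_pos[OF simplex[OF T(1)]] by simp
  ultimately show False by simp
 qed
qed

text \<open>The supports are disjoint almost everywhere, so orthogonality holds with any weight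
  \<open>h\<close>, in particular with powers of the mesh size.\<close>

lemma theta_weighted_orthogonal:
 assumes "nu : N0" "nu' : N0" "nu ~= nu'"
 shows "l2_inner Om (%x. h x * \<theta> nu x) (%x. h x * \<theta> nu' x) = 0"
 unfolding l2_inner_def
proof (rule integral_eq_zero_AE)
 show "AE x in leb Om. h x * \<theta> nu x * (h x * \<theta> nu' x) = 0"
  using theta_disjoint[OF N0_node[OF assms(1)] N0_node[OF assms(2)] assms(3)] by eventually_elim auto
qed


subsection \<open>Stability\<close>

definition patch_sq :: "('a => 'b::euclidean_space) => 'a => real" where
 "patch_sq u nu = (SUM T:star nu. (cnorm T u)^2)"

lemma patch_sq_nonneg [simp]: "0 <= patch_sq u nu"
 unfolding patch_sq_def by (intro sum_nonneg) auto

text \<open>Cauchy-Schwarz on the star only. The factor \<open>om nu\<close> is later cancelled by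
  the normalization \<open>1 / om nu\<close> of the coefficients, which makes the bounds independent
  of scale.\<close>

lemma patch_inner_bound:
 assumes u: "u : L2 Om" and f: "f : L2 Om" and nu: "nu : nodes \<T>"
  and M: "0 <= M" "AE x in leb Om. \<bar>f x\<bar> <= M"
  and z: "!!T x. T : \<T> ==> T ~: star nu ==> x : interior T ==> f x = 0"
 shows "(l2_inner Om u f)^2 <= M^2 * om nu * patch_sq u nu"
proof -
 have star: "star nu <= \<T>" by (auto simp: star_def)
 have z0: "l2_inner (interior T) u f = 0" if "T : \<T> - star nu" for T
 proof -
  have "l2_inner (interior T) u f = lint (interior T) (%x. 0)"
   by (rule l2_inner_cell_cong) (use z that in auto)
  thus ?thesis by simp
 qed
 have "l2_inner Om u f = (SUM T:star nu. l2_inner (interior T) u f)"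
  unfolding l2_inner_mesh[OF u f] by (rule sum.mono_neutral_right[OF fin star]) (use z0 in auto)
 hence "\<bar>l2_inner Om u f\<bar> <= (SUM T:star nu. \<bar>l2_inner (interior T) u f\<bar>)" by simp
 also have "... <= (SUM T:star nu. cnorm T u * cnorm T f)"
  by (intro sum_mono L2_CS L2_interior u f) (auto simp: star_def)
 finally have "(l2_inner Om u f)^2 <= (SUM T:star nu. cnorm T u * cnorm T f)^2"
  by (metis abs_ge_zero power2_abs power_mono)
 also have "... <= (SUM T:star nu. (cnorm T u)^2) * (SUM T:star nu. (cnorm T f)^2)"
  by (rule Cauchy_Schwarz_ineq_sum)
 also have "... <= patch_sq u nu * (SUM T:star nu. M^2 * vol T)"
  unfolding patch_sq_def
 proof (intro mult_left_mono sum_mono)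
  fix T assume "T : star nu"
  hence T: "T : \<T>" by (simp add: star_def)
  have "AE x in leb (interior T). \<bar>f x\<bar> <= M"
   using M(2) unfolding AE_leb[OF cell_sets(2)] AE_leb[OF cell_sets(1)[OF T]]
   by eventually_elim (use cell_subset[OF T] in auto)
  hence "(cnorm T f)^2 <= M^2 * vol (interior T)"
   by (intro l2_norm_le_bounded simplex_meas(2)[OF simplex[OF T]] L2_interior[OF f T])
  thus "(cnorm T f)^2 <= M^2 * vol T"
   using vol_interior[OF simplex[OF T]] by simp
 qed (intro sum_nonneg, simp)
 also have "... = M^2 * om nu * patch_sq u nu"
  by (simp add: patch_measure[OF nu] sum_distrib_left mult_ac)
 finally show ?thesis .
qed

text \<open>Double counting: every simplex has \<open>d + 1\<close> vertices.\<close>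

lemma sum_patches:
 fixes g :: "'a set => real"
 shows "(SUM nu:nodes \<T>. SUM T:star nu. g T) = (real DIM('a) + 1) * (SUM T:\<T>. g T)"
proof -
 have "(SUM nu:nodes \<T>. SUM T:star nu. g T) = (SUM nu:nodes \<T>. SUM T:{T\<in>\<T>. nu : verts T}. g T)"
  using star_verts by (intro sum.cong) auto
 also have "... = (SUM T:\<T>. SUM nu:{nu\<in>nodes \<T>. nu : verts T}. g T)"
  by (rule sum.swap_restrict[OF finite_nodes fin])
 also have "... = (SUM T:\<T>. (real DIM('a) + 1) * g T)"
 proof (rule sum.cong[OF refl])
  fix T assume T: "T : \<T>"
  have "{nu : nodes \<T>. nu : verts T} = verts T" using vert_node[OF T] by blast
  thus "(SUM nu:{nu\<in>nodes \<T>. nu : verts T}. g T) = (real DIM('a) + 1) * g T"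
   using simplex_card[OF simplex[OF T]] by simp
 qed
 finally show ?thesis by (simp add: sum_distrib_left)
qed

lemma sum_patch_sq:
 assumes "u : L2 Om"
 shows "(SUM nu:nodes \<T>. patch_sq u nu) = (real DIM('a) + 1) * (l2_norm Om u)^2"
 unfolding patch_sq_def sum_patches l2_norm_sq_mesh[OF assms] ..

lemma dual_zero_off_star: "nu : nodes \<T> ==> T : \<T> ==> T ~: star nu ==> x : interior T ==> dual nu x = 0"
 using dual_hat_on star_verts by auto

lemma hat_zero_off_star: "nu : nodes \<T> ==> T : \<T> ==> T ~: star nu ==> x : interior T ==> hat \<T> nu x = 0"
 using hat_eq_bary bary_non_vert[OF simplex] star_verts interior_subset by (metis subsetD)

end

section \<open>Poincare inequalities on vertex patches\<close>

lemma l2_norm_sq_cover: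
 fixes f :: "'a::euclidean_space => 'b::euclidean_space"
 assumes f: "f : L2 D" and D: "D : sets lebesgue"
  and s: "B <= D" "E1 <= D" "E2 <= D" "B : sets lebesgue" "E1 : sets lebesgue" "E2 : sets lebesgue"
  and ae: "AE x in lebesgue. x : B --> x : E1 \<or> x : E2"
 shows "(l2_norm B f)^2 <= (l2_norm E1 f)^2 + (l2_norm E2 f)^2"
proof -
 let ?F = "%x. (norm (f x))^2"
 have i: "integrable lebesgue (%x. indicator E x *\<^sub>R ?F x)" if "E <= D" "E : sets lebesgue" for E
  using integrable_on_subset[OF L2_sq_int[OF f] that D] that by (simp add: integrable_restrict_space)
 have e: "(l2_norm E f)^2 = integral\<^sup>L lebesgue (%x. indicator E x *\<^sub>R ?F x)" if "E : sets lebesgue" for E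
  unfolding l2_norm_sq using that by (simp add: integral_restrict_space)
 have "integral\<^sup>L lebesgue (%x. indicator B x *\<^sub>R ?F x)
   <= integral\<^sup>L lebesgue (%x. indicator E1 x *\<^sub>R ?F x + indicator E2 x *\<^sub>R ?F x)"
 proof (rule integral_mono_AE)
  show "AE x in lebesgue. indicator B x *\<^sub>R ?F x <= indicator E1 x *\<^sub>R ?F x + indicator E2 x *\<^sub>R ?F x"
   using ae by eventually_elim (auto simp: indicator_def)
 qed (intro i s Bochner_Integration.integrable_add)+
 thus ?thesis using i s by (simp add: e)
qed

lemma l2_mono_set:
 fixes f :: "'a::euclidean_space => 'b::euclidean_space"
 assumes "f : L2 D" "E <= D" "E : sets lebesgue" "D : sets lebesgue"
 shows "(l2_norm E f)^2 <= (l2_norm D f)^2"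
 unfolding l2_norm_sq by (rule lint_mono_set[OF L2_sq_int]) (use assms in auto)

text \<open>Lower bound for the share of a simplex that is filled by a half ball around a facet
  centroid; see \<open>ball_fraction\<close>.\<close>

definition cell_frac :: "nat => real => real => real" where
 "cell_frac d sig K = (1 / (real d * K * sig^2)) ^ d"

text \<open>Collects the constants of one passage across a facet. With \<open>\<alpha>\<close> for
  \<open>cell_frac\<close>, \<open>poincare_cell\<close> contributes \<open>2 / \<alpha>\<close>
  times the \<open>2 * 2^d\<close> and \<open>8 * 4^d\<close> of \<open>poincare_half_ball\<close>,
  and its own gradient term \<open>2 sig^d / \<alpha>\<close>; the squared quotient converts
  diameters into \<open>hsize\<close>.\<close>

definition step_const :: "nat => real => real => real" where
 "step_const d sig K = (4 * 2 ^ d + (16 * 4 ^ d + 2 * sig ^ d) * (sig / root d (unit_ball_vol (real d)))^2) / cell_frac d sig K"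

context regular_mesh
begin

abbreviation K :: real where "K \<equiv> max \<kappa> (sig^2)"

lemma K_ge: "T : \<T> ==> 1 <= K"
 using sigma_ge_2 power_mono[of 1 sig 2] by fastforce

lemma cell_frac_bounds:
 assumes "T : \<T>"
 shows "0 < cell_frac DIM('a) sig K" "cell_frac DIM('a) sig K <= 1"
proof -
 have sig: "2 <= sig" "1 <= K" using sigma_ge_2 K_ge assms by auto
 have "1 * 1 * 1 <= real DIM('a) * K * sig^2" using sig by (intro mult_mono one_le_power) auto
 hence "1 <= real DIM('a) * K * sig^2" by simp
 thus "0 < cell_frac DIM('a) sig K" "cell_frac DIM('a) sig K <= 1"
  unfolding cell_frac_def by (auto intro!: zero_less_power power_le_one)
qed

lemma diameter_le_size:
 assumes T: "T : \<T>" and cr: "0 < r" "cball c r <= T" "diameter T <= sig * r"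
 shows "(diameter T)^2 <= (sig / root DIM('a) (unit_ball_vol (real DIM('a))))^2 * (hsize T)^2"
proof -
 let ?rho = "root DIM('a) (unit_ball_vol (real DIM('a)))"
 have p: "0 < ?rho" by (rule root_unit_ball_vol_pos)
 have "diameter T <= sig * r" by (rule cr(3))
 also have "... <= sig * (hsize T / ?rho)"
  using simplex_size_bounds(1)[OF simplex[OF T] cr(1,2)] p sigma_ge_2[OF T]
  by (intro mult_left_mono) (auto simp: pos_le_divide_eq mult.commute)
 finally have "diameter T <= (sig / ?rho) * hsize T" by simp
 from power_mono[OF this, of 2] show ?thesis
  using diameter_ge_0[OF simplex_bounded[OF simplex[OF T]]] by (simp add: power_mult_distrib power_divide)
qed

lemma cell_convex:
 assumes T: "T : \<T>"
 shows "open (interior T)" "bounded (interior T)" "convex (interior T)" "interior T ~= {}"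
  "!!x y. x : interior T ==> y : interior T ==> norm (x - y) <= diameter T" "0 <= diameter T"
proof -
 have b: "bounded T" by (rule simplex_bounded[OF simplex[OF T]])
 show "bounded (interior T)" by (rule bounded_subset[OF b interior_subset])
 show "open (interior T)" "convex (interior T)" "interior T ~= {}"
  using simplex_convex[OF simplex[OF T]] interior_nonempty[OF simplex[OF T]] by (auto intro: convex_interior)
 show "0 <= diameter T" by (rule diameter_ge_0[OF b])
 fix x y assume "x : interior T" "y : interior T"
 thus "norm (x - y) <= diameter T"
  using diameter_bounded_bound[OF b, of x y] interior_subset by (auto simp: dist_norm)
qed

lemma diameter_ball_measure:
 assumes T: "T : \<T>"
 shows "vol (cball (0::'a) (diameter T)) <= sig ^ DIM('a) * vol (interior T)"
proof -
 obtain c r where cr: "0 < r" "cball c r <= T" "diameter T <= sig * r" using inball[OF T] .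
 have "vol (cball (0::'a) (diameter T)) = unit_ball_vol (real DIM('a)) * diameter T ^ DIM('a)"
  using cell_convex(6)[OF T] by (simp add: content_cball)
 also have "... <= unit_ball_vol (real DIM('a)) * (sig * r) ^ DIM('a)"
  using cr cell_convex(6)[OF T] by (intro mult_left_mono power_mono) auto
 also have "... = sig ^ DIM('a) * (unit_ball_vol (real DIM('a)) * r ^ DIM('a))" by (simp add: power_mult_distrib)
 also have "... <= sig ^ DIM('a) * vol T"
  using simplex_measure_ge[OF simplex[OF T] cr(1,2)] sigma_ge_2[OF T] by (intro mult_left_mono) auto
 finally show ?thesis using vol_interior[OF simplex[OF T]] by simp
qed

lemma poincare_cell:
 assumes T: "T : \<T>" and w: "w : L2 (interior T)" and G: "G : L2 (interior T)" "weak_gradient (interior T) w G"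
  and A: "A <= interior T" "A : sets borel" "0 < \<alpha>" "\<alpha> * vol T <= vol A"
 shows "(cnorm T w)^2 <= 2 / \<alpha> * (l2_norm A w)^2
  + 2 * sig ^ DIM('a) * (diameter T)^2 / \<alpha> * (cnorm T G)^2"
 by (rule poincare_rel[OF cell_convex(1-4)[OF T] w G cell_convex(5,6)[OF T] A(1-3) _ diameter_ball_measure[OF T]])
   (use A(4) vol_interior[OF simplex[OF T]] in auto)

text \<open>\<open>t\<close> stands for the inradius, the smaller one of the two at an interior
  facet, and \<open>s = 2 t / d\<close> for the radius of the ball around the centroid. The diameter
  bound compares \<open>vol T\<close> with a ball of radius \<open>s / 2\<close>, which fits into
  the half ball.\<close>

lemma ball_fraction:
 fixes x0 :: 'a
 assumes T: "T : \<T>" and s: "diameter T <= K * sig^2 * t" "0 <= t" and n: "n ~= 0" and t: "t = s * real DIM('a) / 2" "0 < s"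
 shows "cell_frac DIM('a) sig K * vol T <= vol (ball x0 s Int {x. 0 < n \<bullet> (x - x0)})"
proof -
 obtain c r where cr: "0 < r" "cball c r <= T" using inball[OF T] by metis
 have pos: "0 < real DIM('a) * K * sig^2" using K_ge[OF T] sigma_ge_2[OF T] by simp
 have le: "1 / (real DIM('a) * K * sig^2) * diameter T <= s / 2"
  using s(1) pos unfolding t by (simp add: field_simps)
 have "cell_frac DIM('a) sig K * vol T
   <= cell_frac DIM('a) sig K * (unit_ball_vol (real DIM('a)) * diameter T ^ DIM('a))"
  using simplex_measure_le[OF simplex[OF T] cr] cell_frac_bounds[OF T] by (intro mult_left_mono) auto
 also have "... = unit_ball_vol (real DIM('a)) * (1 / (real DIM('a) * K * sig^2) * diameter T) ^ DIM('a)"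
  by (simp add: cell_frac_def power_mult_distrib power_divide)
 also have "... <= unit_ball_vol (real DIM('a)) * (s / 2) ^ DIM('a)"
  using le pos cell_convex(6)[OF T] by (intro mult_left_mono power_mono mult_nonneg_nonneg) auto
 also have "... = vol (ball x0 s) / 2 ^ DIM('a)" using t by (simp add: content_ball power_divide)
 also have "... <= vol (ball x0 s Int {x. 0 < n \<bullet> (x - x0)})" by (rule half_ball_measure[OF t(2) n])
 finally show ?thesis .
qed

lemma step_const_ge:
 assumes "T : \<T>"
 shows "4 * 2 ^ DIM('a) / cell_frac DIM('a) sig K <= step_const DIM('a) sig K"
  "(16 * 4 ^ DIM('a) + 2 * sig ^ DIM('a)) * (sig / root DIM('a) (unit_ball_vol (real DIM('a))))^2 / cell_frac DIM('a) sig K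
   <= step_const DIM('a) sig K"
  "1 <= step_const DIM('a) sig K"
proof -
 have \<alpha>: "0 < cell_frac DIM('a) sig K" "cell_frac DIM('a) sig K <= 1" using cell_frac_bounds[OF assms] by auto
 have sig: "0 <= (16 * 4 ^ DIM('a) + 2 * sig ^ DIM('a)) * (sig / root DIM('a) (unit_ball_vol (real DIM('a))))^2"
  using sigma_ge_2[OF assms] by simp
 show 1: "4 * 2 ^ DIM('a) / cell_frac DIM('a) sig K <= step_const DIM('a) sig K"
  unfolding step_const_def using \<alpha> sig by (intro divide_right_mono) auto
 show "(16 * 4 ^ DIM('a) + 2 * sig ^ DIM('a)) * (sig / root DIM('a) (unit_ball_vol (real DIM('a))))^2 / cell_frac DIM('a) sig K
   <= step_const DIM('a) sig K"
  unfolding step_const_def using \<alpha> sig by (intro divide_right_mono) auto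
 have "1 <= (2::real) ^ DIM('a)" by (rule one_le_power) simp
 hence "1 <= 4 * (2::real) ^ DIM('a)" by linarith
 hence "1 <= 4 * 2 ^ DIM('a) / cell_frac DIM('a) sig K" using \<alpha> by (simp add: pos_le_divide_eq)
 thus "1 <= step_const DIM('a) sig K" using 1 by linarith
qed

lemma energy_bound:
 assumes T: "T : \<T>" and X: "0 <= X"
 shows "(16 * 4 ^ DIM('a) + 2 * sig ^ DIM('a)) * (diameter T)^2 / cell_frac DIM('a) sig K * X
  <= step_const DIM('a) sig K * (hsize T)^2 * X"
proof -
 obtain c r where cr: "0 < r" "cball c r <= T" "diameter T <= sig * r" using inball[OF T] .
 let ?A = "(16 * 4 ^ DIM('a) + 2 * sig ^ DIM('a)) / cell_frac DIM('a) sig K"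
 have "?A * (diameter T)^2 <= ?A * ((sig / root DIM('a) (unit_ball_vol (real DIM('a))))^2 * (hsize T)^2)"
  using diameter_le_size[OF T cr] cell_frac_bounds[OF T] sigma_ge_2[OF T] by (intro mult_left_mono) auto
 also have "... <= step_const DIM('a) sig K * (hsize T)^2"
  using mult_right_mono[OF step_const_ge(2)[OF T], of "(hsize T)^2"] by (simp add: mult_ac)
 finally have "?A * (diameter T)^2 * X <= step_const DIM('a) sig K * (hsize T)^2 * X" using X by (rule mult_right_mono)
 thus ?thesis by (simp add: mult_ac)
qed

text \<open>The Poincare constant is enlarged to \<open>step_const\<close> so that one constant
  serves all estimates on a patch.\<close>

lemma cell_mean:
 assumes T: "T : \<T>" and w: "w : L2 (interior T)" and G: "G : L2 (interior T)" "weak_gradient (interior T) w G"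
 obtains c where "(cnorm T (%x. w x - c))^2
  <= step_const DIM('a) sig K * (hsize T)^2 * (cnorm T G)^2"
proof
 define c where "c = lint (interior T) w / vol (interior T)"
 let ?V = "vol (interior T)" and ?g = "(cnorm T G)^2"
 have V: "0 < ?V" using vol_pos[OF simplex[OF T]] vol_interior[OF simplex[OF T]] by simp
 have "?V * (cnorm T (%x. w x - c))^2 <= (diameter T)^2 * vol (cball (0::'a) (diameter T)) * ?g"
  unfolding l2_norm_sq_real[of _ "%x. w x - c"] by (rule poincare_mean[OF cell_convex(1-4)[OF T] w G cell_convex(5,6)[OF T] c_def])
 also have "... <= (diameter T)^2 * (sig ^ DIM('a) * ?V) * ?g"
  by (intro mult_right_mono mult_left_mono diameter_ball_measure T) auto
 finally have "?V * (cnorm T (%x. w x - c))^2 <= ?V * (sig ^ DIM('a) * (diameter T)^2 * ?g)" by (simp add: mult_ac)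
 hence "(cnorm T (%x. w x - c))^2 <= sig ^ DIM('a) * (diameter T)^2 * ?g" using V by (rule mult_left_le_imp_le)
 also have "... <= (16 * 4 ^ DIM('a) + 2 * sig ^ DIM('a)) / cell_frac DIM('a) sig K * (diameter T)^2 * ?g"
 proof (intro mult_right_mono)
  have s: "0 <= sig ^ DIM('a)" using sigma_ge_2[OF T] by simp
  hence "sig ^ DIM('a) * cell_frac DIM('a) sig K <= sig ^ DIM('a) * 1" using cell_frac_bounds[OF T] by (intro mult_left_mono) auto
  thus "sig ^ DIM('a) <= (16 * 4 ^ DIM('a) + 2 * sig ^ DIM('a)) / cell_frac DIM('a) sig K"
   using cell_frac_bounds[OF T] s by (simp add: pos_le_divide_eq add_increasing)
 qed auto
 also have "... <= step_const DIM('a) sig K * (hsize T)^2 * ?g" using energy_bound[OF T, of ?g] by simp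
 finally show "(cnorm T (%x. w x - c))^2 <= step_const DIM('a) sig K * (hsize T)^2 * ?g" .
qed

text \<open>Second half of a passage into \<open>T\<close>: a half ball inside \<open>T\<close>
  fills a fixed share of it, so \<open>poincare_cell\<close> spreads the bound. \<open>X\<close> is
  what is known on the other side of the facet and \<open>Y\<close> the energy; \<open>X = 0\<close>
  serves facets in \<open>gam\<close>.\<close>

lemma vanishing_part:
 assumes T: "T : \<T>" and w: "w : L2 (interior T)" and G: "G : L2 (interior T)" "weak_gradient (interior T) w G"
  and s: "0 < s" "diameter T <= K * sig^2 * (s * real DIM('a) / 2)" "s <= diameter T" and n: "n ~= 0"
  and sub: "ball x0 s Int {x. 0 < n \<bullet> (x - x0)} <= interior T"
  and y: "(l2_norm (ball x0 s Int {x. 0 < n \<bullet> (x - x0)}) w)^2 <= 2 * 2 ^ DIM('a) * X + 8 * 4 ^ DIM('a) * s^2 * Y"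
  and XY: "0 <= X" "0 <= Y" "(cnorm T G)^2 <= Y"
 shows "(cnorm T w)^2 <= step_const DIM('a) sig K * X + step_const DIM('a) sig K * (hsize T)^2 * Y"
proof -
 define \<alpha> where "\<alpha> = cell_frac DIM('a) sig K"
 have \<alpha>: "0 < \<alpha>" using cell_frac_bounds[OF T] by (simp add: \<alpha>_def)
 let ?A = "ball x0 s Int {x. 0 < n \<bullet> (x - x0)}"
 have "{x. 0 < n \<bullet> (x - x0)} = {x. n \<bullet> x0 < n \<bullet> x}" by (auto simp: inner_diff_right)
 hence Am: "?A : sets borel" by (auto simp: open_halfspace_gt intro!: borel_open open_Int)
 have "\<alpha> * vol T <= vol ?A"
  unfolding \<alpha>_def using s by (intro ball_fraction[OF T s(2) _ n refl s(1)]) auto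
 note pc = poincare_cell[OF T w G sub Am \<alpha> this]
 have 1: "2 / \<alpha> * (l2_norm ?A w)^2 <= 2 / \<alpha> * (2 * 2 ^ DIM('a) * X + 8 * 4 ^ DIM('a) * (diameter T)^2 * Y)"
 proof (intro mult_left_mono order_trans[OF y] add_left_mono mult_right_mono XY)
  show "s^2 <= (diameter T)^2" using s by (intro power_mono) auto
 qed (use \<alpha> in auto)
 have 2: "2 * sig ^ DIM('a) * (diameter T)^2 / \<alpha> * (cnorm T G)^2 <= 2 * sig ^ DIM('a) * (diameter T)^2 / \<alpha> * Y"
  using XY \<alpha> sigma_ge_2[OF T] by (intro mult_left_mono) auto
 have "(cnorm T w)^2 <= 4 * 2 ^ DIM('a) / \<alpha> * X + (16 * 4 ^ DIM('a) + 2 * sig ^ DIM('a)) * (diameter T)^2 / \<alpha> * Y"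
  using pc 1 2 by (simp add: algebra_simps add_divide_distrib)
 also have "... <= step_const DIM('a) sig K * X + step_const DIM('a) sig K * (hsize T)^2 * Y"
  unfolding \<alpha>_def by (intro add_mono mult_right_mono step_const_ge(1)[OF T] energy_bound[OF T] XY)
 finally show ?thesis .
qed

lemma inradius_compare:
 assumes adj: "adj T T'" and cr: "0 < r" "cball c r <= T" "diameter T <= sig * r"
  and cr': "0 < r'" "cball c' r' <= T'" "diameter T' <= sig * r'"
 shows "diameter T' <= K * sig^2 * min r r'"
proof -
 have T: "T : \<T>" "T' : \<T>" using adj by (auto simp: adj_def)
 let ?rho = "root DIM('a) (unit_ball_vol (real DIM('a)))"
 have p: "0 < ?rho" by (rule root_unit_ball_vol_pos)
 have sig: "2 <= sig" "1 <= K" using sigma_ge_2 K_ge T by auto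
 have "?rho * r' <= hsize T'" by (rule simplex_size_bounds(1)[OF simplex[OF T(2)] cr'(1,2)])
 also have "... <= K * hsize T" by (rule adj_size[OF adj_sym[OF adj]])
 also have "... <= K * (?rho * (sig * r))"
  using simplex_size_bounds(2)[OF simplex[OF T(1)] cr(1,2)] cr(3) p sig
  by (intro mult_left_mono) (auto intro: order_trans mult_left_mono)
 finally have "?rho * r' <= ?rho * (K * sig * r)" by (simp add: mult_ac)
 hence r: "r' <= K * sig * r" using p by (simp only: mult_le_cancel_left_pos)
 have "sig * r' <= K * sig^2 * r" using mult_left_mono[OF r, of sig] sig by (simp add: power2_eq_square mult_ac)
 moreover have "sig * r' <= K * sig^2 * r'"
 proof -
  have "1 * (sig * 1) <= K * (sig * sig)" using sig by (intro mult_mono) auto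
  thus ?thesis using cr'(1) by (intro mult_right_mono) (auto simp: power2_eq_square)
 qed
 ultimately show ?thesis using cr'(3) by (auto simp: min_def)
qed

text \<open>From \<open>T\<close> to its half ball at the facet centroid, by
  \<open>poincare_half_ball\<close> to the opposite half ball in \<open>T'\<close>, and by
  \<open>vanishing_part\<close> to all of \<open>T'\<close>.\<close>

lemma adjacent_step:
 assumes adj: "adj T T'" and w: "w : L2 Om" and G: "G : L2 Om" "weak_gradient Om w G"
 shows "(cnorm T' w)^2 <= step_const DIM('a) sig K * (cnorm T w)^2
  + step_const DIM('a) sig K * (hsize T')^2 * ((cnorm T G)^2 + (cnorm T' G)^2)"
proof -
 have T: "T : \<T>" "T' : \<T>" using adj by (auto simp: adj_def)
 obtain c r where cr: "0 < r" "cball c r <= T" "diameter T <= sig * r" using inball[OF T(1)] .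
 obtain c' r' where cr': "0 < r'" "cball c' r' <= T'" "diameter T' <= sig * r'" using inball[OF T(2)] .
 obtain a a' where a: "a : verts T" "a' : verts T'" "verts (T Int T') = verts T - {a}" "verts (T Int T') = verts T' - {a'}"
  "T Int T' = {x : T. bary T a x = 0}"
  "!!r c r' c' m x0. 0 < r ==> cball c r <= T ==> 0 < r' ==> cball c' r' <= T' ==> 0 < m ==> x0 : T Int T' ==>
    (!!nu. nu : verts (T Int T') ==> m <= bary T nu x0) ==>
    ball x0 (2 * min r r' * m) <= Om & (ALL x:ball x0 (2 * min r r' * m).
     (0 < bary T a x --> x : interior T) & (bary T a x < 0 --> x : interior T'))"
  using facet_neighbour_ball[OF adj] by blast
 define x0 where "x0 = (SUM v:verts T - {a}. (1 / real DIM('a)) *\<^sub>R v)"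
 note fc = facet_centroid[OF simplex[OF T(1)] a(1), folded x0_def]
 \<comment> \<open>The coordinates of the centroid are \<open>1 / d\<close>, the lower bound
   \<open>m\<close> with which \<open>facet_neighbour_ball\<close> is applied.\<close>
 define s where "s = 2 * min r r' * (1 / real DIM('a))"
 have x0: "x0 : T Int T'" using a(5) fc by auto
 have m: "1 / real DIM('a) <= bary T nu x0" if "nu : verts (T Int T')" for nu using fc(2)[of nu] that a(3) by simp
 note b = a(6)[OF cr(1,2) cr'(1,2) _ x0 m, folded s_def, simplified]
 obtain n where n: "n ~= 0" "!!x. bary T a x = n \<bullet> (x - x0)" using bary_form[OF simplex[OF T(1)] a(1) fc(1)] by metis
 have s0: "0 < s" using cr(1) cr'(1) by (simp add: s_def)
 have BOm: "ball x0 s <= Om" using b by blast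
 have Bm: "ball x0 s : lmeasurable" "ball x0 s : sets lebesgue" by auto
 note Om = dom_meas cell_sets(2)
 have hs: "{x. 0 < k \<bullet> (x - x0)} = {x. k \<bullet> x0 < k \<bullet> x}" for k by (auto simp: inner_diff_right)
 have hm: "ball x0 s Int {x. 0 < k \<bullet> (x - x0)} : sets lebesgue" for k
  unfolding hs by (intro sets.Int) (auto simp: open_halfspace_gt intro!: sets_completionI_sets borel_open)
 have wB: "w : L2 (ball x0 s)" "G : L2 (ball x0 s)" using L2_subset[OF _ BOm Bm(2) Om(2)] w G(1) by auto
 have gB: "weak_gradient (ball x0 s) w G" by (rule wgrad_subset[OF G(2) Om(1) w G(1) BOm Bm(1)])
 have sub1: "ball x0 s Int {x. 0 < n \<bullet> (x - x0)} <= interior T" using b n(2) by auto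
 have sub2: "ball x0 s Int {x. 0 < - n \<bullet> (x - x0)} <= interior T'" using b n(2) by auto
 let ?Y = "(cnorm T G)^2 + (cnorm T' G)^2"
 have "(l2_norm (ball x0 s Int {x. 0 < - n \<bullet> (x - x0)}) w)^2 <= (l2_norm (ball x0 s) w)^2"
  by (rule l2_mono_set[OF wB(1) _ hm Bm(2)]) auto
 also have "... <= 2 * 2 ^ DIM('a) * (l2_norm (ball x0 s Int {x. 0 < n \<bullet> (x - x0)}) w)^2 + 8 * 4 ^ DIM('a) * s^2 * (l2_norm (ball x0 s) G)^2"
  by (rule poincare_half_ball[OF s0 n(1) wB gB])
 also have "... <= 2 * 2 ^ DIM('a) * (cnorm T w)^2 + 8 * 4 ^ DIM('a) * s^2 * ?Y"
 proof (intro add_mono mult_left_mono)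
  show "(l2_norm (ball x0 s Int {x. 0 < n \<bullet> (x - x0)}) w)^2 <= (cnorm T w)^2"
   by (rule l2_mono_set[OF L2_interior[OF w T(1)] sub1 hm cell_sets(1)[OF T(1)]])
  have "negligible {x. n \<bullet> x = n \<bullet> x0}" using n(1) by (intro negligible_hyperplane) auto
  hence "AE x in lebesgue. x ~: {x. n \<bullet> x = n \<bullet> x0}" by (intro AE_not_in) (simp add: negligible_iff_null_sets)
  hence "AE x in lebesgue. x : ball x0 s --> x : interior T \<or> x : interior T'"
  proof eventually_elim
   case (elim x)
   hence "n \<bullet> (x - x0) ~= 0" by (simp add: inner_diff_right)
   hence "0 < bary T a x \<or> bary T a x < 0" unfolding n(2)[of x] by linarith
   thus ?case using b by blast
  qed
  thus "(l2_norm (ball x0 s) G)^2 <= ?Y"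
   by (intro l2_norm_sq_cover[OF G(1) Om(2) BOm] cell_subset cell_sets Bm T)
 qed auto
 finally have y: "(l2_norm (ball x0 s Int {x. 0 < - n \<bullet> (x - x0)}) w)^2
  <= 2 * 2 ^ DIM('a) * (cnorm T w)^2 + 8 * 4 ^ DIM('a) * s^2 * ?Y" .
 show ?thesis
 proof (rule vanishing_part[OF T(2) _ _ _ s0 _ _ _ sub2 y])
  show "w : L2 (interior T')" "G : L2 (interior T')" using L2_interior T w G by auto
  show "weak_gradient (interior T') w G"
   by (rule wgrad_subset[OF G(2) Om(1) w G(1) cell_subset[OF T(2)] simplex_meas(2)[OF simplex[OF T(2)]]])
  show "diameter T' <= K * sig^2 * (s * real DIM('a) / 2)" using inradius_compare[OF adj cr cr'] by (simp add: s_def)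
  have "s <= 2 * r'"
  proof -
   have "min r r' * (1 / real DIM('a)) <= r' * 1" using cr(1) cr'(1) by (intro mult_mono) (auto simp: divide_le_eq)
   thus ?thesis by (simp add: s_def)
  qed
  thus "s <= diameter T'" using cball_diameter[OF cr'(1,2) simplex_bounded[OF simplex[OF T(2)]]] by linarith
 qed (use n(1) in auto)
qed

end

lemma weak_gradient_minus_const:
 assumes D: "open D" "bounded D" and L: "w : L2 D" "G : L2 D" "weak_gradient D w G"
 shows "weak_gradient D (%x. w x - c) G" "(%x. w x - c) : L2 D"
proof -
 have Dm: "D : lmeasurable" using D by (simp add: lmeasurable_open)
 have c: "weak_gradient D (%x. 0 \<bullet> x + 1) (%x. 0)" by (rule weak_gradient_affine[OF D])
 have "weak_gradient D (%x. 1 * w x + (- c) * (0 \<bullet> x + 1)) (%x. 1 *\<^sub>R G x + (- c) *\<^sub>R 0)"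
  by (rule weak_gradient_lincomb[OF Dm _ _ _ _ L(3) c]) (use L const_L2[OF Dm] in simp_all)
 thus "weak_gradient D (%x. w x - c) G" by simp
 show "(%x. w x - c) : L2 D" by (intro L2_diff L const_L2 Dm)
qed

lemma l2_norm_extend_zero:
 fixes f :: "'a::euclidean_space => 'b::euclidean_space"
 assumes "E <= D" "E : sets lebesgue" "D : sets lebesgue"
 shows "(l2_norm D (%x. if x : E then f x else 0))^2 = (l2_norm E f)^2"
proof -
 have "(l2_norm D (%x. if x : E then f x else 0))^2 = lint E (%x. (norm (if x : E then f x else 0))^2)"
  unfolding l2_norm_sq by (rule lint_subset[OF assms]) auto
 also have "... = (l2_norm E f)^2" unfolding l2_norm_sq by (rule lint_cong) auto
 finally show ?thesis .
qed

section \<open>Chains of simplices around a vertex and the Poincare inequality on patches\<close>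

definition chain_steps :: "nat => real => nat" where "chain_steps d sig = nat \<lceil>(sig ^ d)^2\<rceil>"

text \<open>The result of \<open>rtrancl_bound\<close> after at most \<open>chain_steps\<close>
  passages, with the sizes along the chain replaced by that of the first simplex at the cost of a
  factor \<open>(K ^ chain_steps)^2\<close>.\<close>

definition chain_const :: "nat => real => real => real" where
 "chain_const d sig K = step_const d sig K ^ chain_steps d sig *
   (1 + real (chain_steps d sig) * (step_const d sig K * (K ^ chain_steps d sig)^2))"

text \<open>Two chains in a row: from a simplex with a facet in \<open>gam\<close> to
  \<open>T\<close>, and from \<open>T\<close> to the other simplices at its vertices. Away from
  \<open>gam\<close> the first chain is replaced by the mean value on \<open>T\<close>, whose
  constant is smaller.\<close>

definition patch_const :: "nat => real => real => real" where
 "patch_const d sig K = chain_const d sig K * (chain_const d sig K * (step_const d sig K + 1) * (K ^ chain_steps d sig)^2 + 1)"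

locale regular_refined_mesh = refined_mesh + regular_mesh
begin

text \<open>Adjacent pairs number at most the square of the size of the star, which
  \<open>card_star\<close> bounds.\<close>

lemma card_adj_rel: "card (adj_rel nu) <= chain_steps DIM('a) sig" "finite (adj_rel nu)"
proof -
 have sub: "adj_rel nu <= star nu \<times> star nu" by (auto simp: adj_rel_def)
 show "finite (adj_rel nu)" by (rule finite_subset[OF sub]) (simp add: finite_star)
 have "card (adj_rel nu) <= card (star nu) * card (star nu)"
  using card_mono[OF _ sub] finite_star by (simp add: card_cartesian_product)
 hence "real (card (adj_rel nu)) <= (real (card (star nu)))^2" unfolding power2_eq_square by (metis of_nat_le_iff of_nat_mult)
 also have "... <= (sig ^ DIM('a))^2" by (intro power_mono card_star) auto
 finally show "card (adj_rel nu) <= chain_steps DIM('a) sig" unfolding chain_steps_def by linarith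
qed

lemma star_size:
 assumes T: "T : star nu" "T' : star nu"
 shows "hsize T' <= K ^ chain_steps DIM('a) sig * hsize T"
proof -
 have "hsize T' <= K ^ chain_steps DIM('a) sig * (hsize T + real (chain_steps DIM('a) sig) * 0)"
 proof (rule rtrancl_bound[OF star_connected[OF T] card_adj_rel(2,1)])
  show "1 <= K" using K_ge T by (auto simp: star_def)
  fix A B assume "(A, B) : adj_rel nu"
  thus "hsize B <= K * hsize A + 0" using adj_size[OF adj_sym] by (simp add: adj_rel_def)
 qed (auto simp: simplex_size_def)
 thus ?thesis by simp
qed

text \<open>\<open>rtrancl_bound\<close> asks for one error term for all steps; \<open>e\<close> is
  formed with the energy of the whole patch and the largest size ratio in the star.\<close>

lemma star_chain:
 assumes T: "T : star nu" "T' : star nu" and w: "w : L2 Om" and G: "G : L2 Om" "weak_gradient Om w G"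
 shows "(cnorm T' w)^2
  <= chain_const DIM('a) sig K * ((cnorm T w)^2 + (hsize T)^2 * patch_sq G nu)"
proof -
 let ?C = "step_const DIM('a) sig K" and ?M = "chain_steps DIM('a) sig"
 define e where "e = ?C * ((K ^ ?M)^2 * (hsize T)^2 * patch_sq G nu)"
 have TT: "T : \<T>" using T by (auto simp: star_def)
 have C: "1 <= ?C" by (rule step_const_ge(3)[OF TT])
 have e0: "0 <= e" using C by (simp add: e_def)
 have "(cnorm T' w)^2 <= ?C ^ ?M * ((cnorm T w)^2 + real ?M * e)"
 proof (rule rtrancl_bound[OF star_connected[OF T] card_adj_rel(2,1) C e0])
  fix A B assume AB: "(A, B) : adj_rel nu"
  hence adj: "adj A B" and st: "A : star nu" "B : star nu" and neq: "A ~= B" by (auto simp: adj_rel_def adj_def)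
  have "(cnorm A G)^2 + (cnorm B G)^2 = (SUM T:{A, B}. (cnorm T G)^2)"
   using neq by simp
  also have "... <= patch_sq G nu" unfolding patch_sq_def by (rule sum_mono2[OF finite_star]) (use st in auto)
  finally have E: "(cnorm A G)^2 + (cnorm B G)^2 <= patch_sq G nu" .
  have S: "(hsize B)^2 <= (K ^ ?M)^2 * (hsize T)^2"
   using power_mono[OF star_size[OF T(1) st(2)], of 2] by (simp add: power_mult_distrib simplex_size_def)
  have "?C * (hsize B)^2 * ((cnorm A G)^2 + (cnorm B G)^2) <= e"
   unfolding e_def mult.assoc[of ?C] by (intro mult_left_mono mult_mono E S) (use C in auto)
  thus "(cnorm B w)^2 <= ?C * (cnorm A w)^2 + e"
   using adjacent_step[OF adj w G] by linarith
 qed auto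
 also have "... <= ?C ^ ?M * ((1 + real ?M * (?C * (K ^ ?M)^2)) * ((cnorm T w)^2 + (hsize T)^2 * patch_sq G nu))"
 proof (rule mult_left_mono)
  define F where "F = (cnorm T w)^2"
  define X where "X = (hsize T)^2 * patch_sq G nu"
  define q where "q = real ?M * (?C * (K ^ ?M)^2)"
  have "0 <= F" "0 <= X" "0 <= q" using C by (auto simp: F_def X_def q_def)
  hence "F + q * X <= (1 + q) * (F + X)" by (simp add: algebra_simps)
  moreover have "real ?M * e = q * X" by (simp add: e_def q_def X_def mult_ac)
  ultimately have "F + real ?M * e <= (1 + q) * (F + X)" by simp
  thus "(cnorm T w)^2 + real ?M * e
   <= (1 + real ?M * (?C * (K ^ ?M)^2)) * ((cnorm T w)^2 + (hsize T)^2 * patch_sq G nu)"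
   unfolding F_def X_def q_def .
 qed (use C in simp)
 finally show ?thesis unfolding chain_const_def by (simp only: mult.assoc)
qed

lemma chain_const_ge: "T : \<T> ==> 1 <= chain_const DIM('a) sig K"
proof -
 assume T: "T : \<T>"
 let ?C = "step_const DIM('a) sig K" and ?M = "chain_steps DIM('a) sig"
 have C: "1 <= ?C" by (rule step_const_ge(3)[OF T])
 hence "1 * 1 <= ?C ^ ?M * (1 + real ?M * (?C * (K ^ ?M)^2))" by (intro mult_mono one_le_power) auto
 thus ?thesis by (simp add: chain_const_def)
qed

text \<open>The zero extension plays the part of the neighbour: it vanishes on the outer half ball,
  so \<open>poincare_half_ball\<close> leaves only the gradient term.\<close>

lemma boundary_cell:
 assumes T: "T : \<T>" and a: "a : verts T" and F: "{x : T. bary T a x = 0} <= gam" and v: "v : H1_0 Om gam"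
 shows "(cnorm T v)^2 <= step_const DIM('a) sig K * (hsize T)^2 * (cnorm T (wgrad Om v))^2"
proof -
 obtain c r where cr: "0 < r" "cball c r <= T" "diameter T <= sig * r" using inball[OF T] .
 define x0 where "x0 = (SUM v:verts T - {a}. (1 / real DIM('a)) *\<^sub>R v)"
 note fc = facet_centroid[OF simplex[OF T] a, folded x0_def]
 define s where "s = 2 * r * (1 / real DIM('a))"
 have s0: "0 < s" using cr(1) by (simp add: s_def)
 define B where "B = ball x0 s"
 define E where "E = ball x0 s Int interior T"
 let ?G = "wgrad Om v"
 let ?v = "%x. if x : E then v x else 0" and ?g = "%x. if x : E then ?G x else 0"
 have m: "1 / real DIM('a) <= bary T nu x0" if "nu : verts T - {a}" for nu using fc(2)[OF that] by simp
 have m0: "0 < 1 / real DIM('a)" by simp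
 note ext = gam_facet_extension[OF T a F cr(1,2) m0 fc(1) m v, folded s_def, folded E_def, folded B_def]
 obtain n where n: "n ~= 0" "!!x. bary T a x = n \<bullet> (x - x0)" using bary_form[OF simplex[OF T] a fc(1)] by metis
 have E: "E = B Int {x. 0 < n \<bullet> (x - x0)}" using ext(4) n(2) by simp
 have vH: "v : H1 Om" by (rule H1_0_H1[OF v])
 note vG = H1_L2[OF vH] wgrad_props[OF vH]
 have Es: "E <= B" "E <= interior T" "E : sets lebesgue" "B : sets lebesgue"
  using cell_sets(1)[OF T] by (auto simp: E_def B_def)
 have "(l2_norm B ?v)^2 <= 2 * 2 ^ DIM('a) * (l2_norm (B Int {x. 0 < - n \<bullet> (x - x0)}) ?v)^2 + 8 * 4 ^ DIM('a) * s^2 * (l2_norm B ?g)^2"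
  unfolding B_def by (rule poincare_half_ball[OF s0 _ ext(2,3,1)[unfolded B_def]]) (use n in simp)
 also have "(l2_norm (B Int {x. 0 < - n \<bullet> (x - x0)}) ?v)^2 = 0"
 proof -
  have "l2_norm (B Int {x. 0 < - n \<bullet> (x - x0)}) ?v = l2_norm (B Int {x. 0 < - n \<bullet> (x - x0)}) (%x. 0::real)"
   unfolding l2_norm_def by (rule arg_cong[where f = sqrt], rule lint_cong) (auto simp: E)
  thus ?thesis by (simp add: l2_norm_def)
 qed
 also have "(l2_norm B ?g)^2 = (l2_norm E ?G)^2" by (rule l2_norm_extend_zero[OF Es(1,3,4)])
 also have "(l2_norm B ?v)^2 = (l2_norm E v)^2" by (rule l2_norm_extend_zero[OF Es(1,3,4)])
 finally have "(l2_norm E v)^2 <= 8 * 4 ^ DIM('a) * s^2 * (l2_norm E ?G)^2" by simp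
 also have "... <= 8 * 4 ^ DIM('a) * s^2 * (cnorm T ?G)^2"
  by (intro mult_left_mono l2_mono_set[OF L2_interior[OF _ T] Es(2,3) cell_sets(1)[OF T]] vG) auto
 finally have y: "(l2_norm (ball x0 s Int {x. 0 < n \<bullet> (x - x0)}) v)^2
   <= 2 * 2 ^ DIM('a) * 0 + 8 * 4 ^ DIM('a) * s^2 * (cnorm T ?G)^2" by (simp add: E B_def)
 have "(cnorm T v)^2 <= step_const DIM('a) sig K * 0 + step_const DIM('a) sig K * (hsize T)^2 * (cnorm T ?G)^2"
 proof (rule vanishing_part[OF T _ _ _ s0 _ _ n(1) _ y])
  show "v : L2 (interior T)" "?G : L2 (interior T)" using L2_interior T vG by auto
  show "weak_gradient (interior T) v ?G"
   by (rule wgrad_subset[OF vG(3) dom_meas vG(1,2) cell_subset[OF T] simplex_meas(2)[OF simplex[OF T]]])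
  have "sig * r <= K * sig^2 * r"
  proof -
   have "1 * (sig * 1) <= K * (sig * sig)" using sigma_ge_2[OF T] K_ge[OF T] by (intro mult_mono) auto
   thus ?thesis using cr(1) by (intro mult_right_mono) (auto simp: power2_eq_square)
  qed
  thus "diameter T <= K * sig^2 * (s * real DIM('a) / 2)" using cr(3) by (simp add: s_def)
  have "s <= 2 * r"
  proof -
   have "r * (1 / real DIM('a)) <= r * 1" using cr(1) by (intro mult_left_mono) (auto simp: divide_le_eq)
   thus ?thesis by (simp add: s_def)
  qed
  thus "s <= diameter T" using cball_diameter[OF cr(1,2) simplex_bounded[OF simplex[OF T]]] by linarith
  show "ball x0 s Int {x. 0 < n \<bullet> (x - x0)} <= interior T" using Es(2) by (simp add: E B_def)
 qed auto
 thus ?thesis by simp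
qed

definition patch_energy :: "('a => 'b::euclidean_space) => 'a set => real" where
 "patch_energy G T = (SUM nu:verts T. patch_sq G nu)"

lemma patch_sq_le_energy: "T : \<T> ==> nu : verts T ==> patch_sq G nu <= patch_energy G T"
 unfolding patch_energy_def by (rule member_le_sum) (auto simp: simplex_verts(3)[OF simplex])

lemma cell_le_patch_sq: "T : star nu ==> (cnorm T G)^2 <= patch_sq G nu"
 unfolding patch_sq_def by (rule member_le_sum) (auto simp: finite_star)

lemma vert_star: "T : \<T> ==> nu : verts T ==> T : star nu"
 using star_verts vert_node by blast

text \<open>If a vertex lies on \<open>gam\<close>, then the constant is zero: the facet of \<open>gam\<close> at that vertex belongs to some
 simplex of the patch, from which the bound is carried over along the patch.\<close>

lemma patch_constant:
 assumes T: "T : \<T>" and v: "v : H1_0 Om gam"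
 obtains c where "c = 0 \<or> verts T <= N0"
  "!!nu T'. nu : verts T ==> T' : star nu ==> (cnorm T' (%x. v x - c))^2
   <= patch_const DIM('a) sig K * (hsize T)^2 * patch_energy (wgrad Om v) T"
proof -
 let ?C = "step_const DIM('a) sig K" and ?M = "chain_steps DIM('a) sig" and ?D = "chain_const DIM('a) sig K"
 let ?G = "wgrad Om v"
 have vH: "v : H1 Om" by (rule H1_0_H1[OF v])
 note vG = H1_L2[OF vH] wgrad_props[OF vH]
 note wc = weak_gradient_minus_const[OF domain_open domain_bounded vG]
 define h where "h = (hsize T)^2"
 define E where "E = patch_energy ?G T"
 have C: "1 <= ?C" "1 <= ?D" "1 <= (K ^ ?M)^2"
  using step_const_ge(3)[OF T] chain_const_ge[OF T] K_ge[OF T] by (auto intro!: one_le_power)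
 have E0: "0 <= E" "0 <= h" by (auto simp: E_def h_def patch_energy_def intro!: sum_nonneg)
 have spread: "(cnorm T' (%x. v x - c))^2 <= ?D * (B * (h * E) + h * E)"
  if nu: "nu : verts T" "T' : star nu" and B: "(cnorm T (%x. v x - c))^2 <= B * (h * E)" for c B nu T'
 proof -
  have "(cnorm T' (%x. v x - c))^2 <= ?D * ((cnorm T (%x. v x - c))^2 + (hsize T)^2 * patch_sq ?G nu)"
   by (rule star_chain[OF vert_star[OF T nu(1)] nu(2) wc(2) vG(2) wc(1)])
  also have "... <= ?D * (B * (h * E) + h * E)"
   unfolding h_def E_def using B C patch_sq_le_energy[OF T nu(1)]
   by (intro mult_left_mono add_mono) (auto simp: h_def E_def)
  finally show ?thesis .
 qed
 show thesis
 \<comment> \<open>\<open>T\<close> may touch \<open>gam\<close> in a vertex without having a facet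
   there. The case distinction is therefore on vertices, as are the nodes that the projector
   omits.\<close>
 proof (cases "verts T Int gam = {}")
  case True
  hence N0: "verts T <= N0" using vert_node[OF T] by (auto simp: free_nodes_def)
  obtain c where c: "(cnorm T (%x. v x - c))^2 <= ?C * (hsize T)^2 * (cnorm T ?G)^2"
   by (rule cell_mean[OF T L2_interior[OF vG(1) T] L2_interior[OF vG(2) T]
    wgrad_subset[OF vG(3) dom_meas vG(1,2) cell_subset[OF T] simplex_meas(2)[OF simplex[OF T]]]])
  obtain nu0 where nu0: "nu0 : verts T" using simplex_card[OF simplex[OF T]] by fastforce
  have "(cnorm T ?G)^2 <= E"
   unfolding E_def using cell_le_patch_sq[OF vert_star[OF T nu0]] patch_sq_le_energy[OF T nu0] by (rule order_trans)
  hence "?C * (hsize T)^2 * (cnorm T ?G)^2 <= ?C * (hsize T)^2 * E" using C by (intro mult_left_mono) auto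
  hence B: "(cnorm T (%x. v x - c))^2 <= ?C * (h * E)" using c by (simp add: h_def mult.assoc)
  show thesis
  proof (rule that[of c])
   fix nu T' assume nu: "nu : verts T" "T' : star nu"
   have "(cnorm T' (%x. v x - c))^2 <= ?D * (?C * (h * E) + h * E)" by (rule spread[OF nu B])
   also have "... = ?D * (1 * (?C + 1) * 1) * (h * E)" by (simp add: algebra_simps)
   also have "... <= ?D * (?D * (?C + 1) * (K ^ ?M)^2 + 1) * (h * E)"
   proof (intro mult_right_mono mult_left_mono)
    have "1 * (?C + 1) * 1 <= ?D * (?C + 1) * (K ^ ?M)^2" using C by (intro mult_mono) auto
    thus "1 * (?C + 1) * 1 <= ?D * (?C + 1) * (K ^ ?M)^2 + 1" by simp
   qed (use C E0 in auto)
   finally show "(cnorm T' (%x. v x - c))^2 <= patch_const DIM('a) sig K * (hsize T)^2 * patch_energy ?G T"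
    by (simp add: patch_const_def h_def E_def mult.assoc)
  qed (use N0 in simp)
 next
  case False
  then obtain nu0 where nu0: "nu0 : verts T" "nu0 : gam" by blast
  obtain T0 F a where T0: "T0 : \<T>" "F facet_of T0" "nu0 : F" "F <= gam" "a : verts T0" "verts F = verts T0 - {a}"
   "F = {x : T0. bary T0 a x = 0}"
   using gam_facet[OF nu0(2)] .
  have st: "T0 : star nu0" "T : star nu0" using T0 vert_star[OF T nu0(1)] by (auto simp: star_def)
  let ?h0 = "(hsize T0)^2" and ?p = "patch_sq ?G nu0"
  have "(cnorm T0 v)^2 <= ?C * ?h0 * (cnorm T0 ?G)^2"
   by (rule boundary_cell[OF T0(1,5) _ v]) (use T0 in auto)
  also have "... <= ?C * ?h0 * ?p" using cell_le_patch_sq[OF st(1)] C by (intro mult_left_mono) auto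
  finally have 0: "(cnorm T0 v)^2 <= ?C * ?h0 * ?p" .
  have "(cnorm T v)^2 <= ?D * ((cnorm T0 v)^2 + ?h0 * ?p)" by (rule star_chain[OF st vG])
  also have "... <= ?D * (?C * ?h0 * ?p + ?h0 * ?p)" using 0 C by (intro mult_left_mono add_right_mono) auto
  also have "... = ?D * (?C + 1) * (?h0 * ?p)" by (simp add: algebra_simps)
  also have "... <= ?D * (?C + 1) * (((K ^ ?M)^2 * h) * E)"
  proof (intro mult_left_mono mult_mono)
   show "?h0 <= (K ^ ?M)^2 * h"
    using power_mono[OF star_size[OF st(2,1)], of 2] by (simp add: power_mult_distrib simplex_size_def h_def)
   show "?p <= E" unfolding E_def by (rule patch_sq_le_energy[OF T nu0(1)])
  qed (use C E0 in auto)
  finally have B: "(cnorm T (%x. v x - 0))^2 <= (?D * (?C + 1) * (K ^ ?M)^2) * (h * E)" by (simp add: mult.assoc)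
  show thesis
  proof (rule that[of 0])
   fix nu T' assume nu: "nu : verts T" "T' : star nu"
   have "(cnorm T' (%x. v x - 0))^2 <= ?D * ((?D * (?C + 1) * (K ^ ?M)^2) * (h * E) + h * E)" by (rule spread[OF nu B])
   also have "... = patch_const DIM('a) sig K * (hsize T)^2 * patch_energy ?G T"
    by (simp add: patch_const_def h_def E_def algebra_simps)
   finally show "(cnorm T' (%x. v x - 0))^2 <= patch_const DIM('a) sig K * (hsize T)^2 * patch_energy ?G T" .
  qed simp
 qed
qed

end

section \<open>The adjoint projector\<close>

context refined_mesh
begin

definition adj_coef :: "'a => ('a => real) => real" where
 "adj_coef nu v = (real DIM('a) + 1) / om nu * l2_inner Om v (hat \<T> nu)"

text \<open>The adjoint in closed form: compared with the projector, \<open>hat\<close> and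
  \<open>dual_hat\<close> exchange roles.\<close>

definition Q_adj :: "('a => real) => 'a => real" where
 "Q_adj v = (%x. SUM nu:N0. adj_coef nu v * dual nu x)"

lemma Q_adj_L2: "Q_adj v : L2 Om"
 unfolding Q_adj_def by (intro L2_lincomb dual_hat_L2 N0_node)

lemma Q_adj_adjoint:
 assumes u: "u : L2 Om" and v: "v : L2 Om"
 shows "l2_inner Om (Q u) v = l2_inner Om u (Q_adj v)"
proof -
 have "l2_inner Om (Q u) v = (SUM nu:N0. coef nu u * l2_inner Om (hat \<T> nu) v)"
  unfolding Q_fun by (intro l2_inner_sum_left hat_L2 v)
 also have "... = (SUM nu:N0. adj_coef nu v * l2_inner Om (dual nu) u)"
  by (intro sum.cong refl) (simp add: coef_def adj_coef_def l2_inner_commute[of Om v] l2_inner_commute[of Om u])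
 also have "... = l2_inner Om (Q_adj v) u"
  unfolding Q_adj_def by (intro l2_inner_sum_left[symmetric] dual_hat_L2 N0_node u)
 finally show ?thesis by (simp only: l2_inner_commute)
qed

text \<open>\<open>adjoint_op\<close> is a choice up to null sets. Both functions represent the same
  functional on \<open>L2\<close>, so testing with their difference shows that its norm is
  zero.\<close>

lemma adjoint_op_Q:
 assumes v: "v : L2 Om"
 shows "adjoint_op Om Q v : L2 Om" "AE x in leb Om. adjoint_op Om Q v x = Q_adj v x"
proof -
 let ?A = "adjoint_op Om Q v"
 have "EX w. w : L2 Om & (ALL u:L2 Om. dual_embed Om (Q u) v = l2_inner Om u w)"
  using Q_adj_L2 Q_adj_adjoint[OF _ v] by (auto simp: dual_embed_def)
 from someI_ex[OF this] have A: "?A : L2 Om" "!!u. u : L2 Om ==> l2_inner Om (Q u) v = l2_inner Om u ?A"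
  by (auto simp: adjoint_op_def dual_embed_def)
 show "?A : L2 Om" by (rule A(1))
 let ?D = "%x. ?A x - Q_adj v x"
 have D: "?D : L2 Om" by (intro L2_diff A Q_adj_L2)
 have "l2_inner Om ?D ?D = 0"
  using A(2)[OF D] Q_adj_adjoint[OF D v] by (subst l2_inner_diff_right[OF D A(1) Q_adj_L2]) simp
 hence "(l2_norm Om ?D)^2 = 0"
  unfolding l2_norm_sq_real by (simp add: l2_inner_def power2_eq_square)
 hence "AE x in leb Om. ?D x = 0" by (intro l2_norm_eq_0 D) simp
 thus "AE x in leb Om. ?A x = Q_adj v x" by eventually_elim simp
qed

text \<open>Makes \<open>adj_coef\<close> of a constant function equal to that constant.\<close>

lemma hat_integral:
 assumes nu: "nu : nodes \<T>"
 shows "l2_inner Om (%x. c) (hat \<T> nu) = c * om nu / (real DIM('a) + 1)"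
proof -
 let ?I = "%T. l2_inner (interior T) (%x. c) (hat \<T> nu)"
 have I: "?I T = c * lint (interior T) (bary T nu)" if "T : \<T>" for T
 proof -
  have "?I T = lint (interior T) (%x. c * bary T nu x)"
   by (rule l2_inner_cell_cong) (use hat_eq_bary[OF that] interior_subset in auto)
  thus ?thesis by simp
 qed
 have "l2_inner Om (%x. c) (hat \<T> nu) = (SUM T:\<T>. ?I T)"
  by (rule l2_inner_mesh[OF const_L2[OF dom_meas] hat_L2])
 also have "... = (SUM T:star nu. ?I T)"
 proof (rule sum.mono_neutral_right[OF fin])
  show "ALL T:\<T> - star nu. ?I T = 0"
  proof
   fix T assume "T : \<T> - star nu"
   hence T: "T : \<T>" "nu ~: verts T" using star_verts[OF nu] by auto
   hence "bary T nu = (%x. 0)" using bary_non_vert[OF simplex[OF T(1)] T(2)] by blast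
   thus "?I T = 0" unfolding I[OF T(1)] by simp
  qed
 qed (auto simp: star_def)
 also have "... = (SUM T:star nu. c / (real DIM('a) + 1) * vol T)"
 proof (rule sum.cong[OF refl])
  fix T assume "T : star nu"
  hence T: "T : \<T>" "nu : verts T" using star_verts[OF nu] by auto
  show "?I T = c / (real DIM('a) + 1) * vol T" unfolding I[OF T(1)] bary_integral[OF simplex[OF T(1)] T(2)] by simp
 qed
 also have "... = c * om nu / (real DIM('a) + 1)" unfolding patch_measure[OF nu] by (simp add: sum_distrib_left sum_divide_distrib)
 finally show ?thesis .
qed

text \<open>Each corner indicator enters with weight \<open>d\<close> at its own vertex and with
  weight -1 at the \<open>d\<close> other ones, so all of them cancel in the sum.\<close>

lemma dual_local_sum:
 assumes T: "T : \<T>"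
 shows "(SUM nu:verts T. dual_local T nu x) = 1"
proof -
 let ?D = "real DIM('a) + 1"
 define P :: real where "P = 2 ^ (1 + DIM('a)) / ?D"
 define s where "s nu = step (1/2) (bary T nu x)" for nu
 define S where "S = (SUM nu:verts T. s nu)"
 have fin: "finite (verts T)" by (rule simplex_verts(3)[OF simplex[OF T]])
 have card: "real (card (verts T)) = ?D" using simplex_card[OF simplex[OF T]] by simp
 have "(SUM nu:verts T. dual_local T nu x) = (SUM nu:verts T. 1 / ?D * (1 + real DIM('a) * P * s nu - P * (S - s nu)))"
 proof (rule sum.cong[OF refl])
  fix nu assume "nu : verts T"
  hence "(SUM nu':verts T - {nu}. s nu') = S - s nu" unfolding S_def using fin by (simp add: sum_diff1)
  thus "dual_local T nu x = 1 / ?D * (1 + real DIM('a) * P * s nu - P * (S - s nu))"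
   unfolding dual_local_def P_def s_def by simp
 qed
 also have "... = 1 / ?D * (SUM nu:verts T. 1 + real DIM('a) * P * s nu - P * (S - s nu))" by (rule sum_distrib_left[symmetric])
 also have "(SUM nu:verts T. 1 + real DIM('a) * P * s nu - P * (S - s nu)) = ?D + real DIM('a) * P * S - P * (?D * S - S)"
  by (simp add: sum.distrib sum_subtractf card S_def flip: sum_distrib_left)
 also have "... = ?D" by (simp add: algebra_simps)
 finally show ?thesis by simp
qed

lemma mesh_size_on: "T : \<T> ==> x : interior T ==> mesh_size \<T> x = hsize T"
proof -
 assume T: "T : \<T>" "x : interior T"
 have "mesh_size \<T> x = (SUM T':\<T>. if T' = T then hsize T else 0)"
  unfolding mesh_size_def
 proof (rule sum.cong[OF refl])
  fix T' assume T': "T' : \<T>"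
  thus "hsize T' * indicator (interior T') x = (if T' = T then hsize T else 0)"
   using T interior_disjoint[OF T(1) T'] interior_subset[of T'] by (auto simp: indicator_def)
 qed
 thus ?thesis using T fin by simp
qed

lemma mesh_size_measurable: "mesh_size \<T> : borel_measurable borel"
 unfolding mesh_size_def[abs_def] by (intro borel_measurable_sum borel_measurable_times) auto

lemma simplex_size_pos: "T : \<T> ==> 0 < hsize T"
 using vol_pos[OF simplex] by (simp add: simplex_size_def)

lemma mesh_size_cases: "mesh_size \<T> x = 0 \<or> (EX T:\<T>. x : interior T & mesh_size \<T> x = hsize T)"
proof (cases "EX T:\<T>. x : interior T")
 case False
 thus ?thesis unfolding mesh_size_def by (intro disjI1 sum.neutral) auto
qed (use mesh_size_on in blast)

lemma L2_mesh_size: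
 assumes f: "f : L2 Om"
 shows "(%x. inverse (mesh_size \<T> x) * f x) : L2 Om" "(%x. mesh_size \<T> x * f x) : L2 Om"
proof -
 have m: "mesh_size \<T> : borel_measurable (leb Om)"
  by (intro measurable_restrict_space1 borel_imp_lebesgue mesh_size_measurable)
 \<comment> \<open>Off the open cells \<open>mesh_size\<close> is 0, and so is its inverse; hence
   the condition \<open>g 0 = 0\<close>.\<close>
 have le: "g (mesh_size \<T> x) <= (SUM T:\<T>. g (hsize T))" if g: "g 0 = 0" "!!t. 0 <= t ==> 0 <= g t" for g :: "real => real" and x
 proof (cases "mesh_size \<T> x = 0")
  case True
  have "0 <= (SUM T:\<T>. g (hsize T))" by (intro sum_nonneg g(2) less_imp_le simplex_size_pos)
  thus ?thesis using True g(1) by simp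
 next
  case False
  then obtain T where T: "T : \<T>" "mesh_size \<T> x = hsize T" using mesh_size_cases[of x] by blast
  have "g (hsize T) <= (SUM T:\<T>. g (hsize T))"
   by (rule member_le_sum[OF T(1)]) (use g simplex_size_pos fin in \<open>auto intro: less_imp_le\<close>)
  thus ?thesis using T by simp
 qed
 have pos: "0 <= mesh_size \<T> x" for x using mesh_size_cases[of x] simplex_size_pos by (auto intro: less_imp_le)
 show "(%x. inverse (mesh_size \<T> x) * f x) : L2 Om"
 proof (rule L2_mult_bounded[OF f])
  show "(%x. inverse (mesh_size \<T> x)) : borel_measurable (leb Om)" using m by measurable
  show "\<bar>inverse (mesh_size \<T> x)\<bar> <= (SUM T:\<T>. inverse (hsize T))" for x using le[of inverse x] pos[of x] by simp
 qed
 show "(%x. mesh_size \<T> x * f x) : L2 Om"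
 proof (rule L2_mult_bounded[OF f m])
  show "\<bar>mesh_size \<T> x\<bar> <= (SUM T:\<T>. hsize T)" for x using le[of "%t. t" x] pos[of x] by simp
 qed
qed

lemma l2_norm_cell_scaled:
 assumes "!!x. x : interior T ==> g x = c * (f x :: real)"
 shows "(cnorm T g)^2 = c^2 * (cnorm T f)^2"
proof -
 have "(cnorm T g)^2 = lint (interior T) (%x. c^2 * (f x)^2)"
  unfolding l2_norm_sq_real by (rule lint_cong) (use assms in \<open>auto simp: power_mult_distrib\<close>)
 thus ?thesis by (simp add: l2_norm_sq_real)
qed

lemma sum_over_verts:
 fixes g :: "'a => real"
 shows "(SUM T:\<T>. SUM nu:verts T. g nu) = (SUM nu:nodes \<T>. real (card (star nu)) * g nu)"
proof -
 have "(SUM T:\<T>. SUM nu:verts T. g nu) = (SUM T:\<T>. SUM nu:{nu\<in>nodes \<T>. nu : verts T}. g nu)"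
  using vert_node by (intro sum.cong) auto
 also have "... = (SUM nu:nodes \<T>. SUM T:{T\<in>\<T>. nu : verts T}. g nu)" by (rule sum.swap_restrict[OF fin finite_nodes])
 also have "... = (SUM nu:nodes \<T>. real (card (star nu)) * g nu)"
 proof (rule sum.cong[OF refl])
  fix nu assume "nu : nodes \<T>"
  hence "{T : \<T>. nu : verts T} = star nu" using star_verts by blast
  thus "(SUM T:{T\<in>\<T>. nu : verts T}. g nu) = real (card (star nu)) * g nu" by simp
 qed
 finally show ?thesis .
qed

end

text \<open>The factor 2 comes from splitting \<open>w - Q' w\<close> with \<open>w = v - c\<close>.
  The 1 belongs to \<open>w\<close>; the other summand belongs to \<open>Q' w\<close> and combines
  \<open>frame_bound\<close> with the sum over \<open>d + 1\<close> patches of at most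
  \<open>sig^d\<close> simplices each.\<close>

definition adjoint_const :: "nat => real => real => real" where
 "adjoint_const d sig K = 2 * patch_const d sig K * (1 + (real d + 1) ^ 4 * (1 + 4 * 2 ^ d)^2 * sig ^ d)"

section \<open>Local bounds for the projector and its adjoint, and their summation\<close>

context regular_refined_mesh
begin

text \<open>One bound for both operators: \<open>f = dual\<close>, \<open>g = hat\<close> gives
  \<open>Q\<close>, and the exchanged choice gives its adjoint. A coefficient carries
  \<open>1 / om nu\<close>, which compensates \<open>vol T\<close> because \<open>T\<close> belongs
  to the patch. Two powers of \<open>d + 1\<close> come from the coefficients and one from the
  number of terms.\<close>

lemma frame_bound:
 assumes u: "u : L2 Om" and T: "T : \<T>" and M: "0 <= M" "0 <= M'"
  and f: "!!nu. nu : N0 ==> f nu : L2 Om" "!!nu. nu : N0 ==> AE x in leb Om. \<bar>f nu x\<bar> <= M"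
   "!!nu T x. nu : N0 ==> T : \<T> ==> T ~: star nu ==> x : interior T ==> f nu x = 0"
  and g: "!!nu. nu : N0 ==> g nu : L2 Om" "!!nu. nu : N0 ==> AE x in leb Om. \<bar>g nu x\<bar> <= M'"
   "!!nu T x. nu : N0 ==> T : \<T> ==> T ~: star nu ==> x : interior T ==> g nu x = 0"
 shows "(cnorm T (%x. SUM nu:N0. (real DIM('a) + 1) / om nu * l2_inner Om u (f nu) * g nu x))^2
  <= (real DIM('a) + 1) ^ 3 * (M * M')^2 * patch_energy u T"
proof -
 let ?D = "real DIM('a) + 1"
 define a where "a nu = ?D / om nu * l2_inner Om u (f nu)" for nu
 define J where "J = verts T Int N0"
 have fin: "finite (verts T)" by (rule simplex_verts(3)[OF simplex[OF T]])
 have J: "J <= verts T" "J <= N0" "finite J" "real (card J) <= ?D"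
  using fin simplex_card[OF simplex[OF T]] card_mono[OF fin, of J] unfolding J_def by auto
 have a: "(a nu * M')^2 * vol T <= ?D^2 * (M * M')^2 * patch_sq u nu" if nu: "nu : J" for nu
 proof -
  have N: "nu : N0" and n: "nu : nodes \<T>" and st: "T : star nu" using nu J N0_node vert_star[OF T] by blast+
  have w: "0 < om nu" by (rule patch_pos[OF n])
  have "(a nu)^2 * vol T <= (a nu)^2 * om nu" by (intro mult_left_mono patch_measure_ge[OF n st]) simp
  also have "... = ?D^2 / om nu * (l2_inner Om u (f nu))^2"
   using w by (simp add: a_def power_mult_distrib power_divide power2_eq_square)
  also have "... <= ?D^2 / om nu * (M^2 * om nu * patch_sq u nu)"
   using w by (intro mult_left_mono patch_inner_bound[OF u f(1)[OF N] n M(1) f(2)[OF N] f(3)[OF N]]) auto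
  also have "... = ?D^2 * (M^2 * patch_sq u nu)" using w by simp
  finally have "M'^2 * ((a nu)^2 * vol T) <= M'^2 * (?D^2 * (M^2 * patch_sq u nu))" by (intro mult_left_mono) auto
  thus ?thesis by (simp add: power_mult_distrib mult_ac)
 qed
 let ?r = "%x. SUM nu:N0. a nu * g nu x"
 define B where "B = (SUM nu:J. \<bar>a nu * M'\<bar>)"
 have "AE x in leb Om. ALL nu:N0. \<bar>g nu x\<bar> <= M'" using finite_N0 g(2) by (intro AE_finite_allI) auto
 hence "AE x in leb (interior T). \<bar>?r x\<bar> <= B"
  unfolding AE_leb[OF cell_sets(2)] AE_leb[OF cell_sets(1)[OF T]]
 proof eventually_elim
  case (elim x)
  show ?case
  proof
   assume x: "x : interior T"
   hence gM: "\<bar>g nu x\<bar> <= M'" if "nu : N0" for nu using elim cell_subset[OF T] that by blast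
   have "?r x = (SUM nu:J. a nu * g nu x)"
   proof (rule sum.mono_neutral_right[OF finite_N0 J(2)])
    show "ALL nu:N0 - J. a nu * g nu x = 0"
    proof
     fix nu assume nu: "nu : N0 - J"
     hence "T ~: star nu" using star_verts[OF N0_node] by (auto simp: J_def)
     thus "a nu * g nu x = 0" using g(3)[OF _ T _ x] nu by simp
    qed
   qed
   also have "\<bar>...\<bar> <= (SUM nu:J. \<bar>a nu * g nu x\<bar>)" by (rule sum_abs)
   also have "... <= B"
    unfolding B_def abs_mult using gM J(2) M(2) by (intro sum_mono mult_left_mono) auto
   finally show "\<bar>?r x\<bar> <= B" .
  qed
 qed
 moreover have "?r : L2 (interior T)" by (rule L2_interior[OF _ T]) (intro L2_lincomb g(1))
 ultimately have "(cnorm T ?r)^2 <= B^2 * vol (interior T)"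
  by (intro l2_norm_le_bounded simplex_meas(2)[OF simplex[OF T]])
 also have "... = B^2 * vol T" using vol_interior[OF simplex[OF T]] by simp
 also have "... <= (?D * (SUM nu:J. (a nu * M')^2)) * vol T"
 proof (rule mult_right_mono)
  have "B^2 <= real (card J) * (SUM nu:J. \<bar>a nu * M'\<bar>^2)" unfolding B_def by (rule sum_sq_le_card)
  also have "... <= ?D * (SUM nu:J. \<bar>a nu * M'\<bar>^2)" using J(4) by (intro mult_right_mono sum_nonneg) auto
  finally show "B^2 <= ?D * (SUM nu:J. (a nu * M')^2)" by simp
 qed simp
 also have "... = ?D * (SUM nu:J. (a nu * M')^2 * vol T)" by (simp only: sum_distrib_right mult.assoc)
 also have "... <= ?D * (SUM nu:J. ?D^2 * (M * M')^2 * patch_sq u nu)" by (intro mult_left_mono sum_mono a) auto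
 also have "... <= ?D * (SUM nu:verts T. ?D^2 * (M * M')^2 * patch_sq u nu)"
  by (intro mult_left_mono sum_mono2 fin J(1)) auto
 also have "... = ?D * (?D^2 * (M * M')^2 * patch_energy u T)" by (simp only: patch_energy_def sum_distrib_left)
 also have "... = ?D ^ 3 * (M * M')^2 * patch_energy u T" by (simp add: power2_eq_square power3_eq_cube)
 finally show ?thesis unfolding a_def .
qed

lemma hat_le_1: "AE x in leb Om. \<bar>hat \<T> nu x\<bar> <= 1"
 using AE_cells
proof eventually_elim
 case (elim x)
 then obtain T where T: "T : \<T>" "x : T" using interior_subset by blast
 thus ?case using hat_eq_bary[OF T] bary_nonneg[OF simplex[OF T(1)] T(2), of nu] bary_le_1[OF simplex[OF T(1)] T(2), of nu] by simp
qed

text \<open>Summing the energies counts each patch once per simplex of its star, hence at most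
  \<open>sig^d\<close> times, and each simplex occurs in \<open>d + 1\<close> patches.\<close>

lemma cell_sum_bound:
 assumes F: "F : L2 Om" and u: "u : L2 Om" and C: "0 <= C"
  and le: "!!T. T : \<T> ==> (cnorm T F)^2 <= C * patch_energy u T"
 shows "l2_norm Om F <= sqrt (C * (sig ^ DIM('a) * (real DIM('a) + 1))) * l2_norm Om u"
proof -
 have "\<T> ~= {}" using cover dom closure_eq_empty[of Om] by (auto simp: polytopal_domain_def)
 hence sig: "2 <= sig" using sigma_ge_2 by blast
 have "(l2_norm Om F)^2 <= (SUM T:\<T>. C * patch_energy u T)" unfolding l2_norm_sq_mesh[OF F] by (intro sum_mono le)
 also have "... = C * (SUM nu:nodes \<T>. real (card (star nu)) * patch_sq u nu)"
  unfolding patch_energy_def sum_over_verts[symmetric] by (simp add: sum_distrib_left)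
 also have "... <= C * (SUM nu:nodes \<T>. sig ^ DIM('a) * patch_sq u nu)"
  using C card_star by (intro mult_left_mono sum_mono mult_right_mono) auto
 also have "... = C * (sig ^ DIM('a) * (real DIM('a) + 1)) * (l2_norm Om u)^2"
  using sum_patch_sq[OF u] by (simp flip: sum_distrib_left)
 also have "... = (sqrt (C * (sig ^ DIM('a) * (real DIM('a) + 1))) * l2_norm Om u)^2"
  using C sig by (simp add: power_mult_distrib)
 finally show ?thesis by (rule power2_le_imp_le) (use C sig in simp)
qed

lemma Q_bound:
 assumes u: "u : L2 Om"
 shows "l2_norm Om (Q u)
  <= sqrt ((real DIM('a) + 1) ^ 3 * (1 + 4 * 2 ^ DIM('a))^2 * (sig ^ DIM('a) * (real DIM('a) + 1))) * l2_norm Om u"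
proof (rule cell_sum_bound[OF Q_L2 u])
 fix T assume T: "T : \<T>"
 have "(cnorm T (Q u))^2 <= (real DIM('a) + 1) ^ 3 * ((1 + 4 * 2 ^ DIM('a)) * 1)^2 * patch_energy u T"
  unfolding Q_fun coef_def
  by (rule frame_bound[OF u T]) (auto intro: N0_node dual_hat_L2 hat_L2 dual_hat_bound hat_le_1 dual_zero_off_star hat_zero_off_star)
 thus "(cnorm T (Q u))^2 <= (real DIM('a) + 1) ^ 3 * (1 + 4 * 2 ^ DIM('a))^2 * patch_energy u T" by simp
qed simp

lemma cell_adjoint_bound:
 assumes T: "T : \<T>" and v: "v : H1_0 Om gam"
 shows "(cnorm T (%x. v x - Q_adj v x))^2
  <= adjoint_const DIM('a) sig K * (hsize T)^2 * patch_energy (wgrad Om v) T"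
proof -
 let ?D = "real DIM('a) + 1" and ?M = "1 + 4 * (2::real) ^ DIM('a)"
 define Y where "Y = patch_const DIM('a) sig K * (hsize T)^2 * patch_energy (wgrad Om v) T"
 obtain c where c: "c = 0 \<or> verts T <= N0"
  "!!nu T'. nu : verts T ==> T' : star nu ==> (cnorm T' (%x. v x - c))^2 <= Y"
  using patch_constant[OF T v, folded Y_def] by blast
 have vL: "v : L2 Om" by (rule H1_L2[OF H1_0_H1[OF v]])
 let ?w = "%x. v x - c"
 have wL: "?w : L2 Om" by (intro L2_diff vL const_L2 dom_meas)
 have card: "real (card (verts T)) = ?D" using simplex_card[OF simplex[OF T]] by simp
 then obtain nu where nu: "nu : verts T" by fastforce
 have w: "(cnorm T ?w)^2 <= Y" by (rule c(2)[OF nu vert_star[OF T nu]])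
 have Y0: "0 <= Y" using w by (rule order_trans[rotated]) simp
 have "patch_energy ?w T <= real (card (verts T)) * (sig ^ DIM('a) * Y)"
  unfolding patch_energy_def
 proof (rule sum_bounded_above)
  fix nu assume nu: "nu : verts T"
  have "patch_sq ?w nu <= real (card (star nu)) * Y"
   unfolding patch_sq_def by (rule sum_bounded_above) (rule c(2)[OF nu])
  also have "... <= sig ^ DIM('a) * Y" using card_star Y0 by (intro mult_right_mono) auto
  finally show "patch_sq ?w nu <= sig ^ DIM('a) * Y" .
 qed
 hence e: "patch_energy ?w T <= ?D * (sig ^ DIM('a) * Y)" unfolding card .
 have "(cnorm T (Q_adj ?w))^2 <= ?D ^ 3 * (1 * ?M)^2 * patch_energy ?w T"
  unfolding Q_adj_def adj_coef_def
  by (rule frame_bound[OF wL T]) (auto intro: N0_node dual_hat_L2 hat_L2 dual_hat_bound hat_le_1 dual_zero_off_star hat_zero_off_star)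
 also have "... <= ?D ^ 3 * (1 * ?M)^2 * (?D * (sig ^ DIM('a) * Y))" by (intro mult_left_mono e) simp
 also have "... = ?D ^ 4 * ?M^2 * sig ^ DIM('a) * Y" by (simp only: power3_eq_cube power4_eq_xxxx mult_1 mult_ac)
 finally have r: "(cnorm T (Q_adj ?w))^2 <= ?D ^ 4 * ?M^2 * sig ^ DIM('a) * Y" .
 \<comment> \<open>If \<open>c\<close> is not zero, all vertices of \<open>T\<close> are free nodes,
   so the \<open>dual\<close> functions over \<open>N0\<close> add up to 1 on \<open>T\<close> and
   the constant cancels.\<close>
 have eq: "v x - Q_adj v x = ?w x - Q_adj ?w x" if x: "x : interior T" for x
 proof (cases "c = 0")
  case False
  hence vN: "verts T <= N0" using c(1) by blast
  have "adj_coef nu ?w = adj_coef nu v - c" if "nu : N0" for nu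
  proof -
   note n = N0_node[OF that]
   have "l2_inner Om (%x. 1 * v x + (- c) * 1) (hat \<T> nu) = 1 * l2_inner Om v (hat \<T> nu) + (- c) * l2_inner Om (%x. 1) (hat \<T> nu)"
    by (intro l2_inner_lincomb_left vL const_L2 dom_meas hat_L2)
   hence "l2_inner Om ?w (hat \<T> nu) = l2_inner Om v (hat \<T> nu) - c * om nu / ?D" by (simp add: hat_integral[OF n])
   moreover have "D / w * (P - c * w / D) = D / w * P - c" if "w ~= 0" "D ~= 0" for D w P :: real using that by (simp add: field_simps)
   ultimately show ?thesis unfolding adj_coef_def using patch_pos[OF n] by simp
  qed
  hence "Q_adj ?w x = (SUM nu:N0. adj_coef nu v * dual nu x - c * dual nu x)"
   unfolding Q_adj_def by (intro sum.cong) (auto simp: left_diff_distrib)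
  also have "... = Q_adj v x - c * (SUM nu:N0. dual nu x)" by (simp add: Q_adj_def sum_subtractf sum_distrib_left)
  also have "(SUM nu:N0. dual nu x) = (SUM nu:verts T. dual nu x)"
   by (rule sum.mono_neutral_right[OF finite_N0 vN]) (use dual_hat_on[OF T x N0_node] in auto)
  also have "... = (SUM nu:verts T. dual_local T nu x)"
   using dual_hat_on[OF T x] vert_node[OF T] by (intro sum.cong) auto
  also have "... = 1" by (rule dual_local_sum[OF T])
  finally show ?thesis by simp
 qed simp
 have "(cnorm T (%x. v x - Q_adj v x))^2 = lint (interior T) (%x. (norm (?w x + (-1) * Q_adj ?w x))^2)"
  unfolding l2_norm_sq by (rule lint_cong[OF refl]) (simp add: eq)
 also have "... <= 2 * (cnorm T ?w)^2 + 2 * (cnorm T (%x. (-1) * Q_adj ?w x))^2"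
  unfolding l2_norm_sq by (rule integral_norm_sq_add_le[OF L2_interior[OF wL T] L2_interior[OF L2_cmult[OF Q_adj_L2] T]])
 also have "(cnorm T (%x. (-1) * Q_adj ?w x))^2 = (cnorm T (Q_adj ?w))^2" by (simp add: l2_norm_sq)
 also have "2 * (cnorm T ?w)^2 + 2 * ... <= 2 * Y + 2 * (?D ^ 4 * ?M^2 * sig ^ DIM('a) * Y)" using w r by linarith
 also have "... = adjoint_const DIM('a) sig K * (hsize T)^2 * patch_energy (wgrad Om v) T"
  unfolding adjoint_const_def Y_def by (simp add: algebra_simps)
 finally show ?thesis .
qed

lemma adjoint_estimate:
 assumes v: "v : H1_0 Om gam"
 shows "(%x. inverse (mesh_size \<T> x) * (v x - adjoint_op Om Q v x)) : L2 Om"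
  "l2_norm Om (%x. inverse (mesh_size \<T> x) * (v x - adjoint_op Om Q v x))
   <= sqrt (adjoint_const DIM('a) sig K * (sig ^ DIM('a) * (real DIM('a) + 1))) * h1_norm Om v"
proof -
 let ?C = "adjoint_const DIM('a) sig K"
 have vH: "v : H1 Om" by (rule H1_0_H1[OF v])
 note vG = H1_L2[OF vH] wgrad_props(1)[OF vH]
 let ?f = "%x. inverse (mesh_size \<T> x) * (v x - adjoint_op Om Q v x)"
 let ?g = "%x. inverse (mesh_size \<T> x) * (v x - Q_adj v x)"
 show f: "?f : L2 Om" by (intro L2_mesh_size L2_diff adjoint_op_Q vG)
 have g: "?g : L2 Om" by (intro L2_mesh_size L2_diff Q_adj_L2 vG)
 have "\<T> ~= {}" using cover dom closure_eq_empty[of Om] by (auto simp: polytopal_domain_def)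
 then obtain T0 where T0: "T0 : \<T>" by blast
 have C: "0 <= ?C"
  using step_const_ge(3)[OF T0] chain_const_ge[OF T0] sigma_ge_2[OF T0] by (simp add: adjoint_const_def patch_const_def)
 have "l2_norm Om ?f = l2_norm Om ?g"
 proof (rule l2_norm_cong_AE[OF f g])
  show "AE x in leb Om. ?f x = ?g x" using adjoint_op_Q(2)[OF vG(1)] by eventually_elim simp
 qed
 also have "... <= sqrt (?C * (sig ^ DIM('a) * (real DIM('a) + 1))) * l2_norm Om (wgrad Om v)"
 proof (rule cell_sum_bound[OF g vG(2) C])
  fix T assume T: "T : \<T>"
  have h: "0 < hsize T" by (rule simplex_size_pos[OF T])
  have "(cnorm T ?g)^2 = (inverse (hsize T))^2 * (cnorm T (%x. v x - Q_adj v x))^2"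
   by (rule l2_norm_cell_scaled) (simp add: mesh_size_on[OF T])
  also have "... <= (inverse (hsize T))^2 * (?C * (hsize T)^2 * patch_energy (wgrad Om v) T)"
   by (intro mult_left_mono cell_adjoint_bound[OF T v]) simp
  also have "... = ?C * patch_energy (wgrad Om v) T" using h by (simp add: field_simps)
  finally show "(cnorm T ?g)^2 <= ?C * patch_energy (wgrad Om v) T" .
 qed
 also have "... <= sqrt (?C * (sig ^ DIM('a) * (real DIM('a) + 1))) * h1_norm Om v"
  using C sigma_ge_2[OF T0] by (intro mult_left_mono l2_norm_le_h1_norm) auto
 finally show "l2_norm Om ?f <= sqrt (?C * (sig ^ DIM('a) * (real DIM('a) + 1))) * h1_norm Om v" .
qed

end

section \<open>The inverse inequality in the dual norm\<close>

lemma L2_sq_ge_ball: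
 fixes f :: "'a::euclidean_space => real"
 assumes f: "integrable (leb D) f" and D: "D : sets lebesgue" "ball y s <= D"
  and f0: "!!x. x : D ==> 0 <= f x" and fm: "!!x. x : ball y s ==> m <= f x"
 shows "m * vol (ball y s) <= lint D f"
proof -
 have b: "ball y s : sets lebesgue" by simp
 have "m * vol (ball y s) = lint (ball y s) (%x. m)"
  by (simp add: measure_restrict_space)
 also have "... <= lint (ball y s) f"
  by (rule integral_mono) (use fm int_const[of "ball y s" m] integrable_on_subset[OF f D(2) b D(1)] in auto)
 also have "... <= lint D f" by (rule lint_mono_set[OF f D(2) b D(1) f0])
 finally show ?thesis .
qed

definition bump_fn :: "'a::euclidean_space => real => real => 'a => 'a => real" where
 "bump_fn c r q g x = bump c r x * (q + g \<bullet> (x - c))"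

definition bump_fn_grad :: "'a::euclidean_space => real => real => 'a => 'a => 'a" where
 "bump_fn_grad c r q g x = bump c r x *\<^sub>R g + (q + g \<bullet> (x - c)) *\<^sub>R bump_grad c r x"

lemma test_fn_bump_fn:
 assumes "0 < r" "cball c r <= D"
 shows "test_fn D (bump_fn c r q g) (bump_fn_grad c r q g)"
 unfolding bump_fn_def[abs_def] bump_fn_grad_def[abs_def]
proof (rule test_fn_mult[OF test_fn_bump[OF assms]])
 show "((%x. q + g \<bullet> (x - c)) has_derivative (%y. g \<bullet> y)) (at x)" for x
  by (auto intro!: derivative_eq_intros)
qed simp

lemma bump_fn_outside:
 assumes "0 < r" "x ~: ball c r"
 shows "bump_fn c r q g x = 0" "bump_fn_grad c r q g x = 0"
 using bump_eq_0[OF assms] bump_grad_eq_0[OF assms] by (simp_all add: bump_fn_def bump_fn_grad_def)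

text \<open>\<open>(8 \<tau>)^d\<close> compares \<open>S\<close> with a ball of radius
  \<open>r/8\<close>, \<open>(8 \<tau>)^2\<close> comes from bounding the affine function on
  \<open>S\<close> by \<open>8 \<tau> m\<close>, and 2 from the lower bound 1/2 of the bump.\<close>

definition bump_const :: "nat => real => real" where "bump_const d \<tau> = 2 * (8 * \<tau>) ^ (d + 2)"

context
 fixes S :: "'a::euclidean_space set" and c g :: 'a and r \<tau> q :: real
 assumes S: "full_simplex S" and cr: "0 < r" "cball c r <= S" "diameter S <= \<tau> * r"
begin

private abbreviation "p \<equiv> %x. q + g \<bullet> (x - c)"
private abbreviation "m \<equiv> \<bar>q\<bar> + norm g * r / 8"

private lemma tau: "2 <= \<tau>"
proof -
 have "2 * r <= \<tau> * r" using cball_diameter[OF cr(1,2) simplex_bounded[OF S]] cr(3) by linarith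
 thus ?thesis using cr(1) by simp
qed

private lemma p_le: "x : S ==> \<bar>p x\<bar> <= 8 * \<tau> * m"
proof -
 assume x: "x : S"
 have "c : S" using cr by auto
 hence "norm (x - c) <= \<tau> * r" using diameter_bounded_bound[OF simplex_bounded[OF S] x] cr(3) by (fastforce simp: dist_norm)
 hence "\<bar>g \<bullet> (x - c)\<bar> <= norm g * (\<tau> * r)" using Cauchy_Schwarz_ineq2[of g "x - c"] by (meson mult_left_mono norm_ge_zero order_trans)
 moreover have "1 * \<bar>q\<bar> <= 8 * \<tau> * \<bar>q\<bar>" using tau by (intro mult_right_mono) auto
 moreover have "8 * \<tau> * m = 8 * \<tau> * \<bar>q\<bar> + norm g * (\<tau> * r)" by (simp add: algebra_simps)
 ultimately show ?thesis by linarith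
qed

private lemma sub_ball:
 obtains y where "ball y (r/8) <= interior S" "!!x. x : ball y (r/8) ==> m <= \<bar>p x\<bar> & norm (x - c) <= r / 2"
proof -
 define \<epsilon> :: real where "\<epsilon> = (if 0 <= q then 1 else -1)"
 have \<epsilon>: "\<bar>\<epsilon>\<bar> = 1" "\<epsilon> * \<epsilon> = 1" "\<epsilon> * q = \<bar>q\<bar>" by (auto simp: \<epsilon>_def)
 \<comment> \<open>The shift by \<open>r/4\<close> in the direction where the linear term has the
   sign of \<open>q\<close> outweighs the fluctuation over radius \<open>r/8\<close> and leaves
   \<open>norm g * r / 8\<close>. For \<open>g = 0\<close> there is no shift.\<close>
 define y where "y = c + (\<epsilon> * r / 4) *\<^sub>R sgn g"
 have ny: "norm (y - c) <= r / 4" using \<epsilon>(1) cr(1) by (simp add: y_def norm_sgn abs_mult)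
 have gy: "\<epsilon> * (g \<bullet> (y - c)) = norm g * r / 4"
 proof -
  have "g \<bullet> sgn g = norm g" by (cases "g = 0") (simp_all add: sgn_div_norm dot_square_norm power2_eq_square)
  hence "\<epsilon> * (g \<bullet> (y - c)) = (\<epsilon> * \<epsilon>) * (norm g * r / 4)" by (simp add: y_def)
  thus ?thesis using \<epsilon>(2) by simp
 qed
 have x: "m <= \<bar>p x\<bar> & norm (x - c) <= r / 2" if "x : ball y (r/8)" for x
 proof -
  have xy: "norm (x - y) <= r / 8" using that by (simp add: dist_norm norm_minus_commute)
  have "norm (x - c) <= norm (x - y) + norm (y - c)" using norm_triangle_ineq[of "x - y" "y - c"] by simp
  moreover have "\<bar>g \<bullet> (x - y)\<bar> <= norm g * (r / 8)"
   using Cauchy_Schwarz_ineq2[of g "x - y"] xy by (meson mult_left_mono norm_ge_zero order_trans)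
  hence "\<bar>\<epsilon> * (g \<bullet> (x - y))\<bar> <= norm g * (r / 8)" using \<epsilon>(1) by (simp add: abs_mult)
  moreover have "\<epsilon> * p x = \<bar>q\<bar> + norm g * r / 4 + \<epsilon> * (g \<bullet> (x - y))"
   using \<epsilon>(3) gy by (simp add: inner_diff_right algebra_simps)
  moreover have "\<bar>\<epsilon> * p x\<bar> = \<bar>p x\<bar>" using \<epsilon>(1) by (simp only: abs_mult mult_1)
  ultimately show ?thesis using xy ny cr(1) by linarith
 qed
 have "ball y (r/8) <= cball c r" using x cr(1) by (fastforce simp: dist_norm norm_minus_commute)
 hence "ball y (r/8) <= interior S" using cr(2) by (intro interior_maximal) auto
 thus thesis using x that by blast
qed

private lemma p_L2: "p : L2 (interior S)"
 using simplex_meas(2)[OF S] bounded_subset[OF simplex_bounded[OF S] interior_subset]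
 by (intro cont_L2 continuous_intros) (auto simp: fmeasurableD)

private lemma int_sets: "interior S : sets lebesgue"
 by (simp add: sets_completionI_sets)

private lemma measure_S:
 fixes y :: 'a
 shows "vol S <= (8 * \<tau>) ^ DIM('a) * vol (ball y (r/8))"
proof -
 have d: "0 <= diameter S" by (rule diameter_ge_0[OF simplex_bounded[OF S]])
 have "vol S <= unit_ball_vol (real DIM('a)) * diameter S ^ DIM('a)" by (rule simplex_measure_le[OF S cr(1,2)])
 also have "... <= unit_ball_vol (real DIM('a)) * (\<tau> * r) ^ DIM('a)" using cr(3) d by (intro mult_left_mono power_mono) auto
 also have "... = unit_ball_vol (real DIM('a)) * ((8 * \<tau>) * (r / 8)) ^ DIM('a)" by simp
 also have "... = (8 * \<tau>) ^ DIM('a) * vol (ball y (r/8))"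
  using cr(1) unfolding power_mult_distrib by (simp add: content_ball)
 finally show ?thesis .
qed

lemma bump_fn_L2: "bump_fn c r q g : L2 (interior S)" "bump_fn_grad c r q g : L2 (interior S)"
proof -
 have "test_fn (ball c (2 * r)) (bump_fn c r q g) (bump_fn_grad c r q g)" using cr(1) by (intro test_fn_bump_fn) auto
 thus "bump_fn c r q g : L2 (interior S)" "bump_fn_grad c r q g : L2 (interior S)"
  using test_fn_L2[OF _ simplex_meas(2)[OF S]] by blast+
qed

text \<open>The affine function dominates \<open>m\<close> on a ball of radius \<open>r/8\<close> on the side where both of its terms have the same sign.\<close>

lemma bump_fn_bounds:
 "(cnorm S p)^2 <= bump_const DIM('a) \<tau> * l2_inner (interior S) p (bump_fn c r q g)"
 "(cnorm S (bump_fn c r q g))^2 <= (cnorm S p)^2"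
 "r^2 * (cnorm S (bump_fn_grad c r q g))^2 <= 1600 * bump_const DIM('a) \<tau> * (cnorm S p)^2"
proof -
 obtain y where y: "ball y (r/8) <= interior S" "!!x. x : ball y (r/8) ==> m <= \<bar>p x\<bar> & norm (x - c) <= r / 2"
  using sub_ball by blast
 define V where "V = vol (ball y (r/8))"
 have \<tau>: "2 <= \<tau>" by (rule tau)
 have m0: "0 <= m" using cr(1) by simp
 have msq: "m^2 <= (p x)^2" if "x : ball y (r/8)" for x
  using power_mono[of m "\<bar>p x\<bar>" 2] y(2)[OF that] m0 by simp
 have SV: "vol (interior S) <= (8 * \<tau>) ^ DIM('a) * V"
  using measure_S vol_interior[OF S] by (simp add: V_def)
 have i1: "integrable (leb (interior S)) (%x. p x * bump_fn c r q g x)"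
  by (rule L2_mult_int[OF p_L2 bump_fn_L2(1)])
 have nn: "0 <= p x * bump_fn c r q g x" for x
 proof -
  have "p x * bump_fn c r q g x = bump c r x * (p x)^2" by (simp add: bump_fn_def power2_eq_square)
  thus ?thesis by simp
 qed
 have "m^2 / 2 * V <= l2_inner (interior S) p (bump_fn c r q g)"
  unfolding V_def l2_inner_def
 proof (rule L2_sq_ge_ball[OF i1 int_sets y(1) nn])
  fix x assume x: "x : ball y (r/8)"
  have "1/2 * m^2 <= bump c r x * (p x)^2"
   using bump_ge[of x c r] y(2)[OF x] cr(1) msq[OF x] by (intro mult_mono) auto
  thus "m^2 / 2 <= p x * bump_fn c r q g x" by (simp add: bump_fn_def power2_eq_square mult_ac)
 qed
 hence lower: "m^2 * V <= 2 * l2_inner (interior S) p (bump_fn c r q g)" by simp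
 have "(cnorm S p)^2 <= (8 * \<tau> * m)^2 * vol (interior S)"
  by (rule l2_norm_le_bounded[OF simplex_meas(2)[OF S] p_L2]) (use p_le interior_subset in \<open>intro AE_I2, auto\<close>)
 also have "... <= (8 * \<tau> * m)^2 * ((8 * \<tau>) ^ DIM('a) * V)" by (intro mult_left_mono SV) simp
 also have "... = (8 * \<tau>) ^ (DIM('a) + 2) * (m^2 * V)" unfolding power_mult_distrib[of _ m] power_add by (simp only: mult_ac)
 also have "... <= (8 * \<tau>) ^ (DIM('a) + 2) * (2 * l2_inner (interior S) p (bump_fn c r q g))"
  using lower \<tau> by (intro mult_left_mono) auto
 finally show "(cnorm S p)^2 <= bump_const DIM('a) \<tau> * l2_inner (interior S) p (bump_fn c r q g)"
  by (simp add: bump_const_def mult_ac)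
 have b2: "(bump c r x)^2 <= 1" for x using bump_le_1[of c r x] by (simp add: power_le_one)
 show "(cnorm S (bump_fn c r q g))^2 <= (cnorm S p)^2"
  unfolding l2_norm_sq_real
 proof (rule integral_mono[OF L2_sqr_int[OF bump_fn_L2(1)] L2_sqr_int[OF p_L2]])
  show "(bump_fn c r q g x)^2 <= (p x)^2" for x
   using mult_right_mono[OF b2[of x], of "(p x)^2"] by (simp add: bump_fn_def power_mult_distrib)
 qed
 \<comment> \<open>The triangle inequality gives \<open>norm g + 4 (|q| + norm g * r) / r\<close>,
   that is \<open>4 |q| / r + 5 norm g\<close>; the 40 is 5 times the 8 in \<open>m\<close>, and its
   square is the 1600.\<close>
 have g: "(norm (bump_fn_grad c r q g x))^2 <= (40 * m / r)^2" for x
 proof (cases "x : ball c r")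
  case True
  hence "norm (x - c) <= r" by (simp add: dist_norm norm_minus_commute)
  hence "\<bar>g \<bullet> (x - c)\<bar> <= norm g * r" using Cauchy_Schwarz_ineq2[of g "x - c"] by (meson mult_left_mono norm_ge_zero order_trans)
  hence px: "\<bar>p x\<bar> <= \<bar>q\<bar> + norm g * r" by linarith
  have "norm (bump_fn_grad c r q g x) <= \<bar>bump c r x\<bar> * norm g + \<bar>p x\<bar> * norm (bump_grad c r x)"
   unfolding bump_fn_grad_def by (rule norm_triangle_le) simp
  also have "... <= 1 * norm g + (\<bar>q\<bar> + norm g * r) * (4 / r)"
   using bump_le_1[of c r x] px bump_grad_le[OF cr(1), of c x] cr(1) by (intro add_mono mult_mono) auto
  also have "... <= 40 * m / r" using cr(1) by (simp add: field_simps)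
  finally show ?thesis by (intro power_mono) auto
 next
  case False
  thus ?thesis using bump_fn_outside[OF cr(1) False] by simp
 qed
 have "(cnorm S (bump_fn_grad c r q g))^2 <= lint (interior S) (%x. (40 * m / r)^2)"
  unfolding l2_norm_sq
  by (rule integral_mono[OF L2_sq_int[OF bump_fn_L2(2)] int_const[OF simplex_meas(2)[OF S]]]) (rule g)
 also have "... = (40 * m / r)^2 * vol (interior S)" using int_sets by (simp add: measure_restrict_space)
 also have "... <= (40 * m / r)^2 * ((8 * \<tau>) ^ DIM('a) * V)" by (intro mult_left_mono SV) simp
 finally have "r^2 * (cnorm S (bump_fn_grad c r q g))^2 <= r^2 * ((40 * m / r)^2 * ((8 * \<tau>) ^ DIM('a) * V))"
  by (intro mult_left_mono) auto
 also have "... = 1600 * (8 * \<tau>) ^ DIM('a) * (m^2 * V)"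
 proof -
  have "r^2 * ((40 * M / r)^2 * X) = 1600 * (M^2 * X)" for M X using cr(1) by (simp add: power_divide power_mult_distrib)
  from this[of m "(8 * \<tau>) ^ DIM('a) * V"] show ?thesis by (simp only: mult_ac)
 qed
 also have "... <= 1600 * (8 * \<tau>) ^ DIM('a) * (cnorm S p)^2"
 proof (rule mult_left_mono)
  show "m^2 * V <= (cnorm S p)^2"
   unfolding V_def l2_norm_sq_real by (rule L2_sq_ge_ball[OF L2_sqr_int[OF p_L2] int_sets y(1) _ msq]) auto
 qed (use \<tau> in simp)
 also have "... <= 1600 * bump_const DIM('a) \<tau> * (cnorm S p)^2"
 proof (intro mult_right_mono mult_left_mono)
  have "1 * (8 * \<tau>) ^ DIM('a) <= 2 * (8 * \<tau>)^2 * (8 * \<tau>) ^ DIM('a)"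
  proof (rule mult_right_mono)
   have "1 <= (8 * \<tau>)^2" using \<tau> by (intro one_le_power) simp
   thus "1 <= 2 * (8 * \<tau>)^2" by linarith
  qed (use \<tau> in simp)
  thus "(8 * \<tau>) ^ DIM('a) <= bump_const DIM('a) \<tau>" by (simp add: bump_const_def power_add power2_eq_square mult_ac)
 qed auto
 finally show "r^2 * (cnorm S (bump_fn_grad c r q g))^2 <= 1600 * bump_const DIM('a) \<tau> * (cnorm S p)^2" .
qed

end

section \<open>Cells of the second refinement\<close>

context refined_mesh
begin

lemma fine_cell:
 assumes S: "S : \<S>'"
 obtains T where "T : \<T>" "interior S <= interior T" "hsize T = 4 * hsize S"
proof -
 obtain S1 where S1: "S1 : \<S>" "S <= S1" using refine_parent(2)[OF S] by blast
 obtain T where T: "T : \<T>" "S1 <= T" using refine_parent(1)[OF S1(1)] by blast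
 have "vol T = 4 ^ DIM('a) * vol S"
  using red_refD(6)[OF ref' S1(1) S S1(2)] red_refD(6)[OF ref T(1) S1(1) T(2)]
  by (simp add: field_simps flip: power_mult_distrib)
 hence "hsize T = 4 * hsize S"
  by (simp add: simplex_size_def real_root_mult real_root_power_cancel)
 moreover have "interior S <= interior T" using S1 T by (intro interior_mono) auto
 ultimately show thesis using that T by blast
qed

lemma fine_disjoint: "S : \<S>' ==> S' : \<S>' ==> S ~= S' ==> interior S Int interior S' = {}"
 by (rule red_refD(3)[OF ref'])

lemma disjoint_interior_closure:
 fixes A B :: "'a set"
 assumes "interior A Int interior B = {}" "full_simplex B"
 shows "interior A Int B = {}"
 using assms(1) simplex_closure_interior[OF assms(2)] open_Int_closure_eq_empty[of "interior A" "interior B"] by simp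

lemma fine_cover: "AE x in lebesgue. x : Om --> (EX S:\<S>'. x : interior S)"
proof -
 have "AE x in lebesgue. ALL S:\<S>'. x : S --> x : interior S"
  using finite_refine(2) simplex_boundary_null[OF refine_simplex(2)] by (intro AE_finite_allI)
 thus ?thesis
 proof eventually_elim
  case (elim x)
  show ?case
  proof
   assume "x : Om"
   then obtain T where T: "T : \<T>" "x : T" using cover closure_subset by blast
   then obtain S1 where S1: "S1 : \<S>" "x : S1" using red_refD(5)[OF ref T(1)] by blast
   then obtain S where "S : \<S>'" "x : S" using red_refD(5)[OF ref' S1(1)] by blast
   thus "EX S:\<S>'. x : interior S" using elim by blast
  qed
 qed
qed

lemma fine_subset: "S : \<S>' ==> interior S <= Om"
 using fine_cell cell_subset by (metis order_trans)

lemmas fine_integral = integral_cells[OF _ cell_sets(2) finite_refine(2) fine_subset fine_disjoint fine_cover]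

text \<open>Each patch of either refinement contains the interior of a cell of the second one or
  misses it, so every \<open>theta\<close> is constant there and only the affine part of the finite
  element function remains.\<close>

lemma fine_affine:
 assumes z: "z : Z_space Om gam \<T> \<S> \<S>'" and S: "S : \<S>'"
 obtains q g where "AE x in leb (interior S). z x = q + g \<bullet> (x - c)"
proof -
 obtain u k where z: "z = (%x. u x + (SUM i:N0. k i * \<theta> i x))" and u: "u : U_space Om gam \<T>"
  using z unfolding Z_space_def mem_Collect_eq B_form by (elim exE conjE) blast
 obtain T where T: "T : \<T>" "interior S <= interior T" using fine_cell[OF S] by metis
 obtain a b where ab: "AE x in leb Om. x : T --> u x = a \<bullet> x + b" using u T(1) unfolding U_space_def by blast
 obtain S1 where S1: "S1 : \<S>" "S <= S1" using refine_parent(2)[OF S] by blast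
 have not1: "x ~: S'" if "x : interior S" "S' : \<S>'" "S' ~= S" for x S'
  using disjoint_interior_closure[OF fine_disjoint[OF S that(2)] refine_simplex(2)[OF that(2)]] that by blast
 have not2: "x ~: S'" if "x : interior S" "S' : \<S>" "S' ~= S1" for x S'
  using disjoint_interior_closure[OF red_refD(3)[OF ref S1(1) that(2)] refine_simplex(1)[OF that(2)]] that
   interior_mono[OF S1(2)] by blast
 define t where "t i = 2 ^ (DIM('a) + 2) / (real DIM('a) + 2) * (2 ^ DIM('a) * (if i : S then 1 else 0) - (if i : S1 then 1 else 0))" for i
 have \<theta>: "\<theta> i x = t i" if x: "x : interior S" for i x
 proof -
  have xS: "x : S" "x : S1" using x interior_subset S1(2) by blast+
  have "x : patch \<S>' i \<longleftrightarrow> i : S" unfolding patch_def using xS S not1[OF x] by blast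
  moreover have "x : patch \<S> i \<longleftrightarrow> i : S1" unfolding patch_def using xS S1 not2[OF x] by blast
  ultimately show ?thesis by (simp add: theta_def t_def indicator_def)
 qed
 have Ss: "interior S : sets lebesgue" by (simp add: sets_completionI_sets)
 have "AE x in leb (interior S). z x = (a \<bullet> c + b + (SUM i:N0. k i * t i)) + a \<bullet> (x - c)"
  using ab unfolding AE_leb[OF cell_sets(2)] AE_leb[OF Ss]
 proof eventually_elim
  case (elim x)
  show ?case
  proof
   assume x: "x : interior S"
   hence "x : Om" "x : T" using T fine_subset[OF S] interior_subset by blast+
   hence "u x = a \<bullet> x + b" using elim by blast
   thus "z x = (a \<bullet> c + b + (SUM i:N0. k i * t i)) + a \<bullet> (x - c)"
    by (simp add: z \<theta>[OF x] inner_diff_right)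
  qed
 qed
 thus thesis by (rule that)
qed

lemma size_le_domain: "T : \<T> ==> hsize T <= root DIM('a) (vol Om)"
proof -
 assume T: "T : \<T>"
 have "vol (interior T) <= vol Om"
  using cell_sets(1)[OF T] dom_meas cell_subset[OF T] by (intro measure_mono_fmeasurable) auto
 thus ?thesis
  unfolding simplex_size_def using vol_interior[OF simplex[OF T]] by (intro real_root_le_mono) auto
qed

lemma dual_norm_embed_nonneg: "f : L2 Om ==> 0 <= dual_norm Om gam (dual_embed Om f)"
proof -
 assume f: "f : L2 Om"
 have z: "(%x. 0) : H1_0 Om gam" "h1_norm Om (%x. 0) = 0"
  using zero_H1_0[OF domain_open domain_bounded] zero_H1(2)[OF domain_open domain_bounded] by auto
 show ?thesis
  unfolding dual_norm_def
 proof (rule cSup_upper2)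
  show "\<bar>dual_embed Om f (%x. 0)\<bar> : {\<bar>dual_embed Om f v\<bar> |v. v : H1_0 Om gam & h1_norm Om v <= 1}" using z by auto
  show "bdd_above {\<bar>dual_embed Om f v\<bar> |v. v : H1_0 Om gam & h1_norm Om v <= 1}"
  proof (rule bdd_aboveI)
   fix t assume "t : {\<bar>dual_embed Om f v\<bar> |v. v : H1_0 Om gam & h1_norm Om v <= 1}"
   then obtain v where v: "t = \<bar>dual_embed Om f v\<bar>" "v : H1_0 Om gam" "h1_norm Om v <= 1" by blast
   have "t <= l2_norm Om f * h1_norm Om v" unfolding v(1) by (rule dual_embed_bound[OF domain_open domain_bounded f v(2)])
   also have "... <= l2_norm Om f * 1" using v(3) by (intro mult_left_mono) auto
   finally show "t <= l2_norm Om f" by simp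
  qed
 qed auto
qed

end

text \<open>The square root bounds the \<open>H1\<close> norm of the test function by the norm of
  \<open>h z\<close>. Its summands belong to the function, with \<open>h\<close> at most
  \<open>root d V\<close>, and to its gradient, with \<open>h\<close> bounded by the inradius of the
  cell; the outer factor comes from the pairing.\<close>

definition inverse_const :: "nat => real => real => real" where
 "inverse_const d \<tau> V = bump_const d \<tau> *
   sqrt ((root d V)^2 + 1600 * bump_const d \<tau> * (4 * \<tau> * root d (unit_ball_vol (real d)))^2)"

context refined_mesh
begin

text \<open>The test function is the sum over the cells \<open>S\<close> of the second refinement of \<open>h\<^sub>S^2 b\<^sub>S z\<^sub>S\<close>, where \<open>b\<^sub>S\<close> is a
 bump function on \<open>S\<close> and \<open>z\<^sub>S\<close> the affine function that \<open>z\<close> equals there.\<close>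

lemma inverse_estimate:
 assumes z: "z : Z_space Om gam \<T> \<S> \<S>'"
  and reg: "!!S. S : \<S>' ==> EX c r. 0 < r & cball c r <= interior S & diameter S <= \<tau> * r"
 shows "l2_norm Om (%x. mesh_size \<T> x * z x)
  <= inverse_const DIM('a) \<tau> (vol Om) * dual_norm Om gam (dual_embed Om z)"
proof -
 let ?B = "bump_const DIM('a) \<tau>" and ?rho = "root DIM('a) (unit_ball_vol (real DIM('a)))"
 let ?H = "root DIM('a) (vol Om)"
 obtain c r where cr0: "!!S. S : \<S>' ==> 0 < r S & cball (c S) (r S) <= interior S & diameter S <= \<tau> * r S"
  using reg by metis
 have cr: "0 < r S" "cball (c S) (r S) <= S" "diameter S <= \<tau> * r S" "cball (c S) (r S) <= interior S" if "S : \<S>'" for S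
  using cr0[OF that] interior_subset[of S] by auto
 have "EX q g. AE x in leb (interior S). z x = q + g \<bullet> (x - c S)" if "S : \<S>'" for S
  using fine_affine[OF z that] by metis
 then obtain q g where zp: "!!S. S : \<S>' ==> AE x in leb (interior S). z x = q S + g S \<bullet> (x - c S)"
  by metis
 \<comment> \<open>The size of the coarse simplex around \<open>S\<close>, hence the value of
   \<open>mesh_size\<close> on the interior of \<open>S\<close>.\<close>
 define h where "h S = 4 * hsize S" for S :: "'a set"
 define p where "p S x = q S + g S \<bullet> (x - c S)" for S x
 define b where "b S = bump_fn (c S) (r S) (q S) (g S)" for S
 define \<beta> where "\<beta> S = bump_fn_grad (c S) (r S) (q S) (g S)" for S
 \<comment> \<open>The weight \<open>h^2\<close> makes the pairing with \<open>z\<close> comparable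
   to the square of the norm of \<open>h z\<close>. A bump costs one power of \<open>h\<close> in
   the gradient, so the gradient of \<open>w\<close> is of the order of \<open>h z\<close>
   too.\<close>
 define w where "w x = (SUM S:\<S>'. (h S)^2 * b S x)" for x
 define G where "G x = (SUM S:\<S>'. (h S)^2 *\<^sub>R \<beta> S x)" for x
 let ?hz = "%x. mesh_size \<T> x * z x"
 have zL: "z : L2 Om" by (rule Z_L2[OF z])
 have hzL: "?hz : L2 Om" by (rule L2_mesh_size(2)[OF zL])
 have Ss: "interior S : sets lebesgue" for S :: "'a set" by (simp add: sets_completionI_sets)
 have cell: "f : L2 (interior S)" if "f : L2 Om" "S : \<S>'" for S and f :: "'a => 'b::euclidean_space"
  by (rule L2_subset[OF that(1) fine_subset[OF that(2)] Ss cell_sets(2)])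
 have hS: "mesh_size \<T> x = h S" "h S <= ?H" if S: "S : \<S>'" and x: "x : interior S" for S x
 proof -
  obtain T where T: "T : \<T>" "interior S <= interior T" "hsize T = 4 * hsize S" using fine_cell[OF S] .
  thus "mesh_size \<T> x = h S" "h S <= ?H" using mesh_size_on[OF T(1)] size_le_domain[OF T(1)] x by (auto simp: h_def)
 qed
 have h0: "0 <= h S" "h S <= ?H" if S: "S : \<S>'" for S
  using hS(2)[OF S] interior_nonempty[OF refine_simplex(2)[OF S]] by (auto simp: h_def simplex_size_def)
 have tf: "test_fn Om w G"
  unfolding w_def[abs_def] G_def[abs_def]
 proof (rule test_fn_sum)
  fix S assume S: "S : \<S>'"
  have "test_fn Om (b S) (\<beta> S)"
   unfolding b_def \<beta>_def by (rule test_fn_bump_fn[OF cr(1)[OF S] order_trans[OF cr(4)[OF S] fine_subset[OF S]]])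
  thus "test_fn Om (%x. (h S)^2 * b S x) (%x. (h S)^2 *\<^sub>R \<beta> S x)" by (rule test_fn_scale)
 qed
 note wL = test_fn_L2[OF tf dom_meas]
 have on: "w x = (h S)^2 * b S x" "G x = (h S)^2 *\<^sub>R \<beta> S x" if S: "S : \<S>'" and x: "x : interior S" for S x
 proof -
  have out: "b S' x = 0 & \<beta> S' x = 0" if S': "S' : \<S>' - {S}" for S'
  proof -
   have "interior S Int S' = {}"
    using disjoint_interior_closure[OF fine_disjoint[OF S] refine_simplex(2)] S' by blast
   hence "x ~: ball (c S') (r S')" using x cr(2)[of S'] S' ball_subset_cball[of "c S'" "r S'"] by blast
   thus ?thesis unfolding b_def \<beta>_def using bump_fn_outside[OF cr(1)[of S']] S' by blast
  qed
  show "w x = (h S)^2 * b S x" unfolding w_def by (subst sum.remove[OF finite_refine(2) S]) (use out in \<open>simp add: sum.neutral\<close>)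
  show "G x = (h S)^2 *\<^sub>R \<beta> S x" unfolding G_def by (subst sum.remove[OF finite_refine(2) S]) (use out in \<open>simp add: sum.neutral\<close>)
 qed
 have wgt: "weak_gradient Om w G"
  by (rule weak_gradient_C1[OF dom_meas test_fn_deriv[OF tf] _ wL]) (use tf in \<open>simp add: test_fn_def\<close>)
 obtain k where k: "compact k" "k <= Om" "!!x. x ~: k ==> w x = 0" using tf unfolding test_fn_def by blast
 have wH: "w : H1_0 Om gam"
 proof (rule H1_0I[OF domain_open domain_bounded H1I[OF wL wgt]])
  show "continuous_on (closure Om) w"
   using test_fn_deriv[OF tf] by (meson continuous_at_imp_continuous_on has_derivative_continuous)
  \<comment> \<open>The support is in the open domain, and \<open>gam\<close> is in its
    frontier.\<close>
  show "w x = 0" if "x : gam" for x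
   using that gam_frontier k(2,3) domain_open by (auto simp: frontier_def interior_open)
 qed
 define X where "X S = (cnorm S ?hz)^2" for S
 have XS: "X S = (h S)^2 * (cnorm S (p S))^2"
  and lowS: "X S <= ?B * l2_inner (interior S) z w"
  and wS: "(cnorm S w)^2 <= ?H^2 * X S"
  and GS: "(cnorm S G)^2 <= 1600 * ?B * (4 * \<tau> * ?rho)^2 * X S" if S: "S : \<S>'" for S
 proof -
  note cS = refine_simplex(2)[OF S] cr(1,2,3)[OF S]
  note bb = bump_fn_bounds[OF refine_simplex(2)[OF S] cr(1,2,3)[OF S], of "q S" "g S", folded b_def \<beta>_def p_def]
  note bL = bump_fn_L2[OF refine_simplex(2)[OF S] cr(1,2,3)[OF S], of "q S" "g S", folded b_def \<beta>_def]
  have pL: "p S : L2 (interior S)"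
   unfolding p_def using simplex_meas(2)[OF cS(1)] bounded_subset[OF simplex_bounded[OF cS(1)] interior_subset]
   by (intro cont_L2 continuous_intros) (auto simp: fmeasurableD)
  have zpS: "AE x in leb (interior S). z x = p S x" using zp[OF S] by (simp add: p_def)
  have "X S = (cnorm S (%x. h S * z x))^2"
   unfolding X_def l2_norm_sq by (rule lint_cong[OF refl]) (simp add: hS(1)[OF S])
  also have "... = (h S)^2 * (cnorm S z)^2" by (rule l2_norm_cell_scaled) simp
  also have "cnorm S z = cnorm S (p S)" by (rule l2_norm_cong_AE[OF cell[OF zL S] pL zpS])
  finally show XS: "X S = (h S)^2 * (cnorm S (p S))^2" .
  have "l2_inner (interior S) z w = lint (interior S) (%x. (h S)^2 * (z x * b S x))"
   unfolding l2_inner_def by (rule lint_cong[OF refl]) (simp add: on(1)[OF S] mult_ac)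
  also have "... = (h S)^2 * l2_inner (interior S) z (b S)" by (simp add: l2_inner_def)
  also have "l2_inner (interior S) z (b S) = l2_inner (interior S) (p S) (b S)"
   by (rule l2_inner_cong_AE[OF zpS _ cell[OF zL S] pL bL(1) bL(1)]) simp
  finally have zw: "l2_inner (interior S) z w = (h S)^2 * l2_inner (interior S) (p S) (b S)" .
  show "X S <= ?B * l2_inner (interior S) z w"
   using mult_left_mono[OF bb(1), of "(h S)^2"] unfolding XS zw by (simp add: mult_ac)
  have "(cnorm S w)^2 = ((h S)^2)^2 * (cnorm S (b S))^2"
   by (rule l2_norm_cell_scaled) (rule on(1)[OF S])
  also have "... <= ((h S)^2)^2 * (cnorm S (p S))^2" by (intro mult_left_mono bb(2)) simp
  also have "... = (h S)^2 * X S" unfolding XS by (simp add: power2_eq_square mult_ac)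
  also have "... <= ?H^2 * X S" using h0[OF S] by (intro mult_right_mono power_mono) (auto simp: X_def)
  finally show "(cnorm S w)^2 <= ?H^2 * X S" .
  have hr: "h S <= 4 * \<tau> * ?rho * r S"
  proof -
   have "hsize S <= ?rho * diameter S" by (rule simplex_size_bounds(2)[OF cS(1,2,3)])
   also have "... <= ?rho * (\<tau> * r S)" using cS(4) root_unit_ball_vol_pos[where 'a = 'a] by (intro mult_left_mono) auto
   finally show ?thesis by (simp add: h_def mult_ac)
  qed
  have "(cnorm S G)^2 = lint (interior S) (%x. ((h S)^2)^2 * (norm (\<beta> S x))^2)"
   unfolding l2_norm_sq by (rule lint_cong[OF refl]) (simp add: on(2)[OF S] power_mult_distrib)
  also have "... = ((h S)^2)^2 * (cnorm S (\<beta> S))^2" by (simp add: l2_norm_sq)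
  also have "... = (h S)^2 * ((h S)^2 * (cnorm S (\<beta> S))^2)" by (simp add: power2_eq_square mult_ac)
  also have "... <= (h S)^2 * ((4 * \<tau> * ?rho * r S)^2 * (cnorm S (\<beta> S))^2)"
   using hr h0[OF S] by (intro mult_left_mono mult_right_mono power_mono) auto
  also have "... = (h S)^2 * (4 * \<tau> * ?rho)^2 * ((r S)^2 * (cnorm S (\<beta> S))^2)"
   unfolding power_mult_distrib[of "4 * \<tau> * ?rho" "r S"] by (simp only: mult_ac)
  also have "... <= (h S)^2 * (4 * \<tau> * ?rho)^2 * (1600 * ?B * (cnorm S (p S))^2)"
   by (intro mult_left_mono bb(3)) simp
  also have "... = 1600 * ?B * (4 * \<tau> * ?rho)^2 * X S" unfolding XS by (simp only: mult_ac)
  finally show "(cnorm S G)^2 <= 1600 * ?B * (4 * \<tau> * ?rho)^2 * X S" .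
 qed
 let ?n = "l2_norm Om ?hz" and ?C = "?H^2 + 1600 * ?B * (4 * \<tau> * ?rho)^2" and ?d = "dual_norm Om gam (dual_embed Om z)"
 have n: "?n^2 = (SUM S:\<S>'. X S)"
  unfolding X_def l2_norm_sq by (rule fine_integral[OF L2_sq_int[OF hzL]])
 \<comment> \<open>Some cell of the second refinement exists, and its inscribed ball forces
   \<open>\<tau> > 0\<close>.\<close>
 obtain x0 where "x0 : closure Om" using dom closure_subset unfolding polytopal_domain_def by blast
 then obtain T0 where T0: "T0 : \<T>" "x0 : T0" using cover by blast
 then obtain S1 where S1: "S1 : \<S>" "x0 : S1" using red_refD(5)[OF ref T0(1)] by blast
 then obtain S0 where S0: "S0 : \<S>'" using red_refD(5)[OF ref' S1(1)] by blast
 have "2 * r S0 <= \<tau> * r S0"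
  using cball_diameter[OF cr(1)[OF S0] cr(2)[OF S0] simplex_bounded[OF refine_simplex(2)[OF S0]]] cr(3)[OF S0] by linarith
 hence "0 < \<tau>" using cr(1)[OF S0] by simp
 hence B: "0 <= ?B" by (simp add: bump_const_def)
 have "(h1_norm Om w)^2 = (SUM S:\<S>'. (cnorm S w)^2) + (SUM S:\<S>'. (cnorm S G)^2)"
  unfolding h1_norm_sq_eq[OF domain_open domain_bounded wL wgt] l2_norm_sq
  using fine_integral[OF L2_sq_int[OF wL(1)]] fine_integral[OF L2_sq_int[OF wL(2)]] by simp
 also have "... <= (SUM S:\<S>'. ?H^2 * X S) + (SUM S:\<S>'. 1600 * ?B * (4 * \<tau> * ?rho)^2 * X S)"
  by (intro add_mono sum_mono wS GS)
 also have "... = ?C * ?n^2" unfolding n distrib_right sum_distrib_left by (rule sum.distrib[symmetric])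
 also have "... = (sqrt ?C * ?n)^2" using B by (simp add: power_mult_distrib)
 finally have h1: "h1_norm Om w <= sqrt ?C * ?n" by (rule power2_le_imp_le) (use B in simp)
 have d0: "0 <= ?d" by (rule dual_norm_embed_nonneg[OF zL])
 have "?n^2 <= (SUM S:\<S>'. ?B * l2_inner (interior S) z w)" unfolding n by (intro sum_mono lowS)
 also have "... = ?B * l2_inner Om z w"
  unfolding l2_inner_def using fine_integral[OF L2_mult_int[OF zL wL(1)]] by (simp add: sum_distrib_left)
 also have "... <= ?B * (?d * h1_norm Om w)"
  using dual_norm_apply[OF domain_open domain_bounded dual_embed_in_dual(1)[OF domain_open domain_bounded zL] wH] B
  by (intro mult_left_mono) (auto simp: dual_embed_def)
 also have "... <= ?B * (?d * (sqrt ?C * ?n))" using h1 d0 B by (intro mult_left_mono) auto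
 finally have "?n * ?n <= (inverse_const DIM('a) \<tau> (vol Om) * ?d) * ?n"
  by (simp add: inverse_const_def power2_eq_square mult_ac)
 moreover have "0 <= inverse_const DIM('a) \<tau> (vol Om) * ?d" using B d0 by (simp add: inverse_const_def)
 ultimately show ?thesis by (cases "?n = 0") (auto simp: mult_le_cancel_right)
qed

end

section \<open>The main result\<close>

lemma op_norm_leI: "(!!x. x : X ==> A x : Y) ==> (!!x. x : X ==> nY (A x) <= C * nX x) ==> op_norm_le X nX Y nY A C"
 by (simp add: op_norm_le_def)

theorem proposition5p11:
  fixes \<Omega> \<gamma> :: "'a::euclidean_space set"
    and \<TT> :: "'a set set set"
    and R RR :: "'a set set \<Rightarrow> 'a set set"
    and s :: real
  assumes "polytopal_domain \<Omega>"
    and "\<gamma> \<subseteq> frontier \<Omega>" and "\<gamma> \<in> sets borel" and "closed \<gamma>"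
    and "0 \<le> s" and "s \<le> 1"
    and "admissible_family \<Omega> \<gamma> \<TT>"
    and "\<forall>\<T>\<in>\<TT>. red_refinement \<T> (R \<T>)"
    and "\<forall>\<T>\<in>\<TT>. red_refinement (R \<T>) (RR \<T>)"
    and "uniformly_shape_regular (R ` \<TT>)"
    and "uniformly_shape_regular (RR ` \<TT>)"
  shows "\<exists>C. \<forall>\<T>\<in>\<TT>.
    (let N0 = free_nodes \<gamma> \<T>;
         h = mesh_size \<T>;
         \<phi> = hat \<T>;
         \<phi>' = dual_hat \<T> (R \<T>);
         \<theta> = theta (R \<T>) (RR \<T>);
         \<psi> = psi \<T> (R \<T>) (RR \<T>);
         U = U_space \<Omega> \<gamma> \<T>;
         B = B_space \<gamma> \<T> (R \<T>) (RR \<T>);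
         W = W_space \<gamma> \<T> (R \<T>) (RR \<T>);
         Z = Z_space \<Omega> \<gamma> \<T> (R \<T>) (RR \<T>);
         Q = biorth_proj \<Omega> \<gamma> \<T> (R \<T>);
         IQ = (\<lambda>u x. u x - Q u x);
         Q' = adjoint_op \<Omega> Q
     in
       L2_basis \<Omega> U N0 \<phi> \<and>
       (\<forall>\<nu>\<in>N0. \<forall>\<nu>'\<in>N0. l2_inner \<Omega> (\<phi>' \<nu>) (\<phi> \<nu>') =
          (if \<nu> = \<nu>' then measure lebesgue (patch \<T> \<nu>) / (real DIM('a) + 1) else 0)) \<and>
       W \<subseteq> Z \<and>
       L2_linear \<Omega> Q \<and>
       op_norm_le (L2 \<Omega>) (l2_norm \<Omega>) (H1_0_dual \<Omega> \<gamma>) (dual_norm \<Omega> \<gamma>)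
         (\<lambda>u. dual_embed \<Omega> (Q u)) C \<and>
       L2_projector \<Omega> Q \<and>
       U \<subseteq> L2_range \<Omega> Q \<and> B \<subseteq> L2_range \<Omega> IQ \<and>
       L2_subspace \<Omega> U \<and> L2_subspace \<Omega> B \<and>
       L2_subspace \<Omega> (L2_range \<Omega> Q) \<and> L2_subspace \<Omega> (L2_range \<Omega> IQ) \<and>
       op_norm_le (H1_0 \<Omega> \<gamma>) (h1_norm \<Omega>) (L2 \<Omega>) (l2_norm \<Omega>)
         (\<lambda>v x. inverse (h x) * (v x - Q' v x)) C \<and>
       op_norm_le Z (l2_norm \<Omega>) (L2 \<Omega>) (l2_norm \<Omega>) Q C \<and>
       (\<forall>z\<in>Z. l2_norm \<Omega> (\<lambda>x. h x * z x) \<le> C * dual_norm \<Omega> \<gamma> (dual_embed \<Omega> z)) \<and>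
       (\<forall>\<nu>\<in>N0. ae_eq \<Omega> (Q (\<psi> \<nu>)) (\<phi> \<nu>) \<and> ae_eq \<Omega> (IQ (\<psi> \<nu>)) (\<theta> \<nu>)) \<and>
       L2_basis \<Omega> B N0 \<theta> \<and>
       (\<forall>\<nu>\<in>N0. \<forall>\<nu>'\<in>N0. \<nu> \<noteq> \<nu>' \<longrightarrow>
          l2_inner \<Omega> (\<lambda>x. h x powr s * \<theta> \<nu> x) (\<lambda>x. h x powr s * \<theta> \<nu>' x) = 0))"
proof -
 have part: "!!\<T>. \<T> : \<TT> ==> conforming_partition \<Omega> \<T> & (EX \<F>. (ALL F:\<F>. EX T:\<T>. F facet_of T) & \<gamma> = \<Union>\<F>)"
  and reg: "uniformly_shape_regular \<TT>" and cmp: "DIM('a) = 1 --> neighbours_comparable \<TT>"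
  using assms(7) by (simp_all add: admissible_family_def)
 obtain \<sigma> where \<sigma>: "!!\<T> T. \<T> : \<TT> ==> T : \<T> ==> EX c r. 0 < r & cball c r <= T & diameter T <= \<sigma> * r"
  using reg unfolding uniformly_shape_regular_def by metis
 obtain \<kappa> where "DIM('a) = 1 --> (ALL \<T>:\<TT>. ALL T:\<T>. ALL T':\<T>. T Int T' ~= {} --> hsize T <= \<kappa> * hsize T')"
  using cmp unfolding neighbours_comparable_def by (cases "DIM('a) = 1") auto
 hence \<kappa>: "!!\<T> T T'. DIM('a) = 1 ==> \<T> : \<TT> ==> T : \<T> ==> T' : \<T> ==> T Int T' ~= {} ==>
   hsize T <= \<kappa> * hsize T'" by simp
 obtain \<tau> where \<tau>: "!!\<T> S. \<T> : \<TT> ==> S : RR \<T> ==> EX c r. 0 < r & cball c r <= S & diameter S <= \<tau> * r"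
  using assms(11) unfolding uniformly_shape_regular_def by blast
 define C1 where "C1 = sqrt ((real DIM('a) + 1) ^ 3 * (1 + 4 * 2 ^ DIM('a))^2 * (\<sigma> ^ DIM('a) * (real DIM('a) + 1)))"
 define C2 where "C2 = sqrt (adjoint_const DIM('a) \<sigma> (max \<kappa> (\<sigma>^2)) * (\<sigma> ^ DIM('a) * (real DIM('a) + 1)))"
 \<comment> \<open>The doubled ratio pays for halving the inscribed balls, which have to lie in the
   interiors of the cells.\<close>
 define C3 where "C3 = inverse_const DIM('a) (2 * \<tau>) (vol \<Omega>)"
 define C where "C = max C1 (max C2 C3)"
 have C: "C1 <= C" "C2 <= C" "C3 <= C" by (auto simp: C_def)
 show ?thesis
 proof (rule exI[of _ C], rule ballI, goal_cases)
  case (1 \<T>)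
  note \<T> = \<open>\<T> : \<TT>\<close>
  interpret regular_refined_mesh \<Omega> \<T> \<gamma> "R \<T>" "RR \<T>" \<sigma> \<kappa>
  proof
   show "polytopal_domain \<Omega>" "\<gamma> <= frontier \<Omega>" by (fact assms)+
   show "conforming_partition \<Omega> \<T>" "EX \<F>. (ALL F:\<F>. EX T:\<T>. F facet_of T) & \<gamma> = \<Union>\<F>" using part[OF \<T>] by blast+
   show "red_refinement \<T> (R \<T>)" "red_refinement (R \<T>) (RR \<T>)" using assms(8,9) \<T> by blast+
  qed (use \<sigma>[OF \<T>] \<kappa>[OF _ \<T>] in blast)+
  have Z: "z : L2 \<Omega>" "l2_norm \<Omega> (Q z) <= C * l2_norm \<Omega> z" if "z : Z_space \<Omega> \<gamma> \<T> (R \<T>) (RR \<T>)" for z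
   using Z_L2[OF that] Q_bound[OF Z_L2[OF that]] mult_right_mono[OF C(1), of "l2_norm \<Omega> z"] by (auto simp: C1_def)
  have o1: "op_norm_le (L2 \<Omega>) (l2_norm \<Omega>) (H1_0_dual \<Omega> \<gamma>) (dual_norm \<Omega> \<gamma>) (%u. dual_embed \<Omega> (Q u)) C"
  proof (rule op_norm_leI)
   fix u :: "'a => real" assume u: "u : L2 \<Omega>"
   show "dual_embed \<Omega> (Q u) : H1_0_dual \<Omega> \<gamma>" by (rule dual_embed_in_dual(1)[OF domain_open domain_bounded Q_L2])
   have "dual_norm \<Omega> \<gamma> (dual_embed \<Omega> (Q u)) <= l2_norm \<Omega> (Q u)" by (rule dual_embed_in_dual(2)[OF domain_open domain_bounded Q_L2])
   also have "... <= C1 * l2_norm \<Omega> u" unfolding C1_def by (rule Q_bound[OF u])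
   also have "... <= C * l2_norm \<Omega> u" using C(1) by (rule mult_right_mono) simp
   finally show "dual_norm \<Omega> \<gamma> (dual_embed \<Omega> (Q u)) <= C * l2_norm \<Omega> u" .
  qed
  have o2: "op_norm_le (H1_0 \<Omega> \<gamma>) (h1_norm \<Omega>) (L2 \<Omega>) (l2_norm \<Omega>)
     (%v x. inverse (mesh_size \<T> x) * (v x - adjoint_op \<Omega> Q v x)) C"
  proof (rule op_norm_leI)
   fix v :: "'a => real" assume v: "v : H1_0 \<Omega> \<gamma>"
   show "(%x. inverse (mesh_size \<T> x) * (v x - adjoint_op \<Omega> Q v x)) : L2 \<Omega>" by (rule adjoint_estimate(1)[OF v])
   have "l2_norm \<Omega> (%x. inverse (mesh_size \<T> x) * (v x - adjoint_op \<Omega> Q v x)) <= C2 * h1_norm \<Omega> v"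
    unfolding C2_def by (rule adjoint_estimate(2)[OF v])
   also have "... <= C * h1_norm \<Omega> v" using C(2) by (rule mult_right_mono) simp
   finally show "l2_norm \<Omega> (%x. inverse (mesh_size \<T> x) * (v x - adjoint_op \<Omega> Q v x)) <= C * h1_norm \<Omega> v" .
  qed
  have o3: "op_norm_le (Z_space \<Omega> \<gamma> \<T> (R \<T>) (RR \<T>)) (l2_norm \<Omega>) (L2 \<Omega>) (l2_norm \<Omega>) Q C"
   by (rule op_norm_leI) (use Q_L2 Z in auto)
  have e3: "l2_norm \<Omega> (%x. mesh_size \<T> x * z x) <= C * dual_norm \<Omega> \<gamma> (dual_embed \<Omega> z)"
   if z: "z : Z_space \<Omega> \<gamma> \<T> (R \<T>) (RR \<T>)" for z
  proof -
   have "EX c r. 0 < r & cball c r <= interior S & diameter S <= (2 * \<tau>) * r" if S: "S : RR \<T>" for S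
   proof -
    obtain c r where cr: "0 < r" "cball c r <= S" "diameter S <= \<tau> * r" using \<tau>[OF \<T> S] by blast
    have "ball c r <= S" using cr(2) ball_subset_cball by blast
    hence "ball c r <= interior S" by (rule interior_maximal) simp
    moreover have "cball c (r / 2) <= ball c r" using cr(1) by auto
    ultimately show ?thesis using cr by (intro exI[of _ c] exI[of _ "r / 2"]) auto
   qed
   hence "l2_norm \<Omega> (%x. mesh_size \<T> x * z x) <= C3 * dual_norm \<Omega> \<gamma> (dual_embed \<Omega> z)"
    unfolding C3_def by (rule inverse_estimate[OF z])
   also have "... <= C * dual_norm \<Omega> \<gamma> (dual_embed \<Omega> z)"
    using C(3) dual_norm_embed_nonneg[OF Z_L2[OF z]] by (rule mult_right_mono)
   finally show ?thesis .
  qed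
  have p: "ae_eq \<Omega> (Q (psi \<T> (R \<T>) (RR \<T>) \<nu>)) (hat \<T> \<nu>)"
   "ae_eq \<Omega> (%x. psi \<T> (R \<T>) (RR \<T>) \<nu> x - Q (psi \<T> (R \<T>) (RR \<T>) \<nu>) x) (\<theta> \<nu>)" if "\<nu> : N0" for \<nu>
   unfolding Q_psi[OF that] ae_eq_def by (simp_all add: psi_def)
  show ?case
   unfolding Let_def
   by (intro conjI ballI impI U_basis W_subset_Z Q_ranges o1 o2 o3 U_subspace B_subspace e3 p theta_basis
     theta_weighted_orthogonal biorthogonal N0_node)
 qed
qed

end
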